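(* Let $\sigma_x\ge0$ and $\sigma_y>0$, and let $\mu$ be the unique invariant probability measure of the SDE $$dX_t=(X_t^2-Y_t^2)\,dt+\sqrt{2\sigma_x}\,dW^{(1)}_t,\qquad dY_t=2X_tY_t\,dt+\sqrt{2\sigma_y}\,dW^{(2)}_t$$ on $\mathbb{R}^2$. Then $\mu$ has a smooth density $m(z)$ with respect to Lebesgue measure. Moreover: (i) if $\sigma_x>0$ and $\sigma_y>0$, then $m(z)>0$ for all $z\in\mathbb{R}^2$; (ii) if $\sigma_x=0$ and $\sigma_y>0$, then $m(z)=0$ for every $z=(x,y)$ with $x\ge0$, and $m(z)>0$ for every $z=(x,y)$ with $x<0$.
   Context: $W^{(1)},W^{(2)}$ are independent standard Brownian motions. With $P_t(z,A)=\mathbb{P}_z((X_t,Y_t)\in A)$ and $(\mu P_t)(A)=\int P_t(z,A)\,\mu(dz)$, an invariant probability measure is a probability measure $\mu$ with $\mu P_t=\mu$ for all $t\ge0$. When $\sigma_y>0$ this SDE has exactly one invariant probability measure. *)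

theory Defs
  imports "HOL-Probability.Probability"
begin

text \<open>
  Time is of type \<^typ>\<open>real\<close>; all conditions on processes concern only times \<open>t \<ge> 0\<close>.
\<close>

definition standard_brownian_motion :: "'a measure \<Rightarrow> (real \<Rightarrow> 'a \<Rightarrow> real) \<Rightarrow> bool" where
  "standard_brownian_motion M W \<longleftrightarrow>
     (\<forall>t\<ge>0. W t \<in> borel_measurable M) \<and>
     (AE \<omega> in M. W 0 \<omega> = 0) \<and>
     (AE \<omega> in M. continuous_on {0..} (\<lambda>t. W t \<omega>)) \<and>
     (\<forall>s t. 0 \<le> s \<and> s < t \<longrightarrow>
        distributed M lborel (\<lambda>\<omega>. W t \<omega> - W s \<omega>) (normal_density 0 (sqrt (t - s)))) \<and>
     (\<forall>(n::nat) (t::nat \<Rightarrow> real). 0 \<le> t 0 \<and> mono t \<longrightarrow>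
        prob_space.indep_vars M (\<lambda>_. borel) (\<lambda>i \<omega>. W (t (Suc i)) \<omega> - W (t i) \<omega>) {..<n})"

text \<open>
  Independence of whole processes, i.e. of the sigma-algebras they generate: they are regarded
  as random elements of the product space over all times \<open>t \<ge> 0\<close>.
\<close>

definition independent_processes ::
    "'a measure \<Rightarrow> (real \<Rightarrow> 'a \<Rightarrow> real) \<Rightarrow> (real \<Rightarrow> 'a \<Rightarrow> real) \<Rightarrow> bool" where
  "independent_processes M V W \<longleftrightarrow>
     prob_space.indep_var M
       (PiM {0..} (\<lambda>_. borel)) (\<lambda>\<omega>. \<lambda>t\<in>{0..}. V t \<omega>)
       (PiM {0..} (\<lambda>_. borel)) (\<lambda>\<omega>. \<lambda>t\<in>{0..}. W t \<omega>)"

text \<open>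
  The diffusion coefficients are constant, so the stochastic integral of \<open>sqrt (2 * \<sigma>)\<close>
  against \<open>W\<close> up to time \<open>t\<close> is \<open>sqrt (2 * \<sigma>) * W t\<close> and the integral form of the SDE
  is a pathwise equation, required for all times: solutions are global. The drift is locally
  Lipschitz, so a continuous solution path is determined by the driving path; adaptedness to
  the (completed) Brownian filtration is therefore automatic and is not imposed.
\<close>

definition sde_solution ::
    "'a measure \<Rightarrow> (real \<Rightarrow> 'a \<Rightarrow> real) \<Rightarrow> (real \<Rightarrow> 'a \<Rightarrow> real) \<Rightarrow> real \<Rightarrow> real \<Rightarrow> real \<times> real \<Rightarrow>
     (real \<Rightarrow> 'a \<Rightarrow> real) \<Rightarrow> (real \<Rightarrow> 'a \<Rightarrow> real) \<Rightarrow> bool" where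
  "sde_solution M W1 W2 \<sigma>x \<sigma>y z X Y \<longleftrightarrow>
     (\<forall>t\<ge>0. X t \<in> borel_measurable M \<and> Y t \<in> borel_measurable M) \<and>
     (AE \<omega> in M.
        continuous_on {0..} (\<lambda>t. X t \<omega>) \<and> continuous_on {0..} (\<lambda>t. Y t \<omega>) \<and>
        (\<forall>t\<ge>0.
           X t \<omega> = fst z + integral {0..t} (\<lambda>s. (X s \<omega>)\<^sup>2 - (Y s \<omega>)\<^sup>2) + sqrt (2 * \<sigma>x) * W1 t \<omega> \<and>
           Y t \<omega> = snd z + integral {0..t} (\<lambda>s. 2 * X s \<omega> * Y s \<omega>) + sqrt (2 * \<sigma>y) * W2 t \<omega>))"

text \<open>
  The processes are indexed by their starting point: \<open>X z\<close> and \<open>Y z\<close> start at \<open>z\<close>.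
\<close>

definition transition_prob ::
    "'a measure \<Rightarrow> (real \<times> real \<Rightarrow> real \<Rightarrow> 'a \<Rightarrow> real) \<Rightarrow> (real \<times> real \<Rightarrow> real \<Rightarrow> 'a \<Rightarrow> real) \<Rightarrow>
     real \<Rightarrow> real \<times> real \<Rightarrow> (real \<times> real) set \<Rightarrow> ennreal" where
  "transition_prob M X Y t z A = emeasure M {\<omega> \<in> space M. (X z t \<omega>, Y z t \<omega>) \<in> A}"

definition invariant_prob_measure ::
    "(real \<Rightarrow> real \<times> real \<Rightarrow> (real \<times> real) set \<Rightarrow> ennreal) \<Rightarrow> (real \<times> real) measure \<Rightarrow> bool" where
  "invariant_prob_measure P \<mu> \<longleftrightarrow>
     prob_space \<mu> \<and> sets \<mu> = sets borel \<and>
     (\<forall>t\<ge>0. \<forall>A\<in>sets borel. (\<integral>\<^sup>+ z. P t z A \<partial>\<mu>) = emeasure \<mu> A)"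

primrec cont_differentiable ::
    "nat \<Rightarrow> ('a::real_normed_vector \<Rightarrow> 'b::real_normed_vector) \<Rightarrow> bool" where
  "cont_differentiable 0 f \<longleftrightarrow> continuous_on UNIV f"
| "cont_differentiable (Suc n) f \<longleftrightarrow>
     (\<forall>x. f differentiable (at x)) \<and>
     (\<forall>v. cont_differentiable n (\<lambda>x. frechet_derivative f (at x) v))"

text \<open>
  For a finite-dimensional domain, \<open>cont_differentiable n\<close> is the class of n times
  continuously differentiable functions: all iterated
  directional derivatives up to order \<open>n\<close> exist and are continuous.
\<close>

definition smooth :: "('a::euclidean_space \<Rightarrow> 'b::real_normed_vector) \<Rightarrow> bool" where
  "smooth f \<longleftrightarrow> (\<forall>n. cont_differentiable n f)"

end

theory Submission
  imports Defs "HOL-Complex_Analysis.Complex_Analysis"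
begin

text \<open>
  Write \<open>Z = X + iY\<close> and \<open>N = sqrt (2 \<sigma>x) W1 + i sqrt (2 \<sigma>y) W2\<close>; the equation becomes \<open>dZ = Z^2 dt + dN\<close>.
  The substitution \<open>Z = N + v/q\<close> linearises it: \<open>v' = N (v + N q)\<close>, \<open>q' = - (v + N q)\<close>. The Euler scheme of
  this linear system converges to the solution along every noise path; for fixed noise it is a Moebius map of the
  starting point, and it depends holomorphically on the noise.

  Smoothness. It suffices that the measure \<open>exp (- |z|^2 / 2) \<mu>(dz)\<close> has a rapidly decreasing Fourier transform.
  By invariance this transform is an average of \<open>E exp (i \<xi>.Z_t - |Z_t|^2 / 2)\<close> over starting points. Cut
  \<open>[0, t]\<close> into \<open>n + 1\<close> pieces of length \<open>l = |\<xi>|^(-1/16)\<close> and average over Cameron-Martin shifts of \<open>W2\<close>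
  that are constant on the pieces. If the phase has a large derivative in one of the shifts, a
  contour deformation gains any power of \<open>|\<xi>|\<close>. Otherwise the integrals of \<open>q^2\<close> over all the pieces are
  almost parallel; since the integral over piece \<open>k\<close> turns at a definite rate under a shift in that piece,
  every piece contributes a factor \<open>O(l)\<close> to the probability of this event. From a starting point that is too
  far out the process is still far out at time \<open>t\<close>, where the weight \<open>exp (- |Z_t|^2 / 2)\<close> is small.

  Positivity. If a control path leads from \<open>z1\<close> with \<open>m z1 > 0\<close> to \<open>z0\<close>, the noise is close to the control with
  positive probability, and then the Moebius map hits \<open>z0\<close> from a point near \<open>z1\<close>; so \<open>\<mu>\<close> of a disc of radius
  \<open>\<epsilon>\<close> about \<open>z0\<close> is at least \<open>c \<epsilon>^2\<close>, whence \<open>m z0 > 0\<close>. For \<open>\<sigma>x > 0\<close> straight lines are admissible. For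
  \<open>\<sigma>x = 0\<close> the half-plane \<open>x < 0\<close> is invariant and is reached from every point with \<open>y \<noteq> 0\<close> by the noiseless flow
  \<open>z / (1 - t z)\<close>; inside it the paths \<open>(-1 + i a) / \<theta>\<close> with \<open>\<theta>' = 1 - a^2\<close> connect any two points.
\<close>

section \<open>The linearised Riccati scheme\<close>

text \<open>Smoothness uses shifts of \<open>W2\<close> only, so it does not distinguish
  \<open>\<sigma>x = 0\<close>, where the noise reaches the first coordinate through the drift
  alone. The drift is quadratic, and the scheme started at \<open>z\<close> is under control only
  for times of order \<open>1 / (1 + |z|)\<close>; the tails of \<open>\<mu>\<close> are unknown.
  Hence the time must shrink as the frequency grows, \<open>\<mu>\<close> gets a Gaussian weight,
  and all bounds have to be uniform in \<open>z\<close>. Everything happens for finite Gaussian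
  vectors: the difference of two runs of the scheme is given exactly by a discrete Wronskian, so no
  calculus on path space occurs, and the contour deformation, which needs only a lower bound for a
  first derivative, takes the place of repeated integration by parts. The powers of
  \<open>l\<close>: with \<open>S_k\<close> the integral of \<open>q^2\<close> over piece
  \<open>k\<close>, a shift by \<open>u\<close> there changes \<open>Im (cnj S_0 * S_k)\<close> by
  order \<open>u l^4\<close>, so a tolerance of order \<open>l^5\<close> has probability
  \<open>O(l)\<close>; it corresponds to a phase derivative of order \<open>|\<xi>| l^4\<close>,
  which is stable under complex shifts of size of order \<open>l^4\<close>. The gain is then a power
  of \<open>|\<xi>| l^8\<close>, and the choice of \<open>l\<close> makes this at least
  \<open>1 / l\<close>.\<close>

lemma norm_add_diff_le: "norm (a + b - c) \<le> norm (a - c) + norm (b::'a::real_normed_vector)"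
  using norm_triangle_ineq[of "a - c" b] by (simp add: algebra_simps)

lemma norm_diff_diff_le: "norm (a - b - c) \<le> norm (a - c) + norm (b::'a::real_normed_vector)"
  using norm_triangle_ineq4[of "a - c" b] by (simp add: algebra_simps)

lemma norm_add_le3: "norm (a + b + c) \<le> norm a + norm b + norm (c::'a::real_normed_vector)"
  using norm_triangle_ineq[of "a + b" c] norm_triangle_ineq[of a b] by linarith

lemma norm_add_diff_le3: "norm (a + b - c) \<le> norm a + norm b + norm (c::'a::real_normed_vector)"
  using norm_triangle_ineq4[of "a + b" c] norm_triangle_ineq[of a b] by linarith

lemma norm_diff_diff_le3: "norm (a - b - c) \<le> norm a + norm b + norm (c::'a::real_normed_vector)"
  using norm_triangle_ineq4[of "a - b" c] norm_triangle_ineq4[of a b] by linarith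

text \<open>Euler scheme with step \<open>d\<close> for \<open>(v, q)\<close>, started at \<open>(z, 1)\<close>; \<open>sp = v + N q\<close>, and \<open>sP = N + v / q\<close> approximates
  the solution.\<close>

primrec sch :: "real \<Rightarrow> (nat \<Rightarrow> complex) \<Rightarrow> complex \<Rightarrow> nat \<Rightarrow> complex \<times> complex" where
  "sch d N z 0 = (z, 1)"
| "sch d N z (Suc j) =
     (fst (sch d N z j) + of_real d * N j * (fst (sch d N z j) + N j * snd (sch d N z j)),
      snd (sch d N z j) - of_real d * (fst (sch d N z j) + N j * snd (sch d N z j)))"

definition sv where "sv d N z j = fst (sch d N z j)"
definition sq where "sq d N z j = snd (sch d N z j)"
definition sp where "sp d N z j = sv d N z j + N j * sq d N z j"
definition sP where "sP d N z j = sp d N z j / sq d N z j"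

lemma sv_0 [simp]: "sv d N z 0 = z" and sq_0 [simp]: "sq d N z 0 = 1"
  by (auto simp: sv_def sq_def)

lemma sv_Suc: "sv d N z (Suc j) = sv d N z j + of_real d * N j * sp d N z j"
  and sq_Suc: "sq d N z (Suc j) = sq d N z j - of_real d * sp d N z j"
  by (auto simp: sv_def sq_def sp_def)

lemma sp_0: "sp d N z 0 = z + N 0"
  by (simp add: sp_def)

text \<open>The Euler increments of \<open>v\<close> and of \<open>N q\<close> cancel exactly
  because both use the same \<open>N j\<close>. In the variables \<open>(p, q)\<close> the scheme is
  the symplectic Euler method for \<open>dp = q dN\<close>, \<open>dq = - p dt\<close>.\<close>

lemma sp_Suc: "sp d N z (Suc j) = sp d N z j + (N (Suc j) - N j) * sq d N z (Suc j)"
  by (simp add: sp_def sv_Suc sq_Suc algebra_simps)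

text \<open>The scheme is explicit: step \<open>j\<close> reads the noise strictly before
  \<open>j\<close>. This is the source of the adaptedness on which \<open>bad_prob\<close>
  rests.\<close>

lemma sch_cong:
  assumes "\<And>i. i < j \<Longrightarrow> N i = N' i"
  shows "sch d N z j = sch d N' z j"
  using assms by (induction j) auto

lemma sq_cong: "(\<And>i. i < j \<Longrightarrow> N i = N' i) \<Longrightarrow> sq d N z j = sq d N' z j"
  using sch_cong[of j N N' d z] by (simp add: sq_def)

text \<open>Allows complex conjugation, which is not holomorphic, to be replaced by a second run of
  the scheme with conjugated data.\<close>

lemma cnj_sch: "sch d (\<lambda>i. cnj (N i)) (cnj z) j = (cnj (sv d N z j), cnj (sq d N z j))"
  by (induction j) (auto simp: sv_Suc sq_Suc sp_def)

lemma cnj_sP: "sP d (\<lambda>i. cnj (N i)) (cnj z) j = cnj (sP d N z j)"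
proof -
  have "sv d (\<lambda>i. cnj (N i)) (cnj z) j = cnj (sv d N z j)"
    "sq d (\<lambda>i. cnj (N i)) (cnj z) j = cnj (sq d N z j)"
    using cnj_sch[of d N z j] by (auto simp: sv_def sq_def)
  thus ?thesis by (simp add: sP_def sp_def)
qed

lemma sv_sq_holomorphic:
  assumes "\<And>i. (\<lambda>u. N u i) holomorphic_on A"
  shows "(\<lambda>u. sv d (N u) z j) holomorphic_on A" "(\<lambda>u. sq d (N u) z j) holomorphic_on A"
proof (induction j)
  case (Suc j)
  case 1 show ?case using Suc.IH assms unfolding sv_Suc sp_def by (auto intro!: holomorphic_intros)
  case 2 show ?case using Suc.IH assms unfolding sq_Suc sp_def by (auto intro!: holomorphic_intros)
qed (auto intro!: holomorphic_intros)

lemma sv_sq_measurable: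
  assumes "\<And>i. i \<le> j \<Longrightarrow> (\<lambda>x. N x i) \<in> borel_measurable M" "z \<in> borel_measurable M"
  shows "(\<lambda>x. sv d (N x) (z x) j) \<in> borel_measurable M \<and> (\<lambda>x. sq d (N x) (z x) j) \<in> borel_measurable M"
  using assms
proof (induction j)
  case (Suc j)
  have [measurable]: "(\<lambda>x. sv d (N x) (z x) j) \<in> borel_measurable M" "(\<lambda>x. sq d (N x) (z x) j) \<in> borel_measurable M"
    "(\<lambda>x. N x j) \<in> borel_measurable M"
    using Suc by auto
  show ?case unfolding sv_Suc sq_Suc sp_def by measurable
qed auto

lemma sP_measurable:
  assumes "\<And>i. i \<le> j \<Longrightarrow> (\<lambda>x. N x i) \<in> borel_measurable M" "z \<in> borel_measurable M"
  shows "(\<lambda>x. sP d (N x) (z x) j) \<in> borel_measurable M"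
proof -
  have [measurable]: "(\<lambda>x. sv d (N x) (z x) j) \<in> borel_measurable M" "(\<lambda>x. sq d (N x) (z x) j) \<in> borel_measurable M"
    "(\<lambda>x. N x j) \<in> borel_measurable M"
    using sv_sq_measurable[where M = M and N = N and z = z and d = d and j = j] assms by auto
  show ?thesis unfolding sP_def sp_def by measurable
qed

text \<open>A discrete Wronskian of two solutions of the linear system.\<close>

definition wr where
  "wr d N z N' z' j = sp d N' z' j * sq d N z j - sp d N z j * sq d N' z' j"

text \<open>For equal increments both runs undergo the same linear map of determinant 1, so the
  Wronskian is conserved; only the difference of the increments feeds it, weighted by both new
  values of \<open>q\<close>.\<close>

lemma wr_Suc: "wr d N z N' z' (Suc j) = wr d N z N' z' j
   + ((N' (Suc j) - N' j) - (N (Suc j) - N j)) * sq d N z (Suc j) * sq d N' z' (Suc j)"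
proof -
  have "wr d N z N' z' (Suc j) = (sp d N' z' j * sq d N z (Suc j) - sp d N z j * sq d N' z' (Suc j))
     + ((N' (Suc j) - N' j) - (N (Suc j) - N j)) * sq d N z (Suc j) * sq d N' z' (Suc j)"
    unfolding wr_def sp_Suc by (simp add: algebra_simps)
  also have "sp d N' z' j * sq d N z (Suc j) - sp d N z j * sq d N' z' (Suc j) = wr d N z N' z' j"
    unfolding wr_def sq_Suc by (simp add: algebra_simps)
  finally show ?thesis .
qed

lemma wr_eq: "wr d N z N' z' j = (z' + N' 0) - (z + N 0) +
   (\<Sum>i<j. ((N' (Suc i) - N' i) - (N (Suc i) - N i)) * sq d N z (Suc i) * sq d N' z' (Suc i))"
  by (induction j) (auto simp: wr_Suc, simp add: wr_def sp_0)

text \<open>With \<open>wr_eq\<close> this is a difference formula without remainder term. For equal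
  noise it is the Moebius property in the starting point; for equal starting points it replaces a
  Taylor expansion in the noise.\<close>

lemma sP_diff:
  assumes "sq d N z j \<noteq> 0" "sq d N' z' j \<noteq> 0"
  shows "sP d N' z' j - sP d N z j = wr d N z N' z' j / (sq d N z j * sq d N' z' j)"
  using assms by (simp add: sP_def wr_def field_simps)

text \<open>Reduction of order in discrete form: the increment of the quotient of the two solutions
  is the Wronskian over \<open>q_i * q_(i+1)\<close>, and the sum telescopes.\<close>

lemma sq_ratio:
  assumes "\<And>i. i \<le> j \<Longrightarrow> sq d N z i \<noteq> 0"
  shows "sq d N' z' j / sq d N z j = 1 - (\<Sum>i<j. of_real d * wr d N z N' z' i / (sq d N z i * sq d N z (Suc i)))"
  using assms
proof (induction j)
  case (Suc j)
  have nz: "sq d N z j \<noteq> 0" "sq d N z (Suc j) \<noteq> 0" using Suc.prems by auto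
  have "sq d N' z' (Suc j) * sq d N z j - sq d N z (Suc j) * sq d N' z' j = - of_real d * wr d N z N' z' j"
    unfolding sq_Suc wr_def by (simp add: algebra_simps)
  hence "sq d N' z' (Suc j) / sq d N z (Suc j) - sq d N' z' j / sq d N z j
     = - of_real d * wr d N z N' z' j / (sq d N z j * sq d N z (Suc j))"
    using nz by (simp add: divide_simps) (simp add: mult_ac)
  moreover have "sq d N' z' j / sq d N z j = 1 - (\<Sum>i<j. of_real d * wr d N z N' z' i / (sq d N z i * sq d N z (Suc i)))"
    using Suc by auto
  ultimately show ?case by (simp add: algebra_simps)
qed auto

section \<open>A priori bounds and stability of the scheme\<close>

text \<open>The three bounds feed each other: while \<open>sp\<close> stays below \<open>D\<close>,
  \<open>v\<close> moves by at most 1 and \<open>q\<close> by at most \<open>\<theta> <= 1\<close>,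
  so \<open>|v| <= R + 1\<close> and \<open>|q| <= 2\<close>, which gives
  \<open>|sp| <= R + 1 + 2 * B = D\<close> again.\<close>

lemma scheme_control:
  assumes d: "d \<ge> 0" and z: "norm z \<le> R" and N: "\<And>i. i \<le> L \<Longrightarrow> norm (N i) \<le> B"
    and D: "D = R + 1 + 2 * B" and 1: "real L * d * D \<le> \<theta>" "\<theta> \<le> 1" "real L * d * B * D \<le> 1"
    and j: "j \<le> L"
  shows "norm (sv d N z j - z) \<le> real j * d * B * D \<and> norm (sq d N z j - 1) \<le> real j * d * D
     \<and> norm (sp d N z j) \<le> D"
  using j
proof (induction j)
  case 0
  have B0: "B \<ge> 0" using N[of 0] norm_ge_zero[of "N 0"] by linarith
  have "norm (z + N 0) \<le> R + B" using z N[of 0] norm_triangle_mono by blast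
  moreover have "R + B \<le> D" using D B0 by simp
  ultimately have "norm (z + N 0) \<le> D" by linarith
  thus ?case by (simp add: sp_0)
next
  case (Suc j)
  have B0: "B \<ge> 0" using N[of 0] norm_ge_zero[of "N 0"] by linarith
  have R0: "R \<ge> 0" using z norm_ge_zero[of z] by linarith
  have D0: "D \<ge> 0" using D B0 R0 by simp
  have IH: "norm (sv d N z j - z) \<le> real j * d * B * D" "norm (sq d N z j - 1) \<le> real j * d * D"
     "norm (sp d N z j) \<le> D" using Suc by auto
  have nv: "norm (sv d N z (Suc j) - z) \<le> real (Suc j) * d * B * D"
  proof -
    have "norm (sv d N z (Suc j) - z) \<le> norm (sv d N z j - z) + norm (of_real d * N j * sp d N z j)"
      unfolding sv_Suc by (rule norm_add_diff_le)
    also have "norm (of_real d * N j * sp d N z j) \<le> d * B * D"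
      unfolding norm_mult using d B0 IH N[of j] Suc.prems by (intro mult_mono) auto
    finally show ?thesis using IH(1) by (simp add: algebra_simps)
  qed
  have nq: "norm (sq d N z (Suc j) - 1) \<le> real (Suc j) * d * D"
  proof -
    have "norm (sq d N z (Suc j) - 1) \<le> norm (sq d N z j - 1) + norm (of_real d * sp d N z j)"
      unfolding sq_Suc by (rule norm_diff_diff_le)
    also have "norm (of_real d * sp d N z j) \<le> d * D"
      unfolding norm_mult using d IH by (intro mult_mono) auto
    finally show ?thesis using IH(2) by (simp add: algebra_simps)
  qed
  have le: "real (Suc j) * d * D \<le> real L * d * D" "real (Suc j) * d * B * D \<le> real L * d * B * D"
    using Suc.prems d D0 B0 by (auto intro!: mult_right_mono simp del: of_nat_Suc)
  have q2: "norm (sq d N z (Suc j)) \<le> 2"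
    using nq le 1 norm_triangle_sub[of "sq d N z (Suc j)" 1] by simp
  have v1: "norm (sv d N z (Suc j)) \<le> R + 1"
    using nv le 1 z norm_triangle_sub[of "sv d N z (Suc j)" z] by simp
  have "norm (sp d N z (Suc j)) \<le> norm (sv d N z (Suc j)) + norm (N (Suc j)) * norm (sq d N z (Suc j))"
    unfolding sp_def norm_mult[symmetric] by (rule norm_triangle_ineq)
  also have "\<dots> \<le> (R + 1) + B * 2"
    using v1 q2 N[of "Suc j"] Suc.prems B0 by (intro add_mono mult_mono) auto
  finally show ?case using nv nq D by simp
qed

lemma derivative_step:
  fixes f f' :: "real \<Rightarrow> complex"
  assumes "a \<le> b" and "\<And>s. s \<in> {a..b} \<Longrightarrow> (f has_vector_derivative f' s) (at s within {a..b})"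
    and "\<And>s. s \<in> {a..b} \<Longrightarrow> norm (f' s - f' a) \<le> w"
  shows "norm (f b - f a - of_real (b - a) * f' a) \<le> (b - a) * w"
proof -
  have "norm ((\<lambda>s. f s - s *\<^sub>R f' a) b - (\<lambda>s. f s - s *\<^sub>R f' a) a) \<le> w * norm (b - a)"
  proof (rule differentiable_bound[where f' = "\<lambda>s h. h *\<^sub>R (f' s - f' a)" and S = "{a..b}"])
    fix s assume s: "s \<in> {a..b}"
    have "((\<lambda>s. f s - s *\<^sub>R f' a) has_vector_derivative (f' s - 1 *\<^sub>R f' a)) (at s within {a..b})"
      using assms(2)[OF s] by (auto intro!: derivative_eq_intros)
    thus "((\<lambda>s. f s - s *\<^sub>R f' a) has_derivative (\<lambda>h. h *\<^sub>R (f' s - f' a))) (at s within {a..b})"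
      by (simp add: has_vector_derivative_def)
    show "onorm (\<lambda>h. h *\<^sub>R (f' s - f' a)) \<le> w"
      using assms(3)[OF s] by (intro onorm_le) (simp add: mult.commute[of w] mult_left_mono)
  qed (use assms in auto)
  thus ?thesis using assms(1) by (simp add: algebra_simps scaleR_conv_of_real)
qed

lemma discrete_gronwall:
  fixes E :: "nat \<Rightarrow> real"
  assumes "\<And>j. j < L \<Longrightarrow> E (Suc j) \<le> (1 + d * K) * E j + d * h" "0 \<le> d" "0 \<le> K" "0 \<le> h" "0 \<le> E 0" "j \<le> L"
  shows "E j \<le> (E 0 + real j * d * h) * exp (real j * d * K)"
  using assms(6)
proof (induction j)
  case (Suc j)
  have pos: "E 0 + real j * d * h \<ge> 0" using assms by auto
  have "E (Suc j) \<le> (1 + d * K) * E j + d * h" using assms(1) Suc by auto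
  also have "\<dots> \<le> (1 + d * K) * ((E 0 + real j * d * h) * exp (real j * d * K)) + d * h"
    using Suc assms by (intro add_mono mult_left_mono) auto
  also have "\<dots> \<le> exp (d * K) * ((E 0 + real j * d * h) * exp (real j * d * K)) + d * h"
    using pos assms by (intro add_mono mult_right_mono) auto
  also have "\<dots> = (E 0 + real j * d * h) * exp (real (Suc j) * d * K) + d * h * 1"
    by (simp add: exp_add[symmetric] algebra_simps)
  also have "\<dots> \<le> (E 0 + real j * d * h) * exp (real (Suc j) * d * K) + d * h * exp (real (Suc j) * d * K)"
    using assms by (intro add_mono mult_left_mono) auto
  also have "\<dots> = (E 0 + real (Suc j) * d * h) * exp (real (Suc j) * d * K)"
    by (simp add: algebra_simps)
  finally show ?case .
qed auto

text \<open>Continuity of \<open>n\<close> suffices, as for a Brownian path: the local error of a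
  step is the modulus of continuity of the right-hand sides. One \<open>\<rho>\<close> is the
  tolerance for the start, for the noise at the grid points and for these moduli.\<close>

lemma scheme_stability:
  fixes n vs qs :: "real \<Rightarrow> complex"
  assumes T: "T > 0" and n: "continuous_on {0..T} n"
    and dv: "\<And>s. s \<in> {0..T} \<Longrightarrow> (vs has_vector_derivative n s * (vs s + n s * qs s)) (at s within {0..T})"
    and dq: "\<And>s. s \<in> {0..T} \<Longrightarrow> (qs has_vector_derivative - (vs s + n s * qs s)) (at s within {0..T})"
    and init: "qs 0 = 1" and e: "e > 0"
  shows "\<exists>\<rho>>0. \<exists>L0. \<forall>L\<ge>L0. \<forall>N z. norm (z - vs 0) \<le> \<rho> \<longrightarrow>
     (\<forall>j\<le>L. norm (N j - n (real j * (T / real L))) \<le> \<rho>) \<longrightarrow>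
     (\<forall>j\<le>L. norm (sv (T / real L) N z j - vs (real j * (T / real L))) \<le> e \<and>
             norm (sq (T / real L) N z j - qs (real j * (T / real L))) \<le> e)"
proof -
  define ps where "ps = (\<lambda>s. vs s + n s * qs s)"
  have cv: "continuous_on {0..T} vs" using dv by (rule continuous_on_vector_derivative)
  have cq: "continuous_on {0..T} qs" using dq by (rule continuous_on_vector_derivative)
  have cp: "continuous_on {0..T} ps" unfolding ps_def by (intro continuous_intros cv cq n)
  have cnp: "continuous_on {0..T} (\<lambda>s. n s * ps s)" by (intro continuous_intros cp n)
  have bd: "\<exists>B. \<forall>s\<in>{0..T}. norm (f s) \<le> B" if "continuous_on {0..T} f" for f :: "real \<Rightarrow> complex"
    using compact_imp_bounded[OF compact_continuous_image[OF that compact_Icc]] by (auto simp: bounded_iff)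
  obtain B1 B2 B3 where B: "\<forall>s\<in>{0..T}. norm (n s) \<le> B1" "\<forall>s\<in>{0..T}. norm (qs s) \<le> B2" "\<forall>s\<in>{0..T}. norm (ps s) \<le> B3"
    using bd[OF n] bd[OF cq] bd[OF cp] by auto
  define M where "M = max 1 (max B1 (max B2 B3))"
  have M: "norm (n s) \<le> M" "norm (qs s) \<le> M" "norm (ps s) \<le> M" if "s \<in> {0..T}" for s
    using B that unfolding M_def by (meson le_max_iff_disj)+
  have M1: "M \<ge> 1" by (simp add: M_def)
  \<comment> \<open>\<open>E\<close> adds the errors of \<open>v\<close> and \<open>q\<close>. In
    one step the former grows by \<open>d * (M + 1)^2 * E\<close> and the latter by
    \<open>d * (M + 1) * E\<close>, whence \<open>K\<close>; the remaining terms add up to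
    \<open>d * \<rho> * (M * (M + 3) + 2)\<close>.\<close>
  define K where "K = (M + 2) * (M + 1)"
  have K0: "K \<ge> 0" using M1 by (simp add: K_def)
  define C where "C = (1 + T * (M * (M + 3) + 2)) * exp (T * K)"
  have C0: "C > 0" using M1 T by (auto simp: C_def intro!: mult_pos_pos add_pos_nonneg)
  define \<rho> where "\<rho> = min 1 (e / C)"
  have \<rho>: "\<rho> > 0" "\<rho> \<le> 1" "\<rho> * C \<le> e" using e C0 by (auto simp: \<rho>_def min_def field_simps)
  obtain d1 where d1: "d1 > 0" "\<And>s t. s \<in> {0..T} \<Longrightarrow> t \<in> {0..T} \<Longrightarrow> dist t s < d1 \<Longrightarrow> dist (ps t) (ps s) < \<rho>"
    using compact_uniformly_continuous[OF cp compact_Icc] \<rho>(1) unfolding uniformly_continuous_on_def by metis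
  obtain d2 where d2: "d2 > 0" "\<And>s t. s \<in> {0..T} \<Longrightarrow> t \<in> {0..T} \<Longrightarrow> dist t s < d2 \<Longrightarrow> dist (n t * ps t) (n s * ps s) < \<rho>"
    using compact_uniformly_continuous[OF cnp compact_Icc] \<rho>(1) unfolding uniformly_continuous_on_def by metis
  obtain L0 :: nat where L0: "real L0 > T / min d1 d2" using reals_Archimedean2 by blast
  show ?thesis
  proof (intro exI[of _ \<rho>] conjI exI[of _ L0] allI impI)
    show "\<rho> > 0" by fact
    fix L N z j
    assume L: "L0 \<le> L" and z: "norm (z - vs 0) \<le> \<rho>"
      and N: "\<forall>j\<le>L. norm (N j - n (real j * (T / real L))) \<le> \<rho>" and j: "j \<le> L"
    define d where "d = T / real L"
    have "real L > T / min d1 d2" using L L0 by linarith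
    moreover have "T / min d1 d2 > 0" using T d1 d2 by auto
    ultimately have Lp: "real L > 0" by linarith
    have dd: "d < min d1 d2" "d > 0" "real L * d = T" using \<open>real L > T / min d1 d2\<close> Lp T d1 d2
      by (auto simp: d_def field_simps min_def split: if_splits)
    define E where "E = (\<lambda>j. norm (sv d N z j - vs (real j * d)) + norm (sq d N z j - qs (real j * d)))"
    have step: "E (Suc i) \<le> (1 + d * K) * E i + d * (\<rho> * (M * (M + 3) + 2))" if i: "i < L" for i
    proof -
      define a where "a = real i * d"
      define b where "b = real (Suc i) * d"
      have ab: "a \<le> b" "b - a = d" using dd by (auto simp: a_def b_def algebra_simps)
      have "real (Suc i) * d \<le> real L * d" using i dd by (intro mult_right_mono) auto
      hence aT: "{a..b} \<subseteq> {0..T}" using dd by (auto simp: a_def b_def)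
      hence a0: "a \<in> {0..T}" using ab by auto
      have near: "dist s a < min d1 d2" if "s \<in> {a..b}" for s
        using that ab dd by (auto simp: dist_real_def)
      have 1: "norm (vs b - vs a - of_real (b - a) * (n a * ps a)) \<le> (b - a) * \<rho>"
      proof (rule derivative_step[where f' = "\<lambda>s. n s * ps s"])
        show "(vs has_vector_derivative n s * ps s) (at s within {a..b})" if "s \<in> {a..b}" for s
          using dv[of s] has_vector_derivative_within_subset[OF _ aT] that aT unfolding ps_def by blast
        show "norm (n s * ps s - n a * ps a) \<le> \<rho>" if "s \<in> {a..b}" for s
          using d2(2)[OF a0, of s] near[OF that] that aT by (auto simp: dist_norm intro: less_imp_le)
      qed (use ab in auto)
      have 2: "norm (qs b - qs a - of_real (b - a) * (- ps a)) \<le> (b - a) * \<rho>"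
      proof (rule derivative_step[where f' = "\<lambda>s. - ps s"])
        show "(qs has_vector_derivative - ps s) (at s within {a..b})" if "s \<in> {a..b}" for s
          using dq[of s] has_vector_derivative_within_subset[OF _ aT] that aT unfolding ps_def by blast
        show "norm (- ps s - - ps a) \<le> \<rho>" if "s \<in> {a..b}" for s
          using d1(2)[OF a0, of s] near[OF that] that aT by (auto simp: dist_norm norm_minus_commute intro: less_imp_le)
      qed (use ab in auto)
      have Ni: "norm (N i - n a) \<le> \<rho>" using N i by (auto simp: a_def d_def)
      have NM: "norm (N i) \<le> M + 1" using Ni M(1)[OF a0] \<rho>(2) norm_triangle_sub[of "N i" "n a"] by linarith
      define ev where "ev = norm (sv d N z i - vs a)"
      define eq where "eq = norm (sq d N z i - qs a)"
      have Ei: "E i = ev + eq" by (simp add: E_def ev_def eq_def a_def)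
      have pe: "norm (sp d N z i - ps a) \<le> (M + 1) * E i + \<rho> * M"
      proof -
        have "sp d N z i - ps a = (sv d N z i - vs a) + N i * (sq d N z i - qs a) + (N i - n a) * qs a"
          unfolding sp_def ps_def by (simp add: algebra_simps)
        also have "norm \<dots> \<le> ev + norm (N i) * eq + norm (N i - n a) * norm (qs a)"
          unfolding ev_def eq_def norm_mult[symmetric] by (rule norm_add_le3)
        also have "\<dots> \<le> (M + 1) * ev + (M + 1) * eq + \<rho> * M"
        proof -
          have "1 * ev \<le> (M + 1) * ev" using M1 by (intro mult_right_mono) (auto simp: ev_def)
          moreover have "norm (N i) * eq \<le> (M + 1) * eq" using NM by (intro mult_right_mono) (auto simp: eq_def)
          moreover have "norm (N i - n a) * norm (qs a) \<le> \<rho> * M" using Ni M(2)[OF a0] \<rho> by (intro mult_mono) auto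
          ultimately show ?thesis by linarith
        qed
        finally show ?thesis by (simp add: Ei algebra_simps)
      qed
      have npe: "norm (N i * sp d N z i - n a * ps a) \<le> (M + 1) * ((M + 1) * E i + \<rho> * M) + \<rho> * M"
      proof -
        have "N i * sp d N z i - n a * ps a = N i * (sp d N z i - ps a) + (N i - n a) * ps a"
          by (simp add: algebra_simps)
        also have "norm \<dots> \<le> norm (N i) * norm (sp d N z i - ps a) + norm (N i - n a) * norm (ps a)"
          unfolding norm_mult[symmetric] by (rule norm_triangle_ineq)
        also have "\<dots> \<le> (M + 1) * ((M + 1) * E i + \<rho> * M) + \<rho> * M"
          using NM pe Ni M(3)[OF a0] \<rho> M1 by (intro add_mono mult_mono) auto
        finally show ?thesis .
      qed
      have v': "norm (sv d N z (Suc i) - vs b) \<le> ev + d * ((M + 1) * ((M + 1) * E i + \<rho> * M) + \<rho> * M) + d * \<rho>"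
      proof -
        have "sv d N z (Suc i) - vs b = (sv d N z i - vs a) + of_real d * (N i * sp d N z i - n a * ps a)
           - (vs b - vs a - of_real (b - a) * (n a * ps a))"
          unfolding sv_Suc ab by (simp add: algebra_simps)
        also have "norm \<dots> \<le> ev + norm (of_real d * (N i * sp d N z i - n a * ps a))
            + norm (vs b - vs a - of_real (b - a) * (n a * ps a))"
          unfolding ev_def by (rule norm_add_diff_le3)
        also have "norm (of_real d * (N i * sp d N z i - n a * ps a)) \<le> d * ((M + 1) * ((M + 1) * E i + \<rho> * M) + \<rho> * M)"
          unfolding norm_mult using npe dd by (auto intro!: mult_left_mono)
        finally show ?thesis using 1 ab by simp
      qed
      have q': "norm (sq d N z (Suc i) - qs b) \<le> eq + d * ((M + 1) * E i + \<rho> * M) + d * \<rho>"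
      proof -
        have "sq d N z (Suc i) - qs b = (sq d N z i - qs a) - of_real d * (sp d N z i - ps a)
           - (qs b - qs a - of_real (b - a) * (- ps a))"
          unfolding sq_Suc ab by (simp add: algebra_simps)
        also have "norm \<dots> \<le> eq + norm (of_real d * (sp d N z i - ps a))
            + norm (qs b - qs a - of_real (b - a) * (- ps a))"
          unfolding eq_def by (rule norm_diff_diff_le3)
        also have "norm (of_real d * (sp d N z i - ps a)) \<le> d * ((M + 1) * E i + \<rho> * M)"
          unfolding norm_mult using pe dd by (auto intro!: mult_left_mono)
        finally show ?thesis using 2 ab by simp
      qed
      have "E (Suc i) = norm (sv d N z (Suc i) - vs b) + norm (sq d N z (Suc i) - qs b)"
        by (simp add: E_def b_def)
      also have "\<dots> \<le> (1 + d * K) * E i + d * (\<rho> * (M * (M + 3) + 2))"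
        using v' q' unfolding Ei K_def by (simp add: algebra_simps)
      finally show ?thesis .
    qed
    have E0: "E 0 \<le> \<rho>" "E 0 \<ge> 0" using z init by (auto simp: E_def)
    have "E j \<le> (E 0 + real j * d * (\<rho> * (M * (M + 3) + 2))) * exp (real j * d * K)"
      using step dd K0 E0 \<rho> M1 j by (intro discrete_gronwall[where L = L]) auto
    also have "\<dots> \<le> (\<rho> + T * (\<rho> * (M * (M + 3) + 2))) * exp (T * K)"
    proof -
      have jd: "real j * d \<le> T" "real j * d \<ge> 0" using j dd by (auto intro: order_trans[OF mult_right_mono[of "real j" "real L" d]])
      show ?thesis using jd E0 \<rho> M1 K0 T
        by (intro mult_mono add_mono) (auto intro!: mult_right_mono add_nonneg_nonneg mult_nonneg_nonneg)
    qed
    also have "\<dots> = \<rho> * C" by (simp add: C_def algebra_simps)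
    also have "\<dots> \<le> e" by fact
    finally have "E j \<le> e" .
    thus "norm (sv (T / real L) N z j - vs (real j * (T / real L))) \<le> e"
      "norm (sq (T / real L) N z j - qs (real j * (T / real L))) \<le> e"
      unfolding E_def d_def[symmetric] 
      using norm_ge_zero[of "sv d N z j - vs (real j * d)"] norm_ge_zero[of "sq d N z j - qs (real j * d)"] by linarith+
  qed
qed

section \<open>Vectors of independent Gaussian increments\<close>

abbreviation RL :: "nat \<Rightarrow> (nat \<Rightarrow> real) measure" where "RL L \<equiv> PiM {..<L} (\<lambda>_. borel)"

definition gam :: "real \<Rightarrow> real measure" where
  "gam d = density lborel (\<lambda>x. ennreal (normal_density 0 (sqrt d) x))"

definition Gam :: "real \<Rightarrow> nat \<Rightarrow> (nat \<Rightarrow> real) measure" where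
  "Gam d L = PiM {..<L} (\<lambda>_. gam d)"

lemma sets_gam [simp, measurable_cong]: "sets (gam d) = sets borel"
  and space_gam [simp]: "space (gam d) = UNIV"
  by (auto simp: gam_def)

lemma sets_Gam [simp, measurable_cong]: "sets (Gam d L) = sets (RL L)"
  unfolding Gam_def by (intro sets_PiM_cong) auto

lemma space_Gam: "space (Gam d L) = PiE {..<L} (\<lambda>_. UNIV)"
  unfolding Gam_def by (simp add: space_PiM)

lemma Gam_Collect_sets: "Measurable.pred (RL L) P \<Longrightarrow> {x \<in> space (Gam d L). P x} \<in> sets (RL L)"
  by (simp add: space_Gam space_PiM pred_def)

lemma prob_space_gam: "d > 0 \<Longrightarrow> prob_space (gam d)"
  unfolding gam_def by (rule prob_space_normal_density) simp

lemma product_gam: "d > 0 \<Longrightarrow> product_prob_space (\<lambda>_. gam d)"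
  by (simp add: product_prob_space_def product_prob_space_axioms_def product_sigma_finite_def
    prob_space_gam prob_space_imp_sigma_finite)

lemma prob_space_Gam: "d > 0 \<Longrightarrow> prob_space (Gam d L)"
  unfolding Gam_def by (intro prob_space_PiM prob_space_gam)

lemma normal_density_tilt:
  assumes d: "d > 0"
  shows "normal_density 0 (sqrt d) x * exp (a * x / d - a\<^sup>2 / (2 * d)) = normal_density a (sqrt d) x"
proof -
  have "- (x - 0)\<^sup>2 / (2 * (sqrt d)\<^sup>2) + (a * x / d - a\<^sup>2 / (2 * d)) = - (x - a)\<^sup>2 / (2 * (sqrt d)\<^sup>2)"
    using d by (simp add: field_simps power2_eq_square)
  thus ?thesis unfolding normal_density_def by (simp add: exp_add[symmetric] mult.assoc)
qed

lemma gam_shift: "distr (gam d) borel (\<lambda>x. x + a) = density lborel (\<lambda>x. ennreal (normal_density a (sqrt d) x))"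
proof (rule measure_eqI)
  fix A assume "A \<in> sets (distr (gam d) borel (\<lambda>x. x + a))"
  hence [measurable]: "A \<in> sets borel" by simp
  have "emeasure (distr (gam d) borel (\<lambda>x. x + a)) A
    = (\<integral>\<^sup>+x. ennreal (normal_density 0 (sqrt d) x) * indicator A (x + a) \<partial>lborel)"
  proof -
    have [measurable]: "(\<lambda>x. x + a) -` A \<in> sets borel" using measurable_sets[of "\<lambda>x. x + a" borel borel A] by simp
    show ?thesis unfolding gam_def by (subst emeasure_distr, simp, simp, subst emeasure_density)
       (auto intro!: nn_integral_cong split: split_indicator)
  qed
  also have "\<dots> = (\<integral>\<^sup>+x. ennreal (normal_density a (sqrt d) (a + 1 * x)) * indicator A (a + 1 * x) \<partial>lborel)"
    by (intro nn_integral_cong) (simp add: normal_density_def add.commute)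
  also have "\<dots> = (\<integral>\<^sup>+x. ennreal (normal_density a (sqrt d) x) * indicator A x \<partial>lborel)"
    by (subst (2) nn_integral_real_affine[where c = 1 and t = a]) auto
  finally show "emeasure (distr (gam d) borel (\<lambda>x. x + a)) A
     = emeasure (density lborel (\<lambda>x. ennreal (normal_density a (sqrt d) x))) A"
    by (subst emeasure_density) auto
qed auto

definition shiftv :: "(nat \<Rightarrow> real) \<Rightarrow> nat \<Rightarrow> (nat \<Rightarrow> real) \<Rightarrow> (nat \<Rightarrow> real)" where
  "shiftv a L x = (\<lambda>j\<in>{..<L}. x j + a j)"

text \<open>The Cameron-Martin density of the shift by \<open>a\<close>.\<close>

definition cmw :: "real \<Rightarrow> nat \<Rightarrow> (nat \<Rightarrow> real) \<Rightarrow> (nat \<Rightarrow> real) \<Rightarrow> real" where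
  "cmw d L a x = exp (- (\<Sum>j<L. a j * x j / d + (a j)\<^sup>2 / (2 * d)))"

lemma shiftv_measurable [measurable]: "shiftv a L \<in> measurable (RL L) (RL L)"
  unfolding shiftv_def by measurable

lemma cmw_measurable [measurable]: "cmw d L a \<in> borel_measurable (RL L)"
  unfolding cmw_def by measurable

lemma cmw_pos: "cmw d L a x > 0" by (simp add: cmw_def)

text \<open>Both sides are the product of the normal laws with means \<open>a j\<close>: the left by
  completing the square in each coordinate, the right by translation.\<close>

lemma Gam_shift:
  assumes d: "d > 0"
  shows "density (Gam d L) (\<lambda>x. ennreal (exp (\<Sum>j<L. a j * x j / d - (a j)\<^sup>2 / (2 * d)))) = distr (Gam d L) (Gam d L) (shiftv a L)"
proof -
  let ?S = "\<lambda>x. exp (\<Sum>j<L. a j * x j / d - (a j)\<^sup>2 / (2 * d))"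
  define \<nu> where "\<nu> = (\<lambda>j. density lborel (\<lambda>x. ennreal (normal_density (a j) (sqrt d) x)))"
  have pn: "prob_space (\<nu> j)" for j unfolding \<nu>_def using d by (intro prob_space_normal_density) simp
  interpret N: product_sigma_finite \<nu>
    using pn by (simp add: product_sigma_finite_def prob_space_imp_sigma_finite)
  interpret G: product_prob_space "\<lambda>_::nat. gam d" by (rule product_gam[OF d])
  have setsN: "sets (PiM {..<L} \<nu>) = sets (RL L)"
    by (intro sets_PiM_cong) (auto simp: \<nu>_def)
  have 1: "distr (Gam d L) (Gam d L) (shiftv a L) = PiM {..<L} \<nu>"
  proof (rule N.PiM_eqI)
    fix A assume A: "\<And>i. i \<in> {..<L} \<Longrightarrow> A i \<in> sets (\<nu> i)"
    hence A': "A i \<in> sets borel" if "i < L" for i using that by (auto simp: \<nu>_def)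
    have "shiftv a L -` (PiE {..<L} A) \<inter> space (Gam d L) = PiE {..<L} (\<lambda>i. (\<lambda>x. x + a i) -` A i)"
      by (auto simp: space_Gam shiftv_def PiE_iff extensional_def)
    moreover have "PiE {..<L} A \<in> sets (RL L)" using A' by (intro sets_PiM_I_finite) auto
    ultimately have "emeasure (distr (Gam d L) (Gam d L) (shiftv a L)) (PiE {..<L} A)
       = emeasure (Gam d L) (PiE {..<L} (\<lambda>i. (\<lambda>x. x + a i) -` A i))"
      by (subst emeasure_distr) auto
    also have "\<dots> = (\<Prod>i<L. emeasure (gam d) ((\<lambda>x. x + a i) -` A i))"
      unfolding Gam_def using A' by (intro G.emeasure_PiM) (auto intro!: measurable_sets_borel[where M=borel])
    also have "\<dots> = (\<Prod>i<L. emeasure (\<nu> i) (A i))"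
      using A' by (intro prod.cong refl) (auto simp: \<nu>_def gam_shift[symmetric] emeasure_distr)
    finally show "emeasure (distr (Gam d L) (Gam d L) (shiftv a L)) (PiE {..<L} A) = (\<Prod>i\<in>{..<L}. emeasure (\<nu> i) (A i))" .
  qed (auto simp: setsN)
  have 2: "density (Gam d L) (\<lambda>x. ennreal (?S x)) = PiM {..<L} \<nu>"
  proof (rule N.PiM_eqI)
    fix A assume A: "\<And>i. i \<in> {..<L} \<Longrightarrow> A i \<in> sets (\<nu> i)"
    hence A' [measurable]: "A i \<in> sets borel" if "i < L" for i using that by (auto simp: \<nu>_def)
    have P: "PiE {..<L} A \<in> sets (RL L)" using A' by (intro sets_PiM_I_finite) auto
    define f where "f = (\<lambda>j x. ennreal (exp (a j * x / d - (a j)\<^sup>2 / (2 * d))) * indicator (A j) x)"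
    have "emeasure (density (Gam d L) (\<lambda>x. ennreal (?S x))) (PiE {..<L} A)
       = (\<integral>\<^sup>+x. ennreal (?S x) * indicator (PiE {..<L} A) x \<partial>Gam d L)"
      using P by (intro emeasure_density) auto
    also have "\<dots> = (\<integral>\<^sup>+x. (\<Prod>j<L. f j (x j)) \<partial>Gam d L)"
    proof (intro nn_integral_cong)
      fix x assume "x \<in> space (Gam d L)"
      hence "indicator (PiE {..<L} A) x = (\<Prod>j<L. indicator (A j) (x j) :: ennreal)"
        by (auto simp: space_Gam indicator_def PiE_iff prod_zero_iff)
      moreover have "ennreal (?S x) = (\<Prod>j<L. ennreal (exp (a j * x j / d - (a j)\<^sup>2 / (2 * d))))"
        by (subst exp_sum) (auto simp: prod_ennreal)
      ultimately show "ennreal (?S x) * indicator (PiE {..<L} A) x = (\<Prod>j<L. f j (x j))"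
        unfolding f_def prod.distrib by simp
    qed
    also have "\<dots> = (\<Prod>j<L. integral\<^sup>N (gam d) (f j))"
      unfolding Gam_def by (intro G.product_nn_integral_prod) (auto simp: f_def)
    also have "\<dots> = (\<Prod>i<L. emeasure (\<nu> i) (A i))"
    proof (intro prod.cong refl)
      fix j assume j: "j \<in> {..<L}"
      have [measurable]: "A j \<in> sets borel" using j by auto
      have "integral\<^sup>N (gam d) (f j) = (\<integral>\<^sup>+x. ennreal (normal_density 0 (sqrt d) x) * f j x \<partial>lborel)"
        unfolding gam_def f_def by (subst nn_integral_density) auto
      also have "\<dots> = (\<integral>\<^sup>+x. ennreal (normal_density (a j) (sqrt d) x) * indicator (A j) x \<partial>lborel)"
        by (intro nn_integral_cong)
           (simp add: f_def mult.assoc[symmetric] ennreal_mult[symmetric] normal_density_nonneg normal_density_tilt[OF d])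
      also have "\<dots> = emeasure (\<nu> j) (A j)"
        unfolding \<nu>_def by (subst emeasure_density) auto
      finally show "integral\<^sup>N (gam d) (f j) = emeasure (\<nu> j) (A j)" .
    qed
    finally show "emeasure (density (Gam d L) (\<lambda>x. ennreal (?S x))) (PiE {..<L} A) = (\<Prod>i\<in>{..<L}. emeasure (\<nu> i) (A i))" .
  qed (auto simp: setsN)
  show ?thesis using 1 2 by simp
qed

lemma cmw_eq: "cmw d L a x = exp (\<Sum>j<L. (- a j) * x j / d - (- a j)\<^sup>2 / (2 * d))"
proof -
  have "- (a j * x j / d + (a j)\<^sup>2 / (2 * d)) = (- a j) * x j / d - (- a j)\<^sup>2 / (2 * d)" for j by simp
  thus ?thesis unfolding cmw_def sum_negf[symmetric] by simp
qed

lemma shiftv_cancel: "x \<in> space (Gam d L) \<Longrightarrow> shiftv a L (shiftv (\<lambda>j. - a j) L x) = x"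
  by (auto simp: shiftv_def space_Gam PiE_iff extensional_def)

lemma Gam_shift_cmw: "d > 0 \<Longrightarrow> density (Gam d L) (\<lambda>x. ennreal (cmw d L a x)) = distr (Gam d L) (Gam d L) (shiftv (\<lambda>j. - a j) L)"
  unfolding cmw_eq using Gam_shift[of d L "\<lambda>j. - a j"] by simp

text \<open>\<open>cmw\<close> compensates the substitution \<open>x -> x + a\<close>, hence its
  negative exponent: weighting moves the mean to \<open>- a\<close>, and the shift moves it
  back.\<close>

lemma Gam_nn_shift:
  assumes d: "d > 0" and [measurable]: "f \<in> borel_measurable (RL L)"
  shows "(\<integral>\<^sup>+x. f x \<partial>Gam d L) = (\<integral>\<^sup>+x. ennreal (cmw d L a x) * f (shiftv a L x) \<partial>Gam d L)"
proof -
  have "(\<integral>\<^sup>+x. ennreal (cmw d L a x) * f (shiftv a L x) \<partial>Gam d L) = (\<integral>\<^sup>+x. f (shiftv a L x) \<partial>density (Gam d L) (\<lambda>x. ennreal (cmw d L a x)))"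
    by (subst nn_integral_density) auto
  also have "\<dots> = (\<integral>\<^sup>+x. f (shiftv a L (shiftv (\<lambda>j. - a j) L x)) \<partial>Gam d L)"
    unfolding Gam_shift_cmw[OF d] by (subst nn_integral_distr) auto
  also have "\<dots> = (\<integral>\<^sup>+x. f x \<partial>Gam d L)"
    by (intro nn_integral_cong) (simp add: shiftv_cancel)
  finally show ?thesis ..
qed

lemma Gam_integral_shift:
  fixes f :: "_ \<Rightarrow> complex"
  assumes d: "d > 0" and [measurable]: "f \<in> borel_measurable (RL L)"
  shows "(\<integral>x. f x \<partial>Gam d L) = (\<integral>x. cmw d L a x *\<^sub>R f (shiftv a L x) \<partial>Gam d L)"
proof -
  have "(\<integral>x. cmw d L a x *\<^sub>R f (shiftv a L x) \<partial>Gam d L) = (\<integral>x. f (shiftv a L x) \<partial>density (Gam d L) (\<lambda>x. ennreal (cmw d L a x)))"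
    by (subst integral_density) (auto simp: less_imp_le[OF cmw_pos])
  also have "\<dots> = (\<integral>x. f (shiftv a L (shiftv (\<lambda>j. - a j) L x)) \<partial>Gam d L)"
    unfolding Gam_shift_cmw[OF d] by (subst integral_distr) auto
  also have "\<dots> = (\<integral>x. f x \<partial>Gam d L)"
    by (intro Bochner_Integration.integral_cong) (auto simp: shiftv_cancel)
  finally show ?thesis ..
qed

lemma nn_integral_cmw: "d > 0 \<Longrightarrow> (\<integral>\<^sup>+x. ennreal (cmw d L a x) \<partial>Gam d L) = 1"
  using Gam_nn_shift[of d "\<lambda>_. 1" L a] prob_space.emeasure_space_1[OF prob_space_Gam[of d L]] by simp

section \<open>Exponential moments and the maximal inequality\<close>

lemma gam_exp:
  assumes d: "d > 0"
  shows "(\<integral>\<^sup>+y. ennreal (exp (\<theta> * y)) \<partial>gam d) = ennreal (exp (\<theta>\<^sup>2 * d / 2))"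
proof -
  have eq: "normal_density 0 (sqrt d) y * exp (\<theta> * y) = exp (\<theta>\<^sup>2 * d / 2) * normal_density (\<theta> * d) (sqrt d) y" for y
  proof -
    have "exp (\<theta>\<^sup>2 * d / 2) * exp (\<theta> * d * y / d - (\<theta> * d)\<^sup>2 / (2 * d)) = exp (\<theta> * y)"
      unfolding exp_add[symmetric] using d by (simp add: field_simps power2_eq_square)
    thus ?thesis unfolding normal_density_tilt[OF d, of y "\<theta> * d", symmetric]
      by (metis mult.assoc mult.commute)
  qed
  interpret P: prob_space "density lborel (\<lambda>x. ennreal (normal_density (\<theta> * d) (sqrt d) x))"
    using d by (intro prob_space_normal_density) simp
  have "(\<integral>\<^sup>+y. ennreal (exp (\<theta> * y)) \<partial>gam d) = (\<integral>\<^sup>+y. ennreal (normal_density 0 (sqrt d) y) * ennreal (exp (\<theta> * y)) \<partial>lborel)"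
    unfolding gam_def by (subst nn_integral_density) auto
  also have "\<dots> = (\<integral>\<^sup>+y. ennreal (exp (\<theta>\<^sup>2 * d / 2)) * (ennreal (normal_density (\<theta> * d) (sqrt d) y)) \<partial>lborel)"
    by (intro nn_integral_cong) (simp add: ennreal_mult[symmetric] normal_density_nonneg eq)
  also have "\<dots> = ennreal (exp (\<theta>\<^sup>2 * d / 2)) * (\<integral>\<^sup>+y. ennreal (normal_density (\<theta> * d) (sqrt d) y) \<partial>lborel)"
    by (intro nn_integral_cmult) auto
  also have "(\<integral>\<^sup>+y. ennreal (normal_density (\<theta> * d) (sqrt d) y) \<partial>lborel) = 1"
    using P.emeasure_space_1 by (simp add: emeasure_density)
  finally show ?thesis by simp
qed

lemma gam_cosh:
  assumes d: "d > 0"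
  shows "(\<integral>\<^sup>+y. ennreal (cosh (\<theta> * (s + y))) \<partial>gam d) = ennreal (exp (\<theta>\<^sup>2 * d / 2) * cosh (\<theta> * s))"
proof -
  have "ennreal (cosh (\<theta> * (s + y))) = ennreal (exp (\<theta> * s) / 2) * ennreal (exp (\<theta> * y)) + ennreal (exp (- (\<theta> * s)) / 2) * ennreal (exp ((- \<theta>) * y))" for y
    by (simp add: ennreal_mult[symmetric] ennreal_plus[symmetric] cosh_def exp_add[symmetric] algebra_simps add_divide_distrib del: ennreal_plus)
  hence "(\<integral>\<^sup>+y. ennreal (cosh (\<theta> * (s + y))) \<partial>gam d)
    = ennreal (exp (\<theta> * s) / 2) * ennreal (exp (\<theta>\<^sup>2 * d / 2)) + ennreal (exp (- (\<theta> * s)) / 2) * ennreal (exp ((-\<theta>)\<^sup>2 * d / 2))"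
    using gam_exp[OF d, of \<theta>] gam_exp[OF d, of "- \<theta>"] by (simp add: nn_integral_add nn_integral_cmult)
  also have "\<dots> = ennreal (exp (\<theta>\<^sup>2 * d / 2) * cosh (\<theta> * s))"
    by (simp add: ennreal_mult[symmetric] ennreal_plus[symmetric] cosh_def algebra_simps add_divide_distrib del: ennreal_plus)
  finally show ?thesis .
qed

lemma cosh_abs: "cosh \<bar>x\<bar> = cosh (x::real)"
  by (cases "x \<ge> 0") auto

lemma cosh_measurable [measurable (raw)]:
  "f \<in> borel_measurable M \<Longrightarrow> (\<lambda>x. cosh (f x :: real)) \<in> borel_measurable M"
  by (rule measurable_compose[OF _ borel_measurable_continuous_onI]) (auto intro!: continuous_intros)

lemma psum_upd: "j \<le> L \<Longrightarrow> (\<Sum>i<j. (x(L := y)) i) = (\<Sum>i<j. x i)" for x :: "nat \<Rightarrow> real"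
  by (intro sum.cong) auto

lemma psum_upd_Suc: "(\<Sum>i<Suc L. (x(L := y)) i) = (\<Sum>i<L. x i) + y" for x :: "nat \<Rightarrow> real"
  by (simp add: psum_upd)

lemma Gam_nn_Suc:
  assumes d: "d > 0" and f: "f \<in> borel_measurable (RL (Suc L))"
  shows "(\<integral>\<^sup>+x. f x \<partial>Gam d (Suc L)) = (\<integral>\<^sup>+x. (\<integral>\<^sup>+y. f (x(L := y)) \<partial>gam d) \<partial>Gam d L)"
proof -
  interpret G: product_prob_space "\<lambda>_::nat. gam d" by (rule product_gam[OF d])
  have "f \<in> borel_measurable (PiM (insert L {..<L}) (\<lambda>_. gam d))"
    using f by (subst measurable_cong_sets[OF sets_PiM_cong refl, of _ _ _ "\<lambda>_. borel"]) (auto simp: lessThan_Suc)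
  thus ?thesis unfolding Gam_def lessThan_Suc by (intro G.product_nn_integral_insert) auto
qed

text \<open>Doob's inequality for the submartingale \<open>cosh (\<theta> * S_j)\<close>, by
  integrating out the last coordinate. On paths that have already exceeded \<open>a\<close> the mean
  of \<open>cosh\<close> does not decrease in the last step; a path that exceeds \<open>a\<close>
  only now pays \<open>cosh (\<theta> * a)\<close> at once. Keeping the final value on the
  right-hand side closes the induction.\<close>

lemma Gam_maximal_aux:
  assumes d: "d > 0" and a: "a \<ge> 0"
  defines "Mx \<equiv> \<lambda>L (x::nat\<Rightarrow>real). \<exists>j\<le>L. \<bar>\<Sum>i<j. x i\<bar> \<ge> a"
  shows "(\<integral>\<^sup>+x. ennreal (cosh (\<theta> * a)) * (if Mx L x then 1 else 0) \<partial>Gam d L)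
     \<le> (\<integral>\<^sup>+x. (if Mx L x then ennreal (cosh (\<theta> * (\<Sum>i<L. x i))) else 0) \<partial>Gam d L)"
proof (induction L)
  case 0
  have cosh_mono: "cosh (\<theta> * a) \<le> cosh (\<theta> * s)" if "\<bar>s\<bar> \<ge> a" for s
    using cosh_real_nonneg_le_iff[of "\<bar>\<theta> * a\<bar>" "\<bar>\<theta> * s\<bar>"] that a
    by (simp add: cosh_abs) (simp add: abs_mult mult_left_mono)
  show ?case using cosh_mono[of 0] by (intro nn_integral_mono) (auto simp: Mx_def)
next
  case (Suc L)
  have cosh_mono: "cosh (\<theta> * a) \<le> cosh (\<theta> * s)" if "\<bar>s\<bar> \<ge> a" for s
    using cosh_real_nonneg_le_iff[of "\<bar>\<theta> * a\<bar>" "\<bar>\<theta> * s\<bar>"] that a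
    by (simp add: cosh_abs) (simp add: abs_mult mult_left_mono)
  interpret pg: prob_space "gam d" by (rule prob_space_gam[OF d])
  let ?N = "\<lambda>x. \<integral>\<^sup>+y. ennreal (cosh (\<theta> * a)) * (if \<not> Mx L x \<and> \<bar>(\<Sum>i<L. x i) + y\<bar> \<ge> a then 1 else 0) \<partial>gam d" and ?P = "\<lambda>x. if Mx L x then ennreal (cosh (\<theta> * (\<Sum>i<L. x i))) else 0"
  have Mm [measurable]: "Measurable.pred (RL L) (Mx L)" for L
    unfolding Mx_def by measurable
  have MS: "Mx (Suc L) (x(L := y)) \<longleftrightarrow> Mx L x \<or> \<bar>(\<Sum>i<L. x i) + y\<bar> \<ge> a" for x y
  proof -
    have "Mx (Suc L) z \<longleftrightarrow> Mx L z \<or> a \<le> \<bar>\<Sum>i<Suc L. z i\<bar>" for z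
      unfolding Mx_def by (auto simp: le_Suc_eq simp del: sum.lessThan_Suc)
    moreover have "Mx L (x(L := y)) = Mx L x"
      unfolding Mx_def by (rule ex_cong1) (auto simp: psum_upd simp del: fun_upd_apply)
    ultimately show ?thesis using psum_upd_Suc[where L = L and x = x and y = y] by simp
  qed
  have "(\<integral>\<^sup>+x. ennreal (cosh (\<theta> * a)) * (if Mx (Suc L) x then 1 else 0) \<partial>Gam d (Suc L))
    = (\<integral>\<^sup>+x. (\<integral>\<^sup>+y. ennreal (cosh (\<theta> * a)) * (if Mx L x \<or> \<bar>(\<Sum>i<L. x i) + y\<bar> \<ge> a then 1 else 0) \<partial>gam d) \<partial>Gam d L)"
    by (subst Gam_nn_Suc[OF d]) (auto simp: MS simp del: fun_upd_apply)
  also have "\<dots> = (\<integral>\<^sup>+x. ennreal (cosh (\<theta> * a)) * (if Mx L x then 1 else 0)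
      + ?N x \<partial>Gam d L)"
    by (intro nn_integral_cong) (auto simp: pg.emeasure_space_1[simplified])
  also have "\<dots> = (\<integral>\<^sup>+x. ennreal (cosh (\<theta> * a)) * (if Mx L x then 1 else 0) \<partial>Gam d L)
      + (\<integral>\<^sup>+x. ?N x \<partial>Gam d L)"
    by (intro nn_integral_add) (auto intro!: pg.borel_measurable_nn_integral)
  also have "\<dots> \<le> (\<integral>\<^sup>+x. ?P x \<partial>Gam d L)
      + (\<integral>\<^sup>+x. ?N x \<partial>Gam d L)"
    by (intro add_right_mono Suc.IH)
  also have "\<dots> = (\<integral>\<^sup>+x. ?P x
      + ?N x \<partial>Gam d L)"
    by (intro nn_integral_add[symmetric]) (auto intro!: pg.borel_measurable_nn_integral)
  also have "\<dots> \<le> (\<integral>\<^sup>+x. (\<integral>\<^sup>+y. (if Mx L x \<or> \<bar>(\<Sum>i<L. x i) + y\<bar> \<ge> a then ennreal (cosh (\<theta> * ((\<Sum>i<L. x i) + y))) else 0) \<partial>gam d) \<partial>Gam d L)"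
  proof (intro nn_integral_mono)
    fix x :: "nat \<Rightarrow> real"
    show "?P x
      + ?N x
      \<le> (\<integral>\<^sup>+y. (if Mx L x \<or> \<bar>(\<Sum>i<L. x i) + y\<bar> \<ge> a then ennreal (cosh (\<theta> * ((\<Sum>i<L. x i) + y))) else 0) \<partial>gam d)"
    proof (cases "Mx L x")
      case True
      have "1 * cosh (\<theta> * (\<Sum>i<L. x i)) \<le> exp (\<theta>\<^sup>2 * d / 2) * cosh (\<theta> * (\<Sum>i<L. x i))"
        using d by (intro mult_right_mono) auto
      thus ?thesis using True by (simp add: gam_cosh[OF d] ennreal_leI)
    next
      case False
      thus ?thesis using cosh_mono by (auto intro!: nn_integral_mono ennreal_leI)
    qed
  qed
  also have "\<dots> = (\<integral>\<^sup>+x. (if Mx (Suc L) x then ennreal (cosh (\<theta> * (\<Sum>i<Suc L. x i))) else 0) \<partial>Gam d (Suc L))"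
    by (subst Gam_nn_Suc[OF d]) (auto simp: MS psum_upd_Suc simp del: sum.lessThan_Suc fun_upd_apply cong: if_cong)
  finally show ?case .
qed

lemma Gam_cosh: "d > 0 \<Longrightarrow> (\<integral>\<^sup>+x. ennreal (cosh (\<theta> * (\<Sum>i<L. x i))) \<partial>Gam d L) = ennreal (exp (\<theta>\<^sup>2 * (real L * d) / 2))"
proof (induction L)
  case 0
  show ?case using prob_space.emeasure_space_1[OF prob_space_Gam[OF 0, of 0]] by simp
next
  case (Suc L)
  have "(\<integral>\<^sup>+x. ennreal (cosh (\<theta> * (\<Sum>i<Suc L. x i))) \<partial>Gam d (Suc L))
     = (\<integral>\<^sup>+x. (\<integral>\<^sup>+y. ennreal (cosh (\<theta> * ((\<Sum>i<L. x i) + y))) \<partial>gam d) \<partial>Gam d L)"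
    by (subst Gam_nn_Suc[OF Suc.prems]) (auto simp: psum_upd_Suc simp del: sum.lessThan_Suc fun_upd_apply)
  also have "\<dots> = (\<integral>\<^sup>+x. ennreal (exp (\<theta>\<^sup>2 * d / 2)) * ennreal (cosh (\<theta> * (\<Sum>i<L. x i))) \<partial>Gam d L)"
    by (simp add: gam_cosh[OF Suc.prems] ennreal_mult)
  also have "\<dots> = ennreal (exp (\<theta>\<^sup>2 * d / 2)) * ennreal (exp (\<theta>\<^sup>2 * (real L * d) / 2))"
    by (subst nn_integral_cmult) (auto simp: Suc)
  also have "\<dots> = ennreal (exp (\<theta>\<^sup>2 * (real (Suc L) * d) / 2))"
    by (simp add: ennreal_mult[symmetric] exp_add[symmetric] algebra_simps add_divide_distrib)
  finally show ?case .
qed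

abbreviation exceed where "exceed d L a \<equiv> {x \<in> space (Gam d L). \<exists>j\<le>L. \<bar>\<Sum>i<j. x i\<bar> \<ge> a}"

lemma Gam_maximal:
  assumes d: "d > 0" and a: "a \<ge> 0" and L: "L > 0"
  shows "measure (Gam d L) (exceed d L a) \<le> 4 * exp (- a / sqrt (real L * d))"
proof -
  interpret P: prob_space "Gam d L" by (rule prob_space_Gam[OF d])
  define t where "t = real L * d"
  have t: "t > 0" using d L by (simp add: t_def)
  \<comment> \<open>With this \<open>\<theta>\<close> the moment
    \<open>exp (\<theta>^2 * t / 2)\<close> is a constant. The decay obtained is exponential instead
    of Gaussian in \<open>a / sqrt t\<close>, which still beats every power of
    \<open>t\<close>.\<close>
  define \<theta> where "\<theta> = 1 / sqrt t"
  define A where "A = exceed d L a"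
  have A [measurable]: "A \<in> sets (RL L)"
  proof -
    have "{x \<in> space (RL L). \<exists>j\<le>L. \<bar>\<Sum>i<j. x i\<bar> \<ge> a} \<in> sets (RL L)"
      by measurable
    thus ?thesis by (simp add: A_def space_Gam space_PiM)
  qed
  have "ennreal (cosh (\<theta> * a)) * emeasure (Gam d L) A = (\<integral>\<^sup>+x. ennreal (cosh (\<theta> * a)) * indicator A x \<partial>Gam d L)"
    by (subst nn_integral_cmult_indicator) auto
  also have "\<dots> = (\<integral>\<^sup>+x. ennreal (cosh (\<theta> * a)) * (if \<exists>j\<le>L. \<bar>\<Sum>i<j. x i\<bar> \<ge> a then 1 else 0) \<partial>Gam d L)"
    by (intro nn_integral_cong) (auto simp: A_def indicator_def)
  also have "\<dots> \<le> (\<integral>\<^sup>+x. (if \<exists>j\<le>L. \<bar>\<Sum>i<j. x i\<bar> \<ge> a then ennreal (cosh (\<theta> * (\<Sum>i<L. x i))) else 0) \<partial>Gam d L)"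
    by (rule Gam_maximal_aux[OF d a])
  also have "\<dots> \<le> (\<integral>\<^sup>+x. ennreal (cosh (\<theta> * (\<Sum>i<L. x i))) \<partial>Gam d L)"
    by (intro nn_integral_mono) auto
  also have "\<dots> = ennreal (exp (\<theta>\<^sup>2 * t / 2))" using Gam_cosh[OF d] by (simp add: t_def)
  also have "\<theta>\<^sup>2 * t = 1" using t by (simp add: \<theta>_def power_divide)
  finally have "ennreal (cosh (\<theta> * a) * measure (Gam d L) A) \<le> ennreal (exp (1/2))"
    by (simp add: P.emeasure_eq_measure ennreal_mult)
  hence 1: "cosh (\<theta> * a) * measure (Gam d L) A \<le> exp (1/2)" by simp
  have "exp (\<theta> * a) / 2 \<le> cosh (\<theta> * a)" by (simp add: cosh_def)
  hence "exp (\<theta> * a) / 2 * measure (Gam d L) A \<le> cosh (\<theta> * a) * measure (Gam d L) A" by (intro mult_right_mono) auto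
  also have "\<dots> \<le> exp (1/2)" by fact
  also have "exp (1/2::real) \<le> 2"
  proof -
    have "exp (1/2::real) * exp (1/2) = exp 1" by (simp add: exp_add[symmetric])
    moreover have "exp (1::real) \<le> 3" by (rule exp_le)
    ultimately have "(exp (1/2::real))\<^sup>2 \<le> 2\<^sup>2" by (simp add: power2_eq_square)
    thus ?thesis by (rule power2_le_imp_le) simp
  qed
  finally have "measure (Gam d L) A \<le> 4 / exp (\<theta> * a)" by (simp add: field_simps)
  thus ?thesis by (simp add: A_def \<theta>_def t_def exp_minus field_simps)
qed

section \<open>Small-ball probabilities and their translates\<close>

lemma gam_cexp:
  assumes d: "d > 0"
  shows "(\<integral>y. exp (\<i> * of_real (\<alpha> * y)) \<partial>gam d) = of_real (exp (- (\<alpha>\<^sup>2 * d / 2)))"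
proof -
  interpret P: prob_space "gam d" by (rule prob_space_gam[OF d])
  have "distributed (gam d) lborel (\<lambda>x. x) (\<lambda>x. ennreal (normal_density 0 (sqrt d) x))"
    unfolding distributed_def by (auto simp: gam_def distr_id2)
  hence "distributed (gam d) lborel (\<lambda>x. (x - 0) / sqrt d) (\<lambda>x. ennreal (std_normal_density x))"
    using P.normal_standard_normal_convert[of "sqrt d" "\<lambda>x. x" 0] d by simp
  hence D: "distr (gam d) lborel (\<lambda>x. x / sqrt d) = std_normal_distribution"
    unfolding distributed_def by simp
  have "(\<integral>y. exp (\<i> * of_real (\<alpha> * y)) \<partial>gam d) = (\<integral>y. iexp ((\<alpha> * sqrt d) * (y / sqrt d)) \<partial>gam d)"
    using d by (intro Bochner_Integration.integral_cong) auto
  also have "\<dots> = (\<integral>u. iexp ((\<alpha> * sqrt d) * u) \<partial>distr (gam d) lborel (\<lambda>x. x / sqrt d))"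
    by (subst integral_distr) auto
  also have "\<dots> = char std_normal_distribution (\<alpha> * sqrt d)" unfolding D char_def by simp
  also have "\<dots> = of_real (exp (- (\<alpha>\<^sup>2 * d / 2)))" 
    using d by (simp add: char_std_normal_distribution power_mult_distrib)
  finally show ?thesis .
qed

text \<open>Cosines are eigenfunctions of convolution with the normal law; the one that vanishes at
  the ends of \<open>[-b, b]\<close> is the ground state used in
  \<open>Gam_small_ball\<close>.\<close>

lemma gam_cos:
  assumes d: "d > 0"
  shows "(\<integral>y. cos (\<alpha> * (s + y)) \<partial>gam d) = exp (- (\<alpha>\<^sup>2 * d / 2)) * cos (\<alpha> * s)"
proof -
  interpret P: prob_space "gam d" by (rule prob_space_gam[OF d])
  have int: "integrable (gam d) (\<lambda>y. exp (\<i> * of_real (\<alpha> * y)))"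
    by (rule P.integrable_const_bound[where B = 1]) auto
  have "(\<integral>y. cos (\<alpha> * (s + y)) \<partial>gam d) = (\<integral>y. Re (exp (\<i> * of_real (\<alpha> * s)) * exp (\<i> * of_real (\<alpha> * y))) \<partial>gam d)"
    by (intro Bochner_Integration.integral_cong refl)
       (simp add: exp_add[symmetric] Re_exp distrib_left[symmetric] flip: of_real_add)
  also have "\<dots> = Re (\<integral>y. exp (\<i> * of_real (\<alpha> * s)) * exp (\<i> * of_real (\<alpha> * y)) \<partial>gam d)"
    using int by (intro integral_Re) auto
  also have "\<dots> = Re (exp (\<i> * of_real (\<alpha> * s)) * of_real (exp (- (\<alpha>\<^sup>2 * d / 2))))"
    unfolding gam_cexp[OF d, symmetric] by (subst integral_mult_right_zero) auto
  finally show ?thesis by (simp add: Re_exp)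
qed

text \<open>The fourth moment is taken because the bound is summed over \<open>L\<close> steps with
  \<open>d = T / L\<close>: \<open>L * d^2\<close> tends to 0, whereas the variance would leave a
  constant.\<close>

lemma gam_tail:
  assumes d: "d > 0" and b: "b > 0"
  shows "measure (gam d) {y. \<bar>y\<bar> \<ge> b} \<le> 3 * d\<^sup>2 / b ^ 4"
proof -
  interpret P: prob_space "gam d" by (rule prob_space_gam[OF d])
  have hb: "has_bochner_integral lborel (\<lambda>x. normal_density 0 (sqrt d) x * (x - 0) ^ (2 * 2)) (fact (2 * 2) / ((2 / (sqrt d)\<^sup>2)^2 * fact 2))"
    using d by (intro normal_moment_even) simp
  have "has_bochner_integral (gam d) (\<lambda>x. x ^ 4) (3 * d\<^sup>2)"
    unfolding gam_def using hb d
    by (intro has_bochner_integral_density) (auto simp: normal_density_nonneg fact_numeral field_simps power2_eq_square)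
  hence i: "integrable (gam d) (\<lambda>x. x ^ 4)" and e: "(\<integral>x. x ^ 4 \<partial>gam d) = 3 * d\<^sup>2"
    by (auto simp: has_bochner_integral_iff)
  have "measure (gam d) {y \<in> space (gam d). y ^ 4 \<ge> b ^ 4} \<le> (\<integral>x. x ^ 4 \<partial>gam d) / b ^ 4"
    using i b by (intro integral_Markov_inequality_measure[where A = "{}"]) auto
  moreover have "y ^ 4 \<ge> b ^ 4 \<longleftrightarrow> \<bar>y\<bar> \<ge> b" for y
    using b power_mono_iff[of b "\<bar>y\<bar>" 4] by (simp add: power_even_abs)
  ultimately show ?thesis using e by simp
qed

lemma Gam_integral_Suc:
  fixes f :: "_ \<Rightarrow> real"
  assumes d: "d > 0" and f: "integrable (Gam d (Suc L)) f"
  shows "(\<integral>x. f x \<partial>Gam d (Suc L)) = (\<integral>x. (\<integral>y. f (x(L := y)) \<partial>gam d) \<partial>Gam d L)"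
proof -
  interpret G: product_prob_space "\<lambda>_::nat. gam d" by (rule product_gam[OF d])
  show ?thesis using f unfolding Gam_def lessThan_Suc by (intro G.product_integral_insert) auto
qed

text \<open>\<open>F\<close> is the walk killed on leaving \<open>[-b, b]\<close>, tested against
  the ground state \<open>cos (\<alpha> * s)\<close>. Each step multiplies its mean by the
  eigenvalue \<open>?q\<close>, up to a loss \<open>p\<close> caused by long jumps; and
  \<open>F\<close> is at most the indicator of survival.\<close>

lemma Gam_small_ball:
  assumes d: "d > 0" and b: "b > 0"
  shows "measure (Gam d L) {x \<in> space (Gam d L). \<forall>j\<le>L. \<bar>\<Sum>i<j. x i\<bar> \<le> b}
     \<ge> exp (- ((pi / (2 * b))\<^sup>2 * (real L * d) / 2)) - real L * (3 * d\<^sup>2 / (2 * b) ^ 4)"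
proof -
  define \<alpha> where "\<alpha> = pi / (2 * b)"
  let ?q = "exp (- (\<alpha>\<^sup>2 * d / 2))"
  define p where "p = 3 * d\<^sup>2 / (2 * b) ^ 4"
  have p0: "p \<ge> 0" using d b by (simp add: p_def)
  define st where "st = (\<lambda>L (x::nat \<Rightarrow> real). \<forall>j\<le>L. \<bar>\<Sum>i<j. x i\<bar> \<le> b)"
  define F where "F = (\<lambda>L x. (if st L x then cos (\<alpha> * (\<Sum>i<L. x i)) else 0))"
  have stm [measurable]: "Measurable.pred (RL L) (st L)" for L
    unfolding st_def by measurable
  interpret pg: prob_space "gam d" by (rule prob_space_gam[OF d])
  have PG: "prob_space (Gam d L)" for L by (rule prob_space_Gam[OF d])
  have Fm [measurable]: "F L \<in> borel_measurable (RL L)" for L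
    unfolding F_def by measurable
  have iF: "integrable (Gam d L) (F L)" for L
    by (rule finite_measure.integrable_const_bound[where B = 1])
       (auto simp: F_def PG[THEN prob_space.finite_measure])
  have stS: "st (Suc L) (x(L := y)) \<longleftrightarrow> st L x \<and> \<bar>(\<Sum>i<L. x i) + y\<bar> \<le> b" for L x y
  proof -
    have "st (Suc L) z \<longleftrightarrow> st L z \<and> \<bar>\<Sum>i<Suc L. z i\<bar> \<le> b" for z
      unfolding st_def by (auto simp: le_Suc_eq simp del: sum.lessThan_Suc)
    moreover have "st L (x(L := y)) = st L x"
      unfolding st_def by (rule all_cong1) (auto simp: psum_upd simp del: fun_upd_apply)
    ultimately show ?thesis using psum_upd_Suc[where L = L and x = x and y = y] by simp
  qed
  have K: "(\<integral>x. F L x \<partial>Gam d L) \<ge> exp (- (\<alpha>\<^sup>2 * (real L * d) / 2)) - real L * p" for L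
  proof (induction L)
    case 0
    have "F 0 x = 1" for x using b by (simp add: F_def st_def)
    thus ?case using prob_space.prob_space[OF PG[of 0]] by simp
  next
    case (Suc L)
    \<comment> \<open>Killing at \<open>b < |s| <= 3 * b\<close> only increases the mean, since the
      cosine is not positive there. Beyond \<open>3 * b\<close> the last jump has size at least
      \<open>2 * b\<close>, which is the indicator.\<close>
    have key: "(if \<bar>s\<bar> \<le> b then cos (\<alpha> * s) else 0) \<ge> cos (\<alpha> * s) - indicator {y. \<bar>y\<bar> \<ge> 2 * b} (s - s0)" if "\<bar>s0\<bar> \<le> b" for s s0
    proof -
      consider "\<bar>s\<bar> \<le> b" | "b < \<bar>s\<bar>" "\<bar>s\<bar> \<le> 3 * b" | "\<bar>s\<bar> > 3 * b" by linarith
      thus ?thesis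
      proof cases
        case 2
        have "pi / 2 \<le> \<alpha> * \<bar>s\<bar>" "\<alpha> * \<bar>s\<bar> \<le> 3 * pi / 2"
          using 2 b by (auto simp: \<alpha>_def field_simps)
        hence "- cos (\<alpha> * \<bar>s\<bar> - pi) \<le> 0" by (intro neg_le_0_iff_le[THEN iffD2] cos_ge_zero) auto
        hence "cos (\<alpha> * \<bar>s\<bar>) \<le> 0" by (simp add: cos_diff)
        moreover have "cos (\<alpha> * \<bar>s\<bar>) = cos (\<alpha> * s)" by (cases "s \<ge> 0") auto
        ultimately show ?thesis using 2 by (auto simp: indicator_def)
      next
        case 3
        hence "\<bar>s - s0\<bar> \<ge> 2 * b" using that by linarith
        thus ?thesis using 3 b cos_le_one[of "\<alpha> * s"] by (auto simp: indicator_def)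
      qed (auto simp: indicator_def)
    qed
    have "exp (- (\<alpha>\<^sup>2 * (real (Suc L) * d) / 2)) - real (Suc L) * p
       = ?q * exp (- (\<alpha>\<^sup>2 * (real L * d) / 2)) - real L * p - p"
      by (simp add: exp_add[symmetric] algebra_simps add_divide_distrib)
    also have "\<dots> \<le> ?q * exp (- (\<alpha>\<^sup>2 * (real L * d) / 2)) - ?q * (real L * p) - p"
    proof -
      have "?q \<le> 1" using d by simp
      hence "?q * (real L * p) \<le> 1 * (real L * p)" using p0 by (intro mult_right_mono) auto
      thus ?thesis by simp
    qed
    also have "\<dots> = ?q * (exp (- (\<alpha>\<^sup>2 * (real L * d) / 2)) - real L * p) - p"
      by (simp add: algebra_simps)
    also have "\<dots> \<le> ?q * (\<integral>x. F L x \<partial>Gam d L) - p"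
      using Suc.IH by (intro diff_right_mono mult_left_mono) auto
    also have "\<dots> = (\<integral>x. ?q * F L x - p \<partial>Gam d L)"
      using iF[of L] prob_space.prob_space[OF PG[of L]] by (subst Bochner_Integration.integral_diff) 
        (auto simp: finite_measure.integrable_const[OF prob_space.finite_measure[OF PG]])
    also have "\<dots> \<le> (\<integral>x. (\<integral>y. F (Suc L) (x(L := y)) \<partial>gam d) \<partial>Gam d L)"
    proof (rule integral_mono)
      show "integrable (Gam d L) (\<lambda>x. ?q * F L x - p)"
        using iF[of L] by (auto simp: finite_measure.integrable_const[OF prob_space.finite_measure[OF PG]])
      have eqF: "F (Suc L) (x(L := y)) = (if st L x \<and> \<bar>(\<Sum>i<L. x i) + y\<bar> \<le> b then cos (\<alpha> * ((\<Sum>i<L. x i) + y)) else 0)" for x y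
        unfolding F_def stS psum_upd_Suc by simp
      have bdF: "\<bar>\<integral>y. F (Suc L) (x(L := y)) \<partial>gam d\<bar> \<le> 1" for x
      proof -
        have "norm (\<integral>y. F (Suc L) (x(L := y)) \<partial>gam d) \<le> (\<integral>y. norm (F (Suc L) (x(L := y))) \<partial>gam d)" by (rule integral_norm_bound)
        also have "\<dots> \<le> (\<integral>y. 1 \<partial>gam d)"
          unfolding eqF by (intro integral_mono pg.integrable_const_bound[where B = 1]) auto
        finally show ?thesis by (simp add: pg.prob_space[simplified])
      qed
      show "integrable (Gam d L) (\<lambda>x. \<integral>y. F (Suc L) (x(L := y)) \<partial>gam d)"
      proof (rule finite_measure.integrable_const_bound[where B = 1, OF prob_space.finite_measure[OF PG]])
        show "(\<lambda>x. \<integral>y. F (Suc L) (x(L := y)) \<partial>gam d) \<in> borel_measurable (Gam d L)"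
          unfolding eqF by (intro pg.borel_measurable_lebesgue_integral) measurable
      qed (use bdF in auto)
      fix x assume "x \<in> space (Gam d L)"
      show "?q * F L x - p \<le> (\<integral>y. F (Suc L) (x(L := y)) \<partial>gam d)"
      proof (cases "st L x")
        case True
        define s where "s = (\<Sum>i<L. x i)"
        have s: "\<bar>s\<bar> \<le> b" using True by (auto simp: s_def st_def)
        have "?q * F L x - p \<le> ?q * cos (\<alpha> * s) - measure (gam d) {y. \<bar>y\<bar> \<ge> 2 * b}"
          using gam_tail[OF d, of "2 * b"] b True by (simp add: F_def s_def p_def)
        also have "\<dots> = (\<integral>y. cos (\<alpha> * (s + y)) \<partial>gam d) - (\<integral>y. indicator {y. \<bar>y\<bar> \<ge> 2 * b} y \<partial>gam d)"
          by (simp add: gam_cos[OF d])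
        also have "\<dots> = (\<integral>y. cos (\<alpha> * (s + y)) - indicator {y. \<bar>y\<bar> \<ge> 2 * b} y \<partial>gam d)"
          by (intro Bochner_Integration.integral_diff[symmetric] pg.integrable_const_bound[where B = 1]) auto
        also have "\<dots> \<le> (\<integral>y. (if \<bar>s + y\<bar> \<le> b then cos (\<alpha> * (s + y)) else 0) \<partial>gam d)"
        proof (rule integral_mono)
          show "integrable (gam d) (\<lambda>y. cos (\<alpha> * (s + y)) - indicator {y. \<bar>y\<bar> \<ge> 2 * b} y)"
            by (intro Bochner_Integration.integrable_diff pg.integrable_const_bound[where B = 1]) auto
          show "integrable (gam d) (\<lambda>y. (if \<bar>s + y\<bar> \<le> b then cos (\<alpha> * (s + y)) else 0))"
            by (intro pg.integrable_const_bound[where B = 1]) auto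
          show "cos (\<alpha> * (s + y)) - indicator {y. \<bar>y\<bar> \<ge> 2 * b} y \<le> (if \<bar>s + y\<bar> \<le> b then cos (\<alpha> * (s + y)) else 0)" for y
            using key[OF s, of "s + y"] by simp
        qed
        also have "\<dots> = (\<integral>y. F (Suc L) (x(L := y)) \<partial>gam d)" unfolding eqF using True by (simp add: s_def cong: if_cong)
        finally show ?thesis .
      next
        case False
        thus ?thesis unfolding eqF using p0 by (simp add: F_def)
      qed
    qed
    also have "\<dots> = (\<integral>x. F (Suc L) x \<partial>Gam d (Suc L))"
      by (rule Gam_integral_Suc[OF d iF, symmetric])
    finally show ?case .
  qed
  interpret PL: prob_space "Gam d L" by (rule PG)
  have S: "{x \<in> space (Gam d L). st L x} \<in> sets (RL L)"
    by (rule Gam_Collect_sets) measurable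
  have "(\<integral>x. F L x \<partial>Gam d L) \<le> (\<integral>x. indicator {x \<in> space (Gam d L). st L x} x \<partial>Gam d L)"
    using S by (intro integral_mono iF PL.integrable_const_bound[where B = 1]) (auto simp: F_def)
  also have "\<dots> = measure (Gam d L) {x \<in> space (Gam d L). st L x}" using S by simp
  finally show ?thesis using K[of L] by (simp add: st_def \<alpha>_def p_def)
qed

text \<open>Cauchy-Schwarz in the form \<open>P(B)^2 <= E[w 1_B] * E[1/w]\<close> for the
  Cameron-Martin density \<open>w\<close>. Up to the factor \<open>exp (sum a_j^2 / d)\<close>,
  \<open>1/w\<close> is the density of the opposite shift, which gives
  \<open>E[1/w]\<close>.\<close>

lemma Gam_shifted_lower:
  assumes d: "d > 0" and B: "B \<in> sets (RL L)" and E: "(\<Sum>j<L. (a j)\<^sup>2 / d) \<le> E"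
  shows "measure (Gam d L) {x \<in> space (Gam d L). shiftv (\<lambda>j. - a j) L x \<in> B} \<ge> (measure (Gam d L) B)\<^sup>2 / exp E"
proof -
  interpret P: prob_space "Gam d L" by (rule prob_space_Gam[OF d])
  note B [measurable]
  define pB where "pB = measure (Gam d L) B"
  define I where "I = measure (Gam d L) {x \<in> space (Gam d L). shiftv (\<lambda>j. - a j) L x \<in> B}"
  show ?thesis
  proof (cases "pB = 0")
    case False
    hence pB: "pB > 0" by (simp add: pB_def zero_less_measure_iff)
    \<comment> \<open>With this \<open>s\<close> the second term of
      \<open>1 <= s * w / 2 + 1 / (2 * s * w)\<close> integrates to at most \<open>pB / 2\<close>;
      the pointwise inequality stands in for Cauchy-Schwarz.\<close>
    define s where "s = exp E / pB"
    have s: "s > 0" using pB by (simp add: s_def)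
    define w where "w = cmw d L a"
    have w[measurable]: "w \<in> borel_measurable (RL L)" and wp: "w x > 0" for x
      by (auto simp: w_def cmw_pos)
    have Ieq: "ennreal I = (\<integral>\<^sup>+x. ennreal (w x) * indicator B x \<partial>Gam d L)"
    proof -
      have "ennreal I = (\<integral>\<^sup>+x. indicator {x \<in> space (Gam d L). shiftv (\<lambda>j. - a j) L x \<in> B} x \<partial>Gam d L)"
      proof -
        have "{x \<in> space (RL L). shiftv (\<lambda>j. - a j) L x \<in> B} \<in> sets (RL L)" by measurable
        thus ?thesis by (subst nn_integral_indicator) (auto simp: I_def P.emeasure_eq_measure space_Gam space_PiM)
      qed
      also have "\<dots> = (\<integral>\<^sup>+x. indicator B (shiftv (\<lambda>j. - a j) L x) \<partial>Gam d L)"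
        by (intro nn_integral_cong) (auto simp: indicator_def)
      also have "\<dots> = (\<integral>\<^sup>+x. ennreal (cmw d L a x) * indicator B (shiftv (\<lambda>j. - a j) L (shiftv a L x)) \<partial>Gam d L)"
        by (subst Gam_nn_shift[OF d, where a = a]) auto
      also have "\<dots> = (\<integral>\<^sup>+x. ennreal (w x) * indicator B x \<partial>Gam d L)"
        using shiftv_cancel[of _ d L "\<lambda>j. - a j"] by (intro nn_integral_cong) (simp add: w_def)
      finally show ?thesis .
    qed
    have inv: "(\<integral>\<^sup>+x. ennreal (1 / w x) \<partial>Gam d L) \<le> ennreal (exp E)"
    proof -
      have "1 / w x = exp (\<Sum>j<L. (a j)\<^sup>2 / d) * cmw d L (\<lambda>j. - a j) x" for x
      proof -
        have "(\<Sum>j<L. (a j)\<^sup>2 / d) + (- (\<Sum>j<L. (- a j) * x j / d + (- a j)\<^sup>2 / (2 * d))) = (\<Sum>j<L. a j * x j / d + (a j)\<^sup>2 / (2 * d))"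
          unfolding sum_negf[symmetric] sum.distrib[symmetric] by (intro sum.cong) (auto simp: field_simps)
        thus ?thesis unfolding w_def cmw_def exp_add[symmetric] by (simp add: exp_minus field_simps)
      qed
      hence "(\<integral>\<^sup>+x. ennreal (1 / w x) \<partial>Gam d L) = ennreal (exp (\<Sum>j<L. (a j)\<^sup>2 / d)) * (\<integral>\<^sup>+x. ennreal (cmw d L (\<lambda>j. - a j) x) \<partial>Gam d L)"
        by (simp add: ennreal_mult cmw_pos less_imp_le nn_integral_cmult)
      thus ?thesis using E by (simp add: nn_integral_cmw[OF d] ennreal_leI)
    qed
    have "ennreal pB = (\<integral>\<^sup>+x. indicator B x \<partial>Gam d L)" by (simp add: pB_def P.emeasure_eq_measure)
    also have "\<dots> \<le> (\<integral>\<^sup>+x. ennreal (s / 2) * (ennreal (w x) * indicator B x) + ennreal (1 / (2 * s)) * ennreal (1 / w x) \<partial>Gam d L)"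
    proof (intro nn_integral_mono)
      fix x
      have "0 \<le> (s * w x - 1)\<^sup>2 / (2 * s * w x)" using s wp[of x] by simp
      hence "1 \<le> s / 2 * w x + 1 / (2 * s) * (1 / w x)" using s wp[of x] by (simp add: field_simps power2_eq_square)
      hence "ennreal 1 \<le> ennreal (s / 2) * ennreal (w x) + ennreal (1 / (2 * s)) * ennreal (1 / w x)"
        using s wp[of x] by (subst ennreal_mult[symmetric], simp, simp)+ (simp add: ennreal_plus[symmetric] del: ennreal_plus)
      thus "indicator B x \<le> ennreal (s / 2) * (ennreal (w x) * indicator B x) + ennreal (1 / (2 * s)) * ennreal (1 / w x)"
        by (auto simp: indicator_def)
    qed
    also have "\<dots> = ennreal (s / 2) * ennreal I + ennreal (1 / (2 * s)) * (\<integral>\<^sup>+x. ennreal (1 / w x) \<partial>Gam d L)"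
      by (simp add: Ieq nn_integral_add nn_integral_cmult)
    also have "\<dots> \<le> ennreal (s / 2) * ennreal I + ennreal (1 / (2 * s)) * ennreal (exp E)"
      by (intro add_left_mono mult_left_mono inv) auto
    also have "\<dots> = ennreal (s / 2 * I + 1 / (2 * s) * exp E)"
      using s by (simp add: ennreal_mult[symmetric] ennreal_plus[symmetric] I_def del: ennreal_plus)
    finally have "pB \<le> s / 2 * I + 1 / (2 * s) * exp E"
      using s by (subst (asm) ennreal_le_iff) (auto simp: I_def)
    also have "1 / (2 * s) * exp E = pB / 2" using pB by (simp add: s_def)
    finally have "pB / s \<le> I" using s by (simp add: field_simps)
    thus ?thesis using pB by (simp add: s_def I_def pB_def power2_eq_square)
  qed (simp add: pB_def)
qed

section \<open>Smooth densities from rapidly decreasing Fourier transforms\<close>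

lemma has_derivative_quadratic:
  fixes f :: "'a::real_normed_vector \<Rightarrow> 'b::real_normed_vector"
  assumes "bounded_linear D" and "\<And>v. norm (f (z + v) - f z - D v) \<le> C * (norm v)\<^sup>2"
  shows "(f has_derivative D) (at z)"
proof (subst has_derivative_at, intro conjI assms(1))
  show "(\<lambda>h. norm (f (z + h) - f z - D h) / norm h) \<midarrow>0\<rightarrow> 0"
  proof (rule tendsto_sandwich)
    show "\<forall>\<^sub>F h in at 0. 0 \<le> norm (f (z + h) - f z - D h) / norm h" by simp
    show "\<forall>\<^sub>F h in at 0. norm (f (z + h) - f z - D h) / norm h \<le> C * norm h"
    proof (rule eventuallyI)
      fix h :: 'a
      show "norm (f (z + h) - f z - D h) / norm h \<le> C * norm h"
        using assms(2)[of h] by (cases "h = 0") (auto simp: divide_le_eq power2_eq_square mult.assoc)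
    qed
    show "(\<lambda>h::'a. C * norm h) \<midarrow>0\<rightarrow> 0" by (intro tendsto_eq_intros) auto
  qed simp
qed

definition rapid :: "(real \<times> real \<Rightarrow> complex) \<Rightarrow> bool" where
  "rapid a \<longleftrightarrow> a \<in> borel_measurable borel \<and> (\<forall>k. integrable lborel (\<lambda>\<xi>. norm \<xi> ^ k * cmod (a \<xi>)))"

text \<open>The inverse Fourier transform without its factor \<open>1 / (2 * pi)^2\<close>; the real
  part makes it real-valued from the start.\<close>

definition invF :: "(real \<times> real \<Rightarrow> complex) \<Rightarrow> real \<times> real \<Rightarrow> real" where
  "invF a z = (\<integral>\<xi>. Re (cis (- (\<xi> \<bullet> z)) * a \<xi>) \<partial>lborel)"

text \<open>The transform of the derivative along \<open>v\<close>. Since \<open>rapid\<close> is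
  closed under this operation, smoothness follows by induction on the order.\<close>

definition Da :: "(real \<times> real \<Rightarrow> complex) \<Rightarrow> real \<times> real \<Rightarrow> real \<times> real \<Rightarrow> complex" where
  "Da a v \<xi> = - \<i> * of_real (\<xi> \<bullet> v) * a \<xi>"

lemma cis_measurable [measurable (raw)]: "f \<in> borel_measurable M \<Longrightarrow> (\<lambda>x. cis (f x)) \<in> borel_measurable M"
  unfolding cis_conv_exp by measurable

lemma Da_measurable [measurable]: "a \<in> borel_measurable borel \<Longrightarrow> Da a v \<in> borel_measurable borel"
  unfolding Da_def[abs_def] by measurable

lemma norm_Da: "cmod (Da a v \<xi>) \<le> norm v * (norm \<xi> * cmod (a \<xi>))"
proof -
  have "cmod (Da a v \<xi>) = \<bar>\<xi> \<bullet> v\<bar> * cmod (a \<xi>)" by (simp add: Da_def norm_mult)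
  also have "\<dots> \<le> (norm \<xi> * norm v) * cmod (a \<xi>)"
    by (intro mult_right_mono Cauchy_Schwarz_ineq2) auto
  finally show ?thesis by (simp add: mult_ac)
qed

lemma rapid_Da:
  assumes "rapid a" shows "rapid (Da a v)"
proof -
  have a [measurable]: "a \<in> borel_measurable borel"
    and i: "integrable lborel (\<lambda>\<xi>. norm \<xi> ^ k * cmod (a \<xi>))" for k
    using assms by (auto simp: rapid_def)
  have "integrable lborel (\<lambda>\<xi>. norm \<xi> ^ k * cmod (Da a v \<xi>))" for k
  proof (rule Bochner_Integration.integrable_bound)
    show "integrable lborel (\<lambda>\<xi>. norm v * (norm \<xi> ^ Suc k * cmod (a \<xi>)))" 
      by (rule integrable_mult_right[OF i])
    have "norm (norm \<xi> ^ k * cmod (Da a v \<xi>)) \<le> norm (norm v * (norm \<xi> ^ Suc k * cmod (a \<xi>)))" for \<xi>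
      using mult_left_mono[OF norm_Da[of a v \<xi>], of "norm \<xi> ^ k"] by (simp add: mult_ac)
    thus "AE \<xi> in lborel. norm (norm \<xi> ^ k * cmod (Da a v \<xi>)) \<le> norm (norm v * (norm \<xi> ^ Suc k * cmod (a \<xi>)))"
      by simp
  qed measurable
  thus ?thesis unfolding rapid_def using Da_measurable[OF a] by blast
qed

lemma rapid_integrable:
  assumes "rapid a" shows "integrable lborel (\<lambda>\<xi>. Re (cis (- (\<xi> \<bullet> z)) * a \<xi>))"
proof -
  have [measurable]: "a \<in> borel_measurable borel" using assms by (simp add: rapid_def)
  have "integrable lborel (\<lambda>\<xi>. norm \<xi> ^ 0 * cmod (a \<xi>))" using assms unfolding rapid_def by blast
  thus ?thesis
  proof (rule Bochner_Integration.integrable_bound)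
    show "AE \<xi> in lborel. norm (Re (cis (- (\<xi> \<bullet> z)) * a \<xi>)) \<le> norm (norm \<xi> ^ 0 * cmod (a \<xi>))"
    proof (rule AE_I2)
      fix \<xi> :: "real \<times> real"
      show "norm (Re (cis (- (\<xi> \<bullet> z)) * a \<xi>)) \<le> norm (norm \<xi> ^ 0 * cmod (a \<xi>))"
        using abs_Re_le_cmod[of "cis (- (\<xi> \<bullet> z)) * a \<xi>"] unfolding norm_mult norm_cis real_norm_def by simp
    qed
  qed measurable
qed

lemma cis_taylor: "cmod (cis (s + h) - cis s - \<i> * of_real h * cis s) \<le> h\<^sup>2"
proof -
  have "cmod (iexp h - (\<Sum>k \<le> 1. (\<i> * h)^k / fact k)) \<le> \<bar>h\<bar>^(Suc 1) / fact (Suc 1)" by (rule iexp_approx1)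
  hence "cmod (cis h - 1 - \<i> * of_real h) \<le> h\<^sup>2 / 2"
    by (simp add: cis_conv_exp power2_eq_square algebra_simps numeral_2_eq_2)
  moreover have "cis (s + h) - cis s - \<i> * of_real h * cis s = cis s * (cis h - 1 - \<i> * of_real h)"
    by (simp add: cis_mult[symmetric] algebra_simps)
  ultimately have "cmod (cis (s + h) - cis s - \<i> * of_real h * cis s) \<le> h\<^sup>2 / 2" by (simp add: norm_mult)
  thus ?thesis using zero_le_power2[of h] by linarith
qed

text \<open>Taylor expansion of the exponential under the integral; the remainder is
  \<open>|v|^2\<close> times the second moment of \<open>|a|\<close>, so differentiability comes
  from an explicit quadratic bound.\<close>

lemma invF_has_derivative:
  assumes a: "rapid a"
  shows "(invF a has_derivative (\<lambda>v. invF (Da a v) z)) (at z)"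
proof -
  have [measurable]: "a \<in> borel_measurable borel" using a by (simp add: rapid_def)
  have i1: "integrable lborel (\<lambda>\<xi>. norm \<xi> * cmod (a \<xi>))" and i2: "integrable lborel (\<lambda>\<xi>. (norm \<xi>)\<^sup>2 * cmod (a \<xi>))"
    using a[unfolded rapid_def, THEN conjunct2, THEN spec, of 1] a[unfolded rapid_def, THEN conjunct2, THEN spec, of 2] by auto
  note int = rapid_integrable[OF a] rapid_integrable[OF rapid_Da[OF a]]
  have D: "bounded_linear (\<lambda>v. invF (Da a v) z)"
  proof (rule bounded_linear_intro)
    show "invF (Da a (x + y)) z = invF (Da a x) z + invF (Da a y) z" for x y
      unfolding invF_def by (subst Bochner_Integration.integral_add[symmetric, OF int(2) int(2)])
        (auto intro!: Bochner_Integration.integral_cong simp: Da_def inner_add_right algebra_simps)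
    show "invF (Da a (r *\<^sub>R x)) z = r *\<^sub>R invF (Da a x) z" for r x
      unfolding invF_def by (subst integral_scaleR_right[symmetric])
        (auto intro!: Bochner_Integration.integral_cong simp: Da_def algebra_simps)
    show "norm (invF (Da a x) z) \<le> norm x * (\<integral>\<xi>. norm \<xi> * cmod (a \<xi>) \<partial>lborel)" for x
    proof -
      have "norm (invF (Da a x) z) \<le> (\<integral>\<xi>. norm (Re (cis (- (\<xi> \<bullet> z)) * Da a x \<xi>)) \<partial>lborel)"
        unfolding invF_def by (rule integral_norm_bound)
      also have "\<dots> \<le> (\<integral>\<xi>. norm x * (norm \<xi> * cmod (a \<xi>)) \<partial>lborel)"
      proof (rule integral_mono)
        fix \<xi> :: "real \<times> real"
        have "norm (Re (cis (- (\<xi> \<bullet> z)) * Da a x \<xi>)) \<le> cmod (cis (- (\<xi> \<bullet> z)) * Da a x \<xi>)" 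
          unfolding real_norm_def by (rule abs_Re_le_cmod)
        also have "\<dots> \<le> norm x * (norm \<xi> * cmod (a \<xi>))" using norm_Da by (simp add: norm_mult)
        finally show "norm (Re (cis (- (\<xi> \<bullet> z)) * Da a x \<xi>)) \<le> norm x * (norm \<xi> * cmod (a \<xi>))" .
      qed (use int i1 in auto)
      finally show ?thesis by simp
    qed
  qed
  show ?thesis
  proof (rule has_derivative_quadratic[OF D, where C = "\<integral>\<xi>. (norm \<xi>)\<^sup>2 * cmod (a \<xi>) \<partial>lborel"])
    fix v
    have "norm (invF a (z + v) - invF a z - invF (Da a v) z)
      = norm (\<integral>\<xi>. Re (cis (- (\<xi> \<bullet> (z + v))) * a \<xi>) - Re (cis (- (\<xi> \<bullet> z)) * a \<xi>) - Re (cis (- (\<xi> \<bullet> z)) * Da a v \<xi>) \<partial>lborel)"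
      unfolding invF_def using int by simp
    also have "\<dots> \<le> (\<integral>\<xi>. norm (Re (cis (- (\<xi> \<bullet> (z + v))) * a \<xi>) - Re (cis (- (\<xi> \<bullet> z)) * a \<xi>) - Re (cis (- (\<xi> \<bullet> z)) * Da a v \<xi>)) \<partial>lborel)"
      by (rule integral_norm_bound)
    also have "\<dots> \<le> (\<integral>\<xi>. (norm v)\<^sup>2 * ((norm \<xi>)\<^sup>2 * cmod (a \<xi>)) \<partial>lborel)"
    proof (rule integral_mono)
      fix \<xi> :: "real \<times> real"
      define s where "s = - (\<xi> \<bullet> z)"
      define h where "h = - (\<xi> \<bullet> v)"
      have "Re (cis (- (\<xi> \<bullet> (z + v))) * a \<xi>) - Re (cis (- (\<xi> \<bullet> z)) * a \<xi>) - Re (cis (- (\<xi> \<bullet> z)) * Da a v \<xi>)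
         = Re ((cis (s + h) - cis s - \<i> * of_real h * cis s) * a \<xi>)"
        by (simp add: s_def h_def Da_def inner_add_right algebra_simps)
      also have "\<bar>\<dots>\<bar> \<le> cmod ((cis (s + h) - cis s - \<i> * of_real h * cis s) * a \<xi>)" by (rule abs_Re_le_cmod)
      also have "\<dots> \<le> h\<^sup>2 * cmod (a \<xi>)" unfolding norm_mult by (intro mult_right_mono cis_taylor) auto
      also have "\<dots> \<le> (norm \<xi> * norm v)\<^sup>2 * cmod (a \<xi>)"
      proof (rule mult_right_mono)
        have "\<bar>\<xi> \<bullet> v\<bar> \<le> norm \<xi> * norm v" by (rule Cauchy_Schwarz_ineq2)
        hence "\<bar>\<xi> \<bullet> v\<bar>\<^sup>2 \<le> (norm \<xi> * norm v)\<^sup>2" by (intro power_mono) auto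
        thus "h\<^sup>2 \<le> (norm \<xi> * norm v)\<^sup>2" by (simp add: h_def)
      qed simp
      finally show "norm (Re (cis (- (\<xi> \<bullet> (z + v))) * a \<xi>) - Re (cis (- (\<xi> \<bullet> z)) * a \<xi>) - Re (cis (- (\<xi> \<bullet> z)) * Da a v \<xi>))
         \<le> (norm v)\<^sup>2 * ((norm \<xi>)\<^sup>2 * cmod (a \<xi>))" by (simp add: power_mult_distrib mult_ac)
    qed (use int i2 in auto)
    finally show "norm (invF a (z + v) - invF a z - invF (Da a v) z) \<le> (\<integral>\<xi>. (norm \<xi>)\<^sup>2 * cmod (a \<xi>) \<partial>lborel) * (norm v)\<^sup>2"
      by (simp add: mult.commute)
  qed
qed

section \<open>Closure properties of n times continuously differentiable functions\<close>

lemma cont_differentiable_SucI: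
  assumes "\<And>z. (f has_derivative D z) (at z)" "\<And>v. cont_differentiable n (\<lambda>z. D z v)"
  shows "cont_differentiable (Suc n) f"
proof -
  have "frechet_derivative f (at x) = D x" for x using frechet_derivative_at[OF assms(1)] by simp
  thus ?thesis using assms by (auto simp: differentiable_def)
qed

lemma cont_differentiable_0I: "(\<And>z. (f has_derivative D z) (at z)) \<Longrightarrow> cont_differentiable 0 f"
  by (auto intro!: continuous_at_imp_continuous_on has_derivative_continuous)

lemma cont_differentiable_invF: "rapid a \<Longrightarrow> cont_differentiable n (invF a)"
proof (induction n arbitrary: a)
  case 0 show ?case by (rule cont_differentiable_0I[OF invF_has_derivative[OF 0]])
next
  case (Suc n)
  show ?case by (rule cont_differentiable_SucI[OF invF_has_derivative[OF Suc.prems]]) (rule Suc.IH[OF rapid_Da[OF Suc.prems]])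
qed

lemma cont_differentiable_SucD: "cont_differentiable (Suc n) f \<Longrightarrow> cont_differentiable n f"
proof (induction n arbitrary: f)
  case 0
  hence d: "\<And>x. f differentiable (at x)" by simp
  show ?case unfolding cont_differentiable.simps
    by (rule continuous_at_imp_continuous_on) (use d differentiable_imp_continuous_within in blast)
next
  case (Suc n)
  have "cont_differentiable n (\<lambda>x. frechet_derivative f (at x) v)" for v
    by (rule Suc.IH) (use Suc.prems in auto)
  thus ?case using Suc.prems by auto
qed

lemma cont_differentiable_const: "cont_differentiable n (\<lambda>x. c)"
proof (induction n arbitrary: c)
  case (Suc n) show ?case by (rule cont_differentiable_SucI[of _ "\<lambda>_ _. 0"]) (use Suc in auto)
qed auto

lemma cont_differentiable_add:
  "cont_differentiable n f \<Longrightarrow> cont_differentiable n g \<Longrightarrow> cont_differentiable n (\<lambda>x. f x + g x)"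
proof (induction n arbitrary: f g)
  case 0 thus ?case by (auto intro!: continuous_intros)
next
  case (Suc n)
  show ?case
  proof (rule cont_differentiable_SucI)
    show "((\<lambda>x. f x + g x) has_derivative (\<lambda>v. frechet_derivative f (at z) v + frechet_derivative g (at z) v)) (at z)" for z
      using Suc.prems by (intro has_derivative_add) (auto simp: frechet_derivative_works[symmetric])
    show "cont_differentiable n (\<lambda>z. frechet_derivative f (at z) v + frechet_derivative g (at z) v)" for v
      using Suc by auto
  qed
qed

lemma cont_differentiable_mult:
  fixes f g :: "'a::real_normed_vector \<Rightarrow> real"
  shows "cont_differentiable n f \<Longrightarrow> cont_differentiable n g \<Longrightarrow> cont_differentiable n (\<lambda>x. f x * g x)"
proof (induction n arbitrary: f g)
  case 0 thus ?case by (auto intro!: continuous_intros)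
next
  case (Suc n)
  show ?case
  proof (rule cont_differentiable_SucI)
    show "((\<lambda>x. f x * g x) has_derivative (\<lambda>v. f z * frechet_derivative g (at z) v + frechet_derivative f (at z) v * g z)) (at z)" for z
      using Suc.prems by (intro has_derivative_mult) (auto simp: frechet_derivative_works[symmetric])
    show "cont_differentiable n (\<lambda>z. f z * frechet_derivative g (at z) v + frechet_derivative f (at z) v * g z)" for v
      using Suc.prems cont_differentiable_SucD[OF Suc.prems(1)] cont_differentiable_SucD[OF Suc.prems(2)]
      by (intro cont_differentiable_add Suc.IH) auto
  qed
qed

lemma cont_differentiable_inner: "cont_differentiable n (\<lambda>x::'a::real_inner. x \<bullet> c)"
proof (cases n)
  case (Suc m)
  show ?thesis unfolding Suc
    by (rule cont_differentiable_SucI[where D = "\<lambda>_ v. v \<bullet> c"]) (auto intro!: derivative_eq_intros cont_differentiable_const)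
qed (auto intro!: continuous_intros)

lemma exp_sq_has_derivative:
  "((\<lambda>z::'a::real_inner. exp ((z \<bullet> z) / 2)) has_derivative (\<lambda>v. (z \<bullet> v) * exp ((z \<bullet> z) / 2))) (at z)"
  by (auto intro!: derivative_eq_intros simp: inner_commute)

lemma cont_differentiable_exp_sq: "cont_differentiable n (\<lambda>z::'a::real_inner. exp ((z \<bullet> z) / 2))"
proof (induction n)
  case 0 show ?case by (auto intro!: continuous_intros)
next
  case (Suc n)
  show ?case by (rule cont_differentiable_SucI[OF exp_sq_has_derivative])
    (intro cont_differentiable_mult cont_differentiable_inner Suc)
qed

text \<open>Comparison with \<open>C / ((1 + x^2) (1 + y^2))\<close>, which is integrable as a
  product; the exponents \<open>k\<close>, \<open>k + 2\<close>, \<open>k + 4\<close> come from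
  expanding \<open>(1 + |\<xi>|^2)^2\<close>.\<close>

lemma rapidI:
  assumes [measurable]: "a \<in> borel_measurable borel"
    and b: "\<And>N. \<exists>C. \<forall>\<xi>. cmod (a \<xi>) * norm \<xi> ^ N \<le> C"
  shows "rapid a"
  unfolding rapid_def
proof (intro conjI allI)
  show "a \<in> borel_measurable borel" by fact
  fix k
  define w where "w = (\<lambda>x::real. inverse (1 + x\<^sup>2))"
  have w0: "w x > 0" for x unfolding w_def by (simp add: add_pos_nonneg)
  have iw: "integrable lborel w"
    using integrable_inverse_1_plus_square by (simp add: set_integrable_def w_def einterval_def)
  have "integrable (lborel \<Otimes>\<^sub>M lborel) (\<lambda>(x, y). w x * w y)"
    using iw by (intro lborel_pair.Fubini_integrable) (auto simp: w_def norm_mult)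
  hence iww: "integrable lborel (\<lambda>z::real\<times>real. w (fst z) * w (snd z))"
    unfolding lborel_prod by (simp add: case_prod_unfold)
  obtain C0 C2 C4 where C: "\<And>\<xi>. cmod (a \<xi>) * norm \<xi> ^ k \<le> C0" "\<And>\<xi>. cmod (a \<xi>) * norm \<xi> ^ (k + 2) \<le> C2" "\<And>\<xi>. cmod (a \<xi>) * norm \<xi> ^ (k + 4) \<le> C4"
    using b[of k] b[of "k + 2"] b[of "k + 4"] by auto
  define C where "C = C0 + 2 * C2 + C4"
  show "integrable lborel (\<lambda>\<xi>. norm \<xi> ^ k * cmod (a \<xi>))"
  proof (rule Bochner_Integration.integrable_bound)
    show "integrable lborel (\<lambda>z. C * (w (fst z) * w (snd z)))" using iww by simp
    show "AE \<xi> in lborel. norm (norm \<xi> ^ k * cmod (a \<xi>)) \<le> norm (C * (w (fst \<xi>) * w (snd \<xi>)))"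
    proof (rule AE_I2)
      fix \<xi> :: "real \<times> real"
      have n: "(fst \<xi>)\<^sup>2 \<le> (norm \<xi>)\<^sup>2" "(snd \<xi>)\<^sup>2 \<le> (norm \<xi>)\<^sup>2"
        by (cases \<xi>, simp add: norm_Pair)+
      have "(norm \<xi> ^ k * cmod (a \<xi>)) * ((1 + (fst \<xi>)\<^sup>2) * (1 + (snd \<xi>)\<^sup>2)) \<le> (norm \<xi> ^ k * cmod (a \<xi>)) * ((1 + (norm \<xi>)\<^sup>2) * (1 + (norm \<xi>)\<^sup>2))"
        using n by (intro mult_left_mono mult_mono) auto
      also have "\<dots> = cmod (a \<xi>) * norm \<xi> ^ k + 2 * (cmod (a \<xi>) * norm \<xi> ^ (k + 2)) + cmod (a \<xi>) * norm \<xi> ^ (k + 4)"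
        by (simp add: algebra_simps power_add power2_eq_square power4_eq_xxxx)
      also have "\<dots> \<le> C" using C[of \<xi>] unfolding C_def by linarith
      finally have "norm \<xi> ^ k * cmod (a \<xi>) \<le> C / ((1 + (fst \<xi>)\<^sup>2) * (1 + (snd \<xi>)\<^sup>2))"
        by (subst pos_le_divide_eq) (auto intro!: mult_pos_pos add_pos_nonneg)
      also have "\<dots> = C * (w (fst \<xi>) * w (snd \<xi>))" by (simp add: w_def field_simps)
      finally show "norm (norm \<xi> ^ k * cmod (a \<xi>)) \<le> norm (C * (w (fst \<xi>) * w (snd \<xi>)))" by simp
    qed
  qed measurable
qed

text \<open>Continuous functions that increase to the indicator of an open set. \<open>UNIV\<close>
  is a separate case because \<open>infdist\<close> to the empty set is 0.\<close>

definition openapp :: "'a::metric_space set \<Rightarrow> nat \<Rightarrow> 'a \<Rightarrow> real" where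
  "openapp U n z = (if U = UNIV then 1 else min 1 (real n * infdist z (- U)))"

lemma openapp_bounds: "0 \<le> openapp U n z" "openapp U n z \<le> 1"
  by (auto simp: openapp_def infdist_nonneg)

lemma openapp_outside: "z \<notin> U \<Longrightarrow> openapp U n z = 0"
  by (auto simp: openapp_def)

lemma continuous_openapp: "continuous_on A (openapp U n)"
  unfolding openapp_def by (cases "U = UNIV") (auto intro!: continuous_intros)

lemma openapp_measurable [measurable]: "openapp U n \<in> borel_measurable borel"
  by (rule borel_measurable_continuous_onI[OF continuous_openapp])

lemma openapp_tendsto:
  assumes "open U" shows "(\<lambda>n. openapp U n z) \<longlonglongrightarrow> indicator U z"
proof (cases "z \<in> U \<and> U \<noteq> UNIV")
  case True
  have "infdist z (- U) > 0" using True assms by (intro infdist_pos_not_in_closed) (auto simp: closed_def)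
  then obtain N where N: "real N > 1 / infdist z (- U)" using reals_Archimedean2 by blast
  have "openapp U n z = 1" if "n \<ge> N" for n
  proof -
    have "1 / infdist z (- U) \<le> real n" using N that by linarith
    hence "1 \<le> real n * infdist z (- U)" using \<open>infdist z (- U) > 0\<close> by (simp add: divide_le_eq)
    thus ?thesis using True by (simp add: openapp_def)
  qed
  hence "\<forall>\<^sub>F n in sequentially. openapp U n z = 1" by (auto simp: eventually_sequentially)
  thus ?thesis using True by (simp add: tendsto_eventually)
next
  case False
  hence "openapp U n z = indicator U z" for n by (auto simp: openapp_def indicator_def)
  thus ?thesis by simp
qed

section \<open>Fourier inversion for finite measures\<close>

definition gchar :: "real \<Rightarrow> real \<times> real \<Rightarrow> real" where
  "gchar d \<xi> = exp (- (\<xi> \<bullet> \<xi>) / (2 * d))"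

text \<open>The density of the centred normal law with covariance \<open>1 / d\<close> times the
  identity, so the mollification sharpens as \<open>d\<close> grows; \<open>gchar d\<close> is its
  characteristic function.\<close>

definition gmoll :: "real \<Rightarrow> real \<times> real \<Rightarrow> real" where
  "gmoll d w = d / (2 * pi) * exp (- d * (w \<bullet> w) / 2)"

lemma gchar_measurable [measurable]: "gchar d \<in> borel_measurable borel" unfolding gchar_def[abs_def] by measurable
lemma gmoll_measurable [measurable]: "gmoll d \<in> borel_measurable borel" unfolding gmoll_def[abs_def] by measurable

lemma gauss_FT_1d:
  assumes d: "d > 0"
  shows "(\<integral>s. cis (- (s * x)) * of_real (exp (- s\<^sup>2 / (2 * d))) \<partial>lborel) = of_real (sqrt (2 * pi * d) * exp (- d * x\<^sup>2 / 2))"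
    and "integrable lborel (\<lambda>s. cis (- (s * x)) * of_real (exp (- s\<^sup>2 / (2 * d))))"
proof -
  have nd: "exp (- s\<^sup>2 / (2 * d)) = sqrt (2 * pi * d) * normal_density 0 (sqrt d) s" for s
    using d by (simp add: normal_density_def)
  have "(\<integral>s. cis (- (s * x)) * of_real (exp (- s\<^sup>2 / (2 * d))) \<partial>lborel)
     = (\<integral>s. of_real (sqrt (2 * pi * d)) * (normal_density 0 (sqrt d) s *\<^sub>R exp (\<i> * of_real ((- x) * s))) \<partial>lborel)"
    unfolding nd by (intro Bochner_Integration.integral_cong refl) (simp add: cis_conv_exp scaleR_conv_of_real mult_ac)
  also have "\<dots> = of_real (sqrt (2 * pi * d)) * (\<integral>s. normal_density 0 (sqrt d) s *\<^sub>R exp (\<i> * of_real ((- x) * s)) \<partial>lborel)"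
    by (rule integral_mult_right_zero)
  also have "(\<integral>s. normal_density 0 (sqrt d) s *\<^sub>R exp (\<i> * of_real ((- x) * s)) \<partial>lborel) = (\<integral>s. exp (\<i> * of_real ((- x) * s)) \<partial>gam d)"
    unfolding gam_def by (rule integral_density[symmetric]) (auto simp: normal_density_nonneg)
  also have "\<dots> = of_real (exp (- ((- x)\<^sup>2 * d / 2)))" by (rule gam_cexp[OF d])
  finally show "(\<integral>s. cis (- (s * x)) * of_real (exp (- s\<^sup>2 / (2 * d))) \<partial>lborel) = of_real (sqrt (2 * pi * d) * exp (- d * x\<^sup>2 / 2))"
    by (simp add: mult.commute)
  have "integrable lborel (\<lambda>s. sqrt (2 * pi * d) * normal_density 0 (sqrt d) s)" using d by (intro integrable_mult_right) simp
  thus "integrable lborel (\<lambda>s. cis (- (s * x)) * of_real (exp (- s\<^sup>2 / (2 * d))))"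
    unfolding nd[symmetric] by (rule Bochner_Integration.integrable_bound) (auto simp: norm_mult)
qed

lemma product_integral_R2:
  fixes f g :: "real \<Rightarrow> complex"
  assumes "integrable lborel f" "integrable lborel g"
  shows "(\<integral>z. f (fst z) * g (snd z) \<partial>lborel) = (\<integral>x. f x \<partial>lborel) * (\<integral>y. g y \<partial>lborel)"
    and "integrable lborel (\<lambda>z. f (fst z) * g (snd z))"
proof -
  have [measurable]: "f \<in> borel_measurable borel" "g \<in> borel_measurable borel"
    using assms[THEN borel_measurable_integrable] by auto
  have i: "integrable (lborel \<Otimes>\<^sub>M lborel) (\<lambda>z. f (fst z) * g (snd z))"
    using assms by (intro lborel_pair.Fubini_integrable) (auto simp: norm_mult)
  thus "integrable lborel (\<lambda>z. f (fst z) * g (snd z))" by (simp add: lborel_prod)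
  show "(\<integral>z. f (fst z) * g (snd z) \<partial>lborel) = (\<integral>x. f x \<partial>lborel) * (\<integral>y. g y \<partial>lborel)"
    using lborel_pair.integral_fst'[OF i] by (simp add: lborel_prod)
qed

lemma gauss_FT_2d:
  assumes d: "d > 0"
  shows "(\<integral>\<xi>. cis (- (\<xi> \<bullet> w)) * of_real (gchar d \<xi>) \<partial>lborel) = of_real ((2 * pi)\<^sup>2 * gmoll d w)"
    and "integrable lborel (\<lambda>\<xi>. cis (- (\<xi> \<bullet> w)) * of_real (gchar d \<xi>))"
proof -
  define F where "F = (\<lambda>x s. cis (- (s * x)) * of_real (exp (- s\<^sup>2 / (2 * d))))"
  have eq: "cis (- (\<xi> \<bullet> w)) * of_real (gchar d \<xi>) = F (fst w) (fst \<xi>) * F (snd w) (snd \<xi>)" for \<xi>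
  proof -
    have "cis (- (\<xi> \<bullet> w)) = cis (- (fst \<xi> * fst w)) * cis (- (snd \<xi> * snd w))"
      by (cases \<xi>, cases w) (simp add: cis_mult)
    moreover have "gchar d \<xi> = exp (- (fst \<xi>)\<^sup>2 / (2 * d)) * exp (- (snd \<xi>)\<^sup>2 / (2 * d))"
      by (cases \<xi>) (simp add: gchar_def exp_add[symmetric] power2_eq_square add_divide_distrib diff_divide_distrib)
    ultimately show ?thesis by (simp add: F_def)
  qed
  have iF: "integrable lborel (F x)" for x unfolding F_def by (rule gauss_FT_1d(2)[OF d])
  have vF: "(\<integral>s. F x s \<partial>lborel) = of_real (sqrt (2 * pi * d) * exp (- d * x\<^sup>2 / 2))" for x 
    unfolding F_def by (rule gauss_FT_1d(1)[OF d])
  have "(\<integral>\<xi>. cis (- (\<xi> \<bullet> w)) * of_real (gchar d \<xi>) \<partial>lborel) = of_real (sqrt (2 * pi * d) * exp (- d * (fst w)\<^sup>2 / 2)) * of_real (sqrt (2 * pi * d) * exp (- d * (snd w)\<^sup>2 / 2))"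
    unfolding eq product_integral_R2(1)[OF iF iF] vF ..
  also have "\<dots> = of_real ((2 * pi)\<^sup>2 * gmoll d w)"
  proof -
    have s: "sqrt (2 * pi * d) * sqrt (2 * pi * d) = 2 * pi * d" using d by simp
    have e: "exp (- d * (fst w)\<^sup>2 / 2) * exp (- d * (snd w)\<^sup>2 / 2) = exp (- d * (w \<bullet> w) / 2)"
      by (cases w) (simp add: exp_add[symmetric] power2_eq_square algebra_simps add_divide_distrib diff_divide_distrib)
    have "(sqrt (2 * pi * d) * exp (- d * (fst w)\<^sup>2 / 2)) * (sqrt (2 * pi * d) * exp (- d * (snd w)\<^sup>2 / 2))
      = (sqrt (2 * pi * d) * sqrt (2 * pi * d)) * (exp (- d * (fst w)\<^sup>2 / 2) * exp (- d * (snd w)\<^sup>2 / 2))" by (simp only: mult_ac)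
    also have "\<dots> = (2 * pi)\<^sup>2 * gmoll d w" unfolding s e gmoll_def by (simp add: power2_eq_square)
    finally show ?thesis unfolding of_real_mult[symmetric] by simp
  qed
  finally show "(\<integral>\<xi>. cis (- (\<xi> \<bullet> w)) * of_real (gchar d \<xi>) \<partial>lborel) = of_real ((2 * pi)\<^sup>2 * gmoll d w)" .
  show "integrable lborel (\<lambda>\<xi>. cis (- (\<xi> \<bullet> w)) * of_real (gchar d \<xi>))"
    unfolding eq by (rule product_integral_R2(2)[OF iF iF])
qed

lemma gmoll_nonneg: "d > 0 \<Longrightarrow> gmoll d w \<ge> 0" by (simp add: gmoll_def)

lemma gmoll1_integral: "integrable lborel (gmoll 1)" "(\<integral>w. gmoll 1 w \<partial>lborel) = 1"
proof -
  define f where "f = (\<lambda>x. complex_of_real (std_normal_density x))"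
  have i: "integrable lborel f" unfolding f_def by (intro integrable_of_real) simp
  have v: "(\<integral>x. f x \<partial>lborel) = 1" unfolding f_def by simp
  have eq: "complex_of_real (gmoll 1 w) = f (fst w) * f (snd w)" for w
    by (cases w) (simp add: gmoll_def f_def std_normal_density_def exp_add[symmetric] power2_eq_square algebra_simps add_divide_distrib diff_divide_distrib flip: of_real_mult)
  have "integrable lborel (\<lambda>w. complex_of_real (gmoll 1 w))" unfolding eq by (rule product_integral_R2(2)[OF i i])
  thus "integrable lborel (gmoll 1)" using integrable_Re by fastforce
  have "(\<integral>w. complex_of_real (gmoll 1 w) \<partial>lborel) = 1" unfolding eq product_integral_R2(1)[OF i i] v by simp
  thus "(\<integral>w. gmoll 1 w \<partial>lborel) = 1" by (simp only: integral_complex_of_real of_real_eq_1_iff)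
qed

lemma gmoll_conv:
  assumes d: "d > 0" and [measurable]: "h \<in> borel_measurable borel"
  shows "(\<integral>\<^sup>+z. ennreal (h z) * ennreal (gmoll d (z - w)) \<partial>lborel) = (\<integral>\<^sup>+u. ennreal (h (w + (1 / sqrt d) *\<^sub>R u)) * ennreal (gmoll 1 u) \<partial>lborel)"
proof -
  have c: "1 / sqrt d \<noteq> 0" using d by simp
  have "(\<integral>\<^sup>+z. ennreal (h z) * ennreal (gmoll d (z - w)) \<partial>lborel)
     = (\<integral>\<^sup>+z. ennreal (h z) * ennreal (gmoll d (z - w)) \<partial>density (distr lborel borel (\<lambda>x. w + (1 / sqrt d) *\<^sub>R x)) (\<lambda>_. \<bar>1 / sqrt d\<bar>^DIM(real \<times> real)))"
    using lborel_affine[OF c, of w] by simp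
  also have "\<dots> = (\<integral>\<^sup>+u. ennreal (\<bar>1 / sqrt d\<bar>^2) * (ennreal (h (w + (1 / sqrt d) *\<^sub>R u)) * ennreal (gmoll d ((1 / sqrt d) *\<^sub>R u))) \<partial>lborel)"
    by (subst nn_integral_density, simp, simp, subst nn_integral_distr) (use d in \<open>auto simp: power_divide\<close>)
  also have "\<dots> = (\<integral>\<^sup>+u. ennreal (h (w + (1 / sqrt d) *\<^sub>R u)) * ennreal (gmoll 1 u) \<partial>lborel)"
  proof (intro nn_integral_cong)
    fix u :: "real \<times> real"
    have "\<bar>1 / sqrt d\<bar>^2 * gmoll d ((1 / sqrt d) *\<^sub>R u) = gmoll 1 u"
    proof -
      have q: "sqrt d * sqrt d = d" using d by simp
      have "d * (((1 / sqrt d) *\<^sub>R u) \<bullet> ((1 / sqrt d) *\<^sub>R u)) = (d / (sqrt d * sqrt d)) * (u \<bullet> u)" by simp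
      also have "\<dots> = u \<bullet> u" unfolding q using d by simp
      finally have "gmoll d ((1 / sqrt d) *\<^sub>R u) = d * gmoll 1 u" by (simp add: gmoll_def)
      thus ?thesis using d by (simp add: power_divide)
    qed
    hence "ennreal (\<bar>1 / sqrt d\<bar>^2) * ennreal (gmoll d ((1 / sqrt d) *\<^sub>R u)) = ennreal (gmoll 1 u)"
      using d by (subst ennreal_mult[symmetric]) (auto simp: gmoll_nonneg)
    thus "ennreal (\<bar>1 / sqrt d\<bar>^2) * (ennreal (h (w + (1 / sqrt d) *\<^sub>R u)) * ennreal (gmoll d ((1 / sqrt d) *\<^sub>R u))) = ennreal (h (w + (1 / sqrt d) *\<^sub>R u)) * ennreal (gmoll 1 u)"
      by (metis mult.left_commute)
  qed
  finally show ?thesis .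
qed

text \<open>Gaussian regularisation: \<open>\<nu>\<close> convolved with \<open>gmoll\<close> has a
  density \<open>fd n\<close> whose transform is \<open>\<phi>\<close> damped by
  \<open>gchar\<close> (\<open>fdF\<close>). These densities converge boundedly to \<open>f\<close>;
  that \<open>f\<close> is the density of \<open>\<nu>\<close> is tested first on continuous
  functions, then on boxes, which generate.\<close>

lemma smooth_density_of_rapid_FT:
  fixes \<nu> :: "(real \<times> real) measure"
  assumes fin: "finite_measure \<nu>" and sets: "sets \<nu> = sets borel"
    and decay: "\<And>N. \<exists>C. \<forall>\<xi>. cmod (\<integral>z. cis (\<xi> \<bullet> z) \<partial>\<nu>) * norm \<xi> ^ N \<le> C"
  shows "\<exists>f. (\<forall>n. cont_differentiable n f) \<and> (\<forall>z. 0 \<le> f z) \<and> \<nu> = density lborel (\<lambda>z. ennreal (f z))"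
proof -
  interpret finite_measure \<nu> by fact
  note [measurable_cong] = sets
  define \<phi> where "\<phi> = (\<lambda>\<xi>::real\<times>real. \<integral>z. cis (\<xi> \<bullet> z) \<partial>\<nu>)"
  have [measurable]: "\<phi> \<in> borel_measurable borel" unfolding \<phi>_def by measurable
  have rp: "rapid \<phi>" using decay by (intro rapidI) (auto simp: \<phi>_def)
  have i\<phi>: "integrable lborel (\<lambda>\<xi>. cmod (\<phi> \<xi>))"
    using rp[unfolded rapid_def, THEN conjunct2, THEN spec, of 0] by simp
  define f where "f = (\<lambda>z. 1 / (2 * pi)\<^sup>2 * invF \<phi> z)"
  let ?c = "\<lambda>z \<xi>. cis (- (\<xi> \<bullet> z)) * \<phi> \<xi>" and ?g = "\<lambda>n \<xi>. gchar (real (Suc n)) \<xi>" and ?d = "\<lambda>n::nat. 1 / sqrt (real (Suc n))"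
  have cd: "cont_differentiable n f" for n
    unfolding f_def by (intro cont_differentiable_mult cont_differentiable_const cont_differentiable_invF rp)
  have cf: "continuous_on UNIV f" using cd[of 0] by simp
  hence [measurable]: "f \<in> borel_measurable borel" by (rule borel_measurable_continuous_onI)
  define fd where "fd = (\<lambda>n z. \<integral>w. gmoll (real (Suc n)) (z - w) \<partial>\<nu>)"
  have fdm [measurable]: "fd n \<in> borel_measurable borel" for n unfolding fd_def by measurable
  have fd0: "fd n z \<ge> 0" for n z unfolding fd_def by (intro Bochner_Integration.integral_nonneg gmoll_nonneg) simp
  have fdF: "of_real ((2 * pi)\<^sup>2 * fd n z) = (\<integral>\<xi>. ?c z \<xi> * of_real (?g n \<xi>) \<partial>lborel)" for n z
  proof -
    define d where "d = real (Suc n)"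
    have d: "d > 0" by (simp add: d_def)
    interpret P: pair_sigma_finite \<nu> "lborel :: (real \<times> real) measure" ..
    have I: "integrable (\<nu> \<Otimes>\<^sub>M lborel) (\<lambda>(w, \<xi>). cis (- (\<xi> \<bullet> (z - w))) * of_real (gchar d \<xi>))"
    proof (rule P.Fubini_integrable)
      show "AE x in \<nu>. integrable lborel (\<lambda>y. case (x, y) of (w, \<xi>) \<Rightarrow> cis (- (\<xi> \<bullet> (z - w))) * of_real (gchar d \<xi>))"
        using gauss_FT_2d(2)[OF d] by simp
      show "integrable \<nu> (\<lambda>x. \<integral>y. norm (case (x, y) of (w, \<xi>) \<Rightarrow> cis (- (\<xi> \<bullet> (z - w))) * complex_of_real (gchar d \<xi>)) \<partial>lborel)"
        by (simp add: norm_mult gchar_def)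
    qed measurable
    have "of_real ((2 * pi)\<^sup>2 * fd n z) = (\<integral>w. complex_of_real ((2 * pi)\<^sup>2 * gmoll d (z - w)) \<partial>\<nu>)"
      unfolding fd_def d_def by (simp only: integral_complex_of_real integral_mult_right_zero)
    also have "\<dots> = (\<integral>w. (\<integral>\<xi>. cis (- (\<xi> \<bullet> (z - w))) * of_real (gchar d \<xi>) \<partial>lborel) \<partial>\<nu>)"
      unfolding gauss_FT_2d(1)[OF d] ..
    also have "\<dots> = (\<integral>\<xi>. (\<integral>w. cis (- (\<xi> \<bullet> (z - w))) * of_real (gchar d \<xi>) \<partial>\<nu>) \<partial>lborel)"
      by (rule P.Fubini_integral[OF I, symmetric])
    also have "\<dots> = (\<integral>\<xi>. ?c z \<xi> * of_real (gchar d \<xi>) \<partial>lborel)"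
    proof (intro Bochner_Integration.integral_cong refl)
      fix \<xi> :: "real \<times> real"
      have "(\<integral>w. cis (- (\<xi> \<bullet> (z - w))) * of_real (gchar d \<xi>) \<partial>\<nu>) = (\<integral>w. (cis (- (\<xi> \<bullet> z)) * of_real (gchar d \<xi>)) * cis (\<xi> \<bullet> w) \<partial>\<nu>)"
      proof (intro Bochner_Integration.integral_cong refl)
        fix w
        have "cis (- (\<xi> \<bullet> (z - w))) = cis (- (\<xi> \<bullet> z)) * cis (\<xi> \<bullet> w)"
          by (simp add: cis_mult inner_diff_right)
        thus "cis (- (\<xi> \<bullet> (z - w))) * of_real (gchar d \<xi>) = (cis (- (\<xi> \<bullet> z)) * of_real (gchar d \<xi>)) * cis (\<xi> \<bullet> w)"
          by simp
      qed
      also have "\<dots> = (cis (- (\<xi> \<bullet> z)) * of_real (gchar d \<xi>)) * \<phi> \<xi>" unfolding \<phi>_def by (rule integral_mult_right_zero)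
      finally show "(\<integral>w. cis (- (\<xi> \<bullet> (z - w))) * of_real (gchar d \<xi>) \<partial>\<nu>) = ?c z \<xi> * of_real (gchar d \<xi>)" by simp
    qed
    finally show ?thesis unfolding d_def .
  qed
  have gk01: "0 \<le> ?g n \<xi>" "?g n \<xi> \<le> 1" for n \<xi> by (auto simp: gchar_def)
  have gchar_lim: "(\<lambda>n. ?g n \<xi>) \<longlonglongrightarrow> 1" for \<xi>
  proof -
    have "(\<lambda>n. (- (\<xi> \<bullet> \<xi>) / 2) * (1 / real (Suc n))) \<longlonglongrightarrow> (- (\<xi> \<bullet> \<xi>) / 2) * 0"
      by (intro tendsto_intros LIMSEQ_Suc lim_1_over_n)
    hence "(\<lambda>n. exp ((- (\<xi> \<bullet> \<xi>) / 2) * (1 / real (Suc n)))) \<longlonglongrightarrow> exp 0" by (intro tendsto_exp) simp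
    thus ?thesis by (simp add: gchar_def)
  qed
  have icplx: "integrable lborel (\<lambda>\<xi>. ?c z \<xi>)" for z
    using i\<phi> by (rule Bochner_Integration.integrable_bound) (auto simp: norm_mult)
  have inv: "invF \<phi> z = Re (\<integral>\<xi>. ?c z \<xi> \<partial>lborel)" for z
    unfolding invF_def by (rule integral_Re[OF icplx])
  have lim: "(\<lambda>n. fd n z) \<longlonglongrightarrow> f z" for z
  proof -
    have "(\<lambda>n. (\<integral>\<xi>. ?c z \<xi> * of_real (?g n \<xi>) \<partial>lborel)) \<longlonglongrightarrow> (\<integral>\<xi>. ?c z \<xi> \<partial>lborel)"
    proof (rule integral_dominated_convergence[where w = "\<lambda>\<xi>. cmod (\<phi> \<xi>)"])
      have "(\<lambda>n. ?c z \<xi> * complex_of_real (?g n \<xi>)) \<longlonglongrightarrow> ?c z \<xi> * of_real 1" for \<xi>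
        by (intro tendsto_intros gchar_lim)
      thus "AE \<xi> in lborel. (\<lambda>n. ?c z \<xi> * complex_of_real (?g n \<xi>)) \<longlonglongrightarrow> ?c z \<xi>" by simp
      show "AE \<xi> in lborel. norm (?c z \<xi> * complex_of_real (?g n \<xi>)) \<le> cmod (\<phi> \<xi>)" for n
        using gk01[of n] by (simp only: norm_mult norm_cis norm_of_real mult_1 abs_of_nonneg mult_left_le norm_ge_zero AE_I2)
    qed (use i\<phi> in auto)
    hence "(\<lambda>n. Re (of_real ((2 * pi)\<^sup>2 * fd n z))) \<longlonglongrightarrow> Re (\<integral>\<xi>. ?c z \<xi> \<partial>lborel)"
      unfolding fdF by (intro tendsto_Re)
    hence "(\<lambda>n. 1 / (2 * pi)\<^sup>2 * ((2 * pi)\<^sup>2 * fd n z)) \<longlonglongrightarrow> 1 / (2 * pi)\<^sup>2 * invF \<phi> z"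
      unfolding inv by (intro tendsto_intros) simp
    thus ?thesis by (simp add: f_def)
  qed
  have f0: "f z \<ge> 0" for z by (rule LIMSEQ_le_const[OF lim]) (use fd0 in auto)
  define B where "B = 1 / (2 * pi)\<^sup>2 * (\<integral>\<xi>. cmod (\<phi> \<xi>) \<partial>lborel)"
  have fdB: "fd n z \<le> B" for n z
  proof -
    have "(2 * pi)\<^sup>2 * fd n z = norm (complex_of_real ((2 * pi)\<^sup>2 * fd n z))" using fd0[of n z] by (simp del: of_real_mult)
    also have "\<dots> \<le> (\<integral>\<xi>. norm (?c z \<xi> * of_real (?g n \<xi>)) \<partial>lborel)" unfolding fdF by (rule integral_norm_bound)
    also have "\<dots> \<le> (\<integral>\<xi>. cmod (\<phi> \<xi>) \<partial>lborel)"
    proof (rule integral_mono)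
      show b: "norm (?c z \<xi> * of_real (?g n \<xi>)) \<le> cmod (\<phi> \<xi>)" for \<xi>
        using gk01[of n] by (simp only: norm_mult norm_cis norm_of_real mult_1 abs_of_nonneg mult_left_le norm_ge_zero AE_I2)
      show "integrable lborel (\<lambda>\<xi>. norm (?c z \<xi> * of_real (?g n \<xi>)))"
        using i\<phi> by (rule Bochner_Integration.integrable_bound) (use b in auto)
    qed fact
    finally show ?thesis by (simp add: B_def field_simps)
  qed
  have fB: "f z \<le> B" for z by (rule LIMSEQ_le_const2[OF lim]) (use fdB in auto)
  \<comment> \<open>\<open>h\<close> must be integrable for Lebesgue measure: so far
    \<open>f\<close> and all \<open>fd n\<close> are only known to be bounded by \<open>B\<close>,
    and \<open>h * B\<close> is the dominating function.\<close>
  have test: "(\<integral>z. h z * f z \<partial>lborel) = (\<integral>w. h w \<partial>\<nu>)"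
    if hc: "continuous_on UNIV h" and h01: "\<And>z. 0 \<le> h z" "\<And>z. h z \<le> 1" and hi: "integrable lborel h" for h :: "real \<times> real \<Rightarrow> real"
  proof -
    have [measurable]: "h \<in> borel_measurable borel" by (rule borel_measurable_continuous_onI[OF hc])
    define I where "I = (\<lambda>n w. \<integral>u. h (w + ?d n *\<^sub>R u) * gmoll 1 u \<partial>lborel)"
    have [measurable]: "I n \<in> borel_measurable borel" for n unfolding I_def by measurable
    have iI: "integrable lborel (\<lambda>u. h (w + c *\<^sub>R u) * gmoll 1 u)" for w c
      using gmoll1_integral(1) by (rule Bochner_Integration.integrable_bound)
        (auto simp: abs_mult h01 gmoll_nonneg intro!: mult_left_le_one_le)
    have I01: "0 \<le> I n w" "I n w \<le> 1" for n w
    proof -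
      show "0 \<le> I n w" unfolding I_def by (intro Bochner_Integration.integral_nonneg mult_nonneg_nonneg h01 gmoll_nonneg) simp
      have "I n w \<le> (\<integral>u. gmoll 1 u \<partial>lborel)" unfolding I_def
        by (intro integral_mono iI gmoll1_integral) (auto simp: h01 gmoll_nonneg intro!: mult_left_le_one_le)
      thus "I n w \<le> 1" using gmoll1_integral by simp
    qed
    have eq: "(\<integral>z. h z * fd n z \<partial>lborel) = (\<integral>w. I n w \<partial>\<nu>)" for n
    proof -
      define d where "d = real (Suc n)"
      have d: "d > 0" by (simp add: d_def)
      have gb: "gmoll d x \<le> d / (2 * pi)" for x unfolding gmoll_def using d by (intro mult_left_le) auto
      have ig: "integrable \<nu> (\<lambda>w. gmoll d (z - w))" for z
        by (rule integrable_const_bound[where B = "d / (2 * pi)"]) (use gb gmoll_nonneg[OF d] in auto)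
      have fdn: "ennreal (fd n z) = (\<integral>\<^sup>+w. ennreal (gmoll d (z - w)) \<partial>\<nu>)" for z
        unfolding fd_def d_def[symmetric] by (rule nn_integral_eq_integral[symmetric]) (use ig gmoll_nonneg[OF d] in auto)
      interpret P: pair_sigma_finite "lborel :: (real \<times> real) measure" \<nu> ..
      have "ennreal (\<integral>z. h z * fd n z \<partial>lborel) = (\<integral>\<^sup>+z. ennreal (h z * fd n z) \<partial>lborel)"
      proof (rule nn_integral_eq_integral[symmetric])
        show "integrable lborel (\<lambda>z. h z * fd n z)"
          using integrable_mult_left[OF hi, of B]
          by (rule Bochner_Integration.integrable_bound)
            (use fd0 fdB h01 in \<open>auto simp: abs_mult intro!: mult_left_mono order_trans[OF fdB]\<close>)
      qed (use h01 fd0 in auto)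
      also have "\<dots> = (\<integral>\<^sup>+z. (\<integral>\<^sup>+w. ennreal (h z) * ennreal (gmoll d (z - w)) \<partial>\<nu>) \<partial>lborel)"
        by (simp add: ennreal_mult h01 fd0 fdn nn_integral_cmult)
      also have "\<dots> = (\<integral>\<^sup>+w. (\<integral>\<^sup>+z. ennreal (h z) * ennreal (gmoll d (z - w)) \<partial>lborel) \<partial>\<nu>)"
        by (rule P.Fubini'[symmetric]) measurable
      also have "\<dots> = (\<integral>\<^sup>+w. ennreal (I n w) \<partial>\<nu>)"
      proof (intro nn_integral_cong)
        fix w
        have "(\<integral>\<^sup>+u. ennreal (h (w + (1 / sqrt d) *\<^sub>R u)) * ennreal (gmoll 1 u) \<partial>lborel) = (\<integral>\<^sup>+u. ennreal (h (w + (1 / sqrt d) *\<^sub>R u) * gmoll 1 u) \<partial>lborel)"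
          by (simp add: ennreal_mult h01 gmoll_nonneg)
        also have "\<dots> = ennreal (I n w)" unfolding I_def d_def
          by (rule nn_integral_eq_integral[OF iI]) (auto simp: h01 gmoll_nonneg)
        finally show "(\<integral>\<^sup>+z. ennreal (h z) * ennreal (gmoll d (z - w)) \<partial>lborel) = ennreal (I n w)"
          unfolding gmoll_conv[OF d \<open>h \<in> borel_measurable borel\<close>] .
      qed
      also have "\<dots> = ennreal (\<integral>w. I n w \<partial>\<nu>)"
        by (rule nn_integral_eq_integral) (use I01 in \<open>auto intro!: integrable_const_bound[where B = 1]\<close>)
      finally show ?thesis
        by (subst (asm) ennreal_inj) (auto intro!: Bochner_Integration.integral_nonneg simp: h01 fd0 I01)
    qed
    have "(\<lambda>n. \<integral>z. h z * fd n z \<partial>lborel) \<longlonglongrightarrow> (\<integral>z. h z * f z \<partial>lborel)"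
    proof (rule integral_dominated_convergence[where w = "\<lambda>z. h z * B"])
      show "integrable lborel (\<lambda>z. h z * B)" using hi by simp
      show "AE x in lborel. (\<lambda>i. h x * fd i x) \<longlonglongrightarrow> h x * f x" by (intro AE_I2 tendsto_intros lim)
      show "AE x in lborel. norm (h x * fd i x) \<le> h x * B" for i
        using fd0 fdB h01 by (auto simp: abs_mult intro!: mult_left_mono)
    qed measurable
    moreover have "(\<lambda>n. \<integral>w. I n w \<partial>\<nu>) \<longlonglongrightarrow> (\<integral>w. h w \<partial>\<nu>)"
    proof (rule integral_dominated_convergence[where w = "\<lambda>_. 1"])
      show "AE x in \<nu>. (\<lambda>i. I i x) \<longlonglongrightarrow> h x"
      proof (rule AE_I2)
        fix w
        have "(\<lambda>n. I n w) \<longlonglongrightarrow> (\<integral>u. h w * gmoll 1 u \<partial>lborel)"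
          unfolding I_def
        proof (rule integral_dominated_convergence[where w = "gmoll 1"])
          have "(\<lambda>n. h (w + ?d n *\<^sub>R u)) \<longlonglongrightarrow> h w" for u
          proof -
            have "(\<lambda>n. sqrt (1 / real (Suc n))) \<longlonglongrightarrow> sqrt 0"
              by (intro tendsto_real_sqrt LIMSEQ_Suc lim_1_over_n)
            hence "(\<lambda>n. w + ?d n *\<^sub>R u) \<longlonglongrightarrow> w + 0 *\<^sub>R u"
              by (intro tendsto_intros) (simp add: real_sqrt_divide)
            thus ?thesis using continuous_on_tendsto_compose[OF hc] by simp
          qed
          thus "AE u in lborel. (\<lambda>n. h (w + ?d n *\<^sub>R u) * gmoll 1 u) \<longlonglongrightarrow> h w * gmoll 1 u"
            by (intro AE_I2 tendsto_intros)
          show "AE u in lborel. norm (h (w + ?d n *\<^sub>R u) * gmoll 1 u) \<le> gmoll 1 u" for n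
            by (auto simp: abs_mult h01 gmoll_nonneg intro!: mult_left_le_one_le)
        qed (use gmoll1_integral in auto)
        thus "(\<lambda>i. I i w) \<longlonglongrightarrow> h w" using gmoll1_integral by simp
      qed
    qed (use I01 in auto)
    ultimately show ?thesis unfolding eq by (rule LIMSEQ_unique)
  qed
  have boxm: "(\<integral>z. indicator (box a b) z * f z \<partial>lborel) = measure \<nu> (box a b)" for a b :: "real \<times> real"
  proof -
    define h where "h = openapp (box a b)"
    have hb: "h n z \<le> indicator (box a b) z" for n z
      using openapp_bounds[of "box a b" n z] openapp_outside[of z "box a b" n] by (auto simp: h_def indicator_def)
    have hm [measurable]: "h n \<in> borel_measurable borel" for n unfolding h_def by simp
    have h0: "0 \<le> h n z" "h n z \<le> 1" for n z using openapp_bounds[of "box a b" n z] by (auto simp: h_def)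
    have ib: "integrable lborel (indicator (box a b) :: real \<times> real \<Rightarrow> real)"
      by (intro integrable_real_indicator) (auto simp: emeasure_lborel_box_eq)
    have hi: "integrable lborel (h n)" for n
      using ib by (rule Bochner_Integration.integrable_bound) (use hb h0 in auto)
    have "(\<lambda>n. \<integral>z. h n z * f z \<partial>lborel) \<longlonglongrightarrow> (\<integral>z. indicator (box a b) z * f z \<partial>lborel)"
    proof (rule integral_dominated_convergence[where w = "\<lambda>z. indicator (box a b) z * B"])
      show "AE x in lborel. (\<lambda>i. h i x * f x) \<longlonglongrightarrow> indicator (box a b) x * f x"
        unfolding h_def by (intro AE_I2 tendsto_intros openapp_tendsto open_box)
      show "AE x in lborel. norm (h i x * f x) \<le> indicator (box a b) x * B" for i
        using h0 hb f0 fB by (auto simp: abs_mult intro!: mult_mono)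
      show "integrable lborel (\<lambda>z. indicator (box a b) z * B)" using ib by (rule integrable_mult_left)
    qed auto
    moreover have "(\<lambda>n. \<integral>w. h n w \<partial>\<nu>) \<longlonglongrightarrow> (\<integral>w. indicator (box a b) w \<partial>\<nu>)"
    proof (rule integral_dominated_convergence[where w = "\<lambda>_. 1"])
      show "AE x in \<nu>. (\<lambda>i. h i x) \<longlonglongrightarrow> indicator (box a b) x"
        unfolding h_def by (intro AE_I2 openapp_tendsto open_box)
    qed (use h0 in auto)
    moreover have "(\<integral>z. h n z * f z \<partial>lborel) = (\<integral>w. h n w \<partial>\<nu>)" for n
      by (rule test) (use h0 hi continuous_openapp in \<open>auto simp: h_def\<close>)
    ultimately show ?thesis using LIMSEQ_unique by (simp add: sets sets_eq_imp_space_eq[OF sets])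
  qed
  have "\<nu> = density lborel (\<lambda>z. ennreal (f z))"
  proof (rule measure_eqI_generator_eq)
    let ?E = "range (\<lambda>(a, b). box a b::(real\<times>real) set)"
    show "Int_stable ?E" by (auto simp: Int_stable_def box_Int_box)
    show "?E \<subseteq> Pow UNIV" "sets \<nu> = sigma_sets UNIV ?E" "sets (density lborel (\<lambda>z. ennreal (f z))) = sigma_sets UNIV ?E"
      by (simp_all add: borel_eq_box sets)
    let ?A = "\<lambda>n::nat. box (- (real n *\<^sub>R One)) (real n *\<^sub>R One) :: (real\<times>real) set"
    show "range ?A \<subseteq> ?E" "(\<Union>i. ?A i) = UNIV" unfolding UN_box_eq_UNIV by auto
    show "emeasure \<nu> (?A i) \<noteq> \<infinity>" for i by simp
    fix X assume "X \<in> ?E"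
    then obtain a b where X: "X = box a b" by auto
    have "emeasure (density lborel (\<lambda>z. ennreal (f z))) X = (\<integral>\<^sup>+z. ennreal (indicator (box a b) z * f z) \<partial>lborel)"
      unfolding X by (subst emeasure_density) (auto intro!: nn_integral_cong simp: indicator_def)
    also have "\<dots> = ennreal (\<integral>z. indicator (box a b) z * f z \<partial>lborel)"
    proof (rule nn_integral_eq_integral)
      have "integrable lborel (\<lambda>z. indicator (box a b) z * B)"
        by (intro integrable_mult_left integrable_real_indicator) (auto simp: emeasure_lborel_box_eq)
      thus "integrable lborel (\<lambda>z. indicator (box a b) z * f z)"
        by (rule Bochner_Integration.integrable_bound) (use f0 fB in \<open>auto simp: indicator_def abs_of_nonneg order_trans[OF f0 fB]\<close>)
    qed (use f0 in auto)
    finally show "emeasure \<nu> X = emeasure (density lborel (\<lambda>z. ennreal (f z))) X"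
      unfolding boxm by (simp add: X emeasure_eq_measure)
  qed
  thus ?thesis using cd f0 by blast
qed

section \<open>Contour deformation for an oscillating average\<close>

text \<open>A polynomial on \<open>[-r, r]\<close>, so it continues holomorphically off the real
  line. Its zeros of order \<open>M\<close> at the end points tame the ends of a deformed contour,
  and \<open>M\<close> becomes the power of decay that is gained.\<close>

definition bump :: "nat \<Rightarrow> real \<Rightarrow> real \<Rightarrow> real" where
  "bump M r x = (if \<bar>x\<bar> \<le> r then (1 - (x / r)\<^sup>2) ^ M else 0)"

definition bump_mass :: "nat \<Rightarrow> real \<Rightarrow> real" where
  "bump_mass M r = (\<integral>x. bump M r x \<partial>lborel)"

definition psim :: "nat \<Rightarrow> real \<Rightarrow> real measure" where
  "psim M r = density lborel (\<lambda>x. ennreal (bump M r x / bump_mass M r))"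

lemma bump_measurable [measurable]: "bump M r \<in> borel_measurable borel"
  unfolding bump_def[abs_def] by measurable

lemma bump_bounds:
  assumes r: "r > 0" shows "0 \<le> bump M r x" "bump M r x \<le> indicator {-r..r} x"
proof -
  have *: "(x / r)\<^sup>2 \<le> 1" if "\<bar>x\<bar> \<le> r" using that r by (simp add: abs_square_le_1)
  show "0 \<le> bump M r x" using * by (auto simp: bump_def)
  show "bump M r x \<le> indicator {-r..r} x" using * by (auto simp: bump_def indicator_def abs_le_iff intro!: power_le_one)
qed

lemma bump_integrable: "r > 0 \<Longrightarrow> integrable lborel (bump M r)"
proof -
  assume r: "r > 0"
  have "integrable lborel (indicator {-r..r} :: real \<Rightarrow> real)"
    using r by (intro integrable_real_indicator) auto
  thus ?thesis
  proof (rule Bochner_Integration.integrable_bound)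
    show "AE x in lborel. norm (bump M r x) \<le> norm (indicator {-r..r} x :: real)"
      using bump_bounds[OF r] by auto
  qed simp
qed

lemma bump_mass_lower:
  assumes r: "r > 0" shows "bump_mass M r \<ge> r * (3/4) ^ M"
proof -
  have "r * (3/4) ^ M = (\<integral>x. (3/4) ^ M * indicator {-(r/2)..r/2} x \<partial>lborel)" using r by simp
  also have "\<dots> \<le> bump_mass M r" unfolding bump_mass_def
  proof (rule integral_mono)
    fix x
    show "(3/4) ^ M * indicator {-(r/2)..r/2} x \<le> bump M r x"
    proof (cases "\<bar>x\<bar> \<le> r / 2")
      case True
      hence "\<bar>x / r\<bar> \<le> 1/2" using r by (simp add: abs_divide divide_le_eq)
      hence "\<bar>x / r\<bar>\<^sup>2 \<le> (1/2)\<^sup>2" by (intro power_mono) auto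
      hence "(x / r)\<^sup>2 \<le> 1/4" by (simp add: power2_eq_square)
      thus ?thesis using True r by (auto simp: bump_def indicator_def intro!: power_mono)
    next
      case False
      thus ?thesis using bump_bounds[OF r] by (auto simp: indicator_def)
    qed
  qed (use r bump_integrable in auto)
  finally show ?thesis .
qed

lemma bump_mass_pos: "r > 0 \<Longrightarrow> bump_mass M r > 0"
  by (rule less_le_trans[OF _ bump_mass_lower]) auto

lemma sets_psim [simp, measurable_cong]: "sets (psim M r) = sets borel"
  and space_psim [simp]: "space (psim M r) = UNIV"
  by (auto simp: psim_def)

lemma prob_space_psim: "r > 0 \<Longrightarrow> prob_space (psim M r)"
proof
  assume r: "r > 0"
  have "emeasure (psim M r) (space (psim M r)) = (\<integral>\<^sup>+x. ennreal (bump M r x / bump_mass M r) \<partial>lborel)"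
    unfolding psim_def by (simp add: emeasure_density)
  also have "\<dots> = ennreal (\<integral>x. bump M r x / bump_mass M r \<partial>lborel)"
    using bump_integrable[OF r] bump_bounds[OF r] bump_mass_pos[OF r]
    by (intro nn_integral_eq_integral) (auto intro!: AE_I2 divide_nonneg_pos)
  also have "(\<integral>x. bump M r x / bump_mass M r \<partial>lborel) = 1"
    using bump_mass_pos[OF r, of M] by (simp add: bump_mass_def)
  finally show "emeasure (psim M r) (space (psim M r)) = 1" by simp
qed

lemma AE_psim: "r > 0 \<Longrightarrow> AE x in psim M r. \<bar>x\<bar> \<le> r"
  unfolding psim_def by (subst AE_density) (auto simp: bump_def)

lemma pow_exp_le: "y > 0 \<Longrightarrow> t \<ge> 0 \<Longrightarrow> t ^ M * exp (- (y * t)) \<le> fact M / y ^ M" for t y :: real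
proof -
  assume y: "y > 0" and t: "t \<ge> 0"
  have "(y * t) ^ M / fact M \<le> exp (y * t)"
  proof -
    have s: "summable (\<lambda>n. (y * t) ^ n /\<^sub>R fact n)" by (rule summable_exp_generic)
    have "sum (\<lambda>n. (y * t) ^ n /\<^sub>R fact n) {M} \<le> (\<Sum>n. (y * t) ^ n /\<^sub>R fact n)"
      using y t by (intro sum_le_suminf s) auto
    thus ?thesis by (simp add: exp_def divide_inverse mult.commute)
  qed
  hence "(y * t) ^ M \<le> fact M * exp (y * t)" by (simp add: field_simps)
  thus ?thesis using y by (simp add: power_mult_distrib exp_minus field_simps)
qed

text \<open>On the slanted sides of the triangle with vertices \<open>-r\<close>, \<open>r\<close>,
  \<open>i r\<close> a point at height \<open>r * t\<close> is at distance of order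
  \<open>r * t\<close> from a zero of the weight, which is therefore at most
  \<open>(3 * t)^M\<close>. Against \<open>exp (- \<beta> * (r * t))\<close> this leaves
  \<open>M! / (\<beta> * r)^M\<close>, by one term of the exponential series
  (\<open>pow_exp_le\<close>).\<close>

lemma side_bound:
  fixes G :: "complex \<Rightarrow> complex"
  assumes r: "r > 0" and \<beta>: "\<beta> > 0" and B: "B \<ge> 0" and sg: "sg = 1 \<or> sg = -1" and t: "0 \<le> t" "t \<le> 1"
    and z: "\<zeta> = Complex (sg * (r * (1 - t))) (r * t)" and G: "norm (G \<zeta>) \<le> B * exp (- \<beta> * (r * t))"
  shows "norm ((1 - (\<zeta> / of_real r)\<^sup>2) ^ M * G \<zeta>) \<le> B * (3 ^ M * fact M / (\<beta> * r) ^ M)"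
proof -
  define w where "w = \<zeta> / of_real r"
  have w: "w = Complex (sg * (1 - t)) t" using r z by (simp add: w_def complex_eq_iff)
  have "norm (1 - w\<^sup>2) \<le> 3 * t"
  proof -
    have 1: "1 - w\<^sup>2 = (1 - of_real sg * w) * (1 + of_real sg * w)"
      using sg by (auto simp: algebra_simps power2_eq_square)
    have 2: "1 - of_real sg * w = Complex t (- sg * t)" using sg by (auto simp: w complex_eq_iff)
    have 3: "1 + of_real sg * w = Complex (2 - t) (sg * t)" using sg by (auto simp: w complex_eq_iff)
    have s2: "(sg * t)\<^sup>2 = t\<^sup>2" using sg by auto
    have n2: "norm (1 - of_real sg * w) = sqrt (2 * t\<^sup>2)" unfolding 2 using s2 by (simp add: cmod_def)
    have "(2 - t)\<^sup>2 + t\<^sup>2 \<le> 4"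
    proof -
      have "t * t \<le> t * 1" using t by (intro mult_left_mono) auto
      moreover have "(2 - t)\<^sup>2 + t\<^sup>2 = 4 + 2 * (t * t) - 4 * t" by (simp add: power2_eq_square algebra_simps)
      ultimately show ?thesis using t by linarith
    qed
    hence n3: "norm (1 + of_real sg * w) \<le> sqrt 4" unfolding 3 cmod_def using s2 by (intro real_sqrt_le_mono) simp
    have "norm (1 - w\<^sup>2) \<le> sqrt (2 * t\<^sup>2) * sqrt 4"
      unfolding 1 norm_mult n2 using n3 by (intro mult_left_mono) auto
    also have "\<dots> = sqrt (2 * t\<^sup>2 * 4)" by (simp only: real_sqrt_mult)
    also have "\<dots> = sqrt (8 * t\<^sup>2)" by (rule arg_cong[where f = sqrt]) simp
    also have "\<dots> \<le> sqrt ((3 * t)\<^sup>2)" using t by (intro real_sqrt_le_mono) (auto simp: power_mult_distrib)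
    also have "\<dots> = 3 * t" using t by (intro real_sqrt_unique) auto
    finally show ?thesis .
  qed
  hence "norm ((1 - w\<^sup>2) ^ M) \<le> (3 * t) ^ M" unfolding norm_power by (intro power_mono) auto
  hence "norm ((1 - w\<^sup>2) ^ M * G \<zeta>) \<le> (3 * t) ^ M * (B * exp (- \<beta> * (r * t)))"
    unfolding norm_mult using G t by (intro mult_mono) auto
  also have "\<dots> = (B * 3 ^ M) * (t ^ M * exp (- ((\<beta> * r) * t)))" by (simp add: power_mult_distrib mult_ac)
  also have "\<dots> \<le> (B * 3 ^ M) * (fact M / (\<beta> * r) ^ M)"
    using B r \<beta> t by (intro mult_left_mono pow_exp_le) auto
  finally show ?thesis by (simp add: w_def)
qed

text \<open>By Cauchy's theorem the integral over \<open>[-r, r]\<close> is minus the integral over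
  the two slanted sides, each of length at most \<open>2 * r\<close>. The factor \<open>4^M\<close>
  is \<open>3^M\<close> from \<open>side_bound\<close> divided by \<open>(3/4)^M\<close> from the
  normalisation of \<open>psim\<close>.\<close>

lemma contour_bound_upper:
  fixes G :: "complex \<Rightarrow> complex"
  assumes r: "r > 0" and \<beta>: "\<beta> > 0" and B: "B \<ge> 0"
    and meas: "(\<lambda>x. G (of_real x)) \<in> borel_measurable borel"
    and hol: "G holomorphic_on {\<zeta>. \<bar>Re \<zeta>\<bar> + \<bar>Im \<zeta>\<bar> \<le> r}"
    and bd: "\<And>x y. \<bar>x\<bar> + y \<le> r \<Longrightarrow> 0 \<le> y \<Longrightarrow> norm (G (Complex x y)) \<le> B * exp (- \<beta> * y)"
  shows "norm (\<integral>x. G (of_real x) \<partial>psim M r) \<le> 4 * B * (4 ^ M * fact M / (\<beta> * r) ^ M)"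
proof -
  define T where "T = {\<zeta>::complex. \<bar>Re \<zeta>\<bar> + \<bar>Im \<zeta>\<bar> \<le> r}"
  define f where "f = (\<lambda>\<zeta>. (1 - (\<zeta> / of_real r)\<^sup>2) ^ M * G \<zeta>)"
  define a b c where abc: "a = - complex_of_real r" "b = complex_of_real r" "c = \<i> * complex_of_real r"
  define D where "D = B * (3 ^ M * fact M / (\<beta> * r) ^ M)"
  have D0: "D \<ge> 0" using B \<beta> r by (simp add: D_def)
  have convT: "convex T"
  proof (rule convexI)
    fix x y :: complex and u v :: real assume *: "x \<in> T" "y \<in> T" "0 \<le> u" "0 \<le> v" "u + v = 1"
    have "\<bar>Re (u *\<^sub>R x + v *\<^sub>R y)\<bar> \<le> u * \<bar>Re x\<bar> + v * \<bar>Re y\<bar>" "\<bar>Im (u *\<^sub>R x + v *\<^sub>R y)\<bar> \<le> u * \<bar>Im x\<bar> + v * \<bar>Im y\<bar>"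
      using * by (auto intro!: order_trans[OF abs_triangle_ineq] simp: abs_mult)
    hence "\<bar>Re (u *\<^sub>R x + v *\<^sub>R y)\<bar> + \<bar>Im (u *\<^sub>R x + v *\<^sub>R y)\<bar> \<le> u * (\<bar>Re x\<bar> + \<bar>Im x\<bar>) + v * (\<bar>Re y\<bar> + \<bar>Im y\<bar>)"
      by (simp add: algebra_simps)
    also have "\<dots> \<le> u * r + v * r" using * by (intro add_mono mult_left_mono) (auto simp: T_def)
    also have "\<dots> = r" using *(5) by (simp flip: distrib_right)
    finally show "u *\<^sub>R x + v *\<^sub>R y \<in> T" by (simp add: T_def)
  qed
  have abcT: "{a, b, c} \<subseteq> T" using r by (auto simp: T_def abc)
  have hullT: "convex hull {a, b, c} \<subseteq> T" using abcT convT by (rule hull_minimal)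
  have holf: "f holomorphic_on convex hull {a, b, c}"
    unfolding f_def using holomorphic_on_subset[OF hol[folded T_def] hullT] r by (auto intro!: holomorphic_intros)
  have cf: "continuous_on (convex hull {a, b, c}) f" using holf by (rule holomorphic_on_imp_continuous_on)
  have C: "(f has_contour_integral 0) (linepath a b +++ linepath b c +++ linepath c a)"
    by (rule Cauchy_theorem_triangle_interior[OF cf]) (rule holomorphic_on_subset[OF holf interior_subset])
  have seg: "closed_segment a b \<subseteq> convex hull {a, b, c}" "closed_segment b c \<subseteq> convex hull {a, b, c}" "closed_segment c a \<subseteq> convex hull {a, b, c}"
    by (intro closed_segment_subset convex_convex_hull hull_inc; simp)+
  have ci: "f contour_integrable_on linepath a b" "f contour_integrable_on linepath b c" "f contour_integrable_on linepath c a"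
    using seg by (auto intro!: contour_integrable_continuous_linepath continuous_on_subset[OF cf])
  have sum0: "contour_integral (linepath a b) f + (contour_integral (linepath b c) f + contour_integral (linepath c a) f) = 0"
    using contour_integral_unique[OF C] ci by (simp add: contour_integral_join contour_integrable_joinI)
  have nb: "norm (contour_integral (linepath b c) f) \<le> D * norm (c - b)"
  proof (rule has_contour_integral_bound_linepath[OF has_contour_integral_integral[OF ci(2)] D0])
    fix x assume "x \<in> closed_segment b c"
    then obtain t where t: "0 \<le> t" "t \<le> 1" "x = (1 - t) *\<^sub>R b + t *\<^sub>R c" by (auto simp: in_segment)
    have x: "x = Complex (1 * (r * (1 - t))) (r * t)" unfolding t(3) abc by (simp add: complex_eq_iff algebra_simps)
    have "norm (G x) \<le> B * exp (- \<beta> * (r * t))" unfolding x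
    proof (rule bd)
      have "r * (1 - t) \<ge> 0" "r * t \<ge> 0" using r t by auto
      thus "0 \<le> r * t" and "\<bar>1 * (r * (1 - t))\<bar> + r * t \<le> r" by (auto simp: algebra_simps)
    qed
    thus "norm (f x) \<le> D" unfolding f_def D_def
      by (intro side_bound[OF r \<beta> B _ t(1,2) x]) auto
  qed
  have nc: "norm (contour_integral (linepath c a) f) \<le> D * norm (a - c)"
  proof (rule has_contour_integral_bound_linepath[OF has_contour_integral_integral[OF ci(3)] D0])
    fix x assume "x \<in> closed_segment c a"
    then obtain t where t: "0 \<le> t" "t \<le> 1" "x = (1 - t) *\<^sub>R a + t *\<^sub>R c" by (subst (asm) closed_segment_commute) (auto simp: in_segment)
    have x: "x = Complex ((-1) * (r * (1 - t))) (r * t)" unfolding t(3) abc by (simp add: complex_eq_iff algebra_simps)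
    have "norm (G x) \<le> B * exp (- \<beta> * (r * t))" unfolding x
    proof (rule bd)
      have "r * (1 - t) \<ge> 0" "r * t \<ge> 0" using r t by auto
      thus "0 \<le> r * t" and "\<bar>(-1) * (r * (1 - t))\<bar> + r * t \<le> r" by (auto simp: algebra_simps)
    qed
    thus "norm (f x) \<le> D" unfolding f_def D_def
      by (intro side_bound[OF r \<beta> B _ t(1,2) x]) auto
  qed
  have "norm (c - b) = sqrt 2 * r" "norm (a - c) = sqrt 2 * r"
    using r by (auto simp: abc cmod_def real_sqrt_mult power2_eq_square)
  moreover have "sqrt 2 \<le> 2" by (rule real_le_lsqrt) auto
  ultimately have n: "norm (c - b) \<le> 2 * r" "norm (a - c) \<le> 2 * r" using r by auto
  have main: "norm (contour_integral (linepath a b) f) \<le> 4 * r * D"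
  proof -
    have "contour_integral (linepath a b) f = - (contour_integral (linepath b c) f + contour_integral (linepath c a) f)"
      using sum0 by (simp add: add_eq_0_iff2)
    hence "norm (contour_integral (linepath a b) f) \<le> norm (contour_integral (linepath b c) f) + norm (contour_integral (linepath c a) f)"
      by (simp only: norm_minus_cancel norm_triangle_ineq)
    also have "\<dots> \<le> D * (2 * r) + D * (2 * r)"
      using nb nc n D0 by (intro add_mono) (meson mult_left_mono order_trans)+
    finally show ?thesis by (simp add: mult_ac)
  qed
  have "((\<lambda>x. f (of_real x)) has_integral contour_integral (linepath a b) f) {-r..r}"
  proof -
    have ab: "a \<in> \<real>" "b \<in> \<real>" "Re a < Re b" "Re a = - r" "Re b = r" using r by (simp_all add: abc)
    show ?thesis using has_contour_integral_integral[OF ci(1)]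
      unfolding has_contour_integral_linepath_Reals_iff[OF ab(1-3)] ab(4,5) .
  qed
  hence hi: "integral {-r..r} (\<lambda>x. f (of_real x)) = contour_integral (linepath a b) f" by (rule integral_unique)
  have contr: "continuous_on {-r..r} (\<lambda>x. f (of_real x))"
  proof (rule continuous_on_compose2[OF cf])
    show "complex_of_real ` {-r..r} \<subseteq> convex hull {a, b, c}"
    proof safe
      fix x :: real assume x: "x \<in> {-r..r}"
      have "complex_of_real x \<in> closed_segment a b"
      proof -
        have "x \<in> closed_segment (-r) r" using x r by (simp add: closed_segment_eq_real_ivl)
        hence "complex_of_real x \<in> closed_segment (complex_of_real (-r)) (complex_of_real r)"
          unfolding closed_segment_of_real by blast
        thus ?thesis by (simp add: abc)
      qed
      thus "complex_of_real x \<in> convex hull {a, b, c}" using seg(1) by auto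
    qed
  qed (intro continuous_intros)
  have si: "set_integrable lborel {-r..r} (\<lambda>x. f (of_real x))" by (rule borel_integrable_atLeastAtMost'[OF contr])
  have "(\<integral>x. G (of_real x) \<partial>psim M r) = (\<integral>x. indicator {-r..r} x *\<^sub>R G (of_real x) \<partial>psim M r)"
  proof (rule integral_cong_AE)
    show "AE x in psim M r. G (of_real x) = indicator {-r..r} x *\<^sub>R G (of_real x)"
      using AE_psim[OF r, of M] by eventually_elim (auto simp: indicator_def abs_le_iff)
    show "(\<lambda>x. indicator {-r..r} x *\<^sub>R G (of_real x)) \<in> borel_measurable (psim M r)"
      using meas by measurable
  qed (use meas in measurable)
  also have "\<dots> = (\<integral>x. (bump M r x / bump_mass M r) *\<^sub>R (indicator {-r..r} x *\<^sub>R G (of_real x)) \<partial>lborel)"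
    unfolding psim_def using meas bump_bounds[OF r] bump_mass_pos[OF r, of M]
    by (intro integral_density) (auto intro!: divide_nonneg_pos)
  also have "\<dots> = (\<integral>x. (1 / bump_mass M r) *\<^sub>R (indicator {-r..r} x *\<^sub>R f (of_real x)) \<partial>lborel)"
    by (intro Bochner_Integration.integral_cong refl) (auto simp: bump_def f_def indicator_def scaleR_conv_of_real)
  also have "\<dots> = (1 / bump_mass M r) *\<^sub>R contour_integral (linepath a b) f"
    unfolding integral_scaleR_right using set_borel_integral_eq_integral(2)[OF si] by (simp add: hi set_lebesgue_integral_def)
  finally have "norm (\<integral>x. G (of_real x) \<partial>psim M r) = norm (contour_integral (linepath a b) f) / bump_mass M r"
    using bump_mass_pos[OF r, of M] by simp
  also have "\<dots> \<le> (4 * r * D) / (r * (3/4) ^ M)"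
    using main bump_mass_lower[OF r, of M] r D0 by (intro frac_le) auto
  also have "\<dots> = 4 * B * (4 ^ M * fact M / (\<beta> * r) ^ M)"
  proof -
    have "(4::real) ^ M = 3 ^ M / (3/4) ^ M" by (simp add: power_divide[symmetric])
    thus ?thesis using r by (simp add: D_def mult_ac)
  qed
  finally show ?thesis .
qed

section \<open>Shifts for which the phase does not oscillate\<close>

text \<open>Relative error: it passes through products, quotients and sums of nonnegative multiples
  of one direction without any record of magnitudes.\<close>

definition near :: "real \<Rightarrow> complex \<Rightarrow> complex \<Rightarrow> bool" where
  "near a x y \<longleftrightarrow> norm (x - y) \<le> a * norm y"

lemma near_mono: "near a x y \<Longrightarrow> a \<le> b \<Longrightarrow> near b x y"
  unfolding near_def by (meson mult_right_mono norm_ge_zero order_trans)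

lemma near_cnj: "near a x y \<Longrightarrow> near a (cnj x) (cnj y)"
  unfolding near_def by (metis complex_cnj_diff complex_mod_cnj)

lemma near_norm: "near a x y \<Longrightarrow> norm x \<le> (1 + a) * norm y"
  unfolding near_def using norm_triangle_sub[of x y] by (simp add: algebra_simps)

lemma near_mult:
  assumes "near a x y" "near b x' y'" "a \<ge> 0" "b \<ge> 0"
  shows "near (a + b + a * b) (x * x') (y * y')"
proof -
  have "x * x' - y * y' = (x - y) * x' + y * (x' - y')" by (simp add: algebra_simps)
  hence "norm (x * x' - y * y') \<le> norm (x - y) * norm x' + norm y * norm (x' - y')"
    by (metis norm_mult norm_triangle_ineq)
  also have "\<dots> \<le> (a * norm y) * ((1 + b) * norm y') + norm y * (b * norm y')"
    using assms near_norm[OF assms(2)] unfolding near_def by (intro add_mono mult_mono) auto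
  finally show ?thesis unfolding near_def by (simp add: norm_mult algebra_simps)
qed

lemma near_div:
  assumes "near a x y" "near b w 1" "a \<ge> 0" "b \<ge> 0" "b < 1"
  shows "near ((a + b) / (1 - b)) (x / w) y"
proof -
  have w: "norm w \<ge> 1 - b" using assms(2) norm_triangle_sub[of 1 w] unfolding near_def by (simp add: norm_minus_commute)
  hence w0: "w \<noteq> 0" using assms(5) by auto
  have "x / w - y = ((x - y) - y * (w - 1)) / w" using w0 by (simp add: field_simps)
  hence "norm (x / w - y) = norm ((x - y) - y * (w - 1)) / norm w" by (simp add: norm_divide)
  also have "\<dots> \<le> ((a + b) * norm y) / (1 - b)"
  proof (rule frac_le)
    have "norm ((x - y) - y * (w - 1)) \<le> norm (x - y) + norm y * norm (w - 1)" by (metis norm_mult norm_triangle_ineq4)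
    also have "\<dots> \<le> a * norm y + norm y * b" using assms unfolding near_def by (intro add_mono mult_left_mono) auto
    finally show "norm ((x - y) - y * (w - 1)) \<le> (a + b) * norm y" by (simp add: algebra_simps)
  qed (use assms w in auto)
  finally show ?thesis by (simp add: near_def)
qed

lemma near_sum:
  assumes "\<And>i. i \<in> A \<Longrightarrow> near a (x i) (h * of_real (t i))" "\<And>i. i \<in> A \<Longrightarrow> t i \<ge> 0"
  shows "near a (sum x A) (h * of_real (sum t A))"
proof -
  have "sum x A - h * of_real (sum t A) = (\<Sum>i\<in>A. x i - h * of_real (t i))"
    by (simp add: sum_subtractf sum_distrib_left)
  also have "norm \<dots> \<le> (\<Sum>i\<in>A. a * (norm h * t i))"
    using assms by (intro sum_norm_le) (auto simp: near_def norm_mult)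
  also have "\<dots> = a * norm (h * of_real (sum t A))"
  proof -
    have "norm (h * of_real (sum t A)) = norm h * sum t A"
      using sum_nonneg[of A t] assms(2) by (simp add: norm_mult del: of_real_sum)
    thus ?thesis by (simp only: sum_distrib_left)
  qed
  finally show ?thesis by (simp add: near_def)
qed

text \<open>The noise at the grid points, built from increments \<open>e\<close> for
  \<open>W1\<close> and \<open>x\<close> for \<open>W2\<close>. Only \<open>x\<close> will be
  shifted; \<open>e\<close> is a parameter, and \<open>s\<close> may be 0.\<close>

definition nz :: "real \<Rightarrow> real \<Rightarrow> (nat \<Rightarrow> real) \<Rightarrow> (nat \<Rightarrow> real) \<Rightarrow> nat \<Rightarrow> complex" where
  "nz s c e x j = Complex (s * (\<Sum>i<j. e i)) (c * (\<Sum>i<j. x i))"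

lemma nz_0 [simp]: "nz s c e x 0 = 0" by (simp add: nz_def complex_eq_iff)

text \<open>The Riemann sum of \<open>q^2\<close> over the \<open>k\<close>-th piece, which consists of \<open>K\<close> steps: up to the factor \<open>i c / q^2\<close> at the
  final time, it is the derivative of the scheme under a shift of the imaginary noise in that piece.\<close>

definition Sk :: "(nat \<Rightarrow> complex) \<Rightarrow> real \<Rightarrow> nat \<Rightarrow> nat \<Rightarrow> complex" where
  "Sk q d K k = (\<Sum>m<K. of_real d * (q (k * K + m + 1))\<^sup>2)"

lemma double_sum: "6 * (\<Sum>m<K. \<Sum>i\<le>m. real i) = real K ^ 3 - real K"
proof -
  have T: "2 * (\<Sum>i\<le>m. real i) = real m * (real m + 1)" for m
    by (induction m) (auto simp: algebra_simps)
  show ?thesis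
  proof (induction K)
    case (Suc K)
    have "6 * (\<Sum>m<Suc K. \<Sum>i\<le>m. real i) = real K ^ 3 - real K + 3 * (2 * (\<Sum>i\<le>K. real i))" using Suc by simp
    thus ?case unfolding T by (simp add: algebra_simps power3_eq_cube)
  qed auto
qed

text \<open>For \<open>K = 1\<close> the sum is 0: a piece of a single step cannot turn. Hence
  \<open>K >= 2\<close> from here on.\<close>

lemma double_sum_lower:
  assumes K: "K \<ge> 2" shows "(\<Sum>m<K. \<Sum>i\<le>m. real i) \<ge> real K ^ 3 / 12"
proof -
  have "2 * 2 \<le> real K * real K" using K by (intro mult_mono) auto
  hence "real K * 2 \<le> real K * (real K * real K)" using K by (intro mult_left_mono) auto
  hence "2 * real K \<le> real K ^ 3" by (simp add: power3_eq_cube)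
  thus ?thesis using double_sum[of K] by linarith
qed

lemma half_abs: "\<bar>A - B\<bar> \<le> (1/10 + 1/100) * N \<Longrightarrow> N = \<bar>B\<bar> \<Longrightarrow> \<bar>A\<bar> \<ge> N / 2" for A B N :: real
proof -
  assume 1: "\<bar>A - B\<bar> \<le> (1/10 + 1/100) * N" and 2: "N = \<bar>B\<bar>"
  have "\<bar>B\<bar> - \<bar>A\<bar> \<le> \<bar>A - B\<bar>" using abs_triangle_ineq2[of B A] by (simp add: abs_minus_commute)
  moreover have "N \<ge> 0" using 2 by simp
  moreover have "\<bar>A - B\<bar> \<le> 11/100 * N" using 1 by simp
  ultimately show ?thesis using 2 by linarith
qed

text \<open>The shift acts only from the start of piece \<open>k\<close>, so there the Wronskian
  starts at 0, and after \<open>m\<close> steps it is close to \<open>h * m\<close> with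
  \<open>h = i c D d\<close>. By \<open>sq_ratio\<close> the quotient of the two \<open>q\<close> is
  then close to \<open>1 - d h (0 + ... + m)\<close>, and summing the squares moves
  \<open>S_k\<close> along a multiple of \<open>- i D\<close>. As \<open>k >= 1\<close>,
  \<open>S_0\<close> does not feel the shift, and it is close to the positive number
  \<open>K * d\<close>; so the product is nearly imaginary and its size is explicit.\<close>

lemma S_separation:
  fixes x x' :: "nat \<Rightarrow> real"
  assumes d: "d > 0" and K: "K \<ge> 2" and k: "k \<ge> 1" and c: "c > 0"
    and x': "\<And>i. i < (k + 1) * K \<Longrightarrow> x' i = (if i < k * K then x i else x i + d * D)"
    and q: "\<And>j. j \<le> (k + 1) * K \<Longrightarrow> near (1/100) (sq d (nz s c e x) z j) 1"
    and q': "\<And>j. j \<le> (k + 1) * K \<Longrightarrow> near (1/100) (sq d (nz s c e x') z j) 1"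
  shows "\<bar>Im (cnj (Sk (sq d (nz s c e x) z) d K 0) * (Sk (sq d (nz s c e x') z) d K k - Sk (sq d (nz s c e x) z) d K k))\<bar>
     \<ge> c * \<bar>D\<bar> * (real K * d) ^ 4 / 12"
proof -
  define Q where "Q = sq d (nz s c e x) z"
  define Q' where "Q' = sq d (nz s c e x') z"
  define w where "w = wr d (nz s c e x) z (nz s c e x') z"
  note q = q[folded Q_def] and q' = q'[folded Q'_def]
  have qnz: "Q j \<noteq> 0" if "j \<le> (k + 1) * K" for j using q[OF that] by (auto simp: near_def)
  define h where "h = \<i> * of_real (c * D * d)"
  have inc: "(nz s c e x' (Suc i) - nz s c e x' i) - (nz s c e x (Suc i) - nz s c e x i) = (if i < k * K then 0 else h)"
    if "i < (k + 1) * K" for i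
    using x'[OF that] by (auto simp: nz_def h_def complex_eq_iff algebra_simps)
  have weq: "w j = (\<Sum>i<j. (if i < k * K then 0 else h) * Q (Suc i) * Q' (Suc i))" if "j \<le> (k + 1) * K" for j
  proof -
    have "(\<Sum>i<j. ((nz s c e x' (Suc i) - nz s c e x' i) - (nz s c e x (Suc i) - nz s c e x i)) * Q (Suc i) * Q' (Suc i))
      = (\<Sum>i<j. (if i < k * K then 0 else h) * Q (Suc i) * Q' (Suc i))"
      using that by (intro sum.cong refl arg_cong2[where f = "(*)"] inc) auto
    thus ?thesis unfolding w_def wr_eq Q_def[symmetric] Q'_def[symmetric] by simp
  qed
  have w0: "w j = 0" if "j \<le> k * K" for j
    using weq[of j] that by (auto intro!: sum.neutral)
  have wm: "near (21/1000) (w (k * K + m)) (h * of_real (real m))" if m: "m \<le> K" for m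
  proof -
    have "w (k * K + m) = (\<Sum>i<k * K + m. (if i < k * K then 0 else h) * Q (Suc i) * Q' (Suc i))"
      using m by (intro weq) (simp add: algebra_simps)
    also have "\<dots> = (\<Sum>i<m. h * Q (Suc (k * K + i)) * Q' (Suc (k * K + i)))"
    proof -
      have "{..<k * K + m} = {..<k * K} \<union> {k * K..<k * K + m}" by auto
      hence "(\<Sum>i<k * K + m. (if i < k * K then 0 else h) * Q (Suc i) * Q' (Suc i))
        = (\<Sum>i<k*K. (if i < k * K then 0 else h) * Q (Suc i) * Q' (Suc i)) + (\<Sum>i=k*K..<k*K+m. (if i < k * K then 0 else h) * Q (Suc i) * Q' (Suc i))"
        by (simp add: sum.union_disjoint ivl_disj_int)
      also have "(\<Sum>i<k*K. (if i < k * K then 0 else h) * Q (Suc i) * Q' (Suc i)) = 0" by (intro sum.neutral) auto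
      also have "(\<Sum>i=k*K..<k*K+m. (if i < k * K then 0 else h) * Q (Suc i) * Q' (Suc i)) = (\<Sum>i<m. h * Q (Suc (k * K + i)) * Q' (Suc (k * K + i)))"
        by (rule sum.reindex_bij_witness[of _ "\<lambda>i. k * K + i" "\<lambda>i. i - k * K"]) auto
      finally show ?thesis by simp
    qed
    also have "near (21/1000) \<dots> (h * of_real (\<Sum>i<m. 1))"
    proof (rule near_sum)
      fix i assume "i \<in> {..<m}"
      hence "Suc (k * K + i) \<le> (k + 1) * K" using m by (simp add: algebra_simps)
      from near_mult[OF q[OF this] q'[OF this]] 
      have "near (21/1000) (Q (Suc (k * K + i)) * Q' (Suc (k * K + i))) 1" by (auto intro: near_mono)
      thus "near (21/1000) (h * Q (Suc (k * K + i)) * Q' (Suc (k * K + i))) (h * of_real 1)"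
        using near_mult[of 0 h h "21/1000" "Q (Suc (k * K + i)) * Q' (Suc (k * K + i))" 1]
        by (simp add: near_def mult.assoc)
    qed simp
    finally show ?thesis by simp
  qed
  have ratio: "near (43/1000) (Q' (k * K + m + 1) / Q (k * K + m + 1) - 1) ((- of_real d * h) * of_real (\<Sum>i\<le>m. real i))" if m: "m < K" for m
  proof -
    have jm: "k * K + m + 1 \<le> (k + 1) * K" using m by (simp add: algebra_simps)
    have "Q' (k * K + m + 1) / Q (k * K + m + 1) = 1 - (\<Sum>i<k * K + m + 1. of_real d * w i / (Q i * Q (Suc i)))"
      unfolding Q_def Q'_def w_def by (rule sq_ratio) (use qnz jm in \<open>auto simp: Q_def\<close>)
    also have "(\<Sum>i<k * K + m + 1. of_real d * w i / (Q i * Q (Suc i))) = (\<Sum>i\<le>m. of_real d * w (k * K + i) / (Q (k * K + i) * Q (Suc (k * K + i))))"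
    proof -
      have "{..<k * K + m + 1} = {..<k * K} \<union> {k * K..<k * K + m + 1}" by auto
      hence "(\<Sum>i<k * K + m + 1. of_real d * w i / (Q i * Q (Suc i)))
        = (\<Sum>i<k*K. of_real d * w i / (Q i * Q (Suc i))) + (\<Sum>i=k*K..<k*K+m+1. of_real d * w i / (Q i * Q (Suc i)))"
        by (simp add: sum.union_disjoint ivl_disj_int)
      also have "(\<Sum>i<k*K. of_real d * w i / (Q i * Q (Suc i))) = 0" by (intro sum.neutral) (auto simp: w0)
      also have "(\<Sum>i=k*K..<k*K+m+1. of_real d * w i / (Q i * Q (Suc i))) = (\<Sum>i\<le>m. of_real d * w (k * K + i) / (Q (k * K + i) * Q (Suc (k * K + i))))"
        by (rule sum.reindex_bij_witness[of _ "\<lambda>i. k * K + i" "\<lambda>i. i - k * K"]) auto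
      finally show ?thesis by simp
    qed
    finally have eq: "Q' (k * K + m + 1) / Q (k * K + m + 1) - 1 = (\<Sum>i\<le>m. - (of_real d * w (k * K + i) / (Q (k * K + i) * Q (Suc (k * K + i)))))"
      by (simp add: sum_negf)
    show ?thesis unfolding eq
    proof (rule near_sum)
      fix i assume i: "i \<in> {..m}"
      have i1: "k * K + i \<le> (k + 1) * K" "Suc (k * K + i) \<le> (k + 1) * K" "i \<le> K" using i m by (auto simp: algebra_simps)
      have 1: "near (21/1000) (Q (k * K + i) * Q (Suc (k * K + i))) 1"
        using near_mult[OF q[OF i1(1)] q[OF i1(2)]] by (auto intro: near_mono)
      have "near (((21/1000) + (21/1000)) / (1 - 21/1000)) (w (k * K + i) / (Q (k * K + i) * Q (Suc (k * K + i)))) (h * of_real (real i))"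
        by (rule near_div[OF wm[OF i1(3)] 1]) auto
      hence "near (43/1000) (w (k * K + i) / (Q (k * K + i) * Q (Suc (k * K + i)))) (h * of_real (real i))"
        by (rule near_mono) simp
      from near_mult[of 0 "- of_real d" "- of_real d", OF _ this]
      show "near (43/1000) (- (of_real d * w (k * K + i) / (Q (k * K + i) * Q (Suc (k * K + i))))) ((- of_real d * h) * of_real (real i))"
        by (simp add: near_def mult.assoc)
    qed simp
  qed
  have dS: "near (8/100) (Sk Q' d K k - Sk Q d K k) ((- 2 * (of_real d)\<^sup>2 * h) * of_real (\<Sum>m<K. \<Sum>i\<le>m. real i))"
  proof -
    have "Sk Q' d K k - Sk Q d K k = (\<Sum>m<K. of_real d * ((Q' (k * K + m + 1))\<^sup>2 - (Q (k * K + m + 1))\<^sup>2))"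
      by (simp add: Sk_def sum_subtractf right_diff_distrib)
    also have "near (8/100) \<dots> ((- 2 * (of_real d)\<^sup>2 * h) * of_real (\<Sum>m<K. \<Sum>i\<le>m. real i))"
    proof (rule near_sum)
      fix m assume "m \<in> {..<K}"
      hence m: "m < K" by simp
      define j where "j = k * K + m + 1"
      have j: "j \<le> (k + 1) * K" using m by (simp add: j_def algebra_simps)
      define \<rho> where "\<rho> = Q' j / Q j"
      have \<rho>1: "near (43/1000) (\<rho> - 1) ((- of_real d * h) * of_real (\<Sum>i\<le>m. real i))"
        using ratio[OF m] by (simp add: \<rho>_def j_def)
      have "near (((1/100) + (1/100)) / (1 - 1/100)) \<rho> 1"
        unfolding \<rho>_def by (rule near_div[OF q'[OF j] q[OF j]]) auto
      hence "near (21/1000) \<rho> 1" by (rule near_mono) simp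
      hence \<rho>2: "near (11/1000) (\<rho> + 1) 2" by (simp add: near_def)
      have e: "of_real d * ((Q' j)\<^sup>2 - (Q j)\<^sup>2) = of_real d * ((\<rho> - 1) * (\<rho> + 1) * (Q j * Q j))"
        using qnz[OF j] by (simp add: \<rho>_def field_simps power2_eq_square)
      have a: "near (55/1000) ((\<rho> - 1) * (\<rho> + 1)) (((- of_real d * h) * of_real (\<Sum>i\<le>m. real i)) * 2)"
        by (rule near_mono[OF near_mult[OF \<rho>1 \<rho>2]]) auto
      have b: "near (21/1000) (Q j * Q j) (1 * 1)" by (rule near_mono[OF near_mult[OF q[OF j] q[OF j]]]) auto
      have "near (8/100) ((\<rho> - 1) * (\<rho> + 1) * (Q j * Q j)) (((- of_real d * h) * of_real (\<Sum>i\<le>m. real i)) * 2 * (1 * 1))"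
        by (rule near_mono[OF near_mult[OF a b]]) auto
      from near_mult[of 0 "of_real d" "of_real d", OF _ this]
      have "near (8/100) (of_real d * ((\<rho> - 1) * (\<rho> + 1) * (Q j * Q j))) (of_real d * (((- of_real d * h) * of_real (\<Sum>i\<le>m. real i)) * 2 * (1 * 1)))"
        by (simp add: near_def)
      moreover have "of_real d * (((- of_real d * h) * of_real (\<Sum>i\<le>m. real i)) * 2 * (1 * 1)) = (- 2 * (of_real d)\<^sup>2 * h) * of_real (\<Sum>i\<le>m. real i)"
        by (simp add: power2_eq_square)
      ultimately show "near (8/100) (of_real d * ((Q' (k * K + m + 1))\<^sup>2 - (Q (k * K + m + 1))\<^sup>2)) ((- 2 * (of_real d)\<^sup>2 * h) * of_real (\<Sum>i\<le>m. real i))"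
        unfolding e[unfolded j_def, folded j_def] j_def[symmetric] by (simp only: e)
    qed (simp add: sum_nonneg)
    finally show ?thesis .
  qed
  have S0: "near (21/1000) (Sk Q d K 0) (of_real d * of_real (\<Sum>m<K. 1))"
    unfolding Sk_def
  proof (rule near_sum)
    fix m assume "m \<in> {..<K}"
    hence "0 * K + m + 1 \<le> (k + 1) * K" by (simp add: algebra_simps)
    from near_mult[OF q[OF this] q[OF this]]
    have "near (21/1000) ((Q (0 * K + m + 1))\<^sup>2) 1" by (auto simp: power2_eq_square intro: near_mono)
    from near_mult[of 0 "of_real d" "of_real d", OF _ this]
    show "near (21/1000) (of_real d * (Q (0 * K + m + 1))\<^sup>2) (of_real d * of_real 1)" by (simp add: near_def)
  qed simp
  hence S0: "near (21/1000) (cnj (Sk Q d K 0)) (of_real (real K * d))"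
    using near_cnj[OF S0] by (simp add: mult.commute)
  \<comment> \<open>The leading term, purely imaginary. The relative errors accumulated from the
    initial 1/100 amount to at most 11/100, so half of \<open>Y\<close> certainly survives.\<close>
  define Y where "Y = of_real (real K * d) * ((- 2 * (of_real d)\<^sup>2 * h) * of_real (\<Sum>m<K. \<Sum>i\<le>m. real i))"
  have nY: "near (1/10 + 1/100) (cnj (Sk Q d K 0) * (Sk Q' d K k - Sk Q d K k)) Y"
    unfolding Y_def by (rule near_mono[OF near_mult[OF S0 dS]]) auto
  have Yr: "Y = \<i> * of_real (- 2 * c * D * (real K * d) * d ^ 3 * (\<Sum>m<K. \<Sum>i\<le>m. real i))"
    unfolding Y_def h_def by (simp add: power2_eq_square power3_eq_cube mult_ac)
  have ImY: "Im Y = - 2 * c * D * (real K * d) * d ^ 3 * (\<Sum>m<K. \<Sum>i\<le>m. real i)"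
    unfolding Yr by (simp only: Im_i_times Re_complex_of_real)
  have absY: "norm Y = \<bar>Im Y\<bar>" unfolding ImY unfolding Yr
    by (simp only: norm_mult norm_ii norm_of_real mult_1)
  have "\<bar>Im (cnj (Sk Q d K 0) * (Sk Q' d K k - Sk Q d K k)) - Im Y\<bar> \<le> (1/10 + 1/100) * norm Y"
    using nY abs_Im_le_cmod[of "cnj (Sk Q d K 0) * (Sk Q' d K k - Sk Q d K k) - Y"] by (simp add: near_def)
  hence 1: "\<bar>Im (cnj (Sk Q d K 0) * (Sk Q' d K k - Sk Q d K k))\<bar> \<ge> norm Y / 2"
    using absY by (rule half_abs)
  have "norm Y = 2 * c * \<bar>D\<bar> * (real K * d) * d ^ 3 * (\<Sum>m<K. \<Sum>i\<le>m. real i)"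
    unfolding absY ImY using c d by (simp add: abs_mult sum_nonneg)
  also have "\<dots> \<ge> 2 * c * \<bar>D\<bar> * (real K * d) * d ^ 3 * (real K ^ 3 / 12)"
    using c d double_sum_lower[OF K] by (intro mult_left_mono) auto
  also have "2 * c * \<bar>D\<bar> * (real K * d) * d ^ 3 * (real K ^ 3 / 12) = 2 * (c * \<bar>D\<bar> * (real K * d) ^ 4 / 12)"
    by (simp add: power_mult_distrib power3_eq_cube power4_eq_xxxx mult_ac)
  finally have "norm Y / 2 \<ge> c * \<bar>D\<bar> * (real K * d) ^ 4 / 12" by simp
  thus ?thesis using 1 unfolding Q_def Q'_def by linarith
qed

lemma PiM_component_measurable [measurable (raw)]:
  "(\<lambda>x. x i) \<in> borel_measurable (PiM I (\<lambda>_. borel :: real measure))"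
proof (cases "i \<in> I")
  case False
  hence "(\<lambda>x. x i) \<in> borel_measurable (PiM I (\<lambda>_. borel :: real measure)) \<longleftrightarrow> (\<lambda>x. undefined :: real) \<in> borel_measurable (PiM I (\<lambda>_. borel :: real measure))"
    by (intro measurable_cong) (auto simp: space_PiM)
  thus ?thesis by simp
qed simp

lemma Complex_measurable [measurable (raw)]:
  "f \<in> borel_measurable M \<Longrightarrow> g \<in> borel_measurable M \<Longrightarrow> (\<lambda>x. Complex (f x) (g x)) \<in> borel_measurable M"
  by (simp add: borel_measurable_complex_iff)

lemma cnj_measurable [measurable (raw)]:
  "f \<in> borel_measurable M \<Longrightarrow> (\<lambda>x. cnj (f x)) \<in> borel_measurable M"
  by (simp add: borel_measurable_complex_iff)

section \<open>Probability that no piece oscillates\<close>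

text \<open>Confinement of one component of the noise, the condition under which all deterministic
  estimates hold. By \<open>Gam_maximal\<close> it fails with exponentially small probability over
  short times.\<close>

definition cx :: "real \<Rightarrow> (nat \<Rightarrow> real) \<Rightarrow> nat \<Rightarrow> bool" where
  "cx c x J \<longleftrightarrow> (\<forall>j\<le>J. \<bar>c * (\<Sum>i<j. x i)\<bar> \<le> 1)"

lemma cx_mono: "cx c x J \<Longrightarrow> J' \<le> J \<Longrightarrow> cx c x J'"
  by (auto simp: cx_def)

lemma nz_bound: "cx s e J \<Longrightarrow> cx c x J \<Longrightarrow> j \<le> J \<Longrightarrow> norm (nz s c e x j) \<le> 2"
  using cmod_le[of "nz s c e x j"] by (fastforce simp: cx_def nz_def)

text \<open>\<open>scheme_control\<close> with noise bound \<open>B = 2\<close>, which makes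
  \<open>D = R + 5\<close>.\<close>

lemma q_near:
  assumes d: "d > 0" and z: "norm z \<le> R" and ctrl: "cx s e J" "cx c x J" and t: "real J * d * (R + 5) \<le> 1/100" and j: "j \<le> J"
  shows "near (1/100) (sq d (nz s c e x) z j) 1" "norm (sp d (nz s c e x) z j) \<le> R + 5"
proof -
  have R0: "R \<ge> 0" using z norm_ge_zero[of z] by linarith
  have "norm (sv d (nz s c e x) z j - z) \<le> real j * d * 2 * (R + 5) \<and> norm (sq d (nz s c e x) z j - 1) \<le> real j * d * (R + 5)
     \<and> norm (sp d (nz s c e x) z j) \<le> R + 5"
    by (rule scheme_control[where L = J and R = R and \<theta> = "1/100"]) (use assms nz_bound[OF ctrl] in auto)
  moreover have "real j * d * (R + 5) \<le> real J * d * (R + 5)" using j d R0 by (intro mult_right_mono) auto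
  ultimately show "near (1/100) (sq d (nz s c e x) z j) 1" "norm (sp d (nz s c e x) z j) \<le> R + 5"
    using t by (auto simp: near_def)
qed

text \<open>\<open>Im (cnj S_0 * S_k)\<close> tests whether the integrals over pieces 0 and
  \<open>k\<close> are nearly parallel, without a division. Confinement is imposed only up to the
  end of piece \<open>k\<close>, so that the event is determined by the increments up to
  there.\<close>

definition nonosc :: "real \<Rightarrow> real \<Rightarrow> (nat \<Rightarrow> real) \<Rightarrow> real \<Rightarrow> complex \<Rightarrow> nat \<Rightarrow> real \<Rightarrow> nat \<Rightarrow> (nat \<Rightarrow> real) \<Rightarrow> bool" where
  "nonosc s c e d z K \<beta> k x \<longleftrightarrow> cx c x ((k + 1) * K) \<and>
     \<bar>Im (cnj (Sk (sq d (nz s c e x) z) d K 0) * Sk (sq d (nz s c e x) z) d K k)\<bar> \<le> \<beta>"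

lemma nz_cong: "(\<And>i. i < j \<Longrightarrow> x i = y i) \<Longrightarrow> nz s c e x j = nz s c e y j"
  by (auto simp: nz_def intro!: sum.cong arg_cong2[where f = Complex] arg_cong2[where f = "(*)"])

lemma Sk_cong:
  assumes "\<And>i. i < (k + 1) * K \<Longrightarrow> x i = y i"
  shows "Sk (sq d (nz s c e x) z) d K k = Sk (sq d (nz s c e y) z) d K k"
proof -
  have "sq d (nz s c e x) z (k * K + m + 1) = sq d (nz s c e y) z (k * K + m + 1)" if "m < K" for m
    using that assms by (intro sq_cong nz_cong) (auto simp: algebra_simps)
  thus ?thesis by (simp add: Sk_def)
qed

lemma cx_cong: "(\<And>i. i < J \<Longrightarrow> x i = y i) \<Longrightarrow> cx c x J = cx c y J"
proof -
  assume *: "\<And>i. i < J \<Longrightarrow> x i = y i"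
  have "(\<Sum>i<j. x i) = (\<Sum>i<j. y i)" if "j \<le> J" for j using * that by (intro sum.cong) auto
  thus ?thesis by (simp add: cx_def)
qed

lemma nonosc_cong:
  assumes k: "k \<ge> 1" and *: "\<And>i. i < (k + 1) * K \<Longrightarrow> x i = y i"
  shows "nonosc s c e d z K \<beta> k x = nonosc s c e d z K \<beta> k y"
proof -
  have "x i = y i" if "i < (0 + 1) * K" for i using that k by (intro *) (auto intro: less_le_trans)
  from Sk_cong[OF this] Sk_cong[OF *] cx_cong[OF *] show ?thesis by (simp add: nonosc_def)
qed

lemma nz_measurable [measurable (raw)]:
  assumes "\<And>i. (\<lambda>w. e w i) \<in> borel_measurable M" "\<And>i. (\<lambda>w. x w i) \<in> borel_measurable M"
  shows "(\<lambda>w. nz s c (e w) (x w) j) \<in> borel_measurable M"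
  unfolding nz_def using assms by measurable

lemma sq_nz_measurable:
  assumes "\<And>i. (\<lambda>w. e w i) \<in> borel_measurable M" "\<And>i. (\<lambda>w. x w i) \<in> borel_measurable M"
  shows "(\<lambda>w. sq d (nz s c (e w) (x w)) z j) \<in> borel_measurable M"
  using sv_sq_measurable[where N = "\<lambda>w. nz s c (e w) (x w)" and z = "\<lambda>_. z" and M = M and j = j and d = d] nz_measurable[OF assms] by auto

lemma Sk_measurable:
  assumes "\<And>i. (\<lambda>w. e w i) \<in> borel_measurable M" "\<And>i. (\<lambda>w. x w i) \<in> borel_measurable M"
  shows "(\<lambda>w. Sk (sq d (nz s c (e w) (x w)) z) d K k) \<in> borel_measurable M"
  unfolding Sk_def using sq_nz_measurable[OF assms] by measurable

lemma cx_measurable [measurable (raw)]: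
  assumes "\<And>i. (\<lambda>w. x w i) \<in> borel_measurable M"
  shows "Measurable.pred M (\<lambda>w. cx c (x w) J)"
  unfolding cx_def using assms by measurable

lemma nonosc_measurable:
  assumes "\<And>i. (\<lambda>w. x w i) \<in> borel_measurable M"
  shows "Measurable.pred M (\<lambda>w. nonosc s c e d z K \<beta> k (x w))"
proof -
  define S where "S = (\<lambda>k w. Sk (sq d (nz s c e (x w)) z) d K k)"
  have [measurable]: "S k \<in> borel_measurable M" for k
    unfolding S_def using Sk_measurable[where e = "\<lambda>_. e" and x = x and M = M] assms by auto
  have "Measurable.pred M (\<lambda>w. \<bar>Im (cnj (S 0 w) * S k w)\<bar> \<le> \<beta>)" by measurable
  thus ?thesis unfolding nonosc_def S_def using cx_measurable[OF assms, of c] by measurable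
qed

definition pu :: "nat \<Rightarrow> nat \<Rightarrow> real \<Rightarrow> nat \<Rightarrow> real" where
  "pu K k v i = (if i div K = k then v else 0)"

lemma div_piece: "K > 0 \<Longrightarrow> i div K = k \<longleftrightarrow> k * K \<le> i \<and> i < (k + 1) * (K::nat)"
proof
  assume "K > 0" "i div K = k"
  thus "k * K \<le> i \<and> i < (k + 1) * K"
    using div_times_less_eq_dividend[of i K] dividend_less_div_times[of K i] by auto
next
  assume "k * K \<le> i \<and> i < (k + 1) * K"
  hence "K * k \<le> i" "i < K * Suc k" by (simp_all add: algebra_simps)
  thus "i div K = k" by (rule div_nat_eqI)
qed

lemma sum_piece:
  fixes f :: "nat \<Rightarrow> 'a::comm_monoid_add"
  assumes K: "K > 0" and k: "k \<le> n"
  shows "(\<Sum>i<(n + 1) * K. if i div K = k then f i else 0) = (\<Sum>i=k*K..<(k+1)*K. f i)"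
proof -
  have "(k + 1) * K \<le> (n + 1) * K" using k by (intro mult_le_mono) auto
  hence "{i \<in> {..<(n + 1) * K}. i div K = k} = {k*K..<(k+1)*K}"
    unfolding div_piece[OF K] by (auto intro: less_le_trans simp del: mult_Suc)
  thus ?thesis by (simp add: sum.If_cases Int_def)
qed

text \<open>A shift by \<open>d * u\<close> per step is a drift \<open>u\<close> over the piece. The
  weight sees the path only through its increment over that piece, which confinement bounds.\<close>

lemma cmw_piece:
  assumes d: "d > 0" and K: "K > 0" and k: "k \<le> n"
  shows "cmw d ((n + 1) * K) (pu K k (d * u)) x = exp (- (u * (\<Sum>i=k*K..<(k+1)*K. x i) + u\<^sup>2 * (real K * d) / 2))"
proof -
  have "(\<Sum>j<(n + 1) * K. pu K k (d * u) j * x j / d + (pu K k (d * u) j)\<^sup>2 / (2 * d))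
    = (\<Sum>j<(n + 1) * K. if j div K = k then u * x j + u\<^sup>2 * d / 2 else 0)"
    using d by (intro sum.cong) (auto simp: pu_def power2_eq_square)
  also have "\<dots> = (\<Sum>i=k*K..<(k+1)*K. u * x i + u\<^sup>2 * d / 2)" by (rule sum_piece[OF K k])
  also have "\<dots> = u * (\<Sum>i=k*K..<(k+1)*K. x i) + u\<^sup>2 * (real K * d) / 2"
    by (simp add: sum.distrib sum_distrib_left)
  finally show ?thesis by (simp add: cmw_def)
qed

lemma sum_diff_nat_ivl: "a \<le> b \<Longrightarrow> (\<Sum>i=a..<b. x i) = (\<Sum>i<b. x i) - (\<Sum>i<a. x i)" for x :: "nat \<Rightarrow> real"
  by (metis atLeast0LessThan sum_diff_nat_ivl zero_le)

text \<open>All increments are frozen and only the drift \<open>u\<close> in piece \<open>k\<close>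
  varies. By \<open>S_separation\<close> any two values of \<open>u\<close> without oscillation are
  closer than \<open>24 * \<beta> / (c * l^4)\<close>, so they fill a short interval, and on it the
  weight is bounded by \<open>exp (2 / c + 1)\<close>.\<close>

lemma bad_step:
  fixes e :: "nat \<Rightarrow> real"
  assumes d: "d > 0" and K: "K \<ge> 2" and c: "c > 0" and z: "norm z \<le> R"
    and t: "real ((n + 1) * K) * d * (R + 5) \<le> 1/100" and l1: "real K * d \<le> 1"
    and ce: "cx s e ((n + 1) * K)" and k: "1 \<le> k" "k \<le> n" and \<beta>: "\<beta> \<ge> 0"
  defines "\<epsilon> \<equiv> exp (2 / c + 1) * (24 * \<beta> / (c * (real K * d) ^ 4))"
  defines "L \<equiv> (n + 1) * K"
  shows "(\<integral>\<^sup>+u. ennreal (1/2) * indicator {-1..1} u * (ennreal (cmw d L (pu K k (d * u)) x) * 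
       (if nonosc s c e d z K \<beta> k (shiftv (pu K k (d * u)) L x) then 1 else 0)) \<partial>lborel) \<le> ennreal \<epsilon>"
proof -
  have K0: "K > 0" using K by simp
  let ?h = "\<lambda>u. ennreal (1/2) * indicator {-1..1} u * (ennreal (cmw d L (pu K k (d * u)) x) * 
       (if nonosc s c e d z K \<beta> k (shiftv (pu K k (d * u)) L x) then 1 else 0))"
  define l where "l = real K * d"
  have l: "l > 0" using d K0 by (simp add: l_def)
  have kL: "(k + 1) * K \<le> L" unfolding L_def using k by (intro mult_le_mono) auto
  have R0: "R \<ge> 0" using z norm_ge_zero[of z] by linarith
  define y where "y = (\<lambda>u. shiftv (pu K k (d * u)) L x)"
  have yi: "y u i = x i + pu K k (d * u) i" if "i < L" for u i using that by (simp add: y_def shiftv_def)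
  define U where "U = {u \<in> {-1..1}. nonosc s c e d z K \<beta> k (y u)}"
  \<comment> \<open>Solved from \<open>c * |u' - u| * l^4 / 12 <= 2 * \<beta>\<close>, where each of
    the two values of \<open>u\<close> contributes one \<open>\<beta>\<close>.\<close>
  define Dm where "Dm = 24 * \<beta> / (c * l ^ 4)"
  have Dm0: "Dm \<ge> 0" using \<beta> c l by (simp add: Dm_def)
  have diam: "\<bar>u' - u\<bar> \<le> Dm" if u: "u \<in> U" "u' \<in> U" for u u'
  proof -
    have A: "nonosc s c e d z K \<beta> k (y u)" "nonosc s c e d z K \<beta> k (y u')" using u by (auto simp: U_def)
    have t': "real ((k + 1) * K) * d * (R + 5) \<le> 1/100"
      using t kL d R0 by (intro order_trans[OF _ t] mult_right_mono) (auto simp: L_def simp del: of_nat_mult)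
    have ce': "cx s e ((k + 1) * K)" by (rule cx_mono[OF ce kL[unfolded L_def]])
    have qn: "near (1/100) (sq d (nz s c e (y v)) z j) 1" if "nonosc s c e d z K \<beta> k (y v)" "j \<le> (k + 1) * K" for v j
      using that by (intro q_near(1)[OF d z ce' _ t']) (auto simp: nonosc_def)
    define S0 where "S0 = Sk (sq d (nz s c e (y u)) z) d K 0"
    have S0': "Sk (sq d (nz s c e (y u')) z) d K 0 = S0"
      unfolding S0_def
    proof (rule Sk_cong)
      fix i assume "i < (0 + 1) * K"
      hence "i < K" "i < L" "i div K \<noteq> k" using k kL K0 by (auto intro: less_le_trans)
      thus "y u' i = y u i" by (simp add: yi pu_def)
    qed
    define S where "S = (\<lambda>v. Sk (sq d (nz s c e (y v)) z) d K k)"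
    have "c * \<bar>u' - u\<bar> * l ^ 4 / 12 \<le> \<bar>Im (cnj S0 * (S u' - S u))\<bar>"
      unfolding S0_def S_def l_def
    proof (rule S_separation[OF d K k(1) c])
      fix i assume i: "i < (k + 1) * K"
      show "y u' i = (if i < k * K then y u i else y u i + d * (u' - u))"
        using i kL div_piece[OF K0, of i k] by (auto simp: yi pu_def algebra_simps)
    qed (use qn A in auto)
    also have "\<dots> \<le> \<bar>Im (cnj S0 * S u')\<bar> + \<bar>Im (cnj S0 * S u)\<bar>" by (simp add: right_diff_distrib)
    also have "\<dots> \<le> 2 * \<beta>" using A S0' unfolding nonosc_def S_def S0_def by simp
    finally show ?thesis using c l by (simp add: Dm_def field_simps)
  qed
  \<comment> \<open>Confinement of the shifted path bounds its increment over the piece by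
    \<open>2 / c\<close>; returning to the unshifted path changes the increment by
    \<open>|u| * l <= 1\<close>.\<close>
  have cm: "cmw d L (pu K k (d * u)) x \<le> exp (2 / c + 1)" if u: "u \<in> U" for u
  proof -
    define G where "G = (\<Sum>i=k*K..<(k+1)*K. x i)"
    have u1: "\<bar>u\<bar> \<le> 1" using u by (auto simp: U_def)
    have "cx c (y u) ((k + 1) * K)" using u by (auto simp: U_def nonosc_def)
    hence b: "\<bar>c * (\<Sum>i<(k+1)*K. y u i)\<bar> \<le> 1" "\<bar>c * (\<Sum>i<k*K. y u i)\<bar> \<le> 1"
      by (auto simp: cx_def)
    have "(\<Sum>i=k*K..<(k+1)*K. y u i) = (\<Sum>i=k*K..<(k+1)*K. x i + d * u)"
      using kL div_piece[OF K0, of _ k] by (intro sum.cong) (auto simp: yi pu_def)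
    also have "\<dots> = G + u * l" by (simp add: G_def sum.distrib l_def)
    finally have Gy: "G + u * l = (\<Sum>i<(k+1)*K. y u i) - (\<Sum>i<k*K. y u i)"
      by (simp add: sum_diff_nat_ivl)
    have "c * \<bar>G + u * l\<bar> = \<bar>c * (\<Sum>i<(k+1)*K. y u i) - c * (\<Sum>i<k*K. y u i)\<bar>"
      unfolding Gy using c by (simp add: abs_mult right_diff_distrib[symmetric])
    also have "\<dots> \<le> 2" using b by linarith
    finally have "\<bar>G + u * l\<bar> \<le> 2 / c" using c by (simp add: field_simps)
    moreover have "\<bar>u * l\<bar> \<le> 1 * 1" unfolding abs_mult using u1 l l1 by (intro mult_mono) (auto simp: l_def)
    ultimately have G: "\<bar>G\<bar> \<le> 2 / c + 1" by linarith
    have "\<bar>u * G\<bar> \<le> 1 * (2 / c + 1)" unfolding abs_mult using u1 G by (intro mult_mono) auto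
    hence "- (u * G + u\<^sup>2 * l / 2) \<le> 2 / c + 1" using l by (smt (verit) divide_nonneg_pos mult_nonneg_nonneg zero_le_power2)
    thus ?thesis unfolding L_def cmw_piece[OF d K0 k(2)] by (simp add: G_def l_def)
  qed
  show ?thesis
  proof (cases "U = {}")
    case True
    hence "(\<integral>\<^sup>+u. ?h u \<partial>lborel) = (\<integral>\<^sup>+(u::real). 0 \<partial>lborel)"
      by (intro nn_integral_cong) (auto simp: U_def y_def indicator_def)
    thus ?thesis by simp
  next
    case False
    then obtain u0 where u0: "u0 \<in> U" by blast
    have "(\<integral>\<^sup>+u. ?h u \<partial>lborel)
       \<le> (\<integral>\<^sup>+u. ennreal (exp (2 / c + 1) / 2) * indicator {u0 - Dm..u0 + Dm} u \<partial>lborel)"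
    proof (rule nn_integral_mono)
      fix u :: real
      show "?h u \<le> ennreal (exp (2 / c + 1) / 2) * indicator {u0 - Dm..u0 + Dm} u"
      proof (cases "u \<in> U")
        case True
        have "u \<in> {u0 - Dm..u0 + Dm}" using diam[OF u0 True] by auto
        moreover have "ennreal (1/2) * ennreal (cmw d L (pu K k (d * u)) x) \<le> ennreal (exp (2 / c + 1) / 2)"
          using cm[OF True] by (subst ennreal_mult[symmetric]) (auto intro!: ennreal_leI simp: less_imp_le[OF cmw_pos])
        ultimately show ?thesis using True by (auto simp: U_def y_def)
      next
        case False
        thus ?thesis by (auto simp: U_def y_def indicator_def)
      qed
    qed
    also have "\<dots> = ennreal (exp (2 / c + 1) / 2) * ennreal (2 * Dm)"
      using Dm0 by (subst nn_integral_cmult_indicator) auto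
    also have "\<dots> = ennreal (exp (2 / c + 1) / 2 * (2 * Dm))"
      using Dm0 by (intro ennreal_mult[symmetric]) auto
    also have "exp (2 / c + 1) / 2 * (2 * Dm) = \<epsilon>" by (simp add: \<epsilon>_def Dm_def l_def)
    finally show ?thesis .
  qed
qed

text \<open>The events of pieces up to \<open>m\<close> depend on earlier increments only and do not
  feel a shift in piece \<open>m + 1\<close>. Averaging the Cameron-Martin identity over that shift
  and applying \<open>bad_step\<close> inside the integral yields one more factor
  \<open>\<epsilon>\<close>; this takes the place of conditioning on the past. Piece 0 is the
  reference direction and gives no factor.\<close>

lemma bad_prob:
  fixes e :: "nat \<Rightarrow> real"
  assumes d: "d > 0" and K: "K \<ge> 2" and c: "c > 0" and z: "norm z \<le> R"
    and t: "real ((n + 1) * K) * d * (R + 5) \<le> 1/100" and l1: "real K * d \<le> 1"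
    and ce: "cx s e ((n + 1) * K)" and \<beta>: "\<beta> \<ge> 0" and m: "m \<le> n"
  defines "\<epsilon> \<equiv> exp (2 / c + 1) * (24 * \<beta> / (c * (real K * d) ^ 4))"
  defines "L \<equiv> (n + 1) * K"
  shows "(\<integral>\<^sup>+x. (if \<forall>k\<in>{1..m}. nonosc s c e d z K \<beta> k x then 1 else 0) \<partial>Gam d L) \<le> ennreal (\<epsilon> ^ m)"
  using m
proof (induction m)
  case 0
  thus ?case using prob_space.emeasure_space_1[OF prob_space_Gam[OF d]] by simp
next
  case (Suc m)
  have K0: "K > 0" using K by simp
  have e0: "\<epsilon> \<ge> 0" using \<beta> c d by (simp add: \<epsilon>_def)
  define k where "k = Suc m"
  have k: "1 \<le> k" "k \<le> n" using Suc.prems by (auto simp: k_def)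
  define f :: "(nat \<Rightarrow> real) \<Rightarrow> ennreal" where "f = (\<lambda>x. if \<forall>k\<in>{1..m}. nonosc s c e d z K \<beta> k x then 1 else 0)"
  define g :: "(nat \<Rightarrow> real) \<Rightarrow> ennreal" where "g = (\<lambda>x. if nonosc s c e d z K \<beta> k x then 1 else 0)"
  have Am [measurable]: "Measurable.pred (RL L) (nonosc s c e d z K \<beta> k)" for k
    using nonosc_measurable[of "\<lambda>x. x" "RL L"] by measurable
  have fm [measurable]: "f \<in> borel_measurable (RL L)" unfolding f_def by measurable
  have gm [measurable]: "g \<in> borel_measurable (RL L)" unfolding g_def by measurable
  define a where "a = (\<lambda>u. pu K k (d * u))"
  have shm [measurable]: "(\<lambda>p. shiftv (a (fst p)) L (snd p)) \<in> measurable (borel \<Otimes>\<^sub>M RL L) (RL L)"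
    unfolding shiftv_def a_def pu_def by measurable
  have cmm [measurable]: "(\<lambda>p. cmw d L (a (fst p)) (snd p)) \<in> borel_measurable (borel \<Otimes>\<^sub>M RL L)"
    unfolding cmw_def a_def pu_def by measurable
  interpret GP: prob_space "Gam d L" by (rule prob_space_Gam[OF d])
  interpret P: pair_sigma_finite "lborel :: real measure" "Gam d L" ..
  define I where "I = (\<integral>\<^sup>+x. f x * g x \<partial>Gam d L)"
  let ?F = "\<lambda>u x. ennreal (1/2) * indicator {-1..1} u * (ennreal (cmw d L (a u) x) * (f x * g (shiftv (a u) L x)))"
  have fsh: "f (shiftv (a u) L x) = f x" for u x
  proof -
    have "nonosc s c e d z K \<beta> j (shiftv (a u) L x) = nonosc s c e d z K \<beta> j x" if j: "j \<in> {1..m}" for j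
    proof (rule nonosc_cong)
      fix i assume i: "i < (j + 1) * K"
      have "(j + 1) * K \<le> k * K" using j by (intro mult_le_mono) (auto simp: k_def)
      moreover have "k * K \<le> L" unfolding L_def using k by (intro mult_le_mono) auto
      ultimately have "i < k * K" "i < L" using i by auto
      thus "shiftv (a u) L x i = x i" using div_piece[OF K0, of i k] by (auto simp: shiftv_def a_def pu_def)
    qed (use j in auto)
    thus ?thesis by (simp add: f_def)
  qed
  have Iu: "I = (\<integral>\<^sup>+x. ennreal (cmw d L (a u) x) * (f x * g (shiftv (a u) L x)) \<partial>Gam d L)" for u
    unfolding I_def by (subst Gam_nn_shift[OF d, where a = "a u"]) (auto simp: fsh)
  have h: "(\<integral>\<^sup>+(u::real). ennreal (1/2) * indicator {-1..1} u \<partial>lborel) = 1"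
  proof -
    have "ennreal (1/2) * ennreal 2 = 1" by (subst ennreal_mult[symmetric]) auto
    thus ?thesis by (subst nn_integral_cmult_indicator) auto
  qed
  have "I = (\<integral>\<^sup>+(u::real). ennreal (1/2) * indicator {-1..1} u \<partial>lborel) * I" by (simp only: h mult_1)
  also have "\<dots> = (\<integral>\<^sup>+(u::real). ennreal (1/2) * indicator {-1..1} u * I \<partial>lborel)" by (rule nn_integral_multc[symmetric]) measurable
  also have "\<dots> = (\<integral>\<^sup>+u. (\<integral>\<^sup>+x. ?F u x \<partial>Gam d L) \<partial>lborel)"
  proof (rule nn_integral_cong)
    fix u :: real
    have "(\<integral>\<^sup>+x. ?F u x \<partial>Gam d L)
      = ennreal (1/2) * indicator {-1..1} u * (\<integral>\<^sup>+x. ennreal (cmw d L (a u) x) * (f x * g (shiftv (a u) L x)) \<partial>Gam d L)"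
      by (rule nn_integral_cmult) measurable
    thus "ennreal (1/2) * indicator {-1..1} u * I = (\<integral>\<^sup>+x. ?F u x \<partial>Gam d L)"
      by (simp only: Iu[of u])
  qed
  also have "\<dots> = (\<integral>\<^sup>+x. (\<integral>\<^sup>+u. ?F u x \<partial>lborel) \<partial>Gam d L)"
    by (rule P.Fubini'[symmetric]) measurable
  also have "\<dots> \<le> (\<integral>\<^sup>+x. f x * ennreal \<epsilon> \<partial>Gam d L)"
  proof (rule nn_integral_mono)
    fix x assume x: "x \<in> space (Gam d L)"
    have [measurable]: "(\<lambda>u. cmw d L (a u) x) \<in> borel_measurable borel" "(\<lambda>u. g (shiftv (a u) L x)) \<in> borel_measurable borel"
    proof -
      have p: "(\<lambda>u. (u, x)) \<in> measurable borel (borel \<Otimes>\<^sub>M RL L)"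
        using x by (intro measurable_Pair) (auto simp: space_Gam space_PiM)
      show "(\<lambda>u. cmw d L (a u) x) \<in> borel_measurable borel" using measurable_compose[OF p cmm] by simp
      show "(\<lambda>u. g (shiftv (a u) L x)) \<in> borel_measurable borel" using measurable_compose[OF measurable_compose[OF p shm] gm] by simp
    qed
    have "(\<integral>\<^sup>+u. ?F u x \<partial>lborel)
      = (\<integral>\<^sup>+u. f x * (ennreal (1/2) * indicator {-1..1} u * (ennreal (cmw d L (a u) x) * g (shiftv (a u) L x))) \<partial>lborel)"
      by (intro nn_integral_cong) (simp add: mult_ac)
    also have "\<dots> = f x * (\<integral>\<^sup>+u. ennreal (1/2) * indicator {-1..1} u * (ennreal (cmw d L (a u) x) * g (shiftv (a u) L x)) \<partial>lborel)"
      by (rule nn_integral_cmult) measurable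
    also have "\<dots> \<le> f x * ennreal \<epsilon>"
      unfolding a_def g_def L_def \<epsilon>_def by (intro mult_left_mono bad_step[OF d K c z t l1 ce k \<beta>]) auto
    finally show "(\<integral>\<^sup>+u. ?F u x \<partial>lborel) \<le> f x * ennreal \<epsilon>" .
  qed
  also have "\<dots> = (\<integral>\<^sup>+x. f x \<partial>Gam d L) * ennreal \<epsilon>" by (rule nn_integral_multc) simp
  also have "\<dots> \<le> ennreal (\<epsilon> ^ m) * ennreal \<epsilon>"
    using Suc by (intro mult_right_mono) (auto simp: f_def)
  also have "\<dots> = ennreal (\<epsilon> ^ Suc m)" using e0 by (simp add: ennreal_mult[symmetric] mult.commute)
  finally have "I \<le> ennreal (\<epsilon> ^ Suc m)" .
  moreover have "I = (\<integral>\<^sup>+x. (if \<forall>k\<in>{1..Suc m}. nonosc s c e d z K \<beta> k x then 1 else 0) \<partial>Gam d L)"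
    unfolding I_def f_def g_def k_def by (intro nn_integral_cong) (auto simp: atLeastAtMostSuc_conv)
  ultimately show ?case by simp
qed

section \<open>Fourier decay for the scheme\<close>

definition hs :: "real \<Rightarrow> nat \<Rightarrow> (nat \<Rightarrow> complex) \<Rightarrow> nat \<Rightarrow> complex" where
  "hs d K u j = of_real d * (\<Sum>i<j. u (i div K))"

definition NP where "NP s c e x d K u j = nz s c e x j + \<i> * of_real c * hs d K u j"
text \<open>For real \<open>u\<close> this is the conjugate of \<open>NP\<close>; with the sign of
  the second term reversed it extends holomorphically to complex \<open>u\<close>.\<close>

definition NQ where "NQ s c e x d K u j = cnj (nz s c e x j) - \<i> * of_real c * hs d K u j"

lemma NP_cnj: "NP s c e x d K (\<lambda>j. of_real (v j)) j = nz s c e (\<lambda>i. x i + d * v (i div K)) j"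
  by (simp add: NP_def nz_def hs_def complex_eq_iff sum.distrib sum_distrib_left algebra_simps)

lemma NQ_cnj: "NQ s c e x d K (\<lambda>j. of_real (v j)) j = cnj (NP s c e x d K (\<lambda>j. of_real (v j)) j)"
  by (simp add: NP_def NQ_def hs_def)

lemma hs_0 [simp]: "hs d K u 0 = 0" by (simp add: hs_def)

lemma hs_bound:
  assumes d: "d > 0" and K: "K > 0" and u: "\<And>k. k \<le> n \<Longrightarrow> norm (u k) \<le> r" and j: "j \<le> (n + 1) * K"
  shows "norm (hs d K u j) \<le> real j * d * r"
proof -
  have "norm (\<Sum>i<j. u (i div K)) \<le> (\<Sum>i<j. r)"
  proof (rule sum_norm_le)
    fix i assume "i \<in> {..<j}"
    hence "i < (n + 1) * K" using j by auto
    hence "i div K < n + 1" using K by (simp add: less_mult_imp_div_less)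
    thus "norm (u (i div K)) \<le> r" by (intro u) auto
  qed
  thus ?thesis using d by (simp add: hs_def norm_mult mult_left_mono mult.assoc mult.left_commute)
qed

text \<open>Both Wronskian formulas in turn: \<open>wr_eq\<close> bounds the Wronskian by
  \<open>11/10 * h\<close>, and \<open>sq_ratio\<close> then keeps the quotient of the two
  \<open>q\<close> within \<open>12/10 * h\<close> of 1.\<close>

lemma q_lip:
  assumes d: "d > 0" and t: "real L * d \<le> 1" and h: "h \<ge> 0"
    and q: "\<And>j. j \<le> L \<Longrightarrow> near (1/100) (sq d N z j) 1" and q': "\<And>j. j \<le> L \<Longrightarrow> near (1/100) (sq d N' z j) 1"
    and N0: "N 0 = N' 0" and inc: "\<And>i. i < L \<Longrightarrow> norm ((N' (Suc i) - N' i) - (N (Suc i) - N i)) \<le> h * d" and j: "j \<le> L"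
  shows "norm (sq d N' z j - sq d N z j) \<le> 2 * h"
proof -
  have qb: "norm (sq d N z j) \<le> 101/100" "norm (sq d N z j) \<ge> 99/100" "norm (sq d N' z j) \<le> 101/100" if "j \<le> L" for j
    using q[OF that] q'[OF that] norm_triangle_sub[of "sq d N z j" 1] norm_triangle_sub[of 1 "sq d N z j"] norm_triangle_sub[of "sq d N' z j" 1]
    by (auto simp: near_def norm_minus_commute)
  have qnz: "sq d N z j \<noteq> 0" if "j \<le> L" for j using qb(2)[OF that] by auto
  have w: "norm (wr d N z N' z i) \<le> 11/10 * h" if i: "i \<le> L" for i
  proof -
    have "wr d N z N' z i = (\<Sum>a<i. ((N' (Suc a) - N' a) - (N (Suc a) - N a)) * sq d N z (Suc a) * sq d N' z (Suc a))"
      unfolding wr_eq using N0 by simp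
    also have "norm \<dots> \<le> (\<Sum>a<i. (h * d) * (101/100) * (101/100))"
    proof (rule sum_norm_le)
      fix a assume a: "a \<in> {..<i}"
      hence a': "a < L" "Suc a \<le> L" using i by auto
      show "norm ((N' (Suc a) - N' a - (N (Suc a) - N a)) * sq d N z (Suc a) * sq d N' z (Suc a)) \<le> (h * d) * (101/100) * (101/100)"
        unfolding norm_mult using d h by (intro mult_mono inc qb a') auto
    qed
    also have "\<dots> = (real i * d) * (h * (10201/10000))" by simp
    also have "\<dots> \<le> 1 * (h * (10201/10000))"
    proof (rule mult_right_mono)
      have "real i * d \<le> real L * d" using i d by (intro mult_right_mono) auto
      thus "real i * d \<le> 1" using t by simp
    qed (use h in auto)
    also have "\<dots> \<le> 11/10 * h" using h by simp
    finally show ?thesis .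
  qed
  have ratio: "norm (sq d N' z j / sq d N z j - 1) \<le> 12/10 * h"
  proof -
    have "sq d N' z j / sq d N z j - 1 = - (\<Sum>i<j. of_real d * wr d N z N' z i / (sq d N z i * sq d N z (Suc i)))"
      using sq_ratio[of j d N z N' z] qnz j by simp
    also have "norm \<dots> \<le> (\<Sum>i<j. d * (11/10 * h) / (99/100 * (99/100)))"
      unfolding norm_minus_cancel
    proof (rule sum_norm_le)
      fix i assume "i \<in> {..<j}"
      hence i: "i \<le> L" "Suc i \<le> L" using j by auto
      have "norm (of_real d * wr d N z N' z i / (sq d N z i * sq d N z (Suc i)))
        = d * norm (wr d N z N' z i) / (norm (sq d N z i) * norm (sq d N z (Suc i)))"
        using d by (simp add: norm_mult norm_divide)
      also have "\<dots> \<le> d * (11/10 * h) / (99/100 * (99/100))"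
        using w[OF i(1)] qb(2)[OF i(1)] qb(2)[OF i(2)] d h by (intro frac_le mult_left_mono mult_mono) auto
      finally show "norm (of_real d * wr d N z N' z i / (sq d N z i * sq d N z (Suc i))) \<le> d * (11/10 * h) / (99/100 * (99/100))" .
    qed
    also have "\<dots> = (real j * d) * (h * (11000/9801))" by simp
    also have "\<dots> \<le> 1 * (h * (11000/9801))"
    proof (rule mult_right_mono)
      have "real j * d \<le> real L * d" using j d by (intro mult_right_mono) auto
      thus "real j * d \<le> 1" using t by simp
    qed (use h in auto)
    finally show ?thesis using h by simp
  qed
  have "sq d N' z j - sq d N z j = sq d N z j * (sq d N' z j / sq d N z j - 1)" using qnz[OF j] by (simp add: field_simps)
  hence "norm (sq d N' z j - sq d N z j) = norm (sq d N z j) * norm (sq d N' z j / sq d N z j - 1)" by (simp add: norm_mult)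
  also have "\<dots> \<le> 101/100 * (12/10 * h)" using qb(1)[OF j] ratio by (intro mult_mono) auto
  finally show ?thesis using h by simp
qed

lemma near1_bounds: "near (1/100) x 1 \<Longrightarrow> norm x \<le> 101/100 \<and> norm x \<ge> 99/100"
  using norm_triangle_sub[of x 1] norm_triangle_sub[of 1 x] by (auto simp: near_def norm_minus_commute)

lemma ratio_close:
  assumes "near (1/100) a 1" "near (1/100) b 1" "near (1/100) a0 1" "near (1/100) b0 1"
    and "norm (a - a0) \<le> \<eta>" "norm (b - b0) \<le> \<eta>"
  shows "norm (a / b - a0 / b0) \<le> 21/10 * \<eta>"
proof -
  note n = assms(1-4)[THEN near1_bounds]
  have nz: "b \<noteq> 0" "b0 \<noteq> 0" using n by auto
  have \<eta>: "\<eta> \<ge> 0" using assms(5) norm_ge_zero order_trans by blast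
  have "a / b - a0 / b0 = ((a - a0) * b0 - a0 * (b - b0)) / (b * b0)" using nz by (simp add: field_simps)
  hence "norm (a / b - a0 / b0) = norm ((a - a0) * b0 - a0 * (b - b0)) / (norm b * norm b0)" by (simp add: norm_divide norm_mult)
  also have "\<dots> \<le> (\<eta> * (101/100) + (101/100) * \<eta>) / (99/100 * (99/100))"
  proof (rule frac_le)
    show "norm ((a - a0) * b0 - a0 * (b - b0)) \<le> \<eta> * (101/100) + (101/100) * \<eta>"
    proof -
      have "norm ((a - a0) * b0 - a0 * (b - b0)) \<le> norm (a - a0) * norm b0 + norm a0 * norm (b - b0)"
        by (simp only: norm_mult[symmetric] norm_triangle_ineq4)
      also have "\<dots> \<le> \<eta> * (101/100) + (101/100) * \<eta>"
        using n assms(5,6) \<eta> by (intro add_mono mult_mono) auto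
      finally show ?thesis .
    qed
    show "99/100 * (99/100) \<le> norm b * norm b0" using n by (intro mult_mono) auto
  qed (use \<eta> in auto)
  also have "\<dots> \<le> 21/10 * \<eta>" using \<eta> by simp
  finally show "norm (a / b - a0 / b0) \<le> 21/10 * \<eta>" .
qed

lemma ratio_norm:
  assumes "near (1/100) a 1" "near (1/100) b 1" shows "norm (a / b) \<le> 103/100"
proof -
  note n = assms[THEN near1_bounds]
  have "norm (a / b) \<le> (101/100) / (99/100)" unfolding norm_divide using n by (intro frac_le) auto
  thus "norm (a / b) \<le> 103/100" by simp
qed

text \<open>By \<open>sP_diff\<close>, \<open>T\<close> is the exact difference quotient of the
  scheme under a shift in piece \<open>k\<close>, with \<open>q\<close> and \<open>q'\<close> from
  the two runs. It is compared with the derivative \<open>S_k / q_L^2\<close> of the unshifted run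
  \<open>q0\<close>.\<close>

lemma T_close:
  fixes q q' q0 :: "nat \<Rightarrow> complex"
  assumes d: "d > 0" and kL: "(k + 1) * K \<le> L"
    and n: "\<And>j. j \<le> L \<Longrightarrow> near (1/100) (q j) 1" "\<And>j. j \<le> L \<Longrightarrow> near (1/100) (q' j) 1" "\<And>j. j \<le> L \<Longrightarrow> near (1/100) (q0 j) 1"
    and c: "\<And>j. j \<le> L \<Longrightarrow> norm (q j - q0 j) \<le> \<eta>" "\<And>j. j \<le> L \<Longrightarrow> norm (q' j - q0 j) \<le> \<eta>"
  defines "T \<equiv> (\<Sum>m<K. of_real d * q (k * K + m + 1) * q' (k * K + m + 1)) / (q L * q' L)"
  shows "norm (T - Sk q0 d K k / (q0 L)\<^sup>2) \<le> 5 * \<eta> * (real K * d)" "norm T \<le> 11/10 * (real K * d)"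
proof -
  have \<eta>: "\<eta> \<ge> 0" using c(1)[of 0] norm_ge_zero order_trans by blast
  have T: "T = (\<Sum>m<K. of_real d * ((q (k * K + m + 1) / q L) * (q' (k * K + m + 1) / q' L)))"
    unfolding T_def sum_divide_distrib by (intro sum.cong) auto
  have S: "Sk q0 d K k / (q0 L)\<^sup>2 = (\<Sum>m<K. of_real d * ((q0 (k * K + m + 1) / q0 L) * (q0 (k * K + m + 1) / q0 L)))"
    unfolding Sk_def sum_divide_distrib by (intro sum.cong) (auto simp: power2_eq_square)
  have le: "k * K + m + 1 \<le> L" if "m < K" for m using that kL by (simp add: algebra_simps)
  have "norm (T - Sk q0 d K k / (q0 L)\<^sup>2) \<le> (\<Sum>m<K. d * (5 * \<eta>))"
    unfolding T S sum_subtractf[symmetric] right_diff_distrib[symmetric]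
  proof (rule sum_norm_le)
    fix m assume "m \<in> {..<K}"
    hence j: "k * K + m + 1 \<le> L" by (intro le) auto
    define j where "j = k * K + m + 1"
    define a b a0 where "a = q j / q L" "b = q' j / q' L" "a0 = q0 j / q0 L"
    have jL: "j \<le> L" "L \<le> L" using j by (auto simp: j_def)
    have 1: "norm (a - a0) \<le> 21/10 * \<eta>" "norm a \<le> 103/100"
      unfolding a_b_a0_def by (rule ratio_close[OF n(1)[OF jL(1)] n(1)[OF jL(2)] n(3)[OF jL(1)] n(3)[OF jL(2)] c(1)[OF jL(1)] c(1)[OF jL(2)]])
        (rule ratio_norm[OF n(1)[OF jL(1)] n(1)[OF jL(2)]])
    have 2: "norm (b - a0) \<le> 21/10 * \<eta>" "norm b \<le> 103/100"
      unfolding a_b_a0_def by (rule ratio_close[OF n(2)[OF jL(1)] n(2)[OF jL(2)] n(3)[OF jL(1)] n(3)[OF jL(2)] c(2)[OF jL(1)] c(2)[OF jL(2)]])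
        (rule ratio_norm[OF n(2)[OF jL(1)] n(2)[OF jL(2)]])
    have 3: "norm a0 \<le> 103/100" unfolding a_b_a0_def
      by (rule ratio_norm[OF n(3)[OF jL(1)] n(3)[OF jL(2)]])
    have "a * b - a0 * a0 = (a - a0) * b + a0 * (b - a0)" by (simp add: algebra_simps)
    hence "norm (a * b - a0 * a0) \<le> norm (a - a0) * norm b + norm a0 * norm (b - a0)"
      by (simp only: norm_mult[symmetric] norm_triangle_ineq)
    also have "\<dots> \<le> (21/10 * \<eta>) * (103/100) + (103/100) * (21/10 * \<eta>)"
      using 1 2 3 \<eta> by (intro add_mono mult_mono) auto
    also have "\<dots> \<le> 5 * \<eta>" using \<eta> by simp
    finally have "norm (a * b - a0 * a0) \<le> 5 * \<eta>" .
    thus "norm (of_real d * (q (k * K + m + 1) / q L * (q' (k * K + m + 1) / q' L) - q0 (k * K + m + 1) / q0 L * (q0 (k * K + m + 1) / q0 L))) \<le> d * (5 * \<eta>)"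
      unfolding j_def[symmetric] a_b_a0_def[symmetric] norm_mult using d by simp
  qed
  thus "norm (T - Sk q0 d K k / (q0 L)\<^sup>2) \<le> 5 * \<eta> * (real K * d)" by (simp add: mult_ac)
  have "norm T \<le> (\<Sum>m<K. d * (11/10))"
    unfolding T
  proof (rule sum_norm_le)
    fix m assume "m \<in> {..<K}"
    hence j: "k * K + m + 1 \<le> L" by (intro le) auto
    define j where "j = k * K + m + 1"
    have jL: "j \<le> L" "L \<le> L" using j by (auto simp: j_def)
    have 1: "norm (q j / q L) \<le> 103/100" by (rule ratio_norm[OF n(1)[OF jL(1)] n(1)[OF jL(2)]])
    have 2: "norm (q' j / q' L) \<le> 103/100" by (rule ratio_norm[OF n(2)[OF jL(1)] n(2)[OF jL(2)]])
    have "norm (q j / q L * (q' j / q' L)) \<le> (103/100) * (103/100)" unfolding norm_mult using 1 2 by (intro mult_mono) auto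
    hence "norm (q j / q L * (q' j / q' L)) \<le> 11/10" by simp
    thus "norm (of_real d * (q (k * K + m + 1) / q L * (q' (k * K + m + 1) / q' L))) \<le> d * (11/10)"
      unfolding j_def[symmetric] norm_mult[of "of_real d"] using d by simp
  qed
  thus "norm T \<le> 11/10 * (real K * d)" by (simp add: mult_ac)
qed

text \<open>The weight \<open>cmw\<close> for piecewise constant shifts, continued to an entire
  function of the shifts.\<close>

definition cmc :: "real \<Rightarrow> nat \<Rightarrow> nat \<Rightarrow> (nat \<Rightarrow> complex) \<Rightarrow> (nat \<Rightarrow> real) \<Rightarrow> complex" where
  "cmc d K L u x = exp (- (\<Sum>i<L. u (i div K) * of_real (x i) + of_real d * (u (i div K))\<^sup>2 / 2))"

lemma sum_by_pieces:
  fixes f :: "nat \<Rightarrow> complex"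
  assumes "K > 0"
  shows "(\<Sum>i<(n + 1) * K. f i) = (\<Sum>k<n + 1. \<Sum>i=k*K..<(k+1)*K. f i)"
proof (induction n)
  case 0 show ?case by (simp add: atLeast0LessThan)
next
  case (Suc n)
  have "{..<(Suc n + 1) * K} = {..<(n + 1) * K} \<union> {(n + 1) * K..<(n + 1 + 1) * K}" by auto
  hence "(\<Sum>i<(Suc n + 1) * K. f i) = (\<Sum>i<(n + 1) * K. f i) + (\<Sum>i=(n+1)*K..<(n+1+1)*K. f i)"
    by (simp add: sum.union_disjoint ivl_disj_int)
  thus ?case using Suc by simp
qed

text \<open>Confinement bounds the increment over each piece by \<open>2 / c\<close>, so
  \<open>small\<close> keeps the exponent below 1 in modulus, and \<open>exp 1 <= 3\<close>.\<close>

lemma cmc_bound: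
  assumes d: "d > 0" and K: "K > 0" and c: "c > 0" and cx: "cx c x ((n + 1) * K)"
    and u: "\<And>k. k \<le> n \<Longrightarrow> norm (u k) \<le> r" and r: "0 \<le> r" and l: "real K * d \<le> 1"
    and small: "real (n + 1) * (2 * r / c + r\<^sup>2) \<le> 1"
  shows "norm (cmc d K ((n + 1) * K) u x) \<le> 3"
proof -
  have "(\<Sum>i<(n + 1) * K. u (i div K) * of_real (x i) + of_real d * (u (i div K))\<^sup>2 / 2)
    = (\<Sum>k<n + 1. \<Sum>i=k*K..<(k+1)*K. u (i div K) * of_real (x i) + of_real d * (u (i div K))\<^sup>2 / 2)" by (rule sum_by_pieces[OF K])
  also have "\<dots> = (\<Sum>k<n + 1. u k * of_real (\<Sum>i=k*K..<(k+1)*K. x i) + of_real (real K * d) * (u k)\<^sup>2 / 2)"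
  proof (rule sum.cong[OF refl])
    fix k
    have "(\<Sum>i=k*K..<(k+1)*K. u (i div K) * of_real (x i) + of_real d * (u (i div K))\<^sup>2 / 2) = (\<Sum>i=k*K..<(k+1)*K. u k * of_real (x i) + of_real d * (u k)\<^sup>2 / 2)"
    proof (rule sum.cong[OF refl])
      fix i assume "i \<in> {k*K..<(k+1)*K}"
      hence "i div K = k" using div_piece[OF K, of i k] by simp
      thus "u (i div K) * of_real (x i) + of_real d * (u (i div K))\<^sup>2 / 2 = u k * of_real (x i) + of_real d * (u k)\<^sup>2 / 2" by simp
    qed
    thus "(\<Sum>i=k*K..<(k+1)*K. u (i div K) * of_real (x i) + of_real d * (u (i div K))\<^sup>2 / 2) = u k * of_real (\<Sum>i=k*K..<(k+1)*K. x i) + of_real (real K * d) * (u k)\<^sup>2 / 2"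
      by (simp add: sum.distrib sum_distrib_left)
  qed
  also have "norm \<dots> \<le> (\<Sum>k<n + 1. 2 * r / c + r\<^sup>2)"
  proof (rule sum_norm_le)
    fix k assume k: "k \<in> {..<n + 1}"
    have kn: "(k + 1) * K \<le> (n + 1) * K" "k * K \<le> (n + 1) * K" using k by (intro mult_le_mono; simp)+
    have b: "\<bar>c * (\<Sum>i<(k+1)*K. x i)\<bar> \<le> 1" "\<bar>c * (\<Sum>i<k*K. x i)\<bar> \<le> 1" using cx kn unfolding cx_def by blast+
    have "(\<Sum>i=k*K..<(k+1)*K. x i) = (\<Sum>i<(k+1)*K. x i) - (\<Sum>i<k*K. x i)" by (intro sum_diff_nat_ivl) auto
    hence "c * \<bar>\<Sum>i=k*K..<(k+1)*K. x i\<bar> = \<bar>c * (\<Sum>i<(k+1)*K. x i) - c * (\<Sum>i<k*K. x i)\<bar>"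
      using c by (simp add: abs_mult right_diff_distrib[symmetric])
    hence "c * \<bar>\<Sum>i=k*K..<(k+1)*K. x i\<bar> \<le> 2" using b by linarith
    hence G: "\<bar>\<Sum>i=k*K..<(k+1)*K. x i\<bar> \<le> 2 / c" using c by (simp add: field_simps)
    have uk: "norm (u k) \<le> r" using u k by auto
    have "norm (u k * of_real (\<Sum>i=k*K..<(k+1)*K. x i) + of_real (real K * d) * (u k)\<^sup>2 / 2)
      \<le> norm (u k) * \<bar>\<Sum>i=k*K..<(k+1)*K. x i\<bar> + (real K * d) * (norm (u k))\<^sup>2 / 2"
      using d by (intro order_trans[OF norm_triangle_ineq]) (simp add: norm_mult norm_divide norm_power del: of_real_sum)
    also have "\<dots> \<le> r * (2 / c) + 1 * r\<^sup>2 / 2"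
      using uk G l r d by (intro add_mono mult_mono divide_right_mono power_mono) auto
    also have "\<dots> \<le> 2 * r / c + r\<^sup>2" using zero_le_power2[of r] by (simp add: mult.commute)
    finally show "norm (u k * of_real (\<Sum>i=k*K..<(k+1)*K. x i) + of_real (real K * d) * (u k)\<^sup>2 / 2) \<le> 2 * r / c + r\<^sup>2" .
  qed
  also have "\<dots> \<le> 1" using small by simp
  finally have S: "norm (\<Sum>i<(n + 1) * K. u (i div K) * of_real (x i) + of_real d * (u (i div K))\<^sup>2 / 2) \<le> 1" .
  have "- Re y \<le> 1" if "norm y \<le> 1" for y using abs_Re_le_cmod[of y] that by linarith
  from this[OF S]
  have "norm (cmc d K ((n + 1) * K) u x) \<le> exp 1" unfolding cmc_def norm_exp_eq_Re by simp
  also have "exp (1::real) \<le> 3" by (rule exp_le)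
  finally show ?thesis .
qed

lemma half_double: "(x + x) / 2 = (x::real)" by simp

text \<open>\<open>PP\<close> and \<open>QQ\<close> are the scheme and its conjugate as holomorphic functions of complex shifts \<open>u\<close>; they are complex
  conjugates of each other only for real shifts.\<close>

definition PP where "PP s c e x d K L z u = sP d (NP s c e x d K u) z L"
definition QQ where "QQ s c e x d K L z u = sP d (NQ s c e x d K u) (cnj z) L"
text \<open>\<open>Re (cnj \<xi> * P)\<close> and \<open>|P|^2\<close> are written with
  \<open>Q\<close> in place of \<open>cnj P\<close>, which turns the integrand into a holomorphic
  function of the shifts.\<close>

definition GG where "GG s c e x d K L z \<xi> u = exp (\<i> * (cnj \<xi> * PP s c e x d K L z u + \<xi> * QQ s c e x d K L z u) / 2
   - PP s c e x d K L z u * QQ s c e x d K L z u / 2) * cmc d K L u x"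

section \<open>The phase on a polydisc of complex shifts\<close>

text \<open>Confined noise, a bounded start and a short time. \<open>r\<close> is the radius of the
  polydisc of shifts: \<open>c * r <= 1\<close> keeps the shifted noise below 3, whence
  \<open>R + 7\<close> from \<open>scheme_control\<close> with \<open>B = 3\<close>, and
  \<open>small\<close> bounds the complex weight.\<close>

locale good_ctx =
  fixes s c d R r :: real and e x :: "nat \<Rightarrow> real" and K n L :: nat and z :: complex
  assumes d: "d > 0" and K2: "K \<ge> 2" and c: "c > 0" and zR: "norm z \<le> R" and L_def: "L = (n + 1) * K"
    and t: "real L * d * (R + 7) \<le> 1/100" and cxe: "cx s e L" and cxx: "cx c x L"
    and r0: "r > 0" and cr: "c * r \<le> 1" and small: "real (n + 1) * (2 * r / c + r\<^sup>2) \<le> 1"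
begin

lemma K0: "K > 0" using K2 by simp
lemma R0: "R \<ge> 0" using zR norm_ge_zero[of z] by linarith
lemma t1: "real L * d \<le> 1/700"
proof -
  have "real L * d * 7 \<le> real L * d * (R + 7)" using R0 d by (intro mult_left_mono) auto
  thus ?thesis using t by linarith
qed
lemma KL: "real K * d \<le> real L * d" unfolding L_def using d by (intro mult_right_mono) auto

definition pd where "pd u \<longleftrightarrow> (\<forall>k\<le>n. norm (u k :: complex) \<le> r)"

lemma chs: "pd u \<Longrightarrow> j \<le> L \<Longrightarrow> norm (\<i> * of_real c * hs d K u j) \<le> 1"
proof -
  assume u: "pd u" and j: "j \<le> L"
  have "norm (hs d K u j) \<le> real j * d * r"
    by (rule hs_bound[OF d K0, of n]) (use u j in \<open>auto simp: pd_def L_def\<close>)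
  also have "\<dots> \<le> real L * d * r" using j d r0 by (intro mult_right_mono) auto
  also have "\<dots> \<le> 1 * r" using t1 r0 by (intro mult_right_mono) auto
  finally have "norm (hs d K u j) \<le> 1 * r" .
  hence "c * norm (hs d K u j) \<le> c * (1 * r)" using c by (intro mult_left_mono) auto
  moreover have "norm (\<i> * of_real c * hs d K u j) = c * norm (hs d K u j)" using c by (simp add: norm_mult)
  ultimately show ?thesis using cr by linarith
qed

lemma NP_bound: assumes "pd u" "j \<le> L" shows "norm (NP s c e x d K u j) \<le> 3" "norm (NQ s c e x d K u j) \<le> 3"
proof -
  have n: "norm (nz s c e x j) \<le> 2" by (rule nz_bound[OF cxe cxx assms(2)])
  show "norm (NP s c e x d K u j) \<le> 3"
    unfolding NP_def using norm_triangle_ineq[of "nz s c e x j" "\<i> * of_real c * hs d K u j"] n chs[OF assms] by linarith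
  show "norm (NQ s c e x d K u j) \<le> 3"
    unfolding NQ_def using norm_triangle_ineq4[of "cnj (nz s c e x j)" "\<i> * of_real c * hs d K u j"] n chs[OF assms] by simp
qed

lemma ctrl_gen:
  assumes N: "\<And>j. j \<le> L \<Longrightarrow> norm (N j) \<le> 3" and z': "norm z' \<le> R" and j: "j \<le> L"
  shows "near (1/100) (sq d N z' j) 1 \<and> norm (sp d N z' j) \<le> R + 7"
proof -
  have "norm (sv d N z' j - z') \<le> real j * d * 3 * (R + 7) \<and> norm (sq d N z' j - 1) \<le> real j * d * (R + 7)
     \<and> norm (sp d N z' j) \<le> R + 7"
    by (rule scheme_control[where L = L and R = R and \<theta> = "1/100"]) (use d N z' j t in auto)
  moreover have "real j * d * (R + 7) \<le> real L * d * (R + 7)" using j d R0 by (intro mult_right_mono) auto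
  ultimately show ?thesis using t by (auto simp: near_def)
qed

lemma qP_near: "pd u \<Longrightarrow> j \<le> L \<Longrightarrow> near (1/100) (sq d (NP s c e x d K u) z j) 1"
  and spP: "pd u \<Longrightarrow> j \<le> L \<Longrightarrow> norm (sp d (NP s c e x d K u) z j) \<le> R + 7"
  and qQ_near: "pd u \<Longrightarrow> j \<le> L \<Longrightarrow> near (1/100) (sq d (NQ s c e x d K u) (cnj z) j) 1"
  and spQ: "pd u \<Longrightarrow> j \<le> L \<Longrightarrow> norm (sp d (NQ s c e x d K u) (cnj z) j) \<le> R + 7"
  using ctrl_gen[of "NP s c e x d K u" z j] ctrl_gen[of "NQ s c e x d K u" "cnj z" j] NP_bound zR by auto

lemma q0_near: "j \<le> L \<Longrightarrow> near (1/100) (sq d (nz s c e x) z j) 1"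
  using ctrl_gen[of "nz s c e x" z j] nz_bound[OF cxe cxx] zR by force

lemma cnj_q: "sq d (\<lambda>j. cnj (nz s c e x j)) (cnj z) j = cnj (sq d (nz s c e x) z j)"
  using cnj_sch[of d "nz s c e x" z j] by (simp add: sq_def)

lemma q0c_near: "j \<le> L \<Longrightarrow> near (1/100) (sq d (\<lambda>j. cnj (nz s c e x j)) (cnj z) j) 1"
  unfolding cnj_q using near_cnj[OF q0_near] by simp

lemma PPb: assumes "pd u" shows "norm (PP s c e x d K L z u) \<le> 103/100 * (R + 7)" "norm (QQ s c e x d K L z u) \<le> 103/100 * (R + 7)"
proof -
  have "norm (PP s c e x d K L z u) \<le> (R + 7) / (99/100)"
    unfolding PP_def sP_def norm_divide using spP[OF assms, of L] near1_bounds[OF qP_near[OF assms, of L]] R0 by (intro frac_le) auto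
  thus "norm (PP s c e x d K L z u) \<le> 103/100 * (R + 7)" using R0 by simp
  have "norm (QQ s c e x d K L z u) \<le> (R + 7) / (99/100)"
    unfolding QQ_def sP_def norm_divide using spQ[OF assms, of L] near1_bounds[OF qQ_near[OF assms, of L]] R0 by (intro frac_le) auto
  thus "norm (QQ s c e x d K L z u) \<le> 103/100 * (R + 7)" using R0 by simp
qed

lemma hs_Suc: "hs d K u (Suc i) - hs d K u i = of_real d * u (i div K)" by (simp add: hs_def algebra_simps)

lemma idiv: "i < L \<Longrightarrow> i div K \<le> n"
proof -
  assume "i < L" hence "i div K < n + 1" unfolding L_def using K0 by (simp add: less_mult_imp_div_less)
  thus ?thesis by simp
qed

lemma lipP: assumes u: "pd u" and j: "j \<le> L"
  shows "norm (sq d (NP s c e x d K u) z j - sq d (nz s c e x) z j) \<le> 2 * (c * r)"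
proof (rule q_lip[OF d _ _ q0_near qP_near[OF u] _ _ j])
  show "real L * d \<le> 1" using t1 by simp
  fix i assume i: "i < L"
  have "(NP s c e x d K u (Suc i) - NP s c e x d K u i) - (nz s c e x (Suc i) - nz s c e x i) = \<i> * of_real c * (hs d K u (Suc i) - hs d K u i)"
    by (simp add: NP_def algebra_simps)
  also have "norm \<dots> = c * (d * norm (u (i div K)))" unfolding hs_Suc using c d by (simp add: norm_mult)
  also have "\<dots> \<le> c * (d * r)" using u idiv[OF i] c d by (intro mult_left_mono) (auto simp: pd_def)
  finally show "norm ((NP s c e x d K u (Suc i) - NP s c e x d K u i) - (nz s c e x (Suc i) - nz s c e x i)) \<le> c * r * d" by (simp add: mult_ac)
qed (use c r0 in \<open>auto simp: NP_def\<close>)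

lemma lipQ: assumes u: "pd u" and j: "j \<le> L"
  shows "norm (sq d (NQ s c e x d K u) (cnj z) j - sq d (\<lambda>j. cnj (nz s c e x j)) (cnj z) j) \<le> 2 * (c * r)"
proof (rule q_lip[OF d _ _ q0c_near qQ_near[OF u] _ _ j])
  show "real L * d \<le> 1" using t1 by simp
  fix i assume i: "i < L"
  have "(NQ s c e x d K u (Suc i) - NQ s c e x d K u i) - (cnj (nz s c e x (Suc i)) - cnj (nz s c e x i)) = - (\<i> * of_real c * (hs d K u (Suc i) - hs d K u i))"
    by (simp add: NQ_def algebra_simps)
  also have "norm \<dots> = c * (d * norm (u (i div K)))" unfolding hs_Suc using c d by (simp add: norm_mult)
  also have "\<dots> \<le> c * (d * r)" using u idiv[OF i] c d by (intro mult_left_mono) (auto simp: pd_def)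
  finally show "norm ((NQ s c e x d K u (Suc i) - NQ s c e x d K u i) - (cnj (nz s c e x (Suc i)) - cnj (nz s c e x i))) \<le> c * r * d" by (simp add: mult_ac)
qed (use c r0 in \<open>auto simp: NQ_def\<close>)

definition TT where "TT k q q' = (\<Sum>m<K. of_real d * q (k * K + m + 1) * q' (k * K + m + 1)) / (q L * q' L)"

lemma diff_gen:
  assumes k: "k \<le> n" and inc: "\<And>i. i < L \<Longrightarrow> (N' (Suc i) - N' i) - (N (Suc i) - N i) = (if i div K = k then h * of_real d else 0)"
    and N0: "N 0 = N' 0" and q: "sq d N z' L \<noteq> 0" "sq d N' z' L \<noteq> 0"
  shows "sP d N' z' L - sP d N z' L = h * TT k (sq d N z') (sq d N' z')"
proof -
  have "wr d N z' N' z' L = (\<Sum>i<L. (if i div K = k then h * of_real d * sq d N z' (Suc i) * sq d N' z' (Suc i) else 0))"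
    unfolding wr_eq using inc N0 by (auto intro!: sum.cong)
  also have "\<dots> = (\<Sum>i=k*K..<(k+1)*K. h * of_real d * sq d N z' (Suc i) * sq d N' z' (Suc i))"
    unfolding L_def by (rule sum_piece[OF K0 k])
  also have "\<dots> = (\<Sum>m<K. h * of_real d * sq d N z' (k * K + m + 1) * sq d N' z' (k * K + m + 1))"
    by (rule sum.reindex_bij_witness[of _ "\<lambda>m. k * K + m" "\<lambda>i. i - k * K"]) auto
  also have "\<dots> = h * (\<Sum>m<K. of_real d * sq d N z' (k * K + m + 1) * sq d N' z' (k * K + m + 1))"
    by (simp add: sum_distrib_left mult_ac)
  finally show ?thesis unfolding sP_diff[OF q] TT_def by simp
qed

lemma kKL: "k \<le> n \<Longrightarrow> (k + 1) * K \<le> L" unfolding L_def by (intro mult_le_mono) auto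

text \<open>The Wronskian formula is algebraic, so it holds for complex shifts of finite size.
  \<open>A\<close> is, up to the factor \<open>i c\<close>, the derivative at the unshifted
  path.\<close>

lemma PP_diff:
  assumes u: "pd u" "pd (u(k := w))" and k: "k \<le> n"
  defines "A \<equiv> Sk (sq d (nz s c e x) z) d K k / (sq d (nz s c e x) z L)\<^sup>2"
  obtains T T' where "PP s c e x d K L z (u(k := w)) - PP s c e x d K L z u = \<i> * of_real c * (w - u k) * T"
    "QQ s c e x d K L z (u(k := w)) - QQ s c e x d K L z u = - \<i> * of_real c * (w - u k) * T'"
    "norm (T - A) \<le> 10 * (c * r) * (real K * d)" "norm (T' - cnj A) \<le> 10 * (c * r) * (real K * d)"
    "norm T \<le> 11/10 * (real K * d)" "norm T' \<le> 11/10 * (real K * d)"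
proof
  let ?q = "sq d (NP s c e x d K u) z" and ?q' = "sq d (NP s c e x d K (u(k := w))) z"
  let ?p = "sq d (NQ s c e x d K u) (cnj z)" and ?p' = "sq d (NQ s c e x d K (u(k := w))) (cnj z)"
  have nz0: "y \<noteq> 0" if "near (1/100) y 1" for y using near1_bounds[OF that] by auto
  have h: "(hs d K (u(k := w)) (Suc i) - hs d K (u(k := w)) i) - (hs d K u (Suc i) - hs d K u i) = (if i div K = k then (w - u k) * of_real d else 0)" for i
    unfolding hs_Suc by (auto simp: algebra_simps)
  show "PP s c e x d K L z (u(k := w)) - PP s c e x d K L z u = \<i> * of_real c * (w - u k) * TT k ?q ?q'"
    unfolding PP_def
  proof (rule diff_gen[OF k])
    fix i
    have "(NP s c e x d K (u(k := w)) (Suc i) - NP s c e x d K (u(k := w)) i) - (NP s c e x d K u (Suc i) - NP s c e x d K u i)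
       = \<i> * of_real c * ((hs d K (u(k := w)) (Suc i) - hs d K (u(k := w)) i) - (hs d K u (Suc i) - hs d K u i))"
      by (simp add: NP_def algebra_simps)
    thus "(NP s c e x d K (u(k := w)) (Suc i) - NP s c e x d K (u(k := w)) i) - (NP s c e x d K u (Suc i) - NP s c e x d K u i)
       = (if i div K = k then \<i> * of_real c * (w - u k) * of_real d else 0)" unfolding h by simp
  qed (use qP_near[OF u(1), of L, THEN nz0] qP_near[OF u(2), of L, THEN nz0] in \<open>auto simp: NP_def\<close>)
  show "QQ s c e x d K L z (u(k := w)) - QQ s c e x d K L z u = - \<i> * of_real c * (w - u k) * TT k ?p ?p'"
    unfolding QQ_def
  proof (rule diff_gen[OF k])
    fix i
    have "(NQ s c e x d K (u(k := w)) (Suc i) - NQ s c e x d K (u(k := w)) i) - (NQ s c e x d K u (Suc i) - NQ s c e x d K u i)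
       = - \<i> * of_real c * ((hs d K (u(k := w)) (Suc i) - hs d K (u(k := w)) i) - (hs d K u (Suc i) - hs d K u i))"
      by (simp add: NQ_def algebra_simps)
    thus "(NQ s c e x d K (u(k := w)) (Suc i) - NQ s c e x d K (u(k := w)) i) - (NQ s c e x d K u (Suc i) - NQ s c e x d K u i)
       = (if i div K = k then - \<i> * of_real c * (w - u k) * of_real d else 0)" unfolding h by simp
  qed (use qQ_near[OF u(1), of L, THEN nz0] qQ_near[OF u(2), of L, THEN nz0] in \<open>auto simp: NQ_def\<close>)
  have cA: "cnj A = Sk (sq d (\<lambda>j. cnj (nz s c e x j)) (cnj z)) d K k / (sq d (\<lambda>j. cnj (nz s c e x j)) (cnj z) L)\<^sup>2"
    by (simp add: A_def Sk_def cnj_q)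
  have two: "5 * (2 * (c * r)) = 10 * (c * r)" by simp
  show "norm (TT k ?q ?q' - A) \<le> 10 * (c * r) * (real K * d)"
    using T_close(1)[OF d kKL[OF k] qP_near[OF u(1)] qP_near[OF u(2)] q0_near lipP[OF u(1)] lipP[OF u(2)]]
    unfolding TT_def A_def two by simp
  show "norm (TT k ?q ?q') \<le> 11/10 * (real K * d)"
    using T_close(2)[OF d kKL[OF k] qP_near[OF u(1)] qP_near[OF u(2)] q0_near lipP[OF u(1)] lipP[OF u(2)]]
    unfolding TT_def by simp
  show "norm (TT k ?p ?p' - cnj A) \<le> 10 * (c * r) * (real K * d)"
    using T_close(1)[OF d kKL[OF k] qQ_near[OF u(1)] qQ_near[OF u(2)] q0c_near lipQ[OF u(1)] lipQ[OF u(2)]]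
    unfolding TT_def cA two by simp
  show "norm (TT k ?p ?p') \<le> 11/10 * (real K * d)"
    using T_close(2)[OF d kKL[OF k] qQ_near[OF u(1)] qQ_near[OF u(2)] q0c_near lipQ[OF u(1)] lipQ[OF u(2)]]
    unfolding TT_def by simp
qed

text \<open>At a real shift the phase is real. Moving the \<open>k\<close>-th shift by
  \<open>i \<sigma>\<close> gives it the imaginary part \<open>\<sigma> * Re Hd\<close>, where
  \<open>Hd\<close> differs by at most \<open>\<beta> / 2\<close> from the derivative at the
  unshifted path, whose modulus is at least \<open>\<beta>\<close>; so half of
  \<open>\<beta>\<close> survives, and the sign of \<open>\<sigma>\<close> turns it into decay. The
  constant is \<open>exp (1/2) * 3 <= 6\<close>, from the Gaussian factor and the weight.\<close>

lemma GG_bound: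
  assumes k: "k \<le> n" and v: "\<And>j. j \<le> n \<Longrightarrow> \<bar>v j\<bar> \<le> r" and a: "\<bar>a\<bar> + \<bar>\<sigma>\<bar> \<le> r" 
    and H0: "\<bar>Re (cnj \<xi> * \<i> * of_real c * (Sk (sq d (nz s c e x) z) d K k / (sq d (nz s c e x) z L)\<^sup>2))\<bar> \<ge> \<beta>"
    and sg: "\<sigma> * Re (cnj \<xi> * \<i> * of_real c * (Sk (sq d (nz s c e x) z) d K k / (sq d (nz s c e x) z L)\<^sup>2)) \<ge> 0"
    and err: "norm \<xi> * c * (10 * (c * r) * (real K * d)) \<le> \<beta> / 2"
  shows "norm (GG s c e x d K L z \<xi> ((\<lambda>j. of_real (v j))(k := Complex a \<sigma>))) \<le> 6 * exp (- (\<beta> / 2) * \<bar>\<sigma>\<bar>)"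
proof -
  define A where "A = Sk (sq d (nz s c e x) z) d K k / (sq d (nz s c e x) z L)\<^sup>2"
  define v0 where "v0 = v(k := a)"
  define u0 where "u0 = (\<lambda>j. complex_of_real (v0 j))"
  define w where "w = Complex a \<sigma>"
  have u1: "(\<lambda>j. of_real (v j))(k := w) = u0(k := w)" by (auto simp: u0_def v0_def)
  have nw: "norm w \<le> r" using cmod_le[of w] a by (simp add: w_def)
  have p0: "pd u0" using v a by (auto simp: pd_def u0_def v0_def)
  have p1: "pd (u0(k := w))" using p0 nw by (auto simp: pd_def)
  define P0 Q0 P1 Q1 where PQ: "P0 = PP s c e x d K L z u0" "Q0 = QQ s c e x d K L z u0" "P1 = PP s c e x d K L z (u0(k := w))" "Q1 = QQ s c e x d K L z (u0(k := w))"
  have Q0: "Q0 = cnj P0"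
  proof -
    have "NQ s c e x d K u0 = (\<lambda>j. cnj (NP s c e x d K u0 j))" unfolding u0_def NQ_cnj ..
    thus ?thesis unfolding PQ PP_def QQ_def by (simp add: cnj_sP)
  qed
  have wk: "w - u0 k = \<i> * of_real \<sigma>" by (simp add: w_def u0_def v0_def complex_eq_iff)
  obtain T T' where T: "P1 - P0 = \<i> * of_real c * (\<i> * of_real \<sigma>) * T" "Q1 - Q0 = - \<i> * of_real c * (\<i> * of_real \<sigma>) * T'"
    and TA: "norm (T - A) \<le> 10 * (c * r) * (real K * d)" "norm (T' - cnj A) \<le> 10 * (c * r) * (real K * d)"
    and Tb: "norm T \<le> 11/10 * (real K * d)" "norm T' \<le> 11/10 * (real K * d)"
    using PP_diff[OF p0 p1 k, folded PQ A_def] unfolding wk by metis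
  define Hd where "Hd = (cnj \<xi> * \<i> * of_real c * T - \<xi> * \<i> * of_real c * T') / 2"
  define h where "h = Re (cnj \<xi> * \<i> * of_real c * A)"
  have h: "of_real h = (cnj \<xi> * \<i> * of_real c * A - \<xi> * \<i> * of_real c * cnj A) / 2"
    by (simp add: h_def complex_eq_iff algebra_simps)
  have Hdh: "norm (Hd - of_real h) \<le> \<beta> / 2"
  proof -
    have "Hd - of_real h = (cnj \<xi> * \<i> * of_real c * (T - A) - \<xi> * \<i> * of_real c * (T' - cnj A)) / 2"
      unfolding Hd_def h by (simp add: algebra_simps diff_divide_distrib add_divide_distrib)
    also have "norm \<dots> \<le> (norm \<xi> * c * norm (T - A) + norm \<xi> * c * norm (T' - cnj A)) / 2"
      using norm_triangle_ineq4[of "cnj \<xi> * \<i> * of_real c * (T - A)" "\<xi> * \<i> * of_real c * (T' - cnj A)"] c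
      by (simp add: norm_mult norm_divide)
    also have "\<dots> \<le> (norm \<xi> * c * (10 * (c * r) * (real K * d)) + norm \<xi> * c * (10 * (c * r) * (real K * d))) / 2"
      using TA c by (intro divide_right_mono add_mono mult_left_mono) auto
    also have "\<dots> \<le> \<beta> / 2" using err by (simp only: half_double)
    finally show ?thesis .
  qed
  have "\<bar>Re Hd - h\<bar> \<le> \<beta> / 2" using Hdh abs_Re_le_cmod[of "Hd - of_real h"] by simp
  hence sH: "\<sigma> * Re Hd \<ge> \<beta> / 2 * \<bar>\<sigma>\<bar>"
  proof -
    assume 1: "\<bar>Re Hd - h\<bar> \<le> \<beta> / 2"
    have f1: "\<sigma> * h = \<bar>\<sigma>\<bar> * \<bar>h\<bar>" using sg by (simp add: h_def A_def abs_mult[symmetric])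
    have f2: "\<bar>\<sigma>\<bar> * \<beta> \<le> \<bar>\<sigma>\<bar> * \<bar>h\<bar>" using H0 by (intro mult_left_mono) (auto simp: h_def A_def)
    have "\<bar>\<sigma> * (Re Hd - h)\<bar> \<le> (\<bar>\<sigma>\<bar> * \<beta>) / 2" unfolding abs_mult using mult_left_mono[OF 1, of "\<bar>\<sigma>\<bar>"] by simp
    hence f3: "- ((\<bar>\<sigma>\<bar> * \<beta>) / 2) \<le> \<sigma> * Re Hd - \<sigma> * h" unfolding abs_le_iff right_diff_distrib by linarith
    have aux: "A = B \<Longrightarrow> C \<le> B \<Longrightarrow> - (C / 2) \<le> X - A \<Longrightarrow> C / 2 \<le> X" for A B C X :: real by linarith
    show ?thesis using aux[OF f1 f2 f3] by (simp add: mult.commute)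
  qed
  define F0 where "F0 = (cnj \<xi> * P0 + \<xi> * Q0) / 2"
  define F1 where "F1 = (cnj \<xi> * P1 + \<xi> * Q1) / 2"
  have "F1 - F0 = \<i> * of_real \<sigma> * Hd"
  proof -
    have "F1 - F0 = (cnj \<xi> * (P1 - P0) + \<xi> * (Q1 - Q0)) / 2" by (simp add: F0_def F1_def algebra_simps diff_divide_distrib add_divide_distrib)
    also have "\<dots> = \<i> * of_real \<sigma> * Hd" unfolding T Hd_def by (simp add: algebra_simps diff_divide_distrib add_divide_distrib)
    finally show ?thesis .
  qed
  hence "Im F1 = Im F0 + \<sigma> * Re Hd" by (simp add: complex_eq_iff)
  moreover have "Im F0 = 0" unfolding F0_def Q0 by (simp add: algebra_simps)
  ultimately have ImF: "Im F1 \<ge> \<beta> / 2 * \<bar>\<sigma>\<bar>" using sH by simp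
  \<comment> \<open>\<open>Re (P0 * Q0) = |P0|^2 >= 0\<close>, and the complex move changes the
    product by less than 1 because \<open>l * (R + 7)\<close> is small. So the Gaussian factor
    cannot blow up off the real shifts.\<close>
  have RePQ: "Re (P1 * Q1) \<ge> -1"
  proof -
    have sr: "\<bar>\<sigma>\<bar> \<le> r" using a by linarith
    have d1: "norm (P1 - P0) \<le> c * r * (11/10 * (real K * d))" "norm (Q1 - Q0) \<le> c * r * (11/10 * (real K * d))"
    proof -
      have m: "c * \<bar>\<sigma>\<bar> * norm S \<le> c * r * (11/10 * (real K * d))" if "norm S \<le> 11/10 * (real K * d)" for S :: complex
        by (intro mult_mono that) (use sr c r0 d in auto)
      have "norm (P1 - P0) = c * \<bar>\<sigma>\<bar> * norm T" "norm (Q1 - Q0) = c * \<bar>\<sigma>\<bar> * norm T'"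
        unfolding T using c by (simp_all add: norm_mult)
      thus "norm (P1 - P0) \<le> c * r * (11/10 * (real K * d))" "norm (Q1 - Q0) \<le> c * r * (11/10 * (real K * d))"
        using m[OF Tb(1)] m[OF Tb(2)] by simp_all
    qed
    have b: "norm P0 \<le> 103/100 * (R + 7)" "norm Q1 \<le> 103/100 * (R + 7)" using PPb(1)[OF p0] PPb(2)[OF p1] by (auto simp: PQ)
    have "P1 * Q1 - P0 * Q0 = (P1 - P0) * Q1 + P0 * (Q1 - Q0)" by (simp add: algebra_simps)
    hence "norm (P1 * Q1 - P0 * Q0) \<le> norm (P1 - P0) * norm Q1 + norm P0 * norm (Q1 - Q0)"
      by (simp only: norm_mult[symmetric] norm_triangle_ineq)
    also have "\<dots> \<le> (c * r * (11/10 * (real K * d))) * (103/100 * (R + 7)) + (103/100 * (R + 7)) * (c * r * (11/10 * (real K * d)))"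
      using d1 b c r0 d R0 by (intro add_mono mult_mono) auto
    also have "\<dots> = (c * r) * (2266/1000 * (real K * d * (R + 7)))" by simp
    also have "\<dots> \<le> 1 * (2266/1000 * (1/100))"
    proof (intro mult_mono cr)
      have "real K * d * (R + 7) \<le> real L * d * (R + 7)" by (rule mult_right_mono[OF KL]) (use R0 in simp)
      thus "real K * d * (R + 7) \<le> 1/100" using t by linarith
    qed (use c r0 d R0 in auto)
    finally have 1: "norm (P1 * Q1 - P0 * Q0) \<le> 1" by simp
    have "Re (P0 * Q0) \<ge> 0" unfolding Q0 by (simp add: complex_mult_cnj)
    thus ?thesis using abs_Re_le_cmod[of "P1 * Q1 - P0 * Q0"] 1 by simp
  qed
  have cm: "norm (cmc d K L (u0(k := w)) x) \<le> 3"
    unfolding L_def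
  proof (rule cmc_bound[OF d K0 c])
    show "norm ((u0(k := w)) j) \<le> r" if "j \<le> n" for j using p1 that by (auto simp: pd_def)
    show "cx c x ((n + 1) * K)" using cxx by (simp add: L_def)
    show "real K * d \<le> 1" using KL t1 by linarith
  qed (use r0 small in auto)
  have e2: "exp (1/2::real) \<le> 2"
  proof -
    have "exp (1/2::real) * exp (1/2) = exp 1" by (simp add: exp_add[symmetric])
    moreover have "exp (1::real) \<le> 3" by (rule exp_le)
    ultimately have "(exp (1/2::real))\<^sup>2 \<le> 2\<^sup>2" by (simp add: power2_eq_square)
    thus ?thesis by (rule power2_le_imp_le) simp
  qed
  have "norm (GG s c e x d K L z \<xi> ((\<lambda>j. of_real (v j))(k := Complex a \<sigma>)))
    = exp (Re (\<i> * F1 - P1 * Q1 / 2)) * norm (cmc d K L (u0(k := w)) x)"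
    unfolding w_def[symmetric] u1 GG_def PQ[symmetric] norm_mult F1_def norm_exp_eq_Re by simp
  also have "\<dots> \<le> exp (1/2 + (- (\<beta> / 2) * \<bar>\<sigma>\<bar>)) * 3"
  proof (intro mult_mono cm)
    have aux: "a \<le> b \<Longrightarrow> -1 \<le> p \<Longrightarrow> - b - p / 2 \<le> 1/2 + - a" for a b p :: real by linarith
    have "Re (\<i> * F1 - P1 * Q1 / 2) = - Im F1 - Re (P1 * Q1) / 2" by (simp del: times_complex.sel)
    also have "\<dots> \<le> 1/2 + - (\<beta> / 2 * \<bar>\<sigma>\<bar>)" by (rule aux[OF ImF RePQ])
    finally show "exp (Re (\<i> * F1 - P1 * Q1 / 2)) \<le> exp (1/2 + (- (\<beta> / 2) * \<bar>\<sigma>\<bar>))" by simp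
  qed auto
  also have "\<dots> = exp (1/2) * (exp (- (\<beta> / 2) * \<bar>\<sigma>\<bar>) * 3)" by (simp only: exp_add mult.assoc)
  also have "\<dots> \<le> 2 * (exp (- (\<beta> / 2) * \<bar>\<sigma>\<bar>) * 3)" by (intro mult_right_mono e2) auto
  finally show ?thesis by simp
qed

lemma GG_holomorphic:
  assumes k: "k \<le> n" and v: "\<And>j. j \<le> n \<Longrightarrow> \<bar>v j\<bar> \<le> r"
  shows "(\<lambda>w. GG s c e x d K L z \<xi> ((\<lambda>j. of_real (v j))(k := w))) holomorphic_on cball 0 r"
proof -
  let ?u = "\<lambda>w. (\<lambda>j. complex_of_real (v j))(k := w)"
  have pdu: "pd (?u w)" if "w \<in> cball 0 r" for w using that v by (auto simp: pd_def)
  have hu: "(\<lambda>w. ?u w j) holomorphic_on A" for j A by (cases "j = k") (auto intro: holomorphic_on_ident holomorphic_on_const)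
  have hh: "(\<lambda>w. hs d K (?u w) i) holomorphic_on A" for i A unfolding hs_def by (intro holomorphic_intros hu)
  have hP: "(\<lambda>w. NP s c e x d K (?u w) i) holomorphic_on A" for i A unfolding NP_def by (intro holomorphic_intros hh)
  have hQ: "(\<lambda>w. NQ s c e x d K (?u w) i) holomorphic_on A" for i A unfolding NQ_def by (intro holomorphic_intros hh)
  have nz0: "y \<noteq> 0" if "near (1/100) y 1" for y using near1_bounds[OF that] by auto
  have PPh: "(\<lambda>w. PP s c e x d K L z (?u w)) holomorphic_on cball 0 r"
    unfolding PP_def sP_def sp_def
    by (intro holomorphic_intros sv_sq_holomorphic hP) (use qP_near[OF pdu, of _ L, THEN nz0] in auto)
  have QQh: "(\<lambda>w. QQ s c e x d K L z (?u w)) holomorphic_on cball 0 r"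
    unfolding QQ_def sP_def sp_def
    by (intro holomorphic_intros sv_sq_holomorphic hQ) (use qQ_near[OF pdu, of _ L, THEN nz0] in auto)
  have cmh: "(\<lambda>w. cmc d K L (?u w) x) holomorphic_on cball 0 r" unfolding cmc_def by (intro holomorphic_intros hu) auto
  show ?thesis unfolding GG_def by (intro holomorphic_intros PPh QQh cmh) auto
qed

end

lemma sP_measurable':
  assumes "\<And>i. (\<lambda>x. N x i) \<in> borel_measurable M"
  shows "(\<lambda>x. sP d (N x) z j) \<in> borel_measurable M"
  using sP_measurable[where N = N and z = "\<lambda>_. z" and M = M and d = d and j = j] assms by auto

lemma GG_measurable:
  assumes e: "\<And>i. (\<lambda>w. e w i) \<in> borel_measurable M" and x: "\<And>i. (\<lambda>w. x w i) \<in> borel_measurable M" and u: "\<And>i. (\<lambda>w. u w i) \<in> borel_measurable M"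
  shows "(\<lambda>w. GG s c (e w) (x w) d K L z \<xi> (u w)) \<in> borel_measurable M"
proof -
  note e [measurable] x [measurable] u [measurable]
  have nzm [measurable]: "(\<lambda>w. nz s c (e w) (x w) i) \<in> borel_measurable M" for i by (rule nz_measurable[OF e x])
  have hsm [measurable]: "(\<lambda>w. hs d K (u w) i) \<in> borel_measurable M" for i unfolding hs_def by measurable
  have P: "(\<lambda>w. PP s c (e w) (x w) d K L z (u w)) \<in> borel_measurable M"
    unfolding PP_def by (rule sP_measurable') (unfold NP_def, measurable)
  have Q: "(\<lambda>w. QQ s c (e w) (x w) d K L z (u w)) \<in> borel_measurable M"
    unfolding QQ_def by (rule sP_measurable') (unfold NQ_def, measurable)
  have C: "(\<lambda>w. cmc d K L (u w) (x w)) \<in> borel_measurable M" unfolding cmc_def by measurable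
  show ?thesis unfolding GG_def using P Q C by measurable
qed

context good_ctx
begin

lemma good_bound:
  assumes k: "k \<le> n" and v: "\<And>j. j \<le> n \<Longrightarrow> \<bar>v j\<bar> \<le> r" and \<beta>: "\<beta> > 0"
    and H0: "\<bar>Re (cnj \<xi> * \<i> * of_real c * (Sk (sq d (nz s c e x) z) d K k / (sq d (nz s c e x) z L)\<^sup>2))\<bar> \<ge> \<beta>"
    and err: "norm \<xi> * c * (10 * (c * r) * (real K * d)) \<le> \<beta> / 2"
  shows "norm (\<integral>y. GG s c e x d K L z \<xi> ((\<lambda>j. of_real (v j))(k := of_real y)) \<partial>psim M r) \<le> 24 * (4 ^ M * fact M / (\<beta> / 2 * r) ^ M)"
proof -
  define h where "h = Re (cnj \<xi> * \<i> * of_real c * (Sk (sq d (nz s c e x) z) d K k / (sq d (nz s c e x) z L)\<^sup>2))"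
  \<comment> \<open>If the derivative is negative, the shift variable is reflected, so that the
    upper triangle is always the right one. \<open>bump\<close> is even, so the average does not
    change.\<close>
  define sg :: real where "sg = (if h \<ge> 0 then 1 else -1)"
  have sg: "sg = 1 \<or> sg = -1" "sg * h \<ge> 0" by (auto simp: sg_def)
  define G where "G = (\<lambda>w. GG s c e x d K L z \<xi> ((\<lambda>j. of_real (v j))(k := w)))"
  define G' where "G' = (\<lambda>w. G (of_real sg * w))"
  have sub: "(\<lambda>w. of_real sg * w) ` {\<zeta>. \<bar>Re \<zeta>\<bar> + \<bar>Im \<zeta>\<bar> \<le> r} \<subseteq> cball 0 r"
    using sg(1) by (auto intro: order_trans[OF cmod_le])
  have Gm: "(\<lambda>y. G (of_real (sg' * y))) \<in> borel_measurable borel" for sg' :: real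
    unfolding G_def by (rule GG_measurable) auto
  have "norm (\<integral>y. G' (of_real y) \<partial>psim M r) \<le> 4 * 6 * (4 ^ M * fact M / (\<beta> / 2 * r) ^ M)"
  proof (rule contour_bound_upper[OF r0])
    show "(\<lambda>y. G' (of_real y)) \<in> borel_measurable borel" using Gm[of sg] by (simp add: G'_def)
    show "G' holomorphic_on {\<zeta>. \<bar>Re \<zeta>\<bar> + \<bar>Im \<zeta>\<bar> \<le> r}"
      unfolding G'_def using holomorphic_on_compose_gen[OF _ GG_holomorphic[OF k v, where \<xi> = \<xi>] sub] 
      by (auto simp: o_def G_def intro!: holomorphic_intros)
    fix a y :: real assume ay: "\<bar>a\<bar> + y \<le> r" "0 \<le> y"
    have "of_real sg * Complex a y = Complex (sg * a) (sg * y)" by (simp add: complex_eq_iff)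
    hence "G' (Complex a y) = GG s c e x d K L z \<xi> ((\<lambda>j. of_real (v j))(k := Complex (sg * a) (sg * y)))"
      by (simp add: G'_def G_def)
    also have "norm \<dots> \<le> 6 * exp (- (\<beta> / 2) * \<bar>sg * y\<bar>)"
    proof (rule GG_bound[OF k v])
      show "\<bar>sg * a\<bar> + \<bar>sg * y\<bar> \<le> r" using ay sg(1) by auto
      have "0 \<le> y * (sg * h)" using ay sg(2) by simp
      thus "0 \<le> sg * y * Re (cnj \<xi> * \<i> * of_real c * (Sk (sq d (nz s c e x) z) d K k / (sq d (nz s c e x) z L)\<^sup>2))"
        unfolding h_def[symmetric] by (simp add: mult_ac)
    qed (use H0 err in auto)
    finally show "norm (G' (Complex a y)) \<le> 6 * exp (- (\<beta> / 2) * y)" using ay sg(1) by (auto simp: abs_mult)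
  qed (use \<beta> in auto)
  moreover have "(\<integral>y. G' (of_real y) \<partial>psim M r) = (\<integral>y. G (of_real y) \<partial>psim M r)"
  proof (cases "sg = 1")
    case False
    hence sg1: "sg = -1" using sg by auto
    have b: "bump M r (- y) = bump M r y" for y by (simp add: bump_def)
    have nn: "0 \<le> bump M r y / bump_mass M r" for y using bump_bounds[OF r0] bump_mass_pos[OF r0, of M] by auto
    have "(\<integral>y. G' (of_real y) \<partial>psim M r) = (\<integral>y. (bump M r y / bump_mass M r) *\<^sub>R G (of_real (- y)) \<partial>lborel)"
      unfolding psim_def G'_def sg1 using Gm[of "-1"] nn by (subst integral_density) auto
    also have "\<dots> = (\<integral>y. (bump M r (- y) / bump_mass M r) *\<^sub>R G (of_real y) \<partial>lborel)"
      by (subst lborel_integral_real_affine[where c = "-1" and t = 0]) auto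
    also have "\<dots> = (\<integral>y. G (of_real y) \<partial>psim M r)"
      unfolding b psim_def using Gm[of 1] nn by (subst integral_density) auto
    finally show ?thesis .
  qed (simp add: G'_def)
  ultimately show ?thesis unfolding G_def by simp
qed

end

lemma PiM_comp_measurable:
  "f \<in> measurable M (PiM I (\<lambda>_. borel :: real measure)) \<Longrightarrow> (\<lambda>x. f x i) \<in> borel_measurable M"
  by (rule measurable_compose[OF _ PiM_component_measurable])

section \<open>Averaging over real shifts\<close>

definition FF :: "real \<Rightarrow> real \<Rightarrow> (nat \<Rightarrow> real) \<Rightarrow> real \<Rightarrow> nat \<Rightarrow> complex \<Rightarrow> complex \<Rightarrow> (nat \<Rightarrow> real) \<Rightarrow> complex" where
  "FF s c e d L z \<xi> x = exp (\<i> * of_real (Re (cnj \<xi> * sP d (nz s c e x) z L)) - of_real ((norm (sP d (nz s c e x) z L))\<^sup>2 / 2))"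

abbreviation FFint where
  "FFint s c d L z \<xi> \<equiv> \<integral>e. (\<integral>x. FF s c e d L z \<xi> x \<partial>Gam d L) \<partial>Gam d L"

lemma norm_FF: "norm (FF s c e d L z \<xi> x) \<le> 1"
  by (simp add: FF_def norm_exp_eq_Re)

lemma FF_measurable:
  assumes "\<And>i. (\<lambda>w. e w i) \<in> borel_measurable M" "\<And>i. (\<lambda>w. x w i) \<in> borel_measurable M"
  shows "(\<lambda>w. FF s c (e w) d L z \<xi> (x w)) \<in> borel_measurable M"
proof -
  have [measurable]: "(\<lambda>w. sP d (nz s c (e w) (x w)) z L) \<in> borel_measurable M"
    by (rule sP_measurable') (rule nz_measurable[OF assms])
  show ?thesis unfolding FF_def by measurable
qed

definition av :: "real \<Rightarrow> nat \<Rightarrow> (nat \<Rightarrow> real) \<Rightarrow> nat \<Rightarrow> real" where "av d K v i = d * v (i div K)"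

lemma sP_cong: "(\<And>i. i \<le> j \<Longrightarrow> N i = N' i) \<Longrightarrow> sP d N z j = sP d N' z j"
  using sch_cong[of j N N' d z] by (simp add: sP_def sp_def sv_def sq_def)

lemma cmc_real: "d > 0 \<Longrightarrow> cmc d K L (\<lambda>j. of_real (v j)) x = of_real (cmw d L (av d K v) x)"
proof -
  assume d: "d > 0"
  have "(\<Sum>i<L. complex_of_real (v (i div K)) * of_real (x i) + of_real d * (complex_of_real (v (i div K)))\<^sup>2 / 2)
     = of_real (\<Sum>i<L. av d K v i * x i / d + (av d K v i)\<^sup>2 / (2 * d))"
    unfolding of_real_sum using d by (intro sum.cong) (auto simp: av_def power2_eq_square)
  thus ?thesis unfolding cmc_def cmw_def by (simp only: exp_of_real[symmetric] of_real_minus)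
qed

lemma GG_real:
  assumes d: "d > 0"
  shows "GG s c e x d K L z \<xi> (\<lambda>j. of_real (v j)) = cmw d L (av d K v) x *\<^sub>R FF s c e d L z \<xi> (shiftv (av d K v) L x)"
proof -
  define P where "P = sP d (nz s c e (shiftv (av d K v) L x)) z L"
  have e1: "PP s c e x d K L z (\<lambda>j. of_real (v j)) = P"
    unfolding PP_def P_def NP_cnj
    by (rule sP_cong, rule nz_cong) (simp add: shiftv_def av_def)
  have "QQ s c e x d K L z (\<lambda>j. of_real (v j)) = cnj (PP s c e x d K L z (\<lambda>j. of_real (v j)))"
    unfolding QQ_def PP_def cnj_sP[symmetric] NQ_cnj ..
  hence e2: "QQ s c e x d K L z (\<lambda>j. of_real (v j)) = cnj P" by (simp only: e1)
  have "(cnj \<xi> * P + \<xi> * cnj P) / 2 = of_real (Re (cnj \<xi> * P))" by (simp add: complex_eq_iff)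
  hence e3: "\<i> * (cnj \<xi> * P + \<xi> * cnj P) / 2 = \<i> * of_real (Re (cnj \<xi> * P))" by (simp only: times_divide_eq_right[symmetric])
  have e4: "P * cnj P / 2 = of_real ((norm P)\<^sup>2 / 2)" by (simp add: complex_norm_square[symmetric])
  show ?thesis unfolding GG_def cmc_real[OF d] FF_def P_def[symmetric] e1 e2 e3 e4
    by (simp only: scaleR_conv_of_real mult.commute)
qed

context good_ctx
begin

lemma Sk_bound: "k \<le> n \<Longrightarrow> norm (Sk (sq d (nz s c e x) z) d K k) \<le> 1021/1000 * (real K * d)"
proof -
  assume k: "k \<le> n"
  have "norm (Sk (sq d (nz s c e x) z) d K k) \<le> (\<Sum>m<K. d * (1021/1000))"
    unfolding Sk_def
  proof (rule sum_norm_le)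
    fix m assume "m \<in> {..<K}"
    hence "k * K + m + 1 \<le> (k + 1) * K" by (simp add: algebra_simps)
    hence j: "k * K + m + 1 \<le> L" using kKL[OF k] by linarith
    have "norm (sq d (nz s c e x) z (k * K + m + 1)) \<le> 101/100" using near1_bounds[OF q0_near[OF j]] by blast
    hence "(norm (sq d (nz s c e x) z (k * K + m + 1)))\<^sup>2 \<le> (101/100)\<^sup>2" by (intro power_mono) auto
    hence "(norm (sq d (nz s c e x) z (k * K + m + 1)))\<^sup>2 \<le> 1021/1000" by (simp add: power2_eq_square)
    thus "norm (of_real d * (sq d (nz s c e x) z (k * K + m + 1))\<^sup>2) \<le> d * (1021/1000)"
      using d by (simp add: norm_mult norm_power)
  qed
  thus ?thesis by (simp add: mult_ac)
qed

text \<open>If \<open>w * S_k\<close> and \<open>w * S_0\<close> have real parts at most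
  \<open>\<beta>\<close>, both are nearly imaginary and hence nearly parallel; dividing by
  \<open>|w|^2\<close> removes the common factor. This matters because \<open>w\<close> contains
  \<open>q\<close> at the final time: the conclusion speaks of the path up to the end of piece
  \<open>k\<close> only, as \<open>bad_prob\<close> requires.\<close>

lemma bad_imp_Aev:
  assumes k: "k \<in> {1..n}" and xi: "\<xi> \<noteq> 0" and b: "\<beta> \<ge> 0"
    and bad: "\<And>k. k \<le> n \<Longrightarrow> \<bar>Re (cnj \<xi> * \<i> * of_real c * (Sk (sq d (nz s c e x) z) d K k / (sq d (nz s c e x) z L)\<^sup>2))\<bar> \<le> \<beta>"
  shows "nonosc s c e d z K (3 * \<beta> * (real K * d) / (norm \<xi> * c)) k x"
proof -
  define q where "q = sq d (nz s c e x) z L"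
  define S where "S = Sk (sq d (nz s c e x) z) d K"
  define w where "w = cnj \<xi> * \<i> * of_real c / q\<^sup>2"
  have qb: "norm q \<le> 101/100" "norm q \<ge> 99/100" using near1_bounds[OF q0_near[of L]] by (auto simp: q_def)
  have q2: "(norm q)\<^sup>2 \<le> 1021/1000" using power_mono[OF qb(1), of 2] by (simp add: power2_eq_square)
  have q2p: "(norm q)\<^sup>2 > 0" using qb by (intro zero_less_power) linarith
  have nw: "norm w = norm \<xi> * c / (norm q)\<^sup>2" using c by (simp add: w_def norm_mult norm_divide norm_power)
  have wp: "norm w > 0" unfolding nw using xi c q2p by simp
  have R: "\<bar>Re (w * S j)\<bar> \<le> \<beta>" if "j \<le> n" for j
    using bad[OF that] unfolding w_def S_def q_def by (simp add: mult_ac)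
  have Sb: "norm (S j) \<le> 1021/1000 * (real K * d)" if "j \<le> n" for j using Sk_bound[OF that] by (simp add: S_def)
  have kn: "k \<le> n" "0 \<le> n" using k by auto
  have im: "\<bar>Im (a * cnj b)\<bar> \<le> \<beta> * (norm a + norm b)" if "\<bar>Re a\<bar> \<le> \<beta>" "\<bar>Re b\<bar> \<le> \<beta>" for a b
  proof -
    have "Im (a * cnj b) = Im a * Re b - Re a * Im b" by simp
    hence "\<bar>Im (a * cnj b)\<bar> \<le> \<bar>Im a\<bar> * \<bar>Re b\<bar> + \<bar>Re a\<bar> * \<bar>Im b\<bar>" by (simp only: abs_mult[symmetric] abs_triangle_ineq4)
    also have "\<dots> \<le> norm a * \<beta> + \<beta> * norm b"
      using that abs_Im_le_cmod[of a] abs_Im_le_cmod[of b] b by (intro add_mono mult_mono) auto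
    finally show ?thesis by (simp add: algebra_simps)
  qed
  have e: "(w * S k) * cnj (w * S 0) = of_real ((norm w)\<^sup>2) * (cnj (S 0) * S k)"
    unfolding complex_norm_square by (simp add: mult_ac)
  have "\<bar>Im ((w * S k) * cnj (w * S 0))\<bar> \<le> \<beta> * (norm (w * S k) + norm (w * S 0))"
    by (rule im) (use R kn in auto)
  hence "(norm w)\<^sup>2 * \<bar>Im (cnj (S 0) * S k)\<bar> \<le> \<beta> * (norm w * norm (S k) + norm w * norm (S 0))"
  proof -
    have imr: "Im (of_real r * y) = r * Im y" for r y by simp
    assume "\<bar>Im ((w * S k) * cnj (w * S 0))\<bar> \<le> \<beta> * (norm (w * S k) + norm (w * S 0))"
    thus ?thesis unfolding e imr abs_mult abs_power2 norm_mult .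
  qed
  also have "\<dots> = norm w * (\<beta> * (norm (S k) + norm (S 0)))" by (simp add: algebra_simps)
  finally have "norm w * (norm w * \<bar>Im (cnj (S 0) * S k)\<bar>) \<le> norm w * (\<beta> * (norm (S k) + norm (S 0)))"
    by (simp add: power2_eq_square mult.assoc)
  hence "norm w * \<bar>Im (cnj (S 0) * S k)\<bar> \<le> \<beta> * (norm (S k) + norm (S 0))" using wp by simp
  also have "\<dots> \<le> \<beta> * (1021/1000 * (real K * d) + 1021/1000 * (real K * d))"
    using Sb kn b by (intro mult_left_mono add_mono) auto
  finally have "\<bar>Im (cnj (S 0) * S k)\<bar> \<le> \<beta> * (2042/1000 * (real K * d)) / norm w"
    using wp by (simp add: pos_le_divide_eq mult.commute)
  also have "\<dots> = (norm q)\<^sup>2 * (\<beta> * (2042/1000 * (real K * d)) / (norm \<xi> * c))" unfolding nw by simp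
  also have "\<dots> \<le> 1021/1000 * (\<beta> * (2042/1000 * (real K * d)) / (norm \<xi> * c))"
    using q2 b d c by (intro mult_right_mono) auto
  also have "\<dots> = (1021/1000 * (2042/1000)) * (\<beta> * (real K * d) / (norm \<xi> * c))" by simp
  also have "\<dots> \<le> 3 * (\<beta> * (real K * d) / (norm \<xi> * c))"
    using b d c by (intro mult_right_mono) auto
  finally have "\<bar>Im (cnj (S 0) * S k)\<bar> \<le> 3 * \<beta> * (real K * d) / (norm \<xi> * c)" by simp
  thus ?thesis unfolding nonosc_def S_def using cx_mono[OF cxx kKL[OF kn(1)]] by simp
qed

end

lemma product_psim: "r > 0 \<Longrightarrow> product_prob_space (\<lambda>_. psim M r)"
  by (simp add: product_prob_space_def product_prob_space_axioms_def product_sigma_finite_def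
    prob_space_psim prob_space_imp_sigma_finite)

definition Um :: "nat \<Rightarrow> real \<Rightarrow> nat set \<Rightarrow> (nat \<Rightarrow> real) measure" where "Um M r I = PiM I (\<lambda>_. psim M r)"

lemma sets_Um [simp, measurable_cong]: "sets (Um M r I) = sets (PiM I (\<lambda>_. borel))"
  unfolding Um_def by (intro sets_PiM_cong) auto

lemma prob_space_Um: "r > 0 \<Longrightarrow> prob_space (Um M r I)"
  unfolding Um_def by (intro prob_space_PiM prob_space_psim)

lemma AE_Um:
  assumes r: "r > 0" and I: "finite I" shows "AE v in Um M r I. \<forall>j\<in>I. \<bar>v j\<bar> \<le> r"
proof (rule AE_finite_allI[OF I])
  fix i assume i: "i \<in> I"
  show "AE v in Um M r I. \<bar>v i\<bar> \<le> r" unfolding Um_def by (rule AE_PiM_component[OF prob_space_psim[OF r] i AE_psim[OF r]])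
qed

text \<open>Each fixed real shift leaves the expectation unchanged, so a random one does too. After
  Fubini the inner average is, for every path, an oscillating integral open to contour
  deformation.\<close>

lemma FFE_identity:
  assumes d: "d > 0" and r: "r > 0" and L: "L = (n + 1) * K"
  shows "(\<integral>x. FF s c e d L z \<xi> x \<partial>Gam d L) = (\<integral>x. (\<integral>v. GG s c e x d K L z \<xi> (\<lambda>j. of_real (v j)) \<partial>Um M r {..n}) \<partial>Gam d L)"
proof -
  interpret U: prob_space "Um M r {..n}" by (rule prob_space_Um[OF r])
  interpret G: prob_space "Gam d L" by (rule prob_space_Gam[OF d])
  interpret P: pair_sigma_finite "Um M r {..n}" "Gam d L" ..
  define g where "g = (\<lambda>v x. GG s c e x d K L z \<xi> (\<lambda>j. of_real (v j)))"
  have gm [measurable]: "case_prod g \<in> borel_measurable (Um M r {..n} \<Otimes>\<^sub>M Gam d L)"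
    unfolding g_def case_prod_beta
  proof (rule GG_measurable)
    fix i
    have f: "(\<lambda>p. fst p i) \<in> borel_measurable (Um M r {..n} \<Otimes>\<^sub>M Gam d L)"
      by (rule PiM_comp_measurable[OF measurable_compose[OF measurable_fst]]) (rule measurable_ident_sets, simp)
    show "(\<lambda>p. snd p i) \<in> borel_measurable (Um M r {..n} \<Otimes>\<^sub>M Gam d L)"
      by (rule PiM_comp_measurable[OF measurable_compose[OF measurable_snd]]) (rule measurable_ident_sets, simp)
    show "(\<lambda>p. complex_of_real (fst p i)) \<in> borel_measurable (Um M r {..n} \<Otimes>\<^sub>M Gam d L)" using f by measurable
  qed simp
  have gb: "norm (g v x) \<le> cmw d L (av d K v) x" for v x
    unfolding g_def GG_real[OF d] using norm_FF[of s c e d L z \<xi> "shiftv (av d K v) L x"] cmw_pos[of d L "av d K v" x] by simp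
  have g1: "(\<integral>\<^sup>+x. ennreal (norm (g v x)) \<partial>Gam d L) \<le> 1" for v
  proof -
    have "(\<integral>\<^sup>+x. ennreal (norm (g v x)) \<partial>Gam d L) \<le> (\<integral>\<^sup>+x. ennreal (cmw d L (av d K v) x) \<partial>Gam d L)"
      by (intro nn_integral_mono ennreal_leI gb)
    thus ?thesis by (simp add: nn_integral_cmw[OF d])
  qed
  have ig: "integrable (Um M r {..n} \<Otimes>\<^sub>M Gam d L) (case_prod g)"
  proof (rule integrableI_bounded)
    have "(\<integral>\<^sup>+p. ennreal (norm (case_prod g p)) \<partial>(Um M r {..n} \<Otimes>\<^sub>M Gam d L)) = (\<integral>\<^sup>+v. \<integral>\<^sup>+x. ennreal (norm (g v x)) \<partial>Gam d L \<partial>Um M r {..n})"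
      by (subst G.nn_integral_fst[symmetric]) auto
    also have "\<dots> \<le> (\<integral>\<^sup>+v. 1 \<partial>Um M r {..n})" by (intro nn_integral_mono g1)
    also have "\<dots> = 1" using U.emeasure_space_1 by simp
    finally show "(\<integral>\<^sup>+p. ennreal (norm (case_prod g p)) \<partial>(Um M r {..n} \<Otimes>\<^sub>M Gam d L)) < \<infinity>"
      by (rule le_less_trans) simp
  qed measurable
  have FFm: "FF s c e d L z \<xi> \<in> borel_measurable (RL L)"
    using FF_measurable[of "\<lambda>_. e" "RL L" "\<lambda>x. x"] by simp
  have "(\<integral>x. FF s c e d L z \<xi> x \<partial>Gam d L) = (\<integral>x. g v x \<partial>Gam d L)" for v
    unfolding g_def GG_real[OF d] by (rule Gam_integral_shift[OF d FFm])
  hence "(\<integral>v. (\<integral>x. g v x \<partial>Gam d L) \<partial>Um M r {..n}) = (\<integral>v. (\<integral>x. FF s c e d L z \<xi> x \<partial>Gam d L) \<partial>Um M r {..n})"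
    by simp
  also have "\<dots> = (\<integral>x. FF s c e d L z \<xi> x \<partial>Gam d L)" by (simp add: U.prob_space)
  finally have "(\<integral>x. FF s c e d L z \<xi> x \<partial>Gam d L) = (\<integral>v. (\<integral>x. g v x \<partial>Gam d L) \<partial>Um M r {..n})" ..
  also have "\<dots> = (\<integral>x. (\<integral>v. g v x \<partial>Um M r {..n}) \<partial>Gam d L)" by (rule P.Fubini_integral[OF ig, symmetric])
  finally show ?thesis unfolding g_def .
qed

context good_ctx
begin

text \<open>Only the shift of the oscillating piece is deformed, and this piece may depend on the
  path; the other shifts stay real and are averaged afterwards.\<close>

lemma good_average:
  assumes k: "k \<le> n" and \<beta>: "\<beta> > 0"
    and H0: "\<bar>Re (cnj \<xi> * \<i> * of_real c * (Sk (sq d (nz s c e x) z) d K k / (sq d (nz s c e x) z L)\<^sup>2))\<bar> \<ge> \<beta>"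
    and err: "norm \<xi> * c * (10 * (c * r) * (real K * d)) \<le> \<beta> / 2"
  shows "norm (\<integral>v. GG s c e x d K L z \<xi> (\<lambda>j. of_real (v j)) \<partial>Um M r {..n}) \<le> 24 * (4 ^ M * fact M / (\<beta> / 2 * r) ^ M)"
    (is "_ \<le> ?B")
proof -
  define g where "g = (\<lambda>v. GG s c e x d K L z \<xi> (\<lambda>j. complex_of_real (v j)))"
  have gm: "g \<in> borel_measurable (Um M r I)" for I
    unfolding g_def by (rule GG_measurable) (auto cong: measurable_cong_sets)
  interpret U: prob_space "Um M r {..n}" by (rule prob_space_Um[OF r0])
  define I where "I = {..n} - {k}"
  have In: "{..n} = insert k I" "k \<notin> I" "finite I" using k by (auto simp: I_def)
  interpret UI: prob_space "Um M r I" by (rule prob_space_Um[OF r0])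
  interpret PS: product_prob_space "\<lambda>_::nat. psim M r" UNIV by (rule product_psim[OF r0])
  have gbd: "AE v in Um M r {..n}. norm (g v) \<le> 3"
    using AE_Um[OF r0 finite_atMost]
  proof eventually_elim
    case (elim v)
    have "norm (g v) \<le> cmw d L (av d K v) x * 1"
      unfolding g_def GG_real[OF d] norm_scaleR using norm_FF less_imp_le[OF cmw_pos] by (simp add: abs_of_pos cmw_pos)
    also have "\<dots> = norm (cmc d K L (\<lambda>j. of_real (v j)) x)" using cmw_pos[of d L "av d K v" x] by (simp add: cmc_real[OF d])
    also have "\<dots> \<le> 3" unfolding L_def
    proof (rule cmc_bound[OF d K0 c])
      show "cx c x ((n + 1) * K)" using cxx by (simp add: L_def)
      show "real K * d \<le> 1" using KL t1 by linarith
    qed (use elim r0 small in auto)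
    finally show ?case .
  qed
  have int: "integrable (Um M r {..n}) g" by (rule U.integrable_const_bound[OF gbd gm])
  have "(\<integral>v. g v \<partial>Um M r {..n}) = (\<integral>v. (\<integral>y. g (v(k := y)) \<partial>psim M r) \<partial>Um M r I)"
    using int unfolding Um_def In(1) by (intro PS.product_integral_insert In) auto
  hence "norm (\<integral>v. g v \<partial>Um M r {..n}) \<le> (\<integral>v. norm (\<integral>y. g (v(k := y)) \<partial>psim M r) \<partial>Um M r I)"
    using integral_norm_bound by metis
  also have "\<dots> \<le> (\<integral>v. ?B \<partial>Um M r I)"
  proof (rule integral_mono_AE')
    show "AE v in Um M r I. norm (\<integral>y. g (v(k := y)) \<partial>psim M r) \<le> ?B"
      using AE_Um[OF r0 In(3)]
    proof eventually_elim
      case (elim v)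
      have "g (v(k := y)) = GG s c e x d K L z \<xi> ((\<lambda>j. of_real ((v(k := 0)) j))(k := of_real y))" for y
        unfolding g_def by (rule arg_cong[where f = "GG s c e x d K L z \<xi>"]) auto
      thus ?case using good_bound[OF k _ \<beta> H0 err, of "v(k := 0)" M] elim r0 by (auto simp: I_def)
    qed
    show "AE v in Um M r I. 0 \<le> ?B" using \<beta> r0 by auto
  qed auto
  also have "\<dots> = ?B" by (simp add: UI.prob_space)
  finally show ?thesis unfolding g_def .
qed

end

text \<open>Undoing the shift removes the weight. As \<open>c * r <= 1/2\<close>, the shift moves
  the scaled path by at most 1/2, so without confinement the unshifted path must reach
  \<open>1 / (2 * c)\<close>.\<close>

lemma cmw_tail:
  assumes d: "d > 0" and K: "K > 0" and c: "c > 0" and L: "L = (n + 1) * K" and r: "r > 0" and cr: "c * r \<le> 1/2" and Ld: "real L * d \<le> 1"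
    and v: "\<And>j. j \<le> n \<Longrightarrow> \<bar>v j\<bar> \<le> r"
  shows "(\<integral>\<^sup>+x. (if cx c x L then 0 else 1) * ennreal (cmw d L (av d K v) x) \<partial>Gam d L) \<le> ennreal (4 * exp (- (1 / (2 * c)) / sqrt (real L * d)))"
proof -
  interpret G: prob_space "Gam d L" by (rule prob_space_Gam[OF d])
  have Lp: "L > 0" using K L by simp
  define f :: "(nat \<Rightarrow> real) \<Rightarrow> ennreal" where "f = (\<lambda>x. if cx c (shiftv (\<lambda>j. - av d K v j) L x) L then 0 else 1)"
  have cm [measurable]: "Measurable.pred (RL L) (\<lambda>x. cx c x L)" by (rule cx_measurable) simp
  have [measurable]: "f \<in> borel_measurable (RL L)"
    unfolding f_def using measurable_compose[OF shiftv_measurable cm] by measurable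
  have "(\<integral>\<^sup>+x. (if cx c x L then 0 else 1) * ennreal (cmw d L (av d K v) x) \<partial>Gam d L)
     = (\<integral>\<^sup>+x. ennreal (cmw d L (av d K v) x) * f (shiftv (av d K v) L x) \<partial>Gam d L)"
  proof (rule nn_integral_cong)
    fix x assume x: "x \<in> space (Gam d L)"
    have "shiftv (\<lambda>j. - av d K v j) L (shiftv (av d K v) L x) = x" using shiftv_cancel[OF x, of "\<lambda>j. - av d K v j"] by simp
    thus "(if cx c x L then 0 else 1) * ennreal (cmw d L (av d K v) x) = ennreal (cmw d L (av d K v) x) * f (shiftv (av d K v) L x)"
      by (simp add: f_def mult.commute)
  qed
  also have "\<dots> = (\<integral>\<^sup>+x. f x \<partial>Gam d L)" by (rule Gam_nn_shift[OF d, symmetric]) measurable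
  also have "\<dots> \<le> (\<integral>\<^sup>+x. indicator (exceed d L (1 / (2 * c))) x \<partial>Gam d L)"
  proof (rule nn_integral_mono)
    fix x assume x: "x \<in> space (Gam d L)"
    show "f x \<le> indicator (exceed d L (1 / (2 * c))) x"
    proof (cases "cx c (shiftv (\<lambda>j. - av d K v j) L x) L")
      case False
      then obtain j where j: "j \<le> L" "\<bar>c * (\<Sum>i<j. shiftv (\<lambda>j. - av d K v j) L x i)\<bar> > 1" by (auto simp: cx_def)
      have "(\<Sum>i<j. shiftv (\<lambda>j. - av d K v j) L x i) = (\<Sum>i<j. x i - av d K v i)"
        using j by (intro sum.cong) (auto simp: shiftv_def)
      also have "\<dots> = (\<Sum>i<j. x i) - (\<Sum>i<j. av d K v i)" by (rule sum_subtractf)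
      finally have e: "(\<Sum>i<j. shiftv (\<lambda>j. - av d K v j) L x i) = (\<Sum>i<j. x i) - (\<Sum>i<j. av d K v i)" .
      have "\<bar>\<Sum>i<j. av d K v i\<bar> \<le> (\<Sum>i<j. d * r)"
      proof (rule order_trans[OF sum_abs], rule sum_mono)
        fix i assume "i \<in> {..<j}"
        hence "i < (n + 1) * K" using j L by auto
        hence "i div K < n + 1" using K by (simp add: less_mult_imp_div_less)
        thus "\<bar>av d K v i\<bar> \<le> d * r" using v[of "i div K"] d by (simp add: av_def abs_mult)
      qed
      also have "\<dots> = (real j * d) * r" by simp
      also have "\<dots> \<le> (real L * d) * r" using j d r by (intro mult_right_mono) auto
      also have "\<dots> \<le> 1 * r" using Ld r by (intro mult_right_mono) auto
      finally have "c * \<bar>\<Sum>i<j. av d K v i\<bar> \<le> c * (1 * r)" using c by (intro mult_left_mono) auto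
      moreover have "\<bar>c * (\<Sum>i<j. av d K v i)\<bar> = c * \<bar>\<Sum>i<j. av d K v i\<bar>" using c by (simp add: abs_mult)
      ultimately have a: "\<bar>c * (\<Sum>i<j. av d K v i)\<bar> \<le> 1/2" using cr by linarith
      have "1 < \<bar>c * (\<Sum>i<j. x i) - c * (\<Sum>i<j. av d K v i)\<bar>" using j(2) unfolding e right_diff_distrib .
      hence "\<bar>c * (\<Sum>i<j. x i)\<bar> \<ge> 1/2" using a by linarith
      hence "\<bar>\<Sum>i<j. x i\<bar> \<ge> 1 / (2 * c)" using c by (simp add: abs_mult field_simps)
      thus ?thesis using j x by (auto simp: indicator_def f_def)
    qed (simp add: f_def)
  qed
  also have "\<dots> = emeasure (Gam d L) (exceed d L (1 / (2 * c)))"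
    by (rule nn_integral_indicator, unfold sets_Gam, rule Gam_Collect_sets) measurable
  also have "\<dots> \<le> ennreal (4 * exp (- (1 / (2 * c)) / sqrt (real L * d)))"
    unfolding G.emeasure_eq_measure using Gam_maximal[OF d _ Lp, of "1 / (2 * c)"] c by (intro ennreal_leI) auto
  finally show ?thesis .
qed

lemma norm_integral_le_nn:
  fixes f :: "'a \<Rightarrow> 'b::{banach, second_countable_topology}"
  shows "ennreal (norm (\<integral>x. f x \<partial>M)) \<le> (\<integral>\<^sup>+x. ennreal (norm (f x)) \<partial>M)"
proof (cases "integrable M f")
  case True thus ?thesis by (rule integral_norm_bound_ennreal)
qed (simp add: not_integrable_integral_eq)

section \<open>The decay estimate for the scheme\<close>

text \<open>The three terms belong to paths that oscillate in some piece, to confined paths that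
  oscillate in none, and to paths that are not confined. They are treated by
  \<open>good_average\<close>, \<open>bad_prob\<close> and \<open>cmw_tail\<close>.\<close>

lemma FF_decay_inner:
  fixes s c d R :: real and e :: "nat \<Rightarrow> real" and \<xi> :: complex
  assumes d: "d > 0" and K2: "K \<ge> 2" and c: "c > 0" and zR: "norm z \<le> R" and L_def: "L = (n + 1) * K"
    and t: "real L * d * (R + 7) \<le> 1/100" and cxe: "cx s e L"
    and l: "l = real K * d" and r: "r = l ^ 4 / (20 * c\<^sup>2)" and cr: "c * r \<le> 1/2"
    and small: "real (n + 1) * (2 * r / c + r\<^sup>2) \<le> 1" and xi: "\<xi> \<noteq> 0"
  shows "norm (\<integral>x. FF s c e d L z \<xi> x \<partial>Gam d L) \<le> 24 * (4 ^ M * fact M / (l ^ 4 * norm \<xi> / 2 * r) ^ M)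
     + 3 * (72 * exp (2 / c + 1) / c\<^sup>2 * l) ^ n + 4 * exp (- (1 / (2 * c)) / sqrt (real L * d))"
proof -
  have K0: "K > 0" using K2 by simp
  let ?E = "4 * exp (- (1 / (2 * c)) / sqrt (real L * d))" and ?G = "\<lambda>x v. GG s c e x d K L z \<xi> (\<lambda>j. of_real (v j))" and ?w = "\<lambda>v x. ennreal (cmw d L (av d K v) x)"
  let ?I = "\<lambda>x. if cx c x L then 0 else 1 :: ennreal" and ?T = "\<lambda>x k. \<bar>Re (cnj \<xi> * \<i> * of_real c * (Sk (sq d (nz s c e x) z) d K k / (sq d (nz s c e x) z L)\<^sup>2))\<bar>" and ?Q = "(72 * exp (2 / c + 1) / c\<^sup>2 * l) ^ n"
  have lp: "l > 0" using K0 d by (simp add: l)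
  have r0: "r > 0" using lp c by (simp add: r)
  have R0: "R \<ge> 0" using zR norm_ge_zero[of z] by linarith
  have Ld1: "real L * d \<le> 1"
  proof -
    have "real L * d * 7 \<le> real L * d * (R + 7)" using R0 d by (intro mult_left_mono) auto
    thus ?thesis using t by linarith
  qed
  have lL: "l \<le> real L * d" unfolding L_def l using d by (intro mult_right_mono) auto
  have l1: "l \<le> 1" using lL Ld1 by linarith
  define \<beta> where "\<beta> = l ^ 4 * norm \<xi>"
  have \<beta>: "\<beta> > 0" using lp xi by (simp add: \<beta>_def)
  define B where "B = 24 * (4 ^ M * fact M / (\<beta> / 2 * r) ^ M)"
  have B0: "B \<ge> 0" using \<beta> r0 by (simp add: B_def)
  have err: "norm \<xi> * c * (10 * (c * r) * (real K * d)) \<le> \<beta> / 2"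
  proof -
    have "norm \<xi> * c * (10 * (c * r) * (real K * d)) = (\<beta> / 2) * l"
      unfolding l[symmetric] r \<beta>_def using c by (simp add: field_simps power2_eq_square)
    also have "\<dots> \<le> (\<beta> / 2) * 1" using l1 \<beta> by (intro mult_left_mono) auto
    finally show ?thesis by simp
  qed
  \<comment> \<open>The tolerance from \<open>bad_imp_Aev\<close>, equal to
    \<open>3 * l^5 / c\<close>. Divided by the turning rate \<open>l^4\<close> it leaves the factor
    \<open>l\<close> for each piece.\<close>
  define \<beta>' where "\<beta>' = 3 * \<beta> * l / (norm \<xi> * c)"
  have \<beta>'0: "\<beta>' \<ge> 0" using \<beta> lp c by (simp add: \<beta>'_def)
  define A where "A = (\<lambda>x. \<forall>k\<in>{1..n}. nonosc s c e d z K \<beta>' k x)"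
  interpret G: prob_space "Gam d L" by (rule prob_space_Gam[OF d])
  interpret U: prob_space "Um M r {..n}" by (rule prob_space_Um[OF r0])
  interpret P: pair_sigma_finite "Um M r {..n}" "Gam d L" ..
  define h where "h = (\<lambda>x. \<integral>v. ?G x v \<partial>Um M r {..n})"
  define w where "w = (\<lambda>x. \<integral>\<^sup>+v. ?w v x \<partial>Um M r {..n})"
  have cm [measurable]: "Measurable.pred (RL L) (\<lambda>x. cx c x L)" by (rule cx_measurable) simp
  have Am [measurable]: "Measurable.pred (RL L) A"
  proof -
    have [measurable]: "Measurable.pred (RL L) (nonosc s c e d z K \<beta>' k)" for k
      using nonosc_measurable[of "\<lambda>x. x" "RL L"] by simp
    show ?thesis unfolding A_def by measurable
  qed
  have cmwm: "(\<lambda>p. cmw d L (av d K (fst p)) (snd p)) \<in> borel_measurable (Um M r {..n} \<Otimes>\<^sub>M Gam d L)"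
  proof -
    have f [measurable]: "(\<lambda>p. fst p i) \<in> borel_measurable (Um M r {..n} \<Otimes>\<^sub>M Gam d L)" for i
      by (rule PiM_comp_measurable[OF measurable_compose[OF measurable_fst]]) (rule measurable_ident_sets, simp)
    have g [measurable]: "(\<lambda>p. snd p i) \<in> borel_measurable (Um M r {..n} \<Otimes>\<^sub>M Gam d L)" for i
      by (rule PiM_comp_measurable[OF measurable_compose[OF measurable_snd]]) (rule measurable_ident_sets, simp)
    show ?thesis unfolding cmw_def av_def by measurable
  qed
  have wm [measurable]: "w \<in> borel_measurable (RL L)"
  proof -
    have "(\<lambda>p. cmw d L (av d K (snd p)) (fst p)) \<in> borel_measurable (Gam d L \<Otimes>\<^sub>M Um M r {..n})"
      using measurable_compose[OF measurable_pair_swap' cmwm] by (simp add: case_prod_beta)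
    hence "w \<in> borel_measurable (Gam d L)" unfolding w_def by (intro U.borel_measurable_nn_integral) (simp add: case_prod_beta)
    thus ?thesis by simp
  qed
  have GGn: "norm (?G x v) \<le> cmw d L (av d K v) x" for v x
    unfolding GG_real[OF d] using norm_FF[of s c e d L z \<xi> "shiftv (av d K v) L x"] cmw_pos[of d L "av d K v" x] by simp
  have pt: "ennreal (norm (h x)) \<le> ennreal B + 3 * (if A x then 1 else 0) + ?I x * w x" for x
  proof (cases "cx c x L")
    case False
    have "ennreal (norm (h x)) \<le> w x"
      unfolding h_def w_def by (rule order_trans[OF norm_integral_le_nn]) (intro nn_integral_mono ennreal_leI GGn)
    thus ?thesis using False by (simp add: add_increasing)
  next
    case True
    interpret good_ctx s c d R r e x K n L z
      by unfold_locales (use d K2 c zR L_def t cxe True r0 cr small in auto)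
    show ?thesis
    proof (cases "\<exists>k\<le>n. ?T x k \<ge> \<beta>")
      case True
      then obtain k where k: "k \<le> n" "?T x k \<ge> \<beta>" by blast
      have "norm (h x) \<le> B" unfolding h_def B_def by (rule good_average[OF k(1) \<beta> k(2) err])
      thus ?thesis by (intro add_increasing2 ennreal_leI) auto
    next
      case False
      hence bad: "?T x k \<le> \<beta>" if "k \<le> n" for k
        using that by (meson linear)
      have "A x" unfolding A_def \<beta>'_def l
        by (intro ballI bad_imp_Aev[OF _ xi _ bad]) (use \<beta> in auto)
      have "AE v in Um M r {..n}. ennreal (norm (?G x v)) \<le> 3"
        using AE_Um[OF r0 finite_atMost]
      proof eventually_elim
        case (elim v)
        have "norm (?G x v) \<le> cmw d L (av d K v) x" by (rule GGn)
        also have "\<dots> = norm (cmc d K L (\<lambda>j. of_real (v j)) x)" using cmw_pos[of d L "av d K v" x] by (simp add: cmc_real[OF d])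
        also have "\<dots> \<le> 3" unfolding L_def
        proof (rule cmc_bound[OF d K0 c])
          show "cx c x ((n + 1) * K)" using cxx by (simp add: L_def)
          show "real K * d \<le> 1" using KL t1 by linarith
        qed (use elim r0 small in auto)
        finally have "ennreal (norm (?G x v)) \<le> ennreal 3" by (rule ennreal_leI)
        thus ?case by simp
      qed
      hence "(\<integral>\<^sup>+v. ennreal (norm (?G x v)) \<partial>Um M r {..n}) \<le> (\<integral>\<^sup>+v. 3 \<partial>Um M r {..n})"
        by (rule nn_integral_mono_AE)
      also have "\<dots> = 3" using U.emeasure_space_1 by simp
      finally have "ennreal (norm (h x)) \<le> 3" unfolding h_def by (rule order_trans[OF norm_integral_le_nn])
      thus ?thesis using \<open>A x\<close> by (simp add: add_increasing add_increasing2)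
    qed
  qed
  have tail: "(\<integral>\<^sup>+x. ?I x * w x \<partial>Gam d L) \<le> ennreal (?E)"
  proof -
    have "(\<integral>\<^sup>+x. ?I x * w x \<partial>Gam d L) = (\<integral>\<^sup>+x. (\<integral>\<^sup>+v. ?I x * ?w v x \<partial>Um M r {..n}) \<partial>Gam d L)"
    proof (rule nn_integral_cong)
      fix x assume x: "x \<in> space (Gam d L)"
      have [measurable]: "(\<lambda>v. cmw d L (av d K v) x) \<in> borel_measurable (Um M r {..n})"
        using measurable_compose[OF measurable_Pair2'[OF x] cmwm] by simp
      show "?I x * w x = (\<integral>\<^sup>+v. ?I x * ?w v x \<partial>Um M r {..n})"
        unfolding w_def by (rule nn_integral_cmult[symmetric]) measurable
    qed
    also have "\<dots> = (\<integral>\<^sup>+v. (\<integral>\<^sup>+x. ?I x * ?w v x \<partial>Gam d L) \<partial>Um M r {..n})"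
    proof (rule P.Fubini')
      have [measurable]: "(\<lambda>p. cmw d L (av d K (fst p)) (snd p)) \<in> borel_measurable (Um M r {..n} \<Otimes>\<^sub>M Gam d L)" by (rule cmwm)
      have [measurable]: "Measurable.pred (Um M r {..n} \<Otimes>\<^sub>M Gam d L) (\<lambda>p. cx c (snd p) L)"
        using measurable_compose[OF measurable_snd, of "\<lambda>x. cx c x L" "Gam d L"] by measurable
      show "(\<lambda>(v, x). ?I x * ?w v x) \<in> borel_measurable (Um M r {..n} \<Otimes>\<^sub>M Gam d L)"
        unfolding case_prod_beta by measurable
    qed
    also have "\<dots> \<le> (\<integral>\<^sup>+v. ennreal (?E) \<partial>Um M r {..n})"
    proof (rule nn_integral_mono_AE)
      show "AE v in Um M r {..n}. (\<integral>\<^sup>+x. ?I x * ?w v x \<partial>Gam d L) \<le> ennreal (?E)"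
        using AE_Um[OF r0 finite_atMost]
      proof eventually_elim
        case (elim v)
        show ?case by (rule cmw_tail[OF d K0 c L_def r0 cr Ld1]) (use elim in auto)
      qed
    qed
    also have "\<dots> = ennreal (?E)" using U.emeasure_space_1 by simp
    finally show ?thesis .
  qed
  have badp: "(\<integral>\<^sup>+x. (if A x then 1 else 0) \<partial>Gam d L) \<le> ennreal (?Q)"
  proof -
    have "(\<integral>\<^sup>+x. (if A x then 1 else 0) \<partial>Gam d L) \<le> ennreal ((exp (2 / c + 1) * (24 * \<beta>' / (c * (real K * d) ^ 4))) ^ n)"
      unfolding A_def L_def
    proof (rule bad_prob[OF d K2 c zR])
      have "real ((n + 1) * K) * d * (R + 5) \<le> real L * d * (R + 7)" unfolding L_def using d R0 by (intro mult_left_mono) auto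
      thus "real ((n + 1) * K) * d * (R + 5) \<le> 1/100" using t by linarith
    qed (use l1 l cxe L_def \<beta>'0 in auto)
    also have "exp (2 / c + 1) * (24 * \<beta>' / (c * (real K * d) ^ 4)) = 72 * exp (2 / c + 1) / c\<^sup>2 * l"
    proof -
      have "\<beta>' = 3 * l ^ 4 * l / c" unfolding \<beta>'_def \<beta>_def using xi c by simp
      thus ?thesis unfolding l[symmetric] using c lp by (simp add: field_simps power2_eq_square)
    qed
    finally show ?thesis .
  qed
  have "ennreal (norm (\<integral>x. FF s c e d L z \<xi> x \<partial>Gam d L)) \<le> (\<integral>\<^sup>+x. ennreal (norm (h x)) \<partial>Gam d L)"
    unfolding FFE_identity[OF d r0 L_def, where M = M] h_def by (rule norm_integral_le_nn)
  also have "\<dots> \<le> (\<integral>\<^sup>+x. ennreal B + 3 * (if A x then 1 else 0) + ?I x * w x \<partial>Gam d L)"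
    by (intro nn_integral_mono pt)
  also have "\<dots> = (\<integral>\<^sup>+x. ennreal B + 3 * (if A x then 1 else 0) \<partial>Gam d L) + (\<integral>\<^sup>+x. ?I x * w x \<partial>Gam d L)"
    by (rule nn_integral_add) measurable
  also have "(\<integral>\<^sup>+x. ennreal B + 3 * (if A x then 1 else 0) \<partial>Gam d L) = (\<integral>\<^sup>+x. ennreal B \<partial>Gam d L) + (\<integral>\<^sup>+x. 3 * (if A x then 1 else 0) \<partial>Gam d L)"
    by (rule nn_integral_add) measurable
  also have "(\<integral>\<^sup>+x. ennreal B \<partial>Gam d L) = ennreal B" using G.emeasure_space_1 by simp
  also have "(\<integral>\<^sup>+x. 3 * (if A x then 1 else 0) \<partial>Gam d L) = 3 * (\<integral>\<^sup>+x. (if A x then 1 else 0) \<partial>Gam d L)"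
    by (rule nn_integral_cmult) measurable
  also have "ennreal B + 3 * (\<integral>\<^sup>+x. (if A x then 1 else 0) \<partial>Gam d L) + (\<integral>\<^sup>+x. ?I x * w x \<partial>Gam d L)
    \<le> ennreal B + 3 * ennreal (?Q) + ennreal (?E)"
    by (intro add_mono mult_left_mono badp tail) auto
  also have "\<dots> = ennreal (B + 3 * ?Q + ?E)"
    using B0 lp by (simp add: ennreal_plus ennreal_mult)
  finally have "norm (\<integral>x. FF s c e d L z \<xi> x \<partial>Gam d L) \<le> B + 3 * ?Q + ?E"
    using B0 lp by (subst (asm) ennreal_le_iff) auto
  thus ?thesis by (simp add: B_def \<beta>_def)
qed

lemma exp_sqrt_bound:
  assumes "a > 0" "t > 0" shows "exp (- a / sqrt t) \<le> fact (2 * N) / a ^ (2 * N) * t ^ N"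
proof -
  have "1 ^ (2 * N) * exp (- ((a / sqrt t) * 1)) \<le> fact (2 * N) / (a / sqrt t) ^ (2 * N)"
    using assms by (intro pow_exp_le) auto
  also have "(a / sqrt t) ^ (2 * N) = a ^ (2 * N) / t ^ N"
    using assms by (simp add: power_divide power_mult)
  finally show ?thesis by simp
qed

text \<open>The noise \<open>e\<close> enters the decay estimate through its confinement only.
  \<open>s + 1\<close> avoids a division by \<open>s\<close>, which is 0 in the degenerate
  case.\<close>

lemma cx_tail:
  assumes d: "d > 0" and s: "s \<ge> 0" and L: "L > 0"
  shows "measure (Gam d L) {e \<in> space (Gam d L). \<not> cx s e L} \<le> 4 * exp (- (1 / (2 * (s + 1))) / sqrt (real L * d))"
proof -
  interpret G: prob_space "Gam d L" by (rule prob_space_Gam[OF d])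
  have "{e \<in> space (Gam d L). \<not> cx s e L} \<subseteq> {e \<in> space (Gam d L). \<exists>j\<le>L. \<bar>\<Sum>i<j. e i\<bar> \<ge> 1 / (2 * (s + 1))}"
  proof safe
    fix e assume "\<not> cx s e L"
    then obtain j where j: "j \<le> L" "\<bar>s * (\<Sum>i<j. e i)\<bar> > 1" by (auto simp: cx_def)
    have "\<bar>s * (\<Sum>i<j. e i)\<bar> \<le> (2 * (s + 1)) * \<bar>\<Sum>i<j. e i\<bar>" unfolding abs_mult using s by (intro mult_right_mono) auto
    hence "1 / (2 * (s + 1)) \<le> \<bar>\<Sum>i<j. e i\<bar>" using j s by (simp add: divide_le_eq mult.commute)
    thus "\<exists>j\<le>L. 1 / (2 * (s + 1)) \<le> \<bar>\<Sum>i<j. e i\<bar>" using j by blast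
  qed
  moreover have "exceed d L (1 / (2 * (s + 1))) \<in> sets (Gam d L)"
    unfolding sets_Gam by (rule Gam_Collect_sets) measurable
  ultimately have "measure (Gam d L) {e \<in> space (Gam d L). \<not> cx s e L} \<le> measure (Gam d L) (exceed d L (1 / (2 * (s + 1))))"
    by (rule G.finite_measure_mono)
  also have "\<dots> \<le> 4 * exp (- (1 / (2 * (s + 1))) / sqrt (real L * d))" using s by (intro Gam_maximal[OF d _ L]) auto
  finally show ?thesis .
qed

text \<open>With \<open>n = M = N\<close> each of the contributions becomes a multiple of
  \<open>l^N\<close>. \<open>C\<close> and \<open>l0\<close> do not depend on \<open>K\<close>,
  \<open>R\<close> and \<open>z\<close>: the first makes the limit of fine grids possible, the
  others the uniformity in the starting point.\<close>

lemma FF_decay: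
  fixes s c :: real
  assumes c: "c > 0" and s: "s \<ge> 0"
  shows "\<exists>C l0. C \<ge> 0 \<and> l0 > 0 \<and> l0 \<le> 1 \<and> (\<forall>l K R z \<xi>. 0 < l \<longrightarrow> l \<le> l0 \<longrightarrow> K \<ge> 2 \<longrightarrow> norm z \<le> R \<longrightarrow> real (N + 1) * l * (R + 7) \<le> 1/100 \<longrightarrow> norm \<xi> * l ^ 16 \<ge> 1 \<longrightarrow>
     norm (FFint s c (l / real K) ((N + 1) * K) z \<xi>) \<le> C * l ^ N)"
proof -
  define a where "a = 1 / (2 * c)"
  define b where "b = 1 / (2 * (s + 1))"
  have ab: "a > 0" "b > 0" using c s by (auto simp: a_def b_def)
  \<comment> \<open>Solved from \<open>small\<close> after bounding \<open>r\<close> and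
    \<open>r^2\<close> by multiples of \<open>l\<close>; the condition \<open>l <= 10 * c\<close> in
    \<open>l0\<close> serves \<open>c * r <= 1/2\<close>.\<close>
  define l1 where "l1 = 1 / (real (N + 1) * (1 / (10 * c ^ 3) + 1 / (400 * c ^ 4)))"
  have l1p: "l1 > 0" using c unfolding l1_def by (intro divide_pos_pos mult_pos_pos add_pos_pos) auto
  define l0 where "l0 = min 1 (min (10 * c) l1)"
  have l0: "l0 > 0" "l0 \<le> 1" "l0 \<le> 10 * c" "l0 \<le> l1" using c l1p by (auto simp: l0_def)
  define C1 where "C1 = 24 * (4 ^ N * fact N) * (40 * c\<^sup>2) ^ N"
  define C2 where "C2 = 3 * (72 * exp (2 / c + 1) / c\<^sup>2) ^ N"
  define C3 where "C3 = (4 * (fact (2 * N) / a ^ (2 * N)) + 4 * (fact (2 * N) / b ^ (2 * N))) * (real (N + 1)) ^ N"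
  define C where "C = C1 + C2 + C3"
  have C0: "C1 \<ge> 0" "C2 \<ge> 0" "C3 \<ge> 0" using c ab by (auto simp: C1_def C2_def C3_def)
  show ?thesis
  proof (rule exI[of _ C], rule exI[of _ l0], intro conjI allI impI)
    show "C \<ge> 0" "l0 > 0" "l0 \<le> 1" using C0 l0 by (auto simp: C_def)
    fix l R :: real and K :: nat and z \<xi> :: complex
    assume lp: "0 < l" and ll: "l \<le> l0" and K: "2 \<le> K" and zR: "norm z \<le> R" and t: "real (N + 1) * l * (R + 7) \<le> 1/100" and xi: "norm \<xi> * l ^ 16 \<ge> 1"
    define d where "d = l / real K"
    define L where "L = (N + 1) * K"
    define r where "r = l ^ 4 / (20 * c\<^sup>2)"
    let ?f = "\<lambda>e. \<integral>x. FF s c e d L z \<xi> x \<partial>Gam d L"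
    have d: "d > 0" using lp K by (simp add: d_def)
    have lK: "l = real K * d" using K by (simp add: d_def)
    have Ld: "real L * d = real (N + 1) * l" using K by (simp add: L_def d_def field_simps)
    have L0: "L > 0" using K by (simp add: L_def)
    have l1: "l \<le> 1" using ll l0 by linarith
    have r0: "r > 0" using lp c by (simp add: r_def)
    have l4: "l ^ 4 \<le> l" using power_decreasing[of 1 4 l] lp l1 by simp
    have rl: "r \<le> l / (20 * c\<^sup>2)" unfolding r_def using l4 c by (intro divide_right_mono) auto
    have cr: "c * r \<le> 1/2"
    proof -
      have "c * r \<le> c * (l / (20 * c\<^sup>2))" using rl c by (intro mult_left_mono) auto
      also have "\<dots> = l / (20 * c)" using c by (simp add: power2_eq_square)
      also have "\<dots> \<le> (10 * c) / (20 * c)" using ll l0 c by (intro divide_right_mono) auto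
      also have "\<dots> = 1/2" using c by simp
      finally show ?thesis .
    qed
    have small: "real (N + 1) * (2 * r / c + r\<^sup>2) \<le> 1"
    proof -
      have 1: "2 * r / c \<le> l * (1 / (10 * c ^ 3))"
      proof -
        have "2 * r / c \<le> 2 * (l / (20 * c\<^sup>2)) / c" using rl c by (intro divide_right_mono mult_left_mono) auto
        also have "\<dots> = l * (1 / (10 * c ^ 3))" using c by (simp add: power2_eq_square power3_eq_cube)
        finally show ?thesis .
      qed
      have 2: "r\<^sup>2 \<le> l * (1 / (400 * c ^ 4))"
      proof -
        have "r\<^sup>2 \<le> (l / (20 * c\<^sup>2))\<^sup>2" using rl r0 by (intro power_mono) auto
        also have "\<dots> = l\<^sup>2 * (1 / (400 * c ^ 4))" by (simp add: power_divide power_mult_distrib flip: power_mult)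
        also have "\<dots> \<le> l * (1 / (400 * c ^ 4))"
        proof (rule mult_right_mono)
          show "l\<^sup>2 \<le> l" using power_decreasing[of 1 2 l] lp l1 by simp
        qed (use c in auto)
        finally show ?thesis .
      qed
      have "real (N + 1) * (2 * r / c + r\<^sup>2) \<le> real (N + 1) * (l * (1 / (10 * c ^ 3)) + l * (1 / (400 * c ^ 4)))"
        using 1 2 by (intro mult_left_mono add_mono) auto
      also have "\<dots> = l / l1" unfolding l1_def by (simp add: algebra_simps)
      also have "\<dots> \<le> 1" using ll l0 l1p by simp
      finally show ?thesis .
    qed
    have tL: "real L * d * (R + 7) \<le> 1/100" using t unfolding Ld .
    have xi0: "\<xi> \<noteq> 0" using xi by auto
    define T where "T = real (N + 1) * l"
    have T: "T > 0" using lp by (simp add: T_def)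
    have TN: "T ^ N = real (N + 1) ^ N * l ^ N" by (simp add: T_def power_mult_distrib)
    define Bx where "Bx = C1 * l ^ N + C2 * l ^ N + 4 * (fact (2 * N) / a ^ (2 * N) * T ^ N)"
    have Bx0: "Bx \<ge> 0" using C0 lp T ab by (simp add: Bx_def)
    have bx: "norm (?f e) \<le> Bx" if "cx s e L" for e
    proof -
      have "norm (?f e) \<le> 24 * (4 ^ N * fact N / (l ^ 4 * norm \<xi> / 2 * r) ^ N)
     + 3 * (72 * exp (2 / c + 1) / c\<^sup>2 * l) ^ N + 4 * exp (- (1 / (2 * c)) / sqrt (real L * d))"
        by (rule FF_decay_inner[OF d K c zR L_def tL that lK r_def cr small xi0])
      also have "\<dots> \<le> Bx" unfolding Bx_def
      proof (intro add_mono)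
        \<comment> \<open>\<open>|\<xi>| l^16 >= 1\<close> gives
          \<open>|\<xi>| l^8 >= l^(-8) >= 1 / l\<close>, and the base of the power to be bounded is
          \<open>|\<xi>| l^8 / (40 * c^2)\<close>.\<close>
        have "l ^ 8 * l ^ 8 = l ^ 16" by (simp flip: power_add)
        hence "1 \<le> (l ^ 8 * norm \<xi>) * l ^ 8" using xi by (simp add: mult_ac)
        also have "\<dots> \<le> (l ^ 8 * norm \<xi>) * l" using power_decreasing[of 1 8 l] lp l1 by (intro mult_left_mono) auto
        finally have q: "1 / l \<le> l ^ 8 * norm \<xi>" using lp by (simp add: divide_le_eq)
        have "l ^ 4 * norm \<xi> / 2 * r = (l ^ 8 * norm \<xi>) / (40 * c\<^sup>2)" unfolding r_def by (simp flip: power_add)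
        also have "\<dots> \<ge> (1 / l) / (40 * c\<^sup>2)" using q by (intro divide_right_mono) auto
        finally have "((1 / l) / (40 * c\<^sup>2)) ^ N \<le> (l ^ 4 * norm \<xi> / 2 * r) ^ N" using lp by (intro power_mono) auto
        hence "4 ^ N * fact N / (l ^ 4 * norm \<xi> / 2 * r) ^ N \<le> 4 ^ N * fact N / ((1 / l) / (40 * c\<^sup>2)) ^ N"
          using lp c by (intro divide_left_mono mult_pos_pos) (auto simp: r_def xi0)
        also have "\<dots> = (4 ^ N * fact N) * (40 * c\<^sup>2) ^ N * l ^ N" by (simp add: power_divide power_mult_distrib)
        finally show "24 * (4 ^ N * fact N / (l ^ 4 * norm \<xi> / 2 * r) ^ N) \<le> C1 * l ^ N" by (simp add: C1_def)
        show "3 * (72 * exp (2 / c + 1) / c\<^sup>2 * l) ^ N \<le> C2 * l ^ N" by (simp only: C2_def power_mult_distrib mult.assoc order_refl)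
        show "4 * exp (- (1 / (2 * c)) / sqrt (real L * d)) \<le> 4 * (fact (2 * N) / a ^ (2 * N) * T ^ N)"
          unfolding Ld T_def[symmetric] a_def[symmetric] by (intro mult_left_mono exp_sqrt_bound ab T) auto
      qed
      finally show ?thesis .
    qed
    interpret G: prob_space "Gam d L" by (rule prob_space_Gam[OF d])
    define S where "S = {e \<in> space (Gam d L). \<not> cx s e L}"
    have Sm[measurable]: "S \<in> sets (Gam d L)"
    proof -
      have [measurable]: "Measurable.pred (RL L) (\<lambda>x. cx s x L)" by (rule cx_measurable) simp
      have "{e \<in> space (RL L). \<not> cx s e L} \<in> sets (RL L)" by measurable
      thus ?thesis by (simp add: S_def space_Gam space_PiM)
    qed
    have "ennreal (norm (\<integral>e. (?f e) \<partial>Gam d L)) \<le> (\<integral>\<^sup>+e. ennreal (norm (?f e)) \<partial>Gam d L)"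
      by (rule norm_integral_le_nn)
    also have "\<dots> \<le> (\<integral>\<^sup>+e. ennreal Bx + indicator S e \<partial>Gam d L)"
    proof (rule nn_integral_mono)
      fix e assume e: "e \<in> space (Gam d L)"
      show "ennreal (norm (?f e)) \<le> ennreal Bx + indicator S e"
      proof (cases "cx s e L")
        case True
        thus ?thesis using bx[OF True] by (intro add_increasing2 ennreal_leI) auto
      next
        case False
        have "ennreal (norm (?f e)) \<le> (\<integral>\<^sup>+x. ennreal (norm (FF s c e d L z \<xi> x)) \<partial>Gam d L)" by (rule norm_integral_le_nn)
        also have "\<dots> \<le> (\<integral>\<^sup>+x. ennreal 1 \<partial>Gam d L)" by (intro nn_integral_mono ennreal_leI norm_FF)
        also have "\<dots> = 1" using G.emeasure_space_1 by simp
        finally show ?thesis using False e by (simp add: S_def add_increasing)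
      qed
    qed
    also have "\<dots> = ennreal Bx + emeasure (Gam d L) S"
      by (subst nn_integral_add) (auto simp: G.emeasure_space_1 nn_integral_indicator[OF Sm])
    also have "\<dots> = ennreal (Bx + measure (Gam d L) S)" using Bx0 by (simp add: G.emeasure_eq_measure ennreal_plus)
    finally have "norm (\<integral>e. (?f e) \<partial>Gam d L) \<le> Bx + measure (Gam d L) S"
      using Bx0 by (subst (asm) ennreal_le_iff) auto
    also have "measure (Gam d L) S \<le> 4 * exp (- (1 / (2 * (s + 1))) / sqrt (real L * d))"
      unfolding S_def by (rule cx_tail[OF d s L0])
    also have "\<dots> \<le> 4 * (fact (2 * N) / b ^ (2 * N) * T ^ N)"
      unfolding Ld T_def[symmetric] b_def[symmetric] by (intro mult_left_mono exp_sqrt_bound ab T) auto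
    also have "Bx + 4 * (fact (2 * N) / b ^ (2 * N) * T ^ N) = C * l ^ N"
      unfolding Bx_def TN C_def C3_def by (simp add: algebra_simps)
    finally have "norm (\<integral>e. (?f e) \<partial>Gam d L) \<le> C * l ^ N" by simp
    thus "norm (FFint s c (l / real K) ((N + 1) * K) z \<xi>) \<le> C * l ^ N"
      unfolding d_def L_def .
  qed
qed

section \<open>From the stochastic equation to the scheme\<close>

text \<open>Transfers a lower bound from events about discretised noise, whose laws are explicit, to
  an event about the solution that holds whenever infinitely many of them occur.\<close>

lemma (in prob_space) fatou_events:
  assumes A: "\<And>L::nat. A L \<in> events" and B: "B \<in> events" and p: "\<And>L. L \<ge> L0 \<Longrightarrow> prob (A L) \<ge> p"
    and AE: "AE \<omega> in M. (\<forall>m. \<exists>L\<ge>m. \<omega> \<in> A L) \<longrightarrow> \<omega> \<in> B"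
  shows "prob B \<ge> p"
proof -
  define C where "C m = (\<Union>L\<in>{m..}. A L)" for m :: nat
  have C: "C m \<in> events" for m unfolding C_def using A by auto
  have "decseq C" unfolding C_def decseq_def by (auto intro: order_trans)
  hence lim: "(\<lambda>m. prob (C m)) \<longlonglongrightarrow> prob (\<Inter>m. C m)" using C by (intro finite_Lim_measure_decseq) auto
  have ev: "p \<le> prob (C m)" if "m \<ge> L0" for m
  proof -
    have "prob (A m) \<le> prob (C m)" by (rule finite_measure_mono[OF _ C]) (auto simp: C_def)
    thus ?thesis using p[OF that] by linarith
  qed
  have "p \<le> prob (\<Inter>m. C m)" by (rule LIMSEQ_le_const[OF lim]) (use ev in blast)
  also have "\<dots> \<le> prob B"
  proof (rule finite_measure_mono_AE[OF _ B])
    show "AE \<omega> in M. \<omega> \<in> (\<Inter>m. C m) \<longrightarrow> \<omega> \<in> B" using AE by eventually_elim (auto simp: C_def)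
  qed
  finally show ?thesis .
qed

text \<open>\<open>Zs\<close> is meant as the path driven by the noise \<open>n\<close>. The limit
  of \<open>sq\<close> is \<open>exp (- integral Zs)\<close> because
  \<open>q' = - p = - Zs * q\<close>.\<close>

definition tracks where
  "tracks T n Zs e \<rho> L0 \<longleftrightarrow> \<rho> > 0 \<and> (\<forall>L\<ge>L0. \<forall>N z. norm (z - Zs 0) \<le> \<rho> \<longrightarrow>
     (\<forall>j\<le>L. norm (N j - n (real j * (T / real L))) \<le> \<rho>) \<longrightarrow>
     norm (sq (T / real L) N z L - exp (- integral {0..T} Zs)) \<le> e \<and> norm (sP (T / real L) N z L - Zs T) \<le> e)"

lemma tracksD:
  assumes "tracks T n Zs e \<rho> L0" "L \<ge> L0" "norm (z - Zs 0) \<le> \<rho>"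
    "\<And>j. j \<le> L \<Longrightarrow> norm (N j - n (real j * (T / real L))) \<le> \<rho>"
  shows "norm (sq (T / real L) N z L - exp (- integral {0..T} Zs)) \<le> e" "norm (sP (T / real L) N z L - Zs T) \<le> e"
  using assms unfolding tracks_def by auto

text \<open>A path \<open>Zs\<close> on \<open>[0, T]\<close> yields a solution of the linear
  system, \<open>q = exp (- integral Zs)\<close> and \<open>v = (Zs - n) * q\<close>. This
  \<open>q\<close> has no zero, so convergence of \<open>(v, q)\<close> passes to the quotient:
  existence of the solution up to \<open>T\<close> is what keeps the scheme away from poles.\<close>

lemma sP_stability:
  fixes Zs n :: "real \<Rightarrow> complex"
  assumes T: "T > 0" and cZ: "continuous_on {0..T} Zs" and cn: "continuous_on {0..T} n"
    and eq: "\<And>t. t \<in> {0..T} \<Longrightarrow> Zs t = Zs 0 + integral {0..t} (\<lambda>u. (Zs u)\<^sup>2) + n t"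
    and e: "e > 0"
  shows "\<exists>\<rho> L0. tracks T n Zs e \<rho> L0"
proof -
  define V where "V t = Zs t - n t" for t
  define qs where "qs t = exp (- integral {0..t} Zs)" for t
  define vs where "vs t = V t * qs t" for t
  have n0: "n 0 = 0" using eq[of 0] T by simp
  have dV: "(V has_vector_derivative (Zs s)\<^sup>2) (at s within {0..T})" if s: "s \<in> {0..T}" for s
  proof -
    have "((\<lambda>t. integral {0..t} (\<lambda>u. (Zs u)\<^sup>2)) has_vector_derivative (Zs s)\<^sup>2) (at s within {0..T})"
      by (rule integral_has_vector_derivative[OF _ s]) (intro continuous_intros cZ)
    hence "((\<lambda>t. Zs 0 + integral {0..t} (\<lambda>u. (Zs u)\<^sup>2)) has_vector_derivative (0 + (Zs s)\<^sup>2)) (at s within {0..T})"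
      by (intro has_vector_derivative_add has_vector_derivative_const)
    hence "((\<lambda>t. Zs 0 + integral {0..t} (\<lambda>u. (Zs u)\<^sup>2)) has_vector_derivative (Zs s)\<^sup>2) (at s within {0..T})" by simp
    note D = this
    have VE: "V t = Zs 0 + integral {0..t} (\<lambda>u. (Zs u)\<^sup>2)" if "t \<in> {0..T}" for t
      unfolding V_def diff_eq_eq by (rule eq[OF that])
    show ?thesis by (rule has_vector_derivative_transform[OF s VE D])
  qed
  have dq: "(qs has_vector_derivative - Zs s * qs s) (at s within {0..T})" if s: "s \<in> {0..T}" for s
  proof -
    have "((\<lambda>t. - integral {0..t} Zs) has_vector_derivative - Zs s) (at s within {0..T})"
      by (intro has_vector_derivative_minus integral_has_vector_derivative[OF cZ s])
    from field_vector_diff_chain_within[OF this, of exp "exp (- integral {0..s} Zs)"]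
    show ?thesis by (simp add: qs_def[abs_def] o_def DERIV_exp has_field_derivative_at_within)
  qed
  have pz: "vs s + n s * qs s = Zs s * qs s" for s by (simp add: vs_def V_def algebra_simps)
  have dv: "(vs has_vector_derivative n s * (vs s + n s * qs s)) (at s within {0..T})" if s: "s \<in> {0..T}" for s
  proof -
    have "(vs has_vector_derivative V s * (- Zs s * qs s) + (Zs s)\<^sup>2 * qs s) (at s within {0..T})"
      unfolding vs_def[abs_def] by (intro has_vector_derivative_mult dV dq s)
    moreover have "V s * (- Zs s * qs s) + (Zs s)\<^sup>2 * qs s = n s * (vs s + n s * qs s)"
      unfolding pz V_def by (simp add: algebra_simps power2_eq_square)
    ultimately show ?thesis by simp
  qed
  have qT: "qs T \<noteq> 0" by (simp add: qs_def)
  have ZT: "Zs T = n T + vs T / qs T" using qT by (simp add: vs_def V_def)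
  have "isCont (\<lambda>p. fst p / snd p) (vs T, qs T)" using qT by (intro continuous_intros) auto
  hence "\<exists>d>0. \<forall>p. dist p (vs T, qs T) < d \<longrightarrow> dist (fst p / snd p) (vs T / qs T) < e / 2"
    using e unfolding continuous_at_eps_delta fst_conv snd_conv by (elim allE[of _ "e / 2"]) simp
  then obtain \<delta> where \<delta>: "\<delta> > 0" "\<And>p. dist p (vs T, qs T) < \<delta> \<Longrightarrow> dist (fst p / snd p) (vs T / qs T) < e / 2" by blast
  \<comment> \<open>\<open>\<delta> / 3\<close> keeps the pair of errors inside the
    \<open>\<delta>\<close>-ball, and \<open>norm (qs T) / 2\<close> keeps \<open>sq\<close>
    different from 0.\<close>
  define e' where "e' = min (\<delta> / 3) (min e (norm (qs T) / 2))"
  have e': "e' > 0" using \<delta> e qT by (simp add: e'_def)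
  have "\<exists>\<rho>>0. \<exists>L0. \<forall>L\<ge>L0. \<forall>N z. norm (z - vs 0) \<le> \<rho> \<longrightarrow>
     (\<forall>j\<le>L. norm (N j - n (real j * (T / real L))) \<le> \<rho>) \<longrightarrow>
     (\<forall>j\<le>L. norm (sv (T / real L) N z j - vs (real j * (T / real L))) \<le> e' \<and>
             norm (sq (T / real L) N z j - qs (real j * (T / real L))) \<le> e')"
  proof (rule scheme_stability[OF T cn dv _ _ e'])
    show "(qs has_vector_derivative - (vs s + n s * qs s)) (at s within {0..T})" if "s \<in> {0..T}" for s
      unfolding pz using dq[OF that] by simp
  qed (simp_all add: qs_def)
  then obtain \<rho> L0 where \<rho>: "\<rho> > 0" and st': "\<forall>L\<ge>L0. \<forall>N z. norm (z - vs 0) \<le> \<rho> \<longrightarrow>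
     (\<forall>j\<le>L. norm (N j - n (real j * (T / real L))) \<le> \<rho>) \<longrightarrow>
     (\<forall>j\<le>L. norm (sv (T / real L) N z j - vs (real j * (T / real L))) \<le> e' \<and>
             norm (sq (T / real L) N z j - qs (real j * (T / real L))) \<le> e')"
    by (elim exE conjE) (rule that, assumption+)
  note st = st'[THEN spec, THEN mp, THEN spec, THEN spec, THEN mp, THEN mp]
  show ?thesis
  proof (rule exI[of _ "min \<rho> (e / 2)"], rule exI[of _ "max L0 1"], unfold tracks_def, rule conjI)
    show "min \<rho> (e / 2) > 0" using \<rho> e by simp
    show "\<forall>L\<ge>max L0 1. \<forall>N z. norm (z - Zs 0) \<le> min \<rho> (e / 2) \<longrightarrow>
     (\<forall>j\<le>L. norm (N j - n (real j * (T / real L))) \<le> min \<rho> (e / 2)) \<longrightarrow>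
     norm (sq (T / real L) N z L - exp (- integral {0..T} Zs)) \<le> e \<and> norm (sP (T / real L) N z L - Zs T) \<le> e"
    proof (intro allI impI)
      fix L N z assume L: "max L0 1 \<le> L" and z: "norm (z - Zs 0) \<le> min \<rho> (e / 2)"
        and N: "\<forall>j\<le>L. norm (N j - n (real j * (T / real L))) \<le> min \<rho> (e / 2)"
      have LT: "real L * (T / real L) = T" using L by simp
      have v0: "vs 0 = Zs 0" by (simp add: vs_def V_def qs_def n0)
      have "\<forall>j\<le>L. norm (sv (T / real L) N z j - vs (real j * (T / real L))) \<le> e' \<and>
             norm (sq (T / real L) N z j - qs (real j * (T / real L))) \<le> e'"
        by (rule st) (use L z N v0 in auto)
      hence a: "norm (sv (T / real L) N z L - vs T) \<le> e'" and b: "norm (sq (T / real L) N z L - qs T) \<le> e'"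
        using LT by (metis order_refl)+
      have "dist (sv (T / real L) N z L, sq (T / real L) N z L) (vs T, qs T) \<le> e' + e'"
        using norm_Pair_le[of "sv (T / real L) N z L - vs T" "sq (T / real L) N z L - qs T"] a b by (simp add: dist_norm)
      also have "\<dots> < \<delta>" using \<delta>(1) by (simp add: e'_def)
      finally have d1: "dist (sv (T / real L) N z L / sq (T / real L) N z L) (vs T / qs T) < e / 2" using \<delta>(2) by fastforce
      have NL: "norm (N L - n T) \<le> e / 2" using N LT by (metis order_refl min.boundedE)
      show "norm (sq (T / real L) N z L - exp (- integral {0..T} Zs)) \<le> e \<and> norm (sP (T / real L) N z L - Zs T) \<le> e"
      proof
        show "norm (sq (T / real L) N z L - exp (- integral {0..T} Zs)) \<le> e" using b unfolding qs_def e'_def by simp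
        have qn: "sq (T / real L) N z L \<noteq> 0"
        proof
          assume "sq (T / real L) N z L = 0"
          hence "norm (qs T) \<le> e'" using b by simp
          thus False using qT by (simp add: e'_def)
        qed
        have "sP (T / real L) N z L - Zs T = (N L - n T) + (sv (T / real L) N z L / sq (T / real L) N z L - vs T / qs T)"
          unfolding ZT sP_def sp_def using qn by (simp add: add_divide_distrib)
        also have "norm \<dots> \<le> e / 2 + e / 2" by (rule order.trans[OF norm_triangle_ineq]) (use NL d1 in \<open>auto simp: dist_norm\<close>)
        finally show "norm (sP (T / real L) N z L - Zs T) \<le> e" by simp
      qed
    qed
  qed
qed

section \<open>Brownian increments and the solution as a limit of the scheme\<close>

locale sde_setting = prob_space M for M :: "'a measure" +
  fixes W1 W2 :: "real \<Rightarrow> 'a \<Rightarrow> real" and X Y :: "real \<times> real \<Rightarrow> real \<Rightarrow> 'a \<Rightarrow> real" and \<sigma>x \<sigma>y :: real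
  assumes sx: "\<sigma>x \<ge> 0" and sy: "\<sigma>y > 0"
    and W1: "standard_brownian_motion M W1" and W2: "standard_brownian_motion M W2"
    and indep: "independent_processes M W1 W2"
    and sol: "\<And>z. sde_solution M W1 W2 \<sigma>x \<sigma>y z (X z) (Y z)"
begin

definition "sg = sqrt (2 * \<sigma>x)"
definition "cg = sqrt (2 * \<sigma>y)"

lemma sg: "sg \<ge> 0" and cg: "cg > 0" using sx sy by (auto simp: sg_def cg_def)

definition inc where "inc W T L \<omega> = (\<lambda>j\<in>{..<L}. W (real (Suc j) * (T / real L)) \<omega> - W (real j * (T / real L)) \<omega>)"
  for W :: "real \<Rightarrow> 'a \<Rightarrow> real"

abbreviation "XY z t \<omega> \<equiv> (X z t \<omega>, Y z t \<omega>)"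
definition "zc z = Complex (fst z) (snd z)" for z :: "real \<times> real"
definition "Z z t \<omega> = Complex (X z t \<omega>) (Y z t \<omega>)"
definition "noise \<omega> t = Complex (sg * W1 t \<omega>) (cg * W2 t \<omega>)"
definition "SP T L z \<omega> = sP (T / real L) (nz sg cg (inc W1 T L \<omega>) (inc W2 T L \<omega>)) (zc z) L"

lemma W_measurable [measurable]: "t \<ge> 0 \<Longrightarrow> W1 t \<in> borel_measurable M" "t \<ge> 0 \<Longrightarrow> W2 t \<in> borel_measurable M"
  using W1 W2 by (auto simp: standard_brownian_motion_def)

lemma XY_measurable [measurable]: "t \<ge> 0 \<Longrightarrow> X z t \<in> borel_measurable M" "t \<ge> 0 \<Longrightarrow> Y z t \<in> borel_measurable M"
  using sol[of z] by (auto simp: sde_solution_def)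

lemma Z_measurable [measurable]: "t \<ge> 0 \<Longrightarrow> Z z t \<in> borel_measurable M"
  unfolding Z_def[abs_def] by measurable

lemma inc_measurable:
  assumes "W = W1 \<or> W = W2" "T \<ge> 0"
  shows "inc W T L \<in> measurable M (RL L)"
proof -
  have [measurable]: "W t \<in> borel_measurable M" if "t \<ge> 0" for t using assms that by auto
  show ?thesis unfolding inc_def[abs_def] using assms(2) by (intro measurable_restrict) measurable
qed

lemma inc_measurable' [measurable]:
  "T \<ge> 0 \<Longrightarrow> inc W1 T L \<in> measurable M (RL L)"
  "T \<ge> 0 \<Longrightarrow> inc W2 T L \<in> measurable M (RL L)"
  by (auto intro: inc_measurable)

lemma continuous_zc: "continuous_on A zc"
  unfolding zc_def[abs_def] Complex_eq by (intro continuous_intros)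

lemma zc_measurable [measurable]: "zc \<in> borel_measurable borel"
  by (rule borel_measurable_continuous_onI[OF continuous_zc])

lemma SP_measurable: "T \<ge> 0 \<Longrightarrow> (\<lambda>(z, \<omega>). SP T L z \<omega>) \<in> borel_measurable (borel \<Otimes>\<^sub>M M)"
  unfolding SP_def case_prod_beta
proof (rule sP_measurable)
  assume T: "T \<ge> 0"
  show "(\<lambda>x. zc (fst x)) \<in> borel_measurable (borel \<Otimes>\<^sub>M M)" by measurable
  fix i assume i: "i \<le> L"
  have 1: "(\<lambda>x. \<Sum>j<i. inc W T L (snd x) j) \<in> borel_measurable (borel \<Otimes>\<^sub>M M)" if "W = W1 \<or> W = W2" for W
  proof (rule borel_measurable_sum)
    fix j assume j: "j \<in> {..<i}"
    have [measurable]: "inc W T L \<in> measurable M (RL L)" by (rule inc_measurable[OF that T])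
    have "(\<lambda>\<omega>. inc W T L \<omega> j) \<in> borel_measurable M"
      using j i by (intro measurable_compose[OF \<open>inc W T L \<in> _\<close>] measurable_component_singleton) auto
    thus "(\<lambda>x. inc W T L (snd x) j) \<in> borel_measurable (borel \<Otimes>\<^sub>M M)" by (rule measurable_compose[OF measurable_snd])
  qed
  have [measurable]: "(\<lambda>x. \<Sum>j<i. inc W1 T L (snd x) j) \<in> borel_measurable (borel \<Otimes>\<^sub>M M)"
    "(\<lambda>x. \<Sum>j<i. inc W2 T L (snd x) j) \<in> borel_measurable (borel \<Otimes>\<^sub>M M)" by (auto intro: 1)
  show "(\<lambda>x. nz sg cg (inc W1 T L (snd x)) (inc W2 T L (snd x)) i) \<in> borel_measurable (borel \<Otimes>\<^sub>M M)"
    unfolding nz_def by measurable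
qed

lemma SP_measurable1 [measurable]: "T \<ge> 0 \<Longrightarrow> SP T L z \<in> borel_measurable M"
  using measurable_compose[OF measurable_Pair1' SP_measurable, of z] by simp

lemma law_inc:
  assumes W: "standard_brownian_motion M W" and T: "T > 0" and L: "L > 0"
  shows "distr M (RL L) (inc W T L) = Gam (T / real L) L"
proof -
  define d where "d = T / real L"
  have d: "d > 0" using T L by (simp add: d_def)
  let ?D = "\<lambda>i \<omega>. W (real (Suc i) * d) \<omega> - W (real i * d) \<omega>"
  have dist: "distributed M lborel (?D i) (normal_density 0 (sqrt d))" for i
  proof -
    have "0 \<le> real i * d" "real i * d < real (Suc i) * d" "real (Suc i) * d - real i * d = d" using d by (auto simp: algebra_simps)
    thus ?thesis using W unfolding standard_brownian_motion_def by metis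
  qed
  have m: "(?D i) \<in> borel_measurable M" for i
    using distributed_measurable[OF dist[of i]] by simp
  have "mono (\<lambda>i. real i * d)" using d by (auto simp: mono_def intro: mult_right_mono)
  hence "indep_vars (\<lambda>_. borel) ?D {..<L}"
  proof -
    assume "mono (\<lambda>i. real i * d)"
    moreover have "\<forall>(n::nat) (t::nat \<Rightarrow> real). 0 \<le> t 0 \<and> mono t \<longrightarrow> indep_vars (\<lambda>_. borel) (\<lambda>i \<omega>. W (t (Suc i)) \<omega> - W (t i) \<omega>) {..<n}"
      using W unfolding standard_brownian_motion_def by (elim conjE)
    ultimately show ?thesis by (elim allE[of _ L] allE[of _ "\<lambda>i. real i * d"]) simp
  qed
  moreover have "{..<L} \<noteq> {}" using L by auto
  ultimately have "distr M (RL L) (\<lambda>x. \<lambda>i\<in>{..<L}. W (real (Suc i) * d) x - W (real i * d) x)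
    = PiM {..<L} (\<lambda>i. distr M borel (?D i))"
    using indep_vars_iff_distr_eq_PiM[where I = "{..<L}" and M' = "\<lambda>_. borel" and X = ?D] m by auto
  also have "\<dots> = PiM {..<L} (\<lambda>i. gam d)"
  proof (rule PiM_cong)
    fix i
    have "distr M borel (?D i) = distr M lborel (?D i)"
      by (rule distr_cong) auto
    also have "\<dots> = gam d" using distributed_distr_eq_density[OF dist[of i]] by (simp add: gam_def)
    finally show "distr M borel (?D i) = gam d" .
  qed simp
  finally show ?thesis unfolding Gam_def inc_def[abs_def] d_def .
qed

text \<open>Independence is given for whole paths; the increments on a grid are one measurable
  function \<open>g\<close> of the path.\<close>

lemma law_joint:
  assumes T: "T > 0" and L: "L > 0"
  shows "distr M (RL L \<Otimes>\<^sub>M RL L) (\<lambda>\<omega>. (inc W1 T L \<omega>, inc W2 T L \<omega>))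
    = Gam (T / real L) L \<Otimes>\<^sub>M Gam (T / real L) L"
proof -
  define g where "g h = (\<lambda>j\<in>{..<L}. h (real (Suc j) * (T / real L)) - h (real j * (T / real L)))" for h :: "real \<Rightarrow> real"
  have g: "g \<in> measurable (PiM {0..} (\<lambda>_. borel)) (RL L)"
    unfolding g_def[abs_def] using T by (intro measurable_restrict borel_measurable_diff measurable_component_singleton) auto
  have gi: "g \<circ> (\<lambda>\<omega>. \<lambda>t\<in>{0..}. W t \<omega>) = inc W T L" for W :: "real \<Rightarrow> 'a \<Rightarrow> real"
    using T by (auto simp: fun_eq_iff g_def inc_def restrict_def)
  have "indep_var (RL L) (g \<circ> (\<lambda>\<omega>. \<lambda>t\<in>{0..}. W1 t \<omega>)) (RL L) (g \<circ> (\<lambda>\<omega>. \<lambda>t\<in>{0..}. W2 t \<omega>))"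
    by (rule indep_var_compose[OF _ g g]) (use indep in \<open>simp add: independent_processes_def\<close>)
  thus ?thesis unfolding gi indep_var_distribution_eq law_inc[OF W1 T L] law_inc[OF W2 T L] by simp
qed

definition "good z \<omega> \<longleftrightarrow> continuous_on {0..} (\<lambda>t. Z z t \<omega>) \<and> continuous_on {0..} (noise \<omega>) \<and> W1 0 \<omega> = 0 \<and> W2 0 \<omega> = 0 \<and>
  (\<forall>t\<ge>0. Z z t \<omega> = zc z + integral {0..t} (\<lambda>u. (Z z u \<omega>)\<^sup>2) + noise \<omega> t)"

lemma AE_good: "AE \<omega> in M. good z \<omega>"
proof -
  have "AE \<omega> in M. W1 0 \<omega> = 0" "AE \<omega> in M. continuous_on {0..} (\<lambda>t. W1 t \<omega>)"
    "AE \<omega> in M. W2 0 \<omega> = 0" "AE \<omega> in M. continuous_on {0..} (\<lambda>t. W2 t \<omega>)"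
    using W1 W2 by (auto simp: standard_brownian_motion_def)
  moreover have "AE \<omega> in M.
        continuous_on {0..} (\<lambda>t. X z t \<omega>) \<and> continuous_on {0..} (\<lambda>t. Y z t \<omega>) \<and>
        (\<forall>t\<ge>0.
           X z t \<omega> = fst z + integral {0..t} (\<lambda>s. (X z s \<omega>)\<^sup>2 - (Y z s \<omega>)\<^sup>2) + sqrt (2 * \<sigma>x) * W1 t \<omega> \<and>
           Y z t \<omega> = snd z + integral {0..t} (\<lambda>s. 2 * X z s \<omega> * Y z s \<omega>) + sqrt (2 * \<sigma>y) * W2 t \<omega>)"
    using sol[of z] by (auto simp: sde_solution_def)
  ultimately show ?thesis
  proof eventually_elim
    case (elim \<omega>)
    have cZ: "continuous_on {0..} (\<lambda>t. Z z t \<omega>)" unfolding Z_def Complex_eq using elim by (intro continuous_intros) auto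
    have cn: "continuous_on {0..} (noise \<omega>)" unfolding noise_def[abs_def] Complex_eq using elim by (intro continuous_intros) auto
    have "Z z t \<omega> = zc z + integral {0..t} (\<lambda>u. (Z z u \<omega>)\<^sup>2) + noise \<omega> t" if t: "t \<ge> 0" for t
    proof -
      have i: "(\<lambda>u. (Z z u \<omega>)\<^sup>2) integrable_on {0..t}"
        by (intro integrable_continuous_real continuous_intros continuous_on_subset[OF cZ]) auto
      have "Re (integral {0..t} (\<lambda>u. (Z z u \<omega>)\<^sup>2)) = integral {0..t} (\<lambda>u. (X z u \<omega>)\<^sup>2 - (Y z u \<omega>)\<^sup>2)"
        using integral_linear[OF i bounded_linear_Re] by (simp add: o_def Z_def power2_eq_square)
      moreover have "Im (integral {0..t} (\<lambda>u. (Z z u \<omega>)\<^sup>2)) = integral {0..t} (\<lambda>u. 2 * X z u \<omega> * Y z u \<omega>)"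
        using integral_linear[OF i bounded_linear_Im] by (simp add: o_def Z_def power2_eq_square mult.assoc)
      ultimately show ?thesis using elim t by (auto simp: complex_eq_iff Z_def zc_def noise_def sg_def cg_def)
    qed
    thus ?case using cZ cn elim by (simp add: good_def)
  qed
qed

lemma nz_inc:
  assumes "good z \<omega>" "j \<le> L"
  shows "nz sg cg (inc W1 T L \<omega>) (inc W2 T L \<omega>) j = noise \<omega> (real j * (T / real L))"
proof -
  have "(\<Sum>i<j. inc W T L \<omega> i) = W (real j * (T / real L)) \<omega>" if "W 0 \<omega> = 0" for W
  proof -
    have "(\<Sum>i<j. inc W T L \<omega> i) = (\<Sum>i<j. W (real (Suc i) * (T / real L)) \<omega> - W (real i * (T / real L)) \<omega>)"
      using assms(2) by (intro sum.cong) (auto simp: inc_def)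
    also have "\<dots> = W (real j * (T / real L)) \<omega>" using that by (subst sum_lessThan_telescope) simp
    finally show ?thesis .
  qed
  thus ?thesis using assms by (simp add: nz_def noise_def good_def)
qed

lemma SP_good: "good z \<omega> \<Longrightarrow> SP T L z' \<omega> = sP (T / real L) (\<lambda>j. noise \<omega> (real j * (T / real L))) (zc z') L"
  unfolding SP_def by (rule sP_cong) (simp add: nz_inc)

lemma Z_0: "good z \<omega> \<Longrightarrow> Z z 0 \<omega> = zc z"
  unfolding good_def noise_def by (auto simp: complex_eq_iff)

lemma conv_good:
  assumes g: "good z \<omega>" and T: "T > 0"
  shows "(\<lambda>L. SP T L z \<omega>) \<longlonglongrightarrow> Z z T \<omega>"
proof (rule LIMSEQ_I)
  fix e :: real assume e: "e > 0"
  have "continuous_on {0..T} (\<lambda>t. Z z t \<omega>)" "continuous_on {0..T} (noise \<omega>)"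
    using g unfolding good_def by (auto elim: continuous_on_subset)
  moreover have "Z z t \<omega> = Z z 0 \<omega> + integral {0..t} (\<lambda>u. (Z z u \<omega>)\<^sup>2) + noise \<omega> t" if "t \<in> {0..T}" for t
    using g that unfolding Z_0[OF g] by (auto simp: good_def)
  ultimately have "\<exists>\<rho> L0. tracks T (noise \<omega>) (\<lambda>t. Z z t \<omega>) (e / 2) \<rho> L0"
    by (rule sP_stability[OF T]) (use e in auto)
  then obtain \<rho> L0 where tr: "tracks T (noise \<omega>) (\<lambda>t. Z z t \<omega>) (e / 2) \<rho> L0" by blast
  hence \<rho>: "\<rho> > 0" by (simp add: tracks_def)
  have "norm (SP T L z \<omega> - Z z T \<omega>) < e" if "L \<ge> L0" for L
  proof -
    have "norm (SP T L z \<omega> - Z z T \<omega>) \<le> e / 2"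
      unfolding SP_good[OF g] by (rule tracksD(2)[OF tr that]) (use \<rho> in \<open>auto simp: Z_0[OF g]\<close>)
    thus ?thesis using e by linarith
  qed
  thus "\<exists>no. \<forall>n\<ge>no. norm (SP T n z \<omega> - Z z T \<omega>) < e" by blast
qed

end

section \<open>Solutions that start far out\<close>

text \<open>The bound is known on infinitely many grids that need not be nested; uniform continuity
  carries it to \<open>u\<close> from the grid point just before it.\<close>

lemma norm_le_of_grids:
  fixes h :: "real \<Rightarrow> 'b::real_normed_vector"
  assumes h: "continuous_on {0..t} h" and t: "t > 0" and gr: "\<forall>m::nat. \<exists>L\<ge>m. \<forall>j\<le>L. norm (h (real j * (t / real L))) \<le> a"
    and u: "u \<in> {0..t}"
  shows "norm (h u) \<le> a"
proof (rule field_le_epsilon)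
  fix e :: real assume e: "e > 0"
  have "uniformly_continuous_on {0..t} h" by (rule compact_uniformly_continuous[OF h]) simp
  then obtain \<delta> where \<delta>: "\<delta> > 0" "\<And>x x'. x \<in> {0..t} \<Longrightarrow> x' \<in> {0..t} \<Longrightarrow> dist x' x < \<delta> \<Longrightarrow> dist (h x') (h x) < e"
    using e unfolding uniformly_continuous_on_def by meson
  obtain m :: nat where m: "real m > t / \<delta>" using reals_Archimedean2 by blast
  obtain L where L: "L \<ge> m" and g: "\<forall>j\<le>L. norm (h (real j * (t / real L))) \<le> a" using gr by blast
  have Lt: "real L > t / \<delta>" using m L by (meson less_le_trans of_nat_le_iff)
  have L0: "real L > 0" using Lt \<delta>(1) t by (meson divide_pos_pos less_trans)
  define j where "j = nat \<lfloor>u * real L / t\<rfloor>"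
  have jj: "real j \<le> u * real L / t" "u * real L / t < real j + 1"
    using u t unfolding j_def by (auto simp: of_nat_nat)
  have uL: "u * real L / t \<le> real L" using u t L0 by (simp add: divide_le_eq mult_right_mono mult.commute)
  have jL: "j \<le> L" using jj uL by linarith
  have a1: "real j * (t / real L) \<le> u" using jj(1) t L0 by (simp add: field_simps)
  have a2: "u < real j * (t / real L) + t / real L" using jj(2) t L0 by (simp add: field_simps)
  have a3: "t / real L < \<delta>" using Lt \<delta>(1) L0 by (simp add: field_simps)
  have "real j * (t / real L) \<ge> 0" using t by simp
  hence "dist (h u) (h (real j * (t / real L))) < e"
    using a1 a2 a3 u by (intro \<delta>(2)) (auto simp: dist_real_def)
  hence "norm (h u) \<le> norm (h (real j * (t / real L))) + e"
    using norm_triangle_ineq[of "h (real j * (t / real L))" "h u - h (real j * (t / real L))"] by (simp add: dist_norm)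
  thus "norm (h u) \<le> a + e" using g jL by (meson add_right_mono order.trans)
qed

text \<open>After the last time with \<open>|Zs| >= R\<close> the path stays in the disc of radius
  \<open>R\<close>, where the drift is at most \<open>R^2\<close>. So it ends at most
  \<open>t * R^2 + 2 * a\<close> below \<open>R\<close>, however far out it started.\<close>

lemma backward_control:
  fixes Zs n :: "real \<Rightarrow> complex"
  assumes t: "t > 0" and cZ: "continuous_on {0..t} Zs"
    and eq: "\<And>u. u \<in> {0..t} \<Longrightarrow> Zs u = Zs 0 + integral {0..u} (\<lambda>u. (Zs u)\<^sup>2) + n u"
    and n: "\<And>u. u \<in> {0..t} \<Longrightarrow> norm (n u) \<le> a" and R: "R \<ge> 0" and z: "norm (Zs 0) \<ge> R"
  shows "norm (Zs t) \<ge> R - t * R\<^sup>2 - 2 * a"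
proof (cases "norm (Zs t) \<ge> R")
  case True
  have "a \<ge> 0" using order.trans[OF norm_ge_zero n[of 0]] t by simp
  moreover have "t * R\<^sup>2 \<ge> 0" using t by simp
  ultimately show ?thesis using True by linarith
next
  case False
  define S where "S = {u \<in> {0..t}. R \<le> norm (Zs u)}"
  have "closed ({0..t} \<inter> (\<lambda>u. norm (Zs u)) -` {R..})"
    by (intro continuous_closed_preimage continuous_intros cZ)
  moreover have "S = {0..t} \<inter> (\<lambda>u. norm (Zs u)) -` {R..}" by (auto simp: S_def)
  ultimately have "closed S" by simp
  hence S: "compact S" unfolding S_def by (auto simp: compact_eq_bounded_closed intro: bounded_subset[OF bounded_closed_interval[of 0 t]])
  have S0: "0 \<in> S" using z t by (simp add: S_def)
  obtain \<tau> where \<tau>: "\<tau> \<in> S" "\<And>u. u \<in> S \<Longrightarrow> u \<le> \<tau>" using compact_attains_sup[OF S] S0 by blast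
  have t1: "0 \<le> \<tau>" "\<tau> < t" using \<tau>(1) False unfolding S_def by (auto simp: less_le)
  have b: "norm (Zs u) \<le> R" if u: "u \<in> {\<tau>..t}" for u
  proof (rule continuous_le_on_closure[of "{\<tau><..t}" "\<lambda>u. norm (Zs u)"])
    show "continuous_on (closure {\<tau><..t}) (\<lambda>u. norm (Zs u))" using t1 by (intro continuous_intros continuous_on_subset[OF cZ]) auto
    show "u \<in> closure {\<tau><..t}" using t1 u by simp
    show "norm (Zs v) \<le> R" if "v \<in> {\<tau><..t}" for v
    proof (rule ccontr)
      assume "\<not> norm (Zs v) \<le> R"
      hence "v \<in> S" using that t1 by (auto simp: S_def)
      thus False using \<tau>(2)[of v] that by auto
    qed
  qed
  have i: "(\<lambda>u. (Zs u)\<^sup>2) integrable_on {0..t}" by (intro integrable_continuous_real continuous_intros cZ)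
  have ii: "integral {0..\<tau>} (\<lambda>u. (Zs u)\<^sup>2) + integral {\<tau>..t} (\<lambda>u. (Zs u)\<^sup>2) = integral {0..t} (\<lambda>u. (Zs u)\<^sup>2)"
    using t1 by (intro Henstock_Kurzweil_Integration.integral_combine i) auto
  have "norm (integral {\<tau>..t} (\<lambda>u. (Zs u)\<^sup>2)) \<le> R\<^sup>2 * (t - \<tau>)"
  proof (rule integral_bound)
    show "continuous_on {\<tau>..t} (\<lambda>u. (Zs u)\<^sup>2)" using t1 by (intro continuous_intros continuous_on_subset[OF cZ]) auto
    show "\<And>u. u \<in> {\<tau>..t} \<Longrightarrow> norm ((Zs u)\<^sup>2) \<le> R\<^sup>2" using b by (auto simp: norm_power intro!: power_mono)
  qed (use t1 in auto)
  also have "\<dots> \<le> R\<^sup>2 * t" using t1 by (intro mult_left_mono) auto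
  finally have 1: "norm (integral {\<tau>..t} (\<lambda>u. (Zs u)\<^sup>2)) \<le> t * R\<^sup>2" by (simp add: mult.commute)
  have "Zs t - Zs \<tau> = integral {\<tau>..t} (\<lambda>u. (Zs u)\<^sup>2) + (n t - n \<tau>)"
    using eq[of t] eq[of \<tau>] ii t t1 by (simp add: algebra_simps)
  hence "norm (Zs t - Zs \<tau>) \<le> norm (integral {\<tau>..t} (\<lambda>u. (Zs u)\<^sup>2)) + norm (n t - n \<tau>)"
    by (metis norm_triangle_ineq)
  moreover have "norm (n t - n \<tau>) \<le> a + a" using n[of t] n[of \<tau>] t1 norm_triangle_ineq4[of "n t" "n \<tau>"] by auto
  moreover have "norm (Zs \<tau>) \<ge> R" using \<tau>(1) by (simp add: S_def)
  moreover have "norm (Zs \<tau>) \<le> norm (Zs t) + norm (Zs t - Zs \<tau>)"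
    using norm_triangle_ineq4[of "Zs t" "Zs t - Zs \<tau>"] by simp
  ultimately show ?thesis using 1 by linarith
qed

section \<open>The transition kernel and invariance\<close>

context sde_setting begin

lemma SP_lim:
  fixes g :: "complex \<Rightarrow> 'b::{banach, second_countable_topology}"
  assumes g: "continuous_on UNIV g" and b: "\<And>w. norm (g w) \<le> B" and T: "T > 0"
  shows "(\<lambda>L. \<integral>\<omega>. g (SP T L z \<omega>) \<partial>M) \<longlonglongrightarrow> (\<integral>\<omega>. g (Z z T \<omega>) \<partial>M)"
proof (rule integral_dominated_convergence[where w = "\<lambda>_. B"])
  have [measurable]: "g \<in> borel_measurable borel" by (rule borel_measurable_continuous_onI[OF g])
  have [measurable]: "SP T L z \<in> borel_measurable M" "Z z T \<in> borel_measurable M" for L using T by auto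
  show "(\<lambda>\<omega>. g (Z z T \<omega>)) \<in> borel_measurable M" "\<And>L. (\<lambda>\<omega>. g (SP T L z \<omega>)) \<in> borel_measurable M" by measurable
  show "AE \<omega> in M. (\<lambda>L. g (SP T L z \<omega>)) \<longlonglongrightarrow> g (Z z T \<omega>)"
    using AE_good[of z]
  proof eventually_elim
    case (elim \<omega>)
    have "isCont g (Z z T \<omega>)" using g by (simp add: continuous_on_eq_continuous_at)
    thus ?case by (rule isCont_tendsto_compose[OF _ conv_good[OF elim T]])
  qed
qed (use b in auto)

definition "ker T z = distr M borel (\<lambda>\<omega>. XY z T \<omega>)"

text \<open>The solutions are given for each start separately, so measurability in \<open>z\<close>
  is not part of the data. The scheme is jointly measurable in \<open>(z, \<omega>)\<close>; the
  property passes to expectations of continuous functions of the solution by \<open>SP_lim\<close>,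
  and from these to open sets by \<open>openapp\<close>.\<close>

lemma ker_measurable:
  assumes T: "T > 0"
  shows "ker T \<in> measurable borel (prob_algebra borel)"
proof (rule measurable_prob_algebra_generated[where \<Omega> = UNIV and G = "{S. open S}"])
  have XYm: "(\<lambda>\<omega>. XY z T \<omega>) \<in> borel_measurable M" for z
    using T by (intro borel_measurable_Pair XY_measurable) auto
  show "sets borel = sigma_sets UNIV {S :: (real \<times> real) set. open S}" by (simp add: borel_def)
  show "Int_stable {S :: (real \<times> real) set. open S}" by (auto simp: Int_stable_def)
  show "prob_space (ker T z)" for z unfolding ker_def by (rule prob_space_distr[OF XYm])
  fix U :: "(real \<times> real) set" assume "U \<in> {S. open S}"
  hence U: "open U" by simp
  define g where "g n w = openapp U n (Re w, Im w)" for n w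
  have gc: "continuous_on UNIV (g n)" for n
    unfolding g_def by (rule continuous_on_compose2[OF continuous_openapp[of UNIV]]) (auto intro!: continuous_intros)
  have gb: "norm (g n w) \<le> 1" for n w using openapp_bounds[of U n] by (simp add: g_def)
  have gm: "g n \<in> borel_measurable borel" for n by (rule borel_measurable_continuous_onI[OF gc])
  note gm[measurable]
  have m1: "(\<lambda>z. \<integral>\<omega>. g n (Z z T \<omega>) \<partial>M) \<in> borel_measurable borel" for n
  proof (rule borel_measurable_LIMSEQ_real[OF SP_lim[OF gc gb T]])
    fix L
    have [measurable]: "(\<lambda>p. SP T L (fst p) (snd p)) \<in> borel_measurable (borel \<Otimes>\<^sub>M M)"
      using SP_measurable[of T L] T by (simp add: case_prod_beta)
    have "(\<lambda>(z, \<omega>). g n (SP T L z \<omega>)) \<in> borel_measurable (borel \<Otimes>\<^sub>M M)" unfolding case_prod_beta by measurable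
    thus "(\<lambda>z. \<integral>\<omega>. g n (SP T L z \<omega>) \<partial>M) \<in> borel_measurable borel" by (rule borel_measurable_lebesgue_integral)
  qed
  have eq: "emeasure (ker T z) U = ennreal (\<integral>\<omega>. indicator U (XY z T \<omega>) \<partial>M)" for z
  proof -
    have "emeasure (ker T z) U = emeasure M {\<omega> \<in> space M. XY z T \<omega> \<in> U}"
      unfolding ker_def using U by (subst emeasure_distr[OF XYm]) (auto intro!: arg_cong[where f = "emeasure M"])
    also have "\<dots> = ennreal (prob {\<omega> \<in> space M. XY z T \<omega> \<in> U})" by (rule emeasure_eq_measure)
    also have "prob {\<omega> \<in> space M. XY z T \<omega> \<in> U} = (\<integral>\<omega>. indicator {\<omega> \<in> space M. XY z T \<omega> \<in> U} \<omega> \<partial>M)"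
      by (subst Bochner_Integration.integral_indicator) (auto intro!: arg_cong[where f = prob])
    also have "\<dots> = (\<integral>\<omega>. indicator U (XY z T \<omega>) \<partial>M)"
      by (rule Bochner_Integration.integral_cong) (auto simp: indicator_def)
    finally show ?thesis .
  qed
  have "(\<lambda>z. \<integral>\<omega>. (indicator U (XY z T \<omega>) :: real) \<partial>M) \<in> borel_measurable borel"
  proof (rule borel_measurable_LIMSEQ_real[OF _ m1])
    fix z
    show "(\<lambda>n. \<integral>\<omega>. g n (Z z T \<omega>) \<partial>M) \<longlonglongrightarrow> (\<integral>\<omega>. (indicator U (XY z T \<omega>) :: real) \<partial>M)"
    proof (rule integral_dominated_convergence[where w = "\<lambda>_. 1"])
      have "Z z T \<in> borel_measurable M" using T by auto
      thus "(\<lambda>\<omega>. g n (Z z T \<omega>)) \<in> borel_measurable M" for n by measurable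
      show "(\<lambda>\<omega>. indicator U (XY z T \<omega>) :: real) \<in> borel_measurable M"
        using U by (intro measurable_compose[OF XYm] borel_measurable_indicator) auto
      show "AE \<omega> in M. (\<lambda>n. g n (Z z T \<omega>)) \<longlonglongrightarrow> indicator U (XY z T \<omega>)"
        using openapp_tendsto[OF U] by (auto simp: g_def Z_def)
    qed (use gb in auto)
  qed
  thus "(\<lambda>z. emeasure (ker T z) U) \<in> borel_measurable borel" unfolding eq by measurable
qed (auto simp: ker_def)

end

locale sde_invariant = sde_setting M W1 W2 X Y \<sigma>x \<sigma>y for M :: "'a measure" and W1 W2 X Y \<sigma>x \<sigma>y +
  fixes \<mu> :: "(real \<times> real) measure"
  assumes inv: "invariant_prob_measure (transition_prob M X Y) \<mu>"
begin

sublocale mu: prob_space \<mu> using inv by (simp add: invariant_prob_measure_def)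

lemma sets_mu [measurable_cong]: "sets \<mu> = sets borel" using inv by (simp add: invariant_prob_measure_def)

lemma space_mu [simp]: "space \<mu> = UNIV" using sets_eq_imp_space_eq[OF sets_mu] by simp

lemma ker_mu: "T > 0 \<Longrightarrow> ker T \<in> measurable \<mu> (prob_algebra borel)"
  using ker_measurable[of T] measurable_cong_sets[OF sets_mu refl] by blast

lemma XY_pair_measurable: "T > 0 \<Longrightarrow> (\<lambda>\<omega>. XY z T \<omega>) \<in> borel_measurable M"
  by (intro borel_measurable_Pair XY_measurable) auto

lemma emeasure_ker:
  assumes "T > 0" "A \<in> sets borel"
  shows "emeasure (ker T z) A = transition_prob M X Y T z A"
  unfolding ker_def transition_prob_def using assms
  by (subst emeasure_distr[OF XY_pair_measurable]) (auto intro!: arg_cong[where f = "emeasure M"])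

lemma bind_ker:
  assumes T: "T > 0" shows "\<mu> \<bind> ker T = \<mu>"
proof (rule measure_eqI)
  have k: "ker T \<in> measurable \<mu> (subprob_algebra borel)" using ker_mu[OF T] by (rule measurable_prob_algebraD)
  show s: "sets (\<mu> \<bind> ker T) = sets \<mu>" using sets_bind_measurable[OF k] sets_mu by simp
  fix A assume "A \<in> sets (\<mu> \<bind> ker T)"
  hence A: "A \<in> sets borel" using s sets_mu by simp
  have "emeasure (\<mu> \<bind> ker T) A = (\<integral>\<^sup>+z. emeasure (ker T z) A \<partial>\<mu>)" by (rule emeasure_bind[OF _ k A]) simp
  also have "\<dots> = (\<integral>\<^sup>+z. transition_prob M X Y T z A \<partial>\<mu>)" by (simp add: emeasure_ker[OF T A])
  also have "\<dots> = emeasure \<mu> A" using inv T A by (simp add: invariant_prob_measure_def)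
  finally show "emeasure (\<mu> \<bind> ker T) A = emeasure \<mu> A" .
qed

lemma inv_integral:
  fixes f :: "real \<times> real \<Rightarrow> real"
  assumes f: "f \<in> borel_measurable borel" and b: "\<And>z. \<bar>f z\<bar> \<le> B" and T: "T > 0"
  shows "integral\<^sup>L \<mu> f = (\<integral>z. (\<integral>\<omega>. f (XY z T \<omega>) \<partial>M) \<partial>\<mu>)"
    and "(\<lambda>z. \<integral>\<omega>. f (XY z T \<omega>) \<partial>M) \<in> borel_measurable \<mu>"
proof -
  have k: "ker T \<in> measurable \<mu> (subprob_algebra borel)" using ker_mu[OF T] by (rule measurable_prob_algebraD)
  have d: "integral\<^sup>L (ker T z) f = (\<integral>\<omega>. f (XY z T \<omega>) \<partial>M)" for z
    unfolding ker_def by (rule integral_distr[OF XY_pair_measurable[OF T] f])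
  have p: "prob_space (ker T z)" for z unfolding ker_def by (rule prob_space_distr[OF XY_pair_measurable[OF T]])
  have "integral\<^sup>L \<mu> f = integral\<^sup>L (\<mu> \<bind> ker T) f" by (simp add: bind_ker[OF T])
  also have "\<dots> = (\<integral>z. integral\<^sup>L (ker T z) f \<partial>\<mu>)"
    by (rule integral_bind[OF f b k mu.finite_measure_axioms, where B' = 1]) (use p in \<open>auto simp: prob_space.emeasure_space_1\<close>)
  finally show "integral\<^sup>L \<mu> f = (\<integral>z. (\<integral>\<omega>. f (XY z T \<omega>) \<partial>M) \<partial>\<mu>)" unfolding d .
  show "(\<lambda>z. \<integral>\<omega>. f (XY z T \<omega>) \<partial>M) \<in> borel_measurable \<mu>"
    unfolding d[symmetric] by (rule measurable_compose[OF k integral_measurable_subprob_algebra[OF f]])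
qed

end

section \<open>Smoothness of the invariant density\<close>

definition Phi :: "complex \<Rightarrow> complex \<Rightarrow> complex" where
  "Phi \<xi> w = exp (\<i> * of_real (Re (cnj \<xi> * w)) - of_real ((norm w)\<^sup>2 / 2))"

lemma norm_Phi: "norm (Phi \<xi> w) = exp (- (norm w)\<^sup>2 / 2)"
  by (simp add: Phi_def norm_exp_eq_Re)

lemma norm_Phi_le: "norm (Phi \<xi> w) \<le> 1"
  by (simp add: norm_Phi)

lemma continuous_Phi: "continuous_on A (Phi \<xi>)"
  unfolding Phi_def[abs_def] by (intro continuous_intros) auto

lemma Phi_measurable [measurable]: "Phi \<xi> \<in> borel_measurable borel"
  by (rule borel_measurable_continuous_onI[OF continuous_Phi])

context sde_setting begin

lemma integral_Phi_SP:
  assumes l: "l > 0" and K: "K > 0" and n: "n > 0"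
  shows "(\<integral>\<omega>. Phi \<xi> (SP (real n * l) (n * K) z \<omega>) \<partial>M) =
    FFint sg cg (l / real K) (n * K) (zc z) \<xi>"
proof -
  define d where "d = l / real K"
  define L where "L = n * K"
  have d: "d > 0" using l K by (simp add: d_def)
  have dT: "real n * l / real L = d" using n K by (simp add: L_def d_def)
  have L: "L > 0" using n K by (simp add: L_def)
  have T: "real n * l > 0" using n l by simp
  interpret G: prob_space "Gam d L" by (rule prob_space_Gam[OF d])
  interpret GG: pair_prob_space "Gam d L" "Gam d L" ..
  define H where "H p = FF sg cg (fst p) d L (zc z) \<xi> (snd p)" for p
  have Hm[measurable]: "H \<in> borel_measurable (RL L \<Otimes>\<^sub>M RL L)"
    unfolding H_def[abs_def] by (intro FF_measurable PiM_comp_measurable) (rule measurable_fst measurable_snd)+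
  have im: "(\<lambda>\<omega>. (inc W1 (real n * l) L \<omega>, inc W2 (real n * l) L \<omega>)) \<in> measurable M (RL L \<Otimes>\<^sub>M RL L)"
    using T by (intro measurable_Pair inc_measurable) auto
  have "(\<integral>\<omega>. Phi \<xi> (SP (real n * l) L z \<omega>) \<partial>M) = (\<integral>\<omega>. H (inc W1 (real n * l) L \<omega>, inc W2 (real n * l) L \<omega>) \<partial>M)"
    by (simp add: SP_def dT H_def FF_def Phi_def)
  also have "\<dots> = integral\<^sup>L (Gam d L \<Otimes>\<^sub>M Gam d L) H"
    using integral_distr[OF im Hm] unfolding law_joint[OF T L] dT by simp
  also have "\<dots> = (\<integral>e. (\<integral>x. H (e, x) \<partial>Gam d L) \<partial>Gam d L)"
  proof (rule GG.integral_fst'[symmetric])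
    show "integrable (Gam d L \<Otimes>\<^sub>M Gam d L) H"
      by (rule GG.P.integrable_const_bound[where B = 1]) (auto simp: H_def norm_FF)
  qed
  finally show ?thesis unfolding L_def d_def H_def by simp
qed

text \<open>\<open>K -> infinity\<close> with the pieces fixed: the bound does not depend on the
  number of steps per piece, so it survives along the grids with \<open>(N + 1) * K\<close>
  steps.\<close>

lemma near_bound:
  assumes l: "l > 0" and b: "\<And>K. K \<ge> 2 \<Longrightarrow> norm (FFint sg cg (l / real K) ((N + 1) * K) (zc z) \<xi>) \<le> B"
  shows "norm (\<integral>\<omega>. Phi \<xi> (Z z (real (N + 1) * l) \<omega>) \<partial>M) \<le> B"
proof -
  let ?I = "\<integral>\<omega>. Phi \<xi> (Z z (real (N + 1) * l) \<omega>) \<partial>M"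
  have "(\<lambda>L. \<integral>\<omega>. Phi \<xi> (SP (real (N + 1) * l) L z \<omega>) \<partial>M) \<longlonglongrightarrow> ?I"
    by (rule SP_lim[where B = 1]) (use l in \<open>auto intro!: continuous_Phi norm_Phi_le\<close>)
  moreover have "strict_mono (\<lambda>K. (N + 1) * K)" by (intro strict_monoI mult_strict_left_mono) auto
  ultimately
  have "(\<lambda>K. \<integral>\<omega>. Phi \<xi> (SP (real (N + 1) * l) ((N + 1) * K) z \<omega>) \<partial>M) \<longlonglongrightarrow> ?I"
    by (drule_tac LIMSEQ_subseq_LIMSEQ) (simp_all only: o_def)
  hence lim: "(\<lambda>K. norm (\<integral>\<omega>. Phi \<xi> (SP (real (N + 1) * l) ((N + 1) * K) z \<omega>) \<partial>M)) \<longlonglongrightarrow> norm ?I"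
    by (rule tendsto_norm)
  show ?thesis
  proof (rule LIMSEQ_le_const2[OF lim], rule exI[of _ 2], intro allI impI)
    fix K :: nat assume K: "2 \<le> K"
    show "norm (\<integral>\<omega>. Phi \<xi> (SP (real (N + 1) * l) ((N + 1) * K) z \<omega>) \<partial>M) \<le> B"
      by (subst integral_Phi_SP) (use l K b[OF K] in auto)
  qed
qed

lemma inc_maximal:
  assumes W: "W = W1 \<or> W = W2" and T: "T > 0" and L: "L > 0" and b: "b \<ge> 0"
  shows "prob {\<omega> \<in> space M. \<exists>j\<le>L. \<bar>\<Sum>i<j. inc W T L \<omega> i\<bar> \<ge> b} \<le> 4 * exp (- b / sqrt T)"
proof -
  have d: "T / real L > 0" using T L by simp
  let ?A = "{x \<in> space (Gam (T / real L) L). \<exists>j\<le>L. \<bar>\<Sum>i<j. x i\<bar> \<ge> b}"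
  have Am: "?A \<in> sets (RL L)"
    by (rule Gam_Collect_sets) measurable
  have im: "inc W T L \<in> measurable M (RL L)" using W T by (intro inc_measurable) auto
  have law: "distr M (RL L) (inc W T L) = Gam (T / real L) L"
    using W law_inc[OF W1 T L] law_inc[OF W2 T L] by auto
  have "prob {\<omega> \<in> space M. \<exists>j\<le>L. \<bar>\<Sum>i<j. inc W T L \<omega> i\<bar> \<ge> b} = prob (inc W T L -` ?A \<inter> space M)"
    using measurable_space[OF im] by (intro arg_cong[where f = prob]) (auto simp: space_Gam space_PiM)
  also have "\<dots> = measure (distr M (RL L) (inc W T L)) ?A" by (rule measure_distr[OF im Am, symmetric])
  also have "\<dots> \<le> 4 * exp (- b / sqrt (real L * (T / real L)))" unfolding law by (rule Gam_maximal[OF d b L])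
  finally show ?thesis using L by simp
qed

lemma psum_inc_measurable [measurable]:
  assumes "W = W1 \<or> W = W2" "T \<ge> 0"
  shows "(\<lambda>\<omega>. \<Sum>i<j. inc W T L \<omega> i) \<in> borel_measurable M"
  by (intro borel_measurable_sum PiM_comp_measurable[OF inc_measurable[OF assms]])

lemma far_prob:
  assumes t: "t > 0" and R: "R \<ge> 0" and z: "norm (zc z) \<ge> R"
  shows "prob {\<omega> \<in> space M. norm (Z z t \<omega>) \<ge> R - t * R\<^sup>2 - 2} \<ge> 1 - 8 * exp (- (1 / (sg + cg)) / sqrt t)"
proof -
  \<comment> \<open>Makes \<open>sg * b + cg * b = 1\<close>, so the noise stays in the unit disc
    while both walks stay below \<open>b\<close>.\<close>
  define b where "b = 1 / (sg + cg)"
  let ?B0 = "{\<omega> \<in> space M. norm (Z z t \<omega>) \<ge> R - t * R\<^sup>2 - 2}"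
  have b: "b \<ge> 0" using sg cg by (simp add: b_def)
  define A where "A L = {\<omega> \<in> space M. (\<forall>j\<le>L. \<bar>\<Sum>i<j. inc W1 t L \<omega> i\<bar> \<le> b) \<and> (\<forall>j\<le>L. \<bar>\<Sum>i<j. inc W2 t L \<omega> i\<bar> \<le> b)}" for L
  have t0: "t \<ge> 0" using t by simp
  have [measurable]: "(\<lambda>\<omega>. \<Sum>i<j. inc W1 t L \<omega> i) \<in> borel_measurable M" "(\<lambda>\<omega>. \<Sum>i<j. inc W2 t L \<omega> i) \<in> borel_measurable M" for j L
    using t0 by (auto intro: psum_inc_measurable)
  have [measurable]: "Z z t \<in> borel_measurable M" using t0 by auto
  show ?thesis unfolding b_def[symmetric]
  proof (rule fatou_events[where A = A and ?L0.0 = 1])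
    show "A L \<in> events" for L unfolding A_def by measurable
    show "?B0 \<in> events" by measurable
    show "1 - 8 * exp (- b / sqrt t) \<le> prob (A L)" if L: "1 \<le> L" for L
    proof -
      let ?B = "\<lambda>W. {\<omega> \<in> space M. \<exists>j\<le>L. \<bar>\<Sum>i<j. inc W t L \<omega> i\<bar> \<ge> b}"
      have Bm: "?B W1 \<in> events" "?B W2 \<in> events" by measurable
      have "prob (space M - A L) \<le> prob (?B W1 \<union> ?B W2)"
        using Bm by (intro finite_measure_mono) (auto simp: A_def not_le intro: less_imp_le)
      also have "\<dots> \<le> prob (?B W1) + prob (?B W2)" by (rule measure_Un_le[OF Bm])
      also have "\<dots> \<le> 4 * exp (- b / sqrt t) + 4 * exp (- b / sqrt t)" using L by (intro add_mono inc_maximal t b) auto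
      finally show ?thesis using prob_compl[of "A L"] \<open>A L \<in> events\<close> by simp
    qed
    show "AE \<omega> in M. (\<forall>m. \<exists>L\<ge>m. \<omega> \<in> A L) \<longrightarrow> \<omega> \<in> ?B0"
      using AE_good[of z] AE_space
    proof eventually_elim
      case (elim \<omega>)
      show ?case
      proof
        assume io: "\<forall>m. \<exists>L\<ge>m. \<omega> \<in> A L"
        have cn: "continuous_on {0..t} (noise \<omega>)" and cZ: "continuous_on {0..t} (\<lambda>u. Z z u \<omega>)"
          using elim(1) unfolding good_def by (auto elim: continuous_on_subset)
        have g: "norm (noise \<omega> (real j * (t / real L))) \<le> 1" if "\<omega> \<in> A L" "j \<le> L" for j L
        proof -
          let ?w = "nz sg cg (inc W1 t L \<omega>) (inc W2 t L \<omega>) j"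
          have "norm ?w \<le> \<bar>Re ?w\<bar> + \<bar>Im ?w\<bar>" by (rule cmod_le)
          also have "\<dots> = sg * \<bar>\<Sum>i<j. inc W1 t L \<omega> i\<bar> + cg * \<bar>\<Sum>i<j. inc W2 t L \<omega> i\<bar>"
            using sg cg by (simp add: nz_def abs_mult)
          also have "\<dots> \<le> sg * b + cg * b" using that sg cg by (intro add_mono mult_left_mono) (auto simp: A_def)
          also have "\<dots> = 1" using sg cg by (simp add: b_def add_divide_distrib[symmetric])
          finally show ?thesis using nz_inc[OF elim(1) that(2)] by simp
        qed
        have n: "norm (noise \<omega> u) \<le> 1" if "u \<in> {0..t}" for u
          by (rule norm_le_of_grids[OF cn t _ that]) (use io g in blast)
        have "norm (Z z t \<omega>) \<ge> R - t * R\<^sup>2 - 2 * 1"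
        proof (rule backward_control[OF t cZ _ n R])
          show "R \<le> norm (Z z 0 \<omega>)" using z by (simp add: Z_0[OF elim(1)])
          show "Z z u \<omega> = Z z 0 \<omega> + integral {0..u} (\<lambda>u. (Z z u \<omega>)\<^sup>2) + noise \<omega> u" if "u \<in> {0..t}" for u
            using elim(1) that unfolding Z_0[OF elim(1)] by (auto simp: good_def)
        qed
        thus "\<omega> \<in> ?B0" using elim(2) by simp
      qed
    qed
  qed
qed

lemma far_bound:
  assumes t: "t > 0" and R: "R \<ge> 0" and z: "norm (zc z) \<ge> R" and \<rho>: "0 \<le> \<rho>" "\<rho> \<le> R - t * R\<^sup>2 - 2"
  shows "norm (\<integral>\<omega>. Phi \<xi> (Z z t \<omega>) \<partial>M) \<le> 8 * exp (- (1 / (sg + cg)) / sqrt t) + exp (- \<rho>\<^sup>2 / 2)"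
proof -
  let ?A = "{\<omega> \<in> space M. norm (Z z t \<omega>) \<ge> R - t * R\<^sup>2 - 2}"
  have [measurable]: "Z z t \<in> borel_measurable M" using t by auto
  define B where "B = {\<omega> \<in> space M. \<not> norm (Z z t \<omega>) \<ge> R - t * R\<^sup>2 - 2}"
  have Bm[measurable]: "B \<in> events" unfolding B_def by measurable
  have "space M - ?A = B" by (auto simp: B_def)
  moreover have "prob (space M - ?A) = 1 - prob ?A"
    by (rule prob_compl) measurable
  ultimately have pB: "prob B \<le> 8 * exp (- (1 / (sg + cg)) / sqrt t)" using far_prob[OF t R z] by simp
  have "norm (\<integral>\<omega>. Phi \<xi> (Z z t \<omega>) \<partial>M) \<le> (\<integral>\<omega>. norm (Phi \<xi> (Z z t \<omega>)) \<partial>M)" by (rule integral_norm_bound)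
  also have "\<dots> \<le> (\<integral>\<omega>. indicator B \<omega> + exp (- \<rho>\<^sup>2 / 2) \<partial>M)"
  proof (rule integral_mono)
    show "integrable M (\<lambda>\<omega>. norm (Phi \<xi> (Z z t \<omega>)))"
      by (rule integrable_const_bound[where B = 1]) (auto simp: norm_Phi_le)
    show "integrable M (\<lambda>\<omega>. indicator B \<omega> + exp (- \<rho>\<^sup>2 / 2))" by (simp add: emeasure_eq_measure)
    fix \<omega> assume w: "\<omega> \<in> space M"
    show "norm (Phi \<xi> (Z z t \<omega>)) \<le> indicator B \<omega> + exp (- \<rho>\<^sup>2 / 2)"
    proof (cases "\<omega> \<in> B")
      case True thus ?thesis using norm_Phi_le[of \<xi> "Z z t \<omega>"] by (simp add: add_increasing2)
    next
      case False
      hence "\<rho> \<le> norm (Z z t \<omega>)" using w \<rho> by (simp add: B_def)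
      hence "\<rho>\<^sup>2 \<le> (norm (Z z t \<omega>))\<^sup>2" using \<rho> by (intro power_mono) auto
      thus ?thesis using False by (simp add: norm_Phi)
    qed
  qed
  also have "\<dots> = prob B + exp (- \<rho>\<^sup>2 / 2)" using Bm by (subst Bochner_Integration.integral_add) (auto simp: emeasure_eq_measure prob_space)
  finally show ?thesis using pB by linarith
qed

text \<open>The bound is uniform in the start, so that it can be integrated against
  \<open>\<mu>\<close> without any moment. Starts up to a radius \<open>R\<close> of order
  \<open>1 / t\<close> are covered by \<open>FF_decay\<close>; from farther out the weight at time
  \<open>t\<close> is already tiny.\<close>

lemma uniform_decay:
  "\<exists>C l1. C \<ge> 0 \<and> l1 > 0 \<and> l1 \<le> 1 \<and> (\<forall>l \<xi> z. 0 < l \<longrightarrow> l \<le> l1 \<longrightarrow> norm \<xi> * l ^ 16 \<ge> 1 \<longrightarrow>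
      norm (\<integral>\<omega>. Phi \<xi> (Z z (real (N + 1) * l) \<omega>) \<partial>M) \<le> C * l ^ N)"
proof -
  obtain C0 l0 where C0: "C0 \<ge> 0" "l0 > 0" "l0 \<le> 1" and decay0: "\<forall>l K R z \<xi>. 0 < l \<longrightarrow> l \<le> l0 \<longrightarrow> K \<ge> 2 \<longrightarrow> norm z \<le> R \<longrightarrow> real (N + 1) * l * (R + 7) \<le> 1/100 \<longrightarrow> norm \<xi> * l ^ 16 \<ge> 1 \<longrightarrow>
     norm (FFint sg cg (l / real K) ((N + 1) * K) z \<xi>) \<le> C0 * l ^ N"
    using FF_decay[OF cg sg, of N] by (elim exE conjE) (rule that, assumption+)
  define b where "b = 1 / (sg + cg)"
  have b: "b > 0" using sg cg by (simp add: b_def)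
  define C1 where "C1 = (8 * (fact (2 * N) / b ^ (2 * N)) + fact N * 800 ^ N) * real (N + 1) ^ N"
  have C1: "C1 \<ge> 0" using b by (simp add: C1_def)
  define l1 where "l1 = min l0 (1 / (1500 * real (N + 1)))"
  show ?thesis
  proof (rule exI[of _ "C0 + C1"], rule exI[of _ l1], intro conjI allI impI)
    show "C0 + C1 \<ge> 0" "l1 > 0" "l1 \<le> 1" using C0 C1 by (auto simp: l1_def)
    fix l :: real and \<xi> :: complex and z assume l: "0 < l" "l \<le> l1" and xi: "1 \<le> norm \<xi> * l ^ 16"
    define t where "t = real (N + 1) * l"
    have t: "t > 0" using l by (simp add: t_def)
    have "l \<le> 1 / (1500 * real (N + 1))" using l by (simp add: l1_def)
    hence t1: "t \<le> 1 / 1500" unfolding t_def by (simp add: field_simps)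
    \<comment> \<open>The largest radius for which \<open>FF_decay\<close> applies at time
      \<open>t\<close>. It also gives \<open>t * R^2 <= R / 100\<close>, so a path from farther out
      is, apart from rare excursions of the noise, still at distance at least
      \<open>1 / (400 * t)\<close> at time \<open>t\<close>.\<close>
    define R where "R = 1 / (100 * t) - 7"
    have tR: "t * (R + 7) = 1 / 100" using t by (simp add: R_def)
    have big: "1 / (200 * t) \<ge> 7" using t t1 by (simp add: le_divide_eq)
    have half: "1 / (100 * t) = 1 / (200 * t) + 1 / (200 * t)" using t by (simp add: field_simps)
    have R200: "R \<ge> 1 / (200 * t)" using big half by (simp add: R_def)
    have R0: "R \<ge> 0" using R200 big by linarith
    show "norm (\<integral>\<omega>. Phi \<xi> (Z z (real (N + 1) * l) \<omega>) \<partial>M) \<le> (C0 + C1) * l ^ N"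
    proof (cases "norm (zc z) \<le> R")
      case True
      have "norm (\<integral>\<omega>. Phi \<xi> (Z z (real (N + 1) * l) \<omega>) \<partial>M) \<le> C0 * l ^ N"
        by (rule near_bound[OF l(1)], rule decay0[THEN spec, THEN spec, THEN spec, THEN spec, THEN spec, THEN mp, THEN mp, THEN mp, THEN mp, THEN mp, THEN mp])
          (use l xi True tR in \<open>auto simp: l1_def t_def\<close>)
      also have "\<dots> \<le> (C0 + C1) * l ^ N" using C1 l by (intro mult_right_mono) auto
      finally show ?thesis .
    next
      case False
      define \<rho> where "\<rho> = 1 / (400 * t)"
      have \<rho>0: "\<rho> \<ge> 1" using big t unfolding \<rho>_def by (simp add: field_simps)
      have "t * R \<le> 1 / 100" using tR t by (simp add: algebra_simps)
      hence "t * R * R \<le> 1 / 100 * R" using R0 by (rule mult_right_mono)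
      hence tRR: "t * R\<^sup>2 \<le> R / 100" by (simp add: power2_eq_square mult.assoc)
      have rr: "1 / (200 * t) = \<rho> + \<rho>" using t by (simp add: \<rho>_def field_simps)
      have "\<rho> \<le> R - t * R\<^sup>2 - 2"
      proof -
        have "R \<ge> \<rho> + \<rho>" "\<rho> + \<rho> \<ge> 7" using R200 big rr by auto
        thus ?thesis using tRR by linarith
      qed
      hence "norm (\<integral>\<omega>. Phi \<xi> (Z z t \<omega>) \<partial>M) \<le> 8 * exp (- b / sqrt t) + exp (- \<rho>\<^sup>2 / 2)"
        unfolding b_def using False \<rho>0 by (intro far_bound[OF t R0]) auto
      also have "\<dots> \<le> 8 * (fact (2 * N) / b ^ (2 * N) * t ^ N) + fact N * 800 ^ N * t ^ N"
      proof (rule add_mono)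
        show "8 * exp (- b / sqrt t) \<le> 8 * (fact (2 * N) / b ^ (2 * N) * t ^ N)"
          by (intro mult_left_mono exp_sqrt_bound b t) auto
        have "\<rho> * 1 \<le> \<rho> * \<rho>" using \<rho>0 by (intro mult_left_mono) auto
        hence "exp (- \<rho>\<^sup>2 / 2) \<le> exp (- (1 / 800 * (1 / t)))" using t by (simp add: power2_eq_square \<rho>_def)
        also have "\<dots> \<le> fact N * 800 ^ N * t ^ N"
        proof -
          have "(1 / t) ^ N * exp (- (1 / 800 * (1 / t))) \<le> fact N / (1 / 800) ^ N" using t by (intro pow_exp_le) auto
          hence "t ^ N * ((1 / t) ^ N * exp (- (1 / 800 * (1 / t)))) \<le> t ^ N * (fact N / (1 / 800) ^ N)"
            using t by (intro mult_left_mono) auto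
          moreover have "t ^ N * ((1 / t) ^ N * E) = E" for E using t by (simp add: power_one_over)
          ultimately show ?thesis by (simp add: power_one_over mult_ac)
        qed
        finally show "exp (- \<rho>\<^sup>2 / 2) \<le> fact N * 800 ^ N * t ^ N" .
      qed
      also have "\<dots> = C1 * l ^ N" unfolding C1_def t_def power_mult_distrib by (simp only: distrib_right mult.assoc)
      also have "\<dots> \<le> (C0 + C1) * l ^ N" using C0 l by (intro mult_right_mono) auto
      finally show ?thesis by (simp add: t_def)
    qed
  qed
qed

end

context sde_invariant begin

text \<open>\<open>inv_integral\<close> concerns real functions; the factor 2 comes from treating
  real and imaginary part separately.\<close>

lemma integral_Phi_inv:
  assumes T: "T > 0" and b: "\<And>z. norm (\<integral>\<omega>. Phi \<xi> (Z z T \<omega>) \<partial>M) \<le> B"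
  shows "norm (\<integral>z. Phi \<xi> (zc z) \<partial>\<mu>) \<le> 2 * B"
proof -
  have zZ: "zc (XY z T \<omega>) = Z z T \<omega>" for z \<omega> by (simp add: zc_def Z_def)
  have pm: "(\<lambda>z. Phi \<xi> (zc z)) \<in> borel_measurable borel" by measurable
  have iZ: "integrable M (\<lambda>\<omega>. Phi \<xi> (Z z T \<omega>))" for z
  proof (rule integrable_const_bound[where B = 1])
    have "Z z T \<in> borel_measurable M" using T by auto
    thus "(\<lambda>\<omega>. Phi \<xi> (Z z T \<omega>)) \<in> borel_measurable M" by measurable
  qed (auto simp: norm_Phi_le)
  have imu: "integrable \<mu> (\<lambda>z. Phi \<xi> (zc z))"
    by (rule mu.integrable_const_bound[where B = 1]) (use pm in \<open>auto simp: norm_Phi_le measurable_cong_sets[OF sets_mu refl]\<close>)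
  have key: "\<bar>integral\<^sup>L \<mu> (\<lambda>z. h (Phi \<xi> (zc z)))\<bar> \<le> B"
    if h: "h = Re \<or> h = Im" for h
  proof -
    have hb: "\<bar>h w\<bar> \<le> norm w" for w using h abs_Re_le_cmod abs_Im_le_cmod by auto
    have hm: "(\<lambda>z. h (Phi \<xi> (zc z))) \<in> borel_measurable borel" using h pm by (elim disjE) auto
    have hb1: "\<bar>h (Phi \<xi> (zc z))\<bar> \<le> 1" for z using order.trans[OF hb norm_Phi_le] .
    have hi: "(\<integral>\<omega>. h (Phi \<xi> (Z z T \<omega>)) \<partial>M) = h (\<integral>\<omega>. Phi \<xi> (Z z T \<omega>) \<partial>M)" for z
      using h integral_Re[OF iZ[of z]] integral_Im[OF iZ[of z]] by auto
    have "integral\<^sup>L \<mu> (\<lambda>z. h (Phi \<xi> (zc z))) = (\<integral>z. (\<integral>\<omega>. h (Phi \<xi> (zc (XY z T \<omega>))) \<partial>M) \<partial>\<mu>)"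
      by (rule inv_integral(1)[OF hm hb1 T])
    also have "\<bar>\<dots>\<bar> \<le> (\<integral>z. \<bar>\<integral>\<omega>. h (Phi \<xi> (zc (XY z T \<omega>))) \<partial>M\<bar> \<partial>\<mu>)" by (rule integral_abs_bound)
    also have "\<dots> \<le> (\<integral>z. B \<partial>\<mu>)"
    proof (rule integral_mono)
      have bb: "\<bar>\<integral>\<omega>. h (Phi \<xi> (zc (XY z T \<omega>))) \<partial>M\<bar> \<le> B" for z
        unfolding zZ hi using order.trans[OF hb b] .
      show "integrable \<mu> (\<lambda>z. \<bar>\<integral>\<omega>. h (Phi \<xi> (zc (XY z T \<omega>))) \<partial>M\<bar>)"
        by (rule mu.integrable_const_bound[where B = B]) (use bb inv_integral(2)[OF hm hb1 T] in auto)
      show "\<bar>\<integral>\<omega>. h (Phi \<xi> (zc (XY z T \<omega>))) \<partial>M\<bar> \<le> B" for z by (rule bb)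
    qed simp
    also have "\<dots> = B" using mu.prob_space by simp
    finally show ?thesis .
  qed
  have "norm (\<integral>z. Phi \<xi> (zc z) \<partial>\<mu>) \<le> \<bar>Re (\<integral>z. Phi \<xi> (zc z) \<partial>\<mu>)\<bar> + \<bar>Im (\<integral>z. Phi \<xi> (zc z) \<partial>\<mu>)\<bar>" by (rule cmod_le)
  also have "\<dots> \<le> B + B" using key[of Re] key[of Im] imu by (intro add_mono) auto
  finally show ?thesis by simp
qed

theorem smooth_density: "\<exists>m. smooth m \<and> (\<forall>z. 0 \<le> m z) \<and> \<mu> = density lborel (\<lambda>z. ennreal (m z))"
proof -
  define w where "w z = exp (- ((z \<bullet> z) / 2))" for z :: "real \<times> real"
  have w[measurable]: "w \<in> borel_measurable borel"
    unfolding w_def[abs_def] by (intro borel_measurable_continuous_onI continuous_intros) auto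
  have wmu: "w \<in> borel_measurable \<mu>" using w measurable_cong_sets[OF sets_mu refl] by blast
  have w01: "0 \<le> w z" "w z \<le> 1" for z by (auto simp: w_def)
  define \<nu> where "\<nu> = density \<mu> (\<lambda>z. ennreal (w z))"
  have fin: "finite_measure \<nu>"
  proof (rule finite_measureI)
    have "emeasure \<nu> (space \<nu>) = (\<integral>\<^sup>+z. ennreal (w z) \<partial>\<mu>)" using wmu by (simp add: \<nu>_def emeasure_density)
    also have "\<dots> \<le> (\<integral>\<^sup>+z. 1 \<partial>\<mu>)" using w01 by (intro nn_integral_mono) (auto simp: ennreal_le_1)
    also have "\<dots> = 1" using mu.emeasure_space_1 by simp
    finally show "emeasure \<nu> (space \<nu>) \<noteq> \<infinity>" by (auto simp: top_unique)
  qed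
  have FT: "(\<integral>z. cis (\<xi> \<bullet> z) \<partial>\<nu>) = (\<integral>z. Phi (zc \<xi>) (zc z) \<partial>\<mu>)" for \<xi>
  proof -
    have cm: "(\<lambda>z. cis (\<xi> \<bullet> z)) \<in> borel_measurable \<mu>"
      unfolding measurable_cong_sets[OF sets_mu refl] by measurable
    have "(\<integral>z. cis (\<xi> \<bullet> z) \<partial>\<nu>) = (\<integral>z. w z *\<^sub>R cis (\<xi> \<bullet> z) \<partial>\<mu>)"
      unfolding \<nu>_def by (rule integral_density[OF cm wmu]) (use w01 in auto)
    moreover have "w z *\<^sub>R cis (\<xi> \<bullet> z) = Phi (zc \<xi>) (zc z)" for z
    proof -
      have "(norm (zc z))\<^sup>2 = (fst z)\<^sup>2 + (snd z)\<^sup>2" by (simp add: zc_def cmod_power2)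
      hence "(norm (zc z))\<^sup>2 = z \<bullet> z" by (simp add: inner_prod_def power2_eq_square)
      moreover have "Re (cnj (zc \<xi>) * zc z) = \<xi> \<bullet> z" by (simp add: zc_def inner_prod_def)
      ultimately have "Phi (zc \<xi>) (zc z) = exp (of_real (- ((z \<bullet> z) / 2)) + \<i> * of_real (\<xi> \<bullet> z))" by (simp add: Phi_def)
      thus ?thesis unfolding exp_add exp_of_real by (simp add: w_def cis_conv_exp scaleR_conv_of_real)
    qed
    ultimately show ?thesis by simp
  qed
  have nzc: "norm (zc \<xi>) = norm \<xi>" for \<xi> by (simp add: zc_def cmod_def norm_prod_def)
  have F1: "norm (\<integral>z. Phi \<xi> (zc z) \<partial>\<mu>) \<le> 1" for \<xi>
  proof -
    have "norm (\<integral>z. Phi \<xi> (zc z) \<partial>\<mu>) \<le> (\<integral>z. norm (Phi \<xi> (zc z)) \<partial>\<mu>)" by (rule integral_norm_bound)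
    also have "\<dots> \<le> (\<integral>z. 1 \<partial>\<mu>)" by (rule integral_mono') (auto simp: norm_Phi_le)
    also have "\<dots> = 1" using mu.prob_space by simp
    finally show ?thesis .
  qed
  have decay: "\<exists>C. \<forall>\<xi>. cmod (\<integral>z. cis (\<xi> \<bullet> z) \<partial>\<nu>) * norm \<xi> ^ k \<le> C" for k
  proof -
    \<comment> \<open>With \<open>l = |\<xi>|^(-1/16)\<close>, \<open>16 * k\<close> pieces beyond
      the reference piece turn \<open>l^(16 * k)\<close> into \<open>|\<xi>|^(-k)\<close>.
      Frequencies too small for \<open>l <= l1\<close> are covered by the trivial bound 1.\<close>
    obtain C l1 where C: "C \<ge> 0" "l1 > 0" "l1 \<le> 1" and un: "\<forall>l \<xi> z. 0 < l \<longrightarrow> l \<le> l1 \<longrightarrow> norm \<xi> * l ^ 16 \<ge> 1 \<longrightarrow>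
      norm (\<integral>\<omega>. Phi \<xi> (Z z (real (16 * k + 1) * l) \<omega>) \<partial>M) \<le> C * l ^ (16 * k)"
      using uniform_decay[of "16 * k"] by (elim exE conjE) (rule that, assumption+)
    define X0 where "X0 = 1 / l1 ^ 16"
    have X0: "X0 > 0" using C by (simp add: X0_def)
    have "cmod (\<integral>z. cis (\<xi> \<bullet> z) \<partial>\<nu>) * norm \<xi> ^ k \<le> max (X0 ^ k) (2 * C)" for \<xi>
    proof (cases "norm \<xi> \<le> X0")
      case True
      have "cmod (\<integral>z. cis (\<xi> \<bullet> z) \<partial>\<nu>) * norm \<xi> ^ k \<le> 1 * X0 ^ k"
        unfolding FT using True by (intro mult_mono F1 power_mono) auto
      thus ?thesis by simp
    next
      case False
      hence x: "norm \<xi> > 0" using X0 by linarith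
      define l where "l = root 16 (1 / norm \<xi>)"
      have l16: "l ^ 16 = 1 / norm \<xi>" unfolding l_def using x by (intro real_root_pow_pos2) auto
      have l0: "l > 0" unfolding l_def using x by simp
      have "l ^ 16 \<le> l1 ^ 16" unfolding l16 using False X0 C x by (simp add: X0_def field_simps)
      hence ll: "l \<le> l1" by (rule power_le_imp_le_base[of l 15, simplified]) (use C in auto)
      have "norm (\<integral>z. Phi (zc \<xi>) (zc z) \<partial>\<mu>) \<le> 2 * (C * l ^ (16 * k))"
      proof (rule integral_Phi_inv[where T = "real (16 * k + 1) * l"])
        show "norm (\<integral>\<omega>. Phi (zc \<xi>) (Z z (real (16 * k + 1) * l) \<omega>) \<partial>M) \<le> C * l ^ (16 * k)" for z
          by (rule un[THEN spec, THEN spec, THEN spec, THEN mp, THEN mp, THEN mp]) (use l0 ll l16 x nzc in auto)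
      qed (use l0 in simp)
      also have "l ^ (16 * k) = (1 / norm \<xi>) ^ k" by (simp add: power_mult l16)
      finally have "norm (\<integral>z. Phi (zc \<xi>) (zc z) \<partial>\<mu>) * norm \<xi> ^ k \<le> 2 * (C * (1 / norm \<xi>) ^ k) * norm \<xi> ^ k"
        by (rule mult_right_mono) simp
      also have "\<dots> = 2 * C" using x by (simp add: power_one_over)
      finally show ?thesis unfolding FT by simp
    qed
    thus ?thesis by blast
  qed
  obtain f where f: "\<And>n. cont_differentiable n f" "\<And>z. 0 \<le> f z" and nu: "\<nu> = density lborel (\<lambda>z. ennreal (f z))"
    using smooth_density_of_rapid_FT[OF fin _ decay] sets_mu by (auto simp: \<nu>_def)
  \<comment> \<open>The weight is smooth and nowhere 0, so dividing it out preserves smoothness,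
    although it destroys every global bound on the derivatives.\<close>
  define m where "m z = exp ((z \<bullet> z) / 2) * f z" for z
  have "f \<in> borel_measurable borel" using f(1)[of 0] by (intro borel_measurable_continuous_onI) simp
  note this[measurable]
  have em: "(\<lambda>z::real\<times>real. ennreal (exp ((z \<bullet> z) / 2))) \<in> borel_measurable borel"
    by (intro measurable_compose[OF _ measurable_ennreal] borel_measurable_continuous_onI continuous_intros) auto
  have em': "(\<lambda>z::real\<times>real. ennreal (exp ((z \<bullet> z) / 2))) \<in> borel_measurable \<mu>" using em measurable_cong_sets[OF sets_mu refl] by blast
  have "\<mu> = density \<mu> (\<lambda>z. ennreal (w z) * ennreal (exp ((z \<bullet> z) / 2)))"
    by (simp add: w_def ennreal_mult[symmetric] exp_minus density_1)
  also have "\<dots> = density \<nu> (\<lambda>z. ennreal (exp ((z \<bullet> z) / 2)))"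
    unfolding \<nu>_def using wmu em' by (subst density_density_eq) auto
  also have "\<dots> = density lborel (\<lambda>z. ennreal (f z) * ennreal (exp ((z \<bullet> z) / 2)))"
    unfolding nu using em by (subst density_density_eq) auto
  also have "\<dots> = density lborel (\<lambda>z. ennreal (m z))"
    by (simp add: m_def ennreal_mult[symmetric] f(2) mult.commute)
  finally have "\<mu> = density lborel (\<lambda>z. ennreal (m z))" .
  moreover have "smooth m" unfolding smooth_def m_def[abs_def] by (intro allI cont_differentiable_mult cont_differentiable_exp_sq f)
  ultimately show ?thesis using f(2) by (intro exI[of _ m]) (simp add: m_def)
qed

end

section \<open>Control paths and positivity of the density\<close>

text \<open>The small ball about 0 is moved onto \<open>w\<close> by
  \<open>Gam_shifted_lower\<close>. The energy of the discretised path, the sum of its squared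
  increments over \<open>d\<close>, is at most \<open>B^2 * T\<close> on every grid, so the lower
  bound does not depend on \<open>L\<close>.\<close>

lemma Gam_tube:
  assumes T: "T > 0" and w: "\<And>u v. u \<in> {0..T} \<Longrightarrow> v \<in> {0..T} \<Longrightarrow> \<bar>w u - w v\<bar> \<le> B * \<bar>u - v\<bar>" and w0: "w 0 = 0" and b: "b > 0"
  shows "\<exists>p>0. \<exists>L0. \<forall>L\<ge>L0. measure (Gam (T / real L) L) {x \<in> space (Gam (T / real L) L). \<forall>j\<le>L. \<bar>(\<Sum>i<j. x i) - w (real j * (T / real L))\<bar> \<le> b} \<ge> p"
proof -
  define p0 where "p0 = exp (- ((pi / (2 * b))\<^sup>2 * T / 2))"
  define E where "E = B\<^sup>2 * T"
  have p0: "p0 > 0" by (simp add: p0_def)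
  \<comment> \<open>Makes the jump loss in \<open>Gam_small_ball\<close>, which is
    \<open>3 * T^2 / (2 * b)^4 / L\<close>, at most half of the main term \<open>p0\<close>.\<close>
  obtain L1 :: nat where L1: "real L1 > 6 * T\<^sup>2 / ((2 * b) ^ 4 * p0)" using reals_Archimedean2 by blast
  show ?thesis
  proof (rule exI[of _ "(p0 / 2)\<^sup>2 / exp E"], intro conjI exI[of _ "max L1 1"] allI impI)
    show "(p0 / 2)\<^sup>2 / exp E > 0" using p0 by simp
    fix L assume L: "max L1 1 \<le> L"
    define d where "d = T / real L"
    have d: "d > 0" using T L by (simp add: d_def)
    have Ld: "real L * d = T" using L by (simp add: d_def)
    interpret G: prob_space "Gam d L" by (rule prob_space_Gam[OF d])
    define D where "D = {x \<in> space (Gam d L). \<forall>j\<le>L. \<bar>\<Sum>i<j. x i\<bar> \<le> b}"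
    have Dm: "D \<in> sets (RL L)"
      unfolding D_def by (rule Gam_Collect_sets) measurable
    have "real L * (3 * d\<^sup>2 / (2 * b) ^ 4) = (3 * T\<^sup>2 / (2 * b) ^ 4) / real L"
      using L by (simp add: d_def power2_eq_square)
    also have "\<dots> \<le> p0 / 2"
    proof -
      have "real L1 \<le> real L" using L by simp
      hence "6 * T\<^sup>2 / ((2 * b) ^ 4 * p0) \<le> real L" using L1 by linarith
      hence "6 * T\<^sup>2 / (2 * b) ^ 4 / p0 \<le> real L" by (simp only: divide_divide_eq_left)
      hence "6 * T\<^sup>2 / (2 * b) ^ 4 \<le> real L * p0" using p0 by (simp only: divide_le_eq if_True)
      moreover have "6 * T\<^sup>2 / (2 * b) ^ 4 = 2 * (3 * T\<^sup>2 / (2 * b) ^ 4)" by simp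
      moreover have "A = 2 * B \<Longrightarrow> A \<le> real L * p0 \<Longrightarrow> B \<le> p0 / 2 * real L" for A B :: real by (simp add: field_simps)
      ultimately have "3 * T\<^sup>2 / (2 * b) ^ 4 \<le> p0 / 2 * real L" by blast
      moreover have "real L > 0" using L by simp
      ultimately show ?thesis by (simp only: divide_le_eq if_True)
    qed
    finally have sm: "real L * (3 * d\<^sup>2 / (2 * b) ^ 4) \<le> p0 / 2" .
    have "p0 - real L * (3 * d\<^sup>2 / (2 * b) ^ 4) \<le> measure (Gam d L) D"
      using Gam_small_ball[OF d b, of L] unfolding Ld p0_def D_def .
    hence pD: "measure (Gam d L) D \<ge> p0 / 2" using sm by linarith
    define a where "a j = w (real (Suc j) * d) - w (real j * d)" for j
    have grid: "real j * d \<in> {0..T}" if "j \<le> L" for j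
    proof -
      have "real j * d \<le> real L * d" using that d by (intro mult_right_mono) auto
      thus ?thesis using d Ld by simp
    qed
    have aB: "(a j)\<^sup>2 / d \<le> B\<^sup>2 * d" if "j < L" for j
    proof -
      have "real (Suc j) * d - real j * d = d" by (simp add: algebra_simps)
      hence "\<bar>a j\<bar> \<le> B * d" unfolding a_def using w[OF grid[of "Suc j"] grid[of j]] that d by (simp del: of_nat_Suc)
      hence "(a j)\<^sup>2 \<le> (B * d)\<^sup>2" by (rule abs_le_square_iff[THEN iffD1, OF order.trans[OF _ abs_ge_self]])
      thus ?thesis using d by (simp add: divide_le_eq power_mult_distrib power2_eq_square mult_ac)
    qed
    have "(\<Sum>j<L. (a j)\<^sup>2 / d) \<le> (\<Sum>j<L. B\<^sup>2 * d)" by (rule sum_mono) (use aB in auto)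
    also have "\<dots> = E" using Ld by (simp add: E_def mult_ac)
    finally have Eb: "(\<Sum>j<L. (a j)\<^sup>2 / d) \<le> E" .
    have eq: "(\<Sum>i<j. shiftv (\<lambda>j. - a j) L x i) = (\<Sum>i<j. x i) - w (real j * d)" if "j \<le> L" for x j
    proof -
      have "(\<Sum>i<j. shiftv (\<lambda>j. - a j) L x i) = (\<Sum>i<j. x i - a i)" using that by (intro sum.cong) (auto simp: shiftv_def)
      also have "\<dots> = (\<Sum>i<j. x i) - (\<Sum>i<j. w (real (Suc i) * d) - w (real i * d))" by (simp add: sum_subtractf a_def)
      also have "\<dots> = (\<Sum>i<j. x i) - w (real j * d)" by (subst sum_lessThan_telescope) (simp add: w0)
      finally show ?thesis .
    qed
    have "(p0 / 2)\<^sup>2 / exp E \<le> (measure (Gam d L) D)\<^sup>2 / exp E" using pD p0 by (intro divide_right_mono power_mono) auto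
    also have "\<dots> \<le> measure (Gam d L) {x \<in> space (Gam d L). shiftv (\<lambda>j. - a j) L x \<in> D}"
      by (rule Gam_shifted_lower[OF d Dm Eb])
    also have "{x \<in> space (Gam d L). shiftv (\<lambda>j. - a j) L x \<in> D} = {x \<in> space (Gam d L). \<forall>j\<le>L. \<bar>(\<Sum>i<j. x i) - w (real j * d)\<bar> \<le> b}"
      using eq by (auto simp: D_def space_Gam) (auto simp: shiftv_def)
    finally show "measure (Gam (T / real L) L) {x \<in> space (Gam (T / real L) L). \<forall>j\<le>L. \<bar>(\<Sum>i<j. x i) - w (real j * (T / real L))\<bar> \<le> b} \<ge> (p0 / 2)\<^sup>2 / exp E"
      unfolding d_def .
  qed
qed

lemma integral_lipschitz:
  fixes b :: "real \<Rightarrow> real"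
  assumes c: "continuous_on {0..T} b"
  shows "\<exists>B. \<forall>u\<in>{0..T}. \<forall>v\<in>{0..T}. \<bar>integral {0..u} b - integral {0..v} b\<bar> \<le> B * \<bar>u - v\<bar>"
proof -
  have "bounded (b ` {0..T})" by (rule compact_imp_bounded[OF compact_continuous_image[OF c]]) simp
  then obtain B where "\<forall>u\<in>{0..T}. \<bar>b u\<bar> \<le> B" unfolding bounded_iff by auto
  hence B: "\<And>u. u \<in> {0..T} \<Longrightarrow> \<bar>b u\<bar> \<le> B" by blast
  have le: "\<bar>integral {0..u} b - integral {0..v} b\<bar> \<le> B * \<bar>u - v\<bar>" if "v \<le> u" "v \<in> {0..T}" "u \<in> {0..T}" for u v
  proof -
    have "integral {0..v} b + integral {v..u} b = integral {0..u} b"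
      using that by (intro Henstock_Kurzweil_Integration.integral_combine integrable_continuous_real continuous_on_subset[OF c]) auto
    moreover have "norm (integral {v..u} b) \<le> B * (u - v)"
      by (rule integral_bound) (use that B in \<open>auto intro: continuous_on_subset[OF c]\<close>)
    ultimately show ?thesis using that by simp
  qed
  have "\<bar>integral {0..u} b - integral {0..v} b\<bar> \<le> B * \<bar>u - v\<bar>" if "v \<in> {0..T}" "u \<in> {0..T}" for u v
    using le[of v u] le[of u v] that by (cases "v \<le> u") (auto simp: abs_minus_commute)
  thus ?thesis by blast
qed

context sde_setting begin

definition "Tube T n \<rho> L = {\<omega> \<in> space M. \<forall>j\<le>L. norm (nz sg cg (inc W1 T L \<omega>) (inc W2 T L \<omega>) j - n (real j * (T / real L))) \<le> \<rho>}"

lemma Tube_measurable [measurable]: "T \<ge> 0 \<Longrightarrow> Tube T n \<rho> L \<in> events"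
proof -
  assume T: "T \<ge> 0"
  have [measurable]: "(\<lambda>\<omega>. nz sg cg (inc W1 T L \<omega>) (inc W2 T L \<omega>) j) \<in> borel_measurable M" for j
    by (intro nz_measurable) (rule PiM_comp_measurable[OF inc_measurable'(1)[OF T]] PiM_comp_measurable[OF inc_measurable'(2)[OF T]])+
  show ?thesis unfolding Tube_def by measurable
qed

lemma Tube_prob:
  fixes b1 b2 :: "real \<Rightarrow> real"
  assumes T: "T > 0" and b: "continuous_on {0..T} b1" "continuous_on {0..T} b2" and \<rho>: "\<rho> > 0"
    and n: "\<And>t. t \<in> {0..T} \<Longrightarrow> n t = Complex (sg * integral {0..t} b1) (cg * integral {0..t} b2)"
  shows "\<exists>p>0. \<exists>L0. \<forall>L\<ge>L0. prob (Tube T n \<rho> L) \<ge> p"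
proof -
  define r where "r = \<rho> / (sg + cg)"
  have r: "r > 0" using \<rho> sg cg by (simp add: r_def)
  have ex: "\<exists>p>0. \<exists>L0. \<forall>L\<ge>L0. measure (Gam (T / real L) L) {x \<in> space (Gam (T / real L) L). \<forall>j\<le>L. \<bar>(\<Sum>i<j. x i) - integral {0..real j * (T / real L)} b\<bar> \<le> r} \<ge> p"
    if "b = b1 \<or> b = b2" for b
  proof -
    have c: "continuous_on {0..T} b" using that b by auto
    obtain B where B: "\<forall>u\<in>{0..T}. \<forall>v\<in>{0..T}. \<bar>integral {0..u} b - integral {0..v} b\<bar> \<le> B * \<bar>u - v\<bar>" using integral_lipschitz[OF c] by blast
    show ?thesis by (rule Gam_tube[OF T _ _ r, where B = B]) (use B in auto)
  qed
  obtain p1 L1 where p1: "p1 > 0" "\<forall>L\<ge>L1. measure (Gam (T / real L) L) {x \<in> space (Gam (T / real L) L). \<forall>j\<le>L. \<bar>(\<Sum>i<j. x i) - integral {0..real j * (T / real L)} b1\<bar> \<le> r} \<ge> p1"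
    using ex[OF disjI1[OF refl]] by (elim exE conjE) (rule that, assumption+)
  obtain p2 L2 where p2: "p2 > 0" "\<forall>L\<ge>L2. measure (Gam (T / real L) L) {x \<in> space (Gam (T / real L) L). \<forall>j\<le>L. \<bar>(\<Sum>i<j. x i) - integral {0..real j * (T / real L)} b2\<bar> \<le> r} \<ge> p2"
    using ex[OF disjI2[OF refl]] by (elim exE conjE) (rule that, assumption+)
  show ?thesis
  proof (rule exI[of _ "p1 * p2"], intro conjI exI[of _ "max 1 (max L1 L2)"] allI impI)
    show "p1 * p2 > 0" using p1 p2 by simp
    fix L assume L: "max 1 (max L1 L2) \<le> L"
    define d where "d = T / real L"
    have d: "d > 0" using T L by (simp add: d_def)
    have L0: "L > 0" using L by simp
    interpret G: prob_space "Gam d L" by (rule prob_space_Gam[OF d])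
    interpret GG: pair_prob_space "Gam d L" "Gam d L" ..
    define A where "A b = {x \<in> space (Gam d L). \<forall>j\<le>L. \<bar>(\<Sum>i<j. x i) - integral {0..real j * d} b\<bar> \<le> r}" for b
    have Am: "A b \<in> sets (RL L)" for b
      unfolding A_def by (rule Gam_Collect_sets) measurable
    have im: "inc W T L \<in> measurable M (RL L)" if "W = W1 \<or> W = W2" for W
      using T that by (intro inc_measurable) auto
    let ?I = "\<lambda>\<omega>. (inc W1 T L \<omega>, inc W2 T L \<omega>)"
    have iim: "?I \<in> measurable M (RL L \<Otimes>\<^sub>M RL L)" by (intro measurable_Pair im) auto
    have "p1 * p2 \<le> measure (Gam d L) (A b1) * measure (Gam d L) (A b2)"
      using p1 p2 L unfolding A_def d_def by (intro mult_mono) auto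
    also have "\<dots> = measure (Gam d L \<Otimes>\<^sub>M Gam d L) (A b1 \<times> A b2)"
      using Am by (simp add: measure_def G.emeasure_pair_measure_Times enn2real_mult)
    also have "\<dots> = measure (distr M (RL L \<Otimes>\<^sub>M RL L) ?I) (A b1 \<times> A b2)"
      unfolding law_joint[OF T L0] d_def ..
    also have "\<dots> = prob (?I -` (A b1 \<times> A b2) \<inter> space M)" using Am by (intro measure_distr[OF iim]) auto
    also have "\<dots> \<le> prob (Tube T n \<rho> L)"
    proof (rule finite_measure_mono)
      show "Tube T n \<rho> L \<in> events" using T by simp
      show "?I -` (A b1 \<times> A b2) \<inter> space M \<subseteq> Tube T n \<rho> L"
      proof (clarsimp simp: Tube_def)
        fix \<omega> j assume w: "\<omega> \<in> space M" "inc W1 T L \<omega> \<in> A b1" "inc W2 T L \<omega> \<in> A b2" and j: "j \<le> L"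
        have "real j * d \<le> real L * d" using j d by (intro mult_right_mono) auto
        moreover have "0 \<le> real j * d" using d by simp
        ultimately have jd: "real j * d \<in> {0..T}" using L0 by (simp add: d_def)
        let ?w = "nz sg cg (inc W1 T L \<omega>) (inc W2 T L \<omega>) j - n (real j * d)"
        have "norm ?w \<le> \<bar>Re ?w\<bar> + \<bar>Im ?w\<bar>" by (rule cmod_le)
        also have "\<dots> = \<bar>sg * ((\<Sum>i<j. inc W1 T L \<omega> i) - integral {0..real j * d} b1)\<bar> + \<bar>cg * ((\<Sum>i<j. inc W2 T L \<omega> i) - integral {0..real j * d} b2)\<bar>"
          by (simp add: nz_def n[OF jd] right_diff_distrib)
        also have "\<dots> = sg * \<bar>(\<Sum>i<j. inc W1 T L \<omega> i) - integral {0..real j * d} b1\<bar> + cg * \<bar>(\<Sum>i<j. inc W2 T L \<omega> i) - integral {0..real j * d} b2\<bar>"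
          using sg cg by (simp add: abs_mult)
        also have "\<dots> \<le> sg * r + cg * r" using w j sg cg by (intro add_mono mult_left_mono) (auto simp: A_def)
        also have "\<dots> = \<rho>" using sg cg by (simp add: r_def add_divide_distrib[symmetric] distrib_right[symmetric])
        finally show "norm (nz sg cg (inc W1 T L \<omega>) (inc W2 T L \<omega>) j - n (real j * T / real L)) \<le> \<rho>" by (simp add: d_def)
      qed
    qed
    finally show "p1 * p2 \<le> prob (Tube T n \<rho> L)" .
  qed
qed

text \<open>A path of the equation in which the noise has been replaced by one with continuous
  derivatives \<open>b1\<close>, \<open>b2\<close>. For \<open>sg = 0\<close> only \<open>b2\<close>
  steers.\<close>

definition "ctrl T Zs b1 b2 \<longleftrightarrow> T > 0 \<and> continuous_on {0..T} b1 \<and> continuous_on {0..T} b2 \<and>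
  (\<forall>t\<in>{0..T}. (Zs has_vector_derivative ((Zs t)\<^sup>2 + Complex (sg * b1 t) (cg * b2 t))) (at t within {0..T}))"

definition "cnoise b1 b2 t = Complex (sg * integral {0..t} b1) (cg * integral {0..t} b2)"

lemma ctrl_eq:
  assumes c: "ctrl T Zs b1 b2" and t: "t \<in> {0..T}"
  shows "Zs t = Zs 0 + integral {0..t} (\<lambda>u. (Zs u)\<^sup>2) + cnoise b1 b2 t"
proof -
  have b: "continuous_on {0..T} b1" "continuous_on {0..T} b2"
    and D: "\<And>u. u \<in> {0..T} \<Longrightarrow> (Zs has_vector_derivative ((Zs u)\<^sup>2 + Complex (sg * b1 u) (cg * b2 u))) (at u within {0..T})"
    using c by (auto simp: ctrl_def)
  have cZ: "continuous_on {0..T} Zs" using D by (rule continuous_on_vector_derivative)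
  have sub: "{0..t} \<subseteq> {0..T}" using t by auto
  have "((\<lambda>u. (Zs u)\<^sup>2 + Complex (sg * b1 u) (cg * b2 u)) has_integral (Zs t - Zs 0)) {0..t}"
  proof (rule fundamental_theorem_of_calculus)
    fix u assume "u \<in> {0..t}"
    hence "u \<in> {0..T}" using sub by blast
    from has_vector_derivative_within_subset[OF D[OF this] sub]
    show "(Zs has_vector_derivative (Zs u)\<^sup>2 + Complex (sg * b1 u) (cg * b2 u)) (at u within {0..t})" .
  qed (use t in simp)
  hence "integral {0..t} (\<lambda>u. (Zs u)\<^sup>2 + Complex (sg * b1 u) (cg * b2 u)) = Zs t - Zs 0" by (rule integral_unique)
  moreover have i1: "(\<lambda>u. (Zs u)\<^sup>2) integrable_on {0..t}"
    by (intro integrable_continuous_real continuous_intros continuous_on_subset[OF cZ sub])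
  moreover have i2: "(\<lambda>u. Complex (sg * b1 u) (cg * b2 u)) integrable_on {0..t}"
    unfolding Complex_eq by (intro integrable_continuous_real continuous_intros continuous_on_subset[OF b(1) sub] continuous_on_subset[OF b(2) sub])
  moreover have "integral {0..t} (\<lambda>u. Complex (sg * b1 u) (cg * b2 u)) = cnoise b1 b2 t"
    using integral_linear[OF i2 bounded_linear_Re] integral_linear[OF i2 bounded_linear_Im]
    by (simp add: complex_eq_iff cnoise_def o_def)
  ultimately show ?thesis by (simp add: Henstock_Kurzweil_Integration.integral_add algebra_simps)
qed

lemma ctrl_stable:
  assumes c: "ctrl T Zs b1 b2" and e: "e > 0"
  shows "\<exists>\<rho> L0. tracks T (cnoise b1 b2) Zs e \<rho> L0"
proof (rule sP_stability[OF _ _ _ ctrl_eq[OF c] e])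
  show "T > 0" using c by (simp add: ctrl_def)
  show "continuous_on {0..T} Zs"
    by (rule continuous_on_vector_derivative) (use c in \<open>auto simp: ctrl_def\<close>)
  have "continuous_on {0..T} (\<lambda>t. integral {0..t} b1)" "continuous_on {0..T} (\<lambda>t. integral {0..t} b2)"
    using c by (auto simp: ctrl_def intro!: indefinite_integral_continuous_1 integrable_continuous_real)
  thus "continuous_on {0..T} (cnoise b1 b2)"
    unfolding cnoise_def[abs_def] Complex_eq by (intro continuous_intros)
qed

text \<open>If the noise lies in the tube for infinitely many grids, the scheme is infinitely often
  within \<open>e\<close> of \<open>Zs T\<close> while it converges to the solution;
  \<open>fatou_events\<close> gives this event positive probability.\<close>

lemma steer_prob:
  assumes c: "ctrl T Zs b1 b2" and z: "Zs 0 = zc z" and e: "e > 0"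
  shows "prob {\<omega> \<in> space M. norm (Z z T \<omega> - Zs T) \<le> e} > 0"
proof -
  let ?B = "{\<omega> \<in> space M. norm (Z z T \<omega> - Zs T) \<le> e}"
  have T: "T > 0" using c by (simp add: ctrl_def)
  obtain \<rho> L1 where tr: "tracks T (cnoise b1 b2) Zs e \<rho> L1" using ctrl_stable[OF c e] by blast
  hence \<rho>: "\<rho> > 0" by (simp add: tracks_def)
  have "\<exists>p>0. \<exists>L0. \<forall>L\<ge>L0. prob (Tube T (cnoise b1 b2) \<rho> L) \<ge> p"
    by (rule Tube_prob[where ?b1.0 = b1 and ?b2.0 = b2, OF T _ _ \<rho>]) (use c in \<open>auto simp: ctrl_def cnoise_def\<close>)
  then obtain p L2 where p: "p > 0" and pT: "\<forall>L\<ge>L2. prob (Tube T (cnoise b1 b2) \<rho> L) \<ge> p"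
    by (elim exE conjE) (rule that, assumption+)
  have Tm: "Tube T (cnoise b1 b2) \<rho> L \<in> events" for L using T by simp
  have [measurable]: "Z z T \<in> borel_measurable M" using T by auto
  have "p \<le> prob ?B"
  proof (rule fatou_events[OF Tm _ pT[rule_format]])
    show "?B \<in> events" by measurable
    show "AE \<omega> in M. (\<forall>m. \<exists>L\<ge>m. \<omega> \<in> Tube T (cnoise b1 b2) \<rho> L) \<longrightarrow> \<omega> \<in> ?B"
      using AE_good[of z] AE_space
    proof eventually_elim
      case (elim \<omega>)
      show ?case
      proof
        assume io: "\<forall>m. \<exists>L\<ge>m. \<omega> \<in> Tube T (cnoise b1 b2) \<rho> L"
        have lim: "(\<lambda>L. norm (SP T L z \<omega> - Zs T)) \<longlonglongrightarrow> norm (Z z T \<omega> - Zs T)"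
          by (intro tendsto_intros conv_good[OF elim(1) T])
        have "norm (Z z T \<omega> - Zs T) \<le> e"
        proof (rule ccontr)
          assume "\<not> norm (Z z T \<omega> - Zs T) \<le> e"
          hence "eventually (\<lambda>L. norm (SP T L z \<omega> - Zs T) > e) sequentially" using lim by (intro order_tendstoD(1)[OF lim]) auto
          then obtain L3 where L3: "\<And>L. L \<ge> L3 \<Longrightarrow> norm (SP T L z \<omega> - Zs T) > e" by (auto simp: eventually_sequentially)
          obtain L where L: "L \<ge> max L1 L3" "\<omega> \<in> Tube T (cnoise b1 b2) \<rho> L" using io by blast
          have "norm (SP T L z \<omega> - Zs T) \<le> e" unfolding SP_def
            by (rule tracksD(2)[OF tr]) (use L \<rho> z in \<open>auto simp: Tube_def\<close>)
          thus False using L3[of L] L by simp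
        qed
        thus "\<omega> \<in> ?B" using elim by simp
      qed
    qed
  qed auto
  thus ?thesis using p by linarith
qed

end

section \<open>Transport of positivity along control paths\<close>

lemma sP_diff_same:
  assumes "sq d N z j \<noteq> 0" "sq d N z' j \<noteq> 0"
  shows "sP d N z' j - sP d N z j = (z' - z) / (sq d N z j * sq d N z' j)"
  using sP_diff[OF assms] by (simp add: wr_eq)

text \<open>For fixed noise the scheme is a Moebius map of its starting point, so a target that is nearly hit from
  \<open>z1\<close> is hit exactly from a point nearby, and the preimage of a small disc contains a disc of comparable size.\<close>

lemma moebius_hit:
  fixes Q z0 z1 :: complex
  assumes Q: "Q \<noteq> 0" and r: "r > 0"
    and q: "\<And>w. norm (w - z1) \<le> r \<Longrightarrow> norm (sq d N w j - Q) \<le> norm Q / 8"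
    and hit: "norm (sP d N z1 j - z0) \<le> r / (4 * (norm Q)\<^sup>2)"
  shows "\<exists>w. norm (w - z1) \<le> r / 2 \<and> (\<forall>w'. norm (w' - w) \<le> r / 2 \<longrightarrow> norm (sP d N w' j - z0) \<le> 2 / (norm Q)\<^sup>2 * norm (w' - w))"
proof -
  have Qp: "norm Q > 0" using Q by simp
  have qlow: "norm (sq d N w j) \<ge> 7/8 * norm Q" if "norm (w - z1) \<le> r" for w
    using q[OF that] norm_triangle_ineq2[of Q "Q - sq d N w j"] by (simp add: norm_minus_commute)
  have q0: "sq d N w j \<noteq> 0" if "norm (w - z1) \<le> r" for w
  proof
    assume "sq d N w j = 0"
    thus False using qlow[OF that] Qp by simp
  qed
  have prod_low: "norm (sq d N w j * sq d N w' j) \<ge> 49/64 * (norm Q)\<^sup>2" if "norm (w - z1) \<le> r" "norm (w' - z1) \<le> r" for w w'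
  proof -
    have "(7/8 * norm Q) * (7/8 * norm Q) \<le> norm (sq d N w j) * norm (sq d N w' j)" using qlow that by (intro mult_mono) auto
    thus ?thesis by (simp add: norm_mult power2_eq_square)
  qed
  \<comment> \<open>Simplified Newton iteration for \<open>sP w = z0\<close>: the derivative of
    \<open>sP\<close> in the start is \<open>1 / q^2\<close>, with approximate inverse
    \<open>Q^2\<close>. As \<open>q\<close> is within one eighth of \<open>Q\<close>, the
    contraction factor is at most \<open>(17/64) / (49/64) <= 1/2\<close>.\<close>
  define f where "f w = w - Q\<^sup>2 * (sP d N w j - z0)" for w
  have lip: "norm (f w - f w') \<le> 1/2 * norm (w - w')" if w: "norm (w - z1) \<le> r" "norm (w' - z1) \<le> r" for w w'
  proof -
    let ?p = "sq d N w' j * sq d N w j"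
    have p0: "?p \<noteq> 0" using q0 w by simp
    have "f w - f w' = (w - w') - Q\<^sup>2 * (sP d N w j - sP d N w' j)" by (simp add: f_def algebra_simps)
    also have "\<dots> = (w - w') * ((?p - Q\<^sup>2) / ?p)"
      unfolding sP_diff_same[OF q0[OF w(2)] q0[OF w(1)]] using p0 by (simp add: divide_simps) (simp add: algebra_simps)
    finally have eq: "norm (f w - f w') = norm (w - w') * (norm (?p - Q\<^sup>2) / norm ?p)" by (simp add: norm_mult norm_divide)
    have "?p - Q\<^sup>2 = (sq d N w' j - Q) * (sq d N w j - Q) + Q * (sq d N w' j - Q) + Q * (sq d N w j - Q)"
      by (simp add: algebra_simps power2_eq_square)
    hence "norm (?p - Q\<^sup>2) \<le> norm ((sq d N w' j - Q) * (sq d N w j - Q)) + norm (Q * (sq d N w' j - Q)) + norm (Q * (sq d N w j - Q))"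
      by (simp only: norm_add_le3)
    also have "\<dots> \<le> (norm Q / 8) * (norm Q / 8) + norm Q * (norm Q / 8) + norm Q * (norm Q / 8)"
      unfolding norm_mult using q w by (intro add_mono mult_mono) auto
    also have "\<dots> = 17/64 * (norm Q)\<^sup>2" by (simp add: power2_eq_square)
    finally have "norm (?p - Q\<^sup>2) \<le> 17/64 * (norm Q)\<^sup>2" .
    also have "\<dots> \<le> 1/2 * norm ?p" using prod_low[OF w(2,1)] zero_le_power2[of "norm Q"] by linarith
    finally have "norm (?p - Q\<^sup>2) / norm ?p \<le> 1/2" using p0 by (simp add: divide_le_eq)
    hence "norm (w - w') * (norm (?p - Q\<^sup>2) / norm ?p) \<le> norm (w - w') * (1/2)" by (intro mult_left_mono) auto
    thus ?thesis unfolding eq by simp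
  qed
  have f1: "norm (f z1 - z1) \<le> r / 4"
  proof -
    have "norm (f z1 - z1) = (norm Q)\<^sup>2 * norm (sP d N z1 j - z0)" by (simp add: f_def norm_mult norm_power)
    also have "\<dots> \<le> (norm Q)\<^sup>2 * (r / (4 * (norm Q)\<^sup>2))" by (intro mult_left_mono hit) auto
    also have "\<dots> = r / 4" using Qp by simp
    finally show ?thesis .
  qed
  have "\<exists>!w\<in>cball z1 (r / 2). f w = w"
  proof (rule Banach_fix[where c = "1/2", OF complete_eq_closed[THEN iffD2, OF closed_cball]])
    show "cball z1 (r / 2) \<noteq> {}" using r by simp
    show "f ` cball z1 (r / 2) \<subseteq> cball z1 (r / 2)"
    proof clarify
      fix w assume "w \<in> cball z1 (r / 2)"
      hence w: "norm (w - z1) \<le> r / 2" by (simp add: dist_norm norm_minus_commute)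
      have "norm (f w - z1) \<le> norm (f w - f z1) + norm (f z1 - z1)" using norm_triangle_ineq[of "f w - f z1" "f z1 - z1"] by simp
      also have "\<dots> \<le> 1/2 * norm (w - z1) + r / 4" using w r by (intro add_mono lip f1) auto
      also have "\<dots> \<le> r / 2" using w by simp
      finally show "f w \<in> cball z1 (r / 2)" by (simp add: dist_norm norm_minus_commute)
    qed
    show "dist (f x) (f y) \<le> 1/2 * dist x y" if "x \<in> cball z1 (r / 2)" "y \<in> cball z1 (r / 2)" for x y
      unfolding dist_norm using that r by (intro lip) (auto simp: dist_norm norm_minus_commute)
  qed auto
  then obtain w where w: "norm (w - z1) \<le> r / 2" "f w = w" by (auto simp: dist_norm norm_minus_commute)
  have hw: "sP d N w j = z0" using w(2) Q by (simp add: f_def)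
  show ?thesis
  proof (rule exI[of _ w], intro conjI allI impI w(1))
    fix w' assume w': "norm (w' - w) \<le> r / 2"
    have a: "norm (w' - z1) \<le> r" using w(1) w' norm_triangle_ineq[of "w' - w" "w - z1"] by simp
    have b: "norm (w - z1) \<le> r" using w(1) r by simp
    have "norm (sP d N w' j - z0) = norm (w' - w) / norm (sq d N w j * sq d N w' j)"
      using sP_diff_same[OF q0[OF b] q0[OF a]] by (simp add: hw norm_divide)
    also have "\<dots> \<le> norm (w' - w) / ((norm Q)\<^sup>2 / 2)"
    proof (intro divide_left_mono)
      show "(norm Q)\<^sup>2 / 2 \<le> norm (sq d N w j * sq d N w' j)" using prod_low[OF b a] zero_le_power2[of "norm Q"] by linarith
      show "0 < norm (sq d N w j * sq d N w' j) * ((norm Q)\<^sup>2 / 2)" using Qp q0[OF a] q0[OF b] by simp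
    qed simp
    finally show "norm (sP d N w' j - z0) \<le> 2 / (norm Q)\<^sup>2 * norm (w' - w)" by (simp add: mult.commute)
  qed
qed

lemma emeasure_cball_R2: "r \<ge> 0 \<Longrightarrow> emeasure lborel (cball (z :: real \<times> real) r) = ennreal (unit_ball_vol 2 * r\<^sup>2)"
  using emeasure_cball[of r z] by (simp add: power2_eq_square)

locale sde_density = sde_invariant M W1 W2 X Y \<sigma>x \<sigma>y \<mu> for M :: "'a measure" and W1 W2 X Y \<sigma>x \<sigma>y \<mu> +
  fixes m :: "real \<times> real \<Rightarrow> real"
  assumes m_cont: "continuous_on UNIV m" and m_nonneg: "\<And>z. 0 \<le> m z" and mu_eq: "\<mu> = density lborel (\<lambda>z. ennreal (m z))"
begin

lemma norm_zc_diff: "norm (zc z - zc z') = dist z z'"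
  by (simp add: zc_def cmod_def dist_norm norm_prod_def)

lemma zc_surj: "zc (Re w, Im w) = w" by (simp add: zc_def)

lemma zc_XY: "zc (XY z t \<omega>) = Z z t \<omega>" by (simp add: zc_def Z_def)

lemma m_measurable [measurable]: "m \<in> borel_measurable borel"
  by (rule borel_measurable_continuous_onI[OF m_cont])

lemma emeasure_mu: "A \<in> sets borel \<Longrightarrow> emeasure \<mu> A = (\<integral>\<^sup>+z. ennreal (m z) * indicator A z \<partial>lborel)"
  unfolding mu_eq by (rule emeasure_density) auto

lemma mu_cball_lower:
  assumes "r \<ge> 0" "a \<ge> 0" "\<And>z'. z' \<in> cball z r \<Longrightarrow> a \<le> m z'"
  shows "ennreal (a * (unit_ball_vol 2 * r\<^sup>2)) \<le> emeasure \<mu> (cball z r)"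
proof -
  have "ennreal (a * (unit_ball_vol 2 * r\<^sup>2)) = (\<integral>\<^sup>+z'. ennreal a * indicator (cball z r) z' \<partial>lborel)"
    using assms by (subst nn_integral_cmult_indicator) (auto simp: emeasure_cball_R2 ennreal_mult)
  also have "\<dots> \<le> (\<integral>\<^sup>+z'. ennreal (m z') * indicator (cball z r) z' \<partial>lborel)"
    using assms by (intro nn_integral_mono) (auto simp: indicator_def intro!: ennreal_leI)
  also have "\<dots> = emeasure \<mu> (cball z r)" by (rule emeasure_mu[symmetric]) simp
  finally show ?thesis .
qed

lemma mu_cball_upper:
  assumes "r \<ge> 0" "a \<ge> 0" "\<And>z'. z' \<in> cball z r \<Longrightarrow> m z' \<le> a"
  shows "emeasure \<mu> (cball z r) \<le> ennreal (a * (unit_ball_vol 2 * r\<^sup>2))"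
proof -
  have "emeasure \<mu> (cball z r) = (\<integral>\<^sup>+z'. ennreal (m z') * indicator (cball z r) z' \<partial>lborel)" by (rule emeasure_mu) simp
  also have "\<dots> \<le> (\<integral>\<^sup>+z'. ennreal a * indicator (cball z r) z' \<partial>lborel)"
    using assms by (intro nn_integral_mono) (auto simp: indicator_def intro!: ennreal_leI)
  also have "\<dots> = ennreal (a * (unit_ball_vol 2 * r\<^sup>2))"
    using assms by (subst nn_integral_cmult_indicator) (auto simp: emeasure_cball_R2 ennreal_mult)
  finally show ?thesis .
qed

text \<open>Fubini with the noise fixed and the start distributed as \<open>\<mu>\<close>: for noise
  in \<open>G L\<close> the starts carried into the disc about \<open>z0\<close> have mass at least
  \<open>c\<close>. Integration over the noise and invariance give the bound. The cut-off
  \<open>g\<close>, 1 up to distance \<open>\<epsilon>\<close> and 0 from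
  \<open>2 * \<epsilon>\<close> on, is continuous so that the limit of the scheme can be
  taken.\<close>

lemma hit_lower:
  assumes T: "T > 0" and \<epsilon>: "\<epsilon> > 0" and p: "p \<ge> 0" and G: "\<And>L. L \<ge> L0 \<Longrightarrow> G L \<in> events \<and> prob (G L) \<ge> p"
    and hit: "\<And>L \<omega>. L \<ge> L0 \<Longrightarrow> \<omega> \<in> G L \<Longrightarrow> \<exists>w. ennreal c \<le> emeasure \<mu> (cball w r) \<and> (\<forall>z\<in>cball w r. norm (SP T L z \<omega> - zc z0) \<le> \<epsilon>)"
    and c: "c \<ge> 0"
  shows "ennreal (c * p) \<le> emeasure \<mu> (cball z0 (2 * \<epsilon>))"
proof -
  define g where "g w = max 0 (min 1 (2 - norm (w - zc z0) / \<epsilon>))" for w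
  have gc: "continuous_on UNIV g" unfolding g_def[abs_def] using \<epsilon> by (intro continuous_intros) auto
  have g01: "0 \<le> g w" "g w \<le> 1" for w by (auto simp: g_def)
  have gb: "norm (g w) \<le> 1" for w using g01[of w] by simp
  let ?J = "\<lambda>L \<omega>. \<integral>\<^sup>+z. ennreal (g (SP T L z \<omega>)) \<partial>\<mu>" and ?g = "\<lambda>L z. \<integral>\<omega>. g (SP T L z \<omega>) \<partial>M"
  have [measurable]: "g \<in> borel_measurable borel" by (rule borel_measurable_continuous_onI[OF gc])
  have [measurable]: "(\<lambda>q. SP T L (fst q) (snd q)) \<in> borel_measurable (borel \<Otimes>\<^sub>M M)" for L
    using SP_measurable[of T L] T by (simp add: case_prod_beta)
  have [measurable]: "(\<lambda>q. SP T L (fst q) (snd q)) \<in> borel_measurable (\<mu> \<Otimes>\<^sub>M M)" for L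
    by measurable
  have SPz: "SP T L z \<in> borel_measurable M" for L z using T by simp
  note SPz[measurable]
  interpret PP: pair_prob_space \<mu> M ..
  define J where "J L = (\<integral>z. (?g L z) \<partial>\<mu>)" for L
  have im: "(?g L) \<in> borel_measurable \<mu>" for L
    by (rule borel_measurable_lebesgue_integral) measurable
  have ib: "norm (?g L z) \<le> 1" for L z
  proof -
    have "norm (?g L z) \<le> (\<integral>\<omega>. norm (g (SP T L z \<omega>)) \<partial>M)" by (rule integral_norm_bound)
    also have "\<dots> \<le> (\<integral>\<omega>. 1 \<partial>M)" by (rule integral_mono') (use gb in auto)
    finally show ?thesis by (simp add: prob_space)
  qed
  have glim: "(\<lambda>L. \<integral>\<omega>. g (SP T L z \<omega>) \<partial>M) \<longlonglongrightarrow> (\<integral>\<omega>. g (Z z T \<omega>) \<partial>M)" for z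
    by (rule SP_lim[OF gc gb T])
  have gzm: "(\<lambda>z. g (zc z)) \<in> borel_measurable borel" by measurable
  have gzb: "\<bar>g (zc z)\<bar> \<le> 1" for z using gb by simp
  have iZm: "(\<lambda>z. \<integral>\<omega>. g (Z z T \<omega>) \<partial>M) \<in> borel_measurable \<mu>"
    using inv_integral(2)[OF gzm gzb T] by (simp add: zc_XY)
  have "J \<longlonglongrightarrow> (\<integral>z. (\<integral>\<omega>. g (Z z T \<omega>) \<partial>M) \<partial>\<mu>)" unfolding J_def
    by (rule integral_dominated_convergence[where w = "\<lambda>_. 1"]) (use im iZm ib glim in auto)
  also have "(\<integral>z. (\<integral>\<omega>. g (Z z T \<omega>) \<partial>M) \<partial>\<mu>) = (\<integral>z. g (zc z) \<partial>\<mu>)"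
    using inv_integral(1)[OF gzm gzb T] by (simp add: zc_XY)
  finally have lim: "J \<longlonglongrightarrow> (\<integral>z. g (zc z) \<partial>\<mu>)" .
  have low: "c * p \<le> J L" if L: "L \<ge> L0" for L
  proof -
    have Gm[measurable]: "G L \<in> events" and Gp: "prob (G L) \<ge> p" using G[OF L] by auto
    have "ennreal (J L) = (\<integral>\<^sup>+z. ennreal (?g L z) \<partial>\<mu>)"
      unfolding J_def
    proof (rule nn_integral_eq_integral[symmetric])
      show "integrable \<mu> (?g L)"
        by (rule mu.integrable_const_bound[where B = 1]) (use im ib in auto)
    qed (auto intro!: Bochner_Integration.integral_nonneg g01)
    also have "\<dots> = (\<integral>\<^sup>+z. (\<integral>\<^sup>+\<omega>. ennreal (g (SP T L z \<omega>)) \<partial>M) \<partial>\<mu>)"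
    proof (rule nn_integral_cong, rule nn_integral_eq_integral[symmetric])
      show "integrable M (\<lambda>\<omega>. g (SP T L z \<omega>))" for z by (rule integrable_const_bound[where B = 1]) (use gb in auto)
    qed (auto intro!: g01)
    also have "\<dots> = (\<integral>\<^sup>+\<omega>. ?J L \<omega> \<partial>M)"
      by (rule PP.Fubini'[symmetric]) (simp add: case_prod_beta)
    finally have JF: "ennreal (J L) = (\<integral>\<^sup>+\<omega>. ?J L \<omega> \<partial>M)" .
    have "ennreal (c * p) \<le> ennreal c * ennreal (prob (G L))" using c p Gp by (simp add: ennreal_mult[symmetric] mult_left_mono)
    also have "\<dots> = (\<integral>\<^sup>+\<omega>. ennreal c * indicator (G L) \<omega> \<partial>M)" using Gm by (simp add: nn_integral_cmult_indicator emeasure_eq_measure)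
    also have "\<dots> \<le> (\<integral>\<^sup>+\<omega>. ?J L \<omega> \<partial>M)"
    proof (rule nn_integral_mono)
      fix \<omega> assume "\<omega> \<in> space M"
      show "ennreal c * indicator (G L) \<omega> \<le> ?J L \<omega>"
      proof (cases "\<omega> \<in> G L")
        case True
        obtain w where w: "ennreal c \<le> emeasure \<mu> (cball w r)" "\<forall>z\<in>cball w r. norm (SP T L z \<omega> - zc z0) \<le> \<epsilon>"
          using hit[OF L True] by blast
        have "ennreal c * indicator (G L) \<omega> \<le> emeasure \<mu> (cball w r)" using w(1) True by simp
        also have "\<dots> = (\<integral>\<^sup>+z. indicator (cball w r) z \<partial>\<mu>)" by (rule nn_integral_indicator[symmetric]) (simp add: sets_mu)
        also have "\<dots> \<le> ?J L \<omega>"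
        proof (rule nn_integral_mono)
          fix z
          show "indicator (cball w r) z \<le> ennreal (g (SP T L z \<omega>))"
          proof (cases "z \<in> cball w r")
            case True
            hence "norm (SP T L z \<omega> - zc z0) / \<epsilon> \<le> 1" using w(2) \<epsilon> by (simp add: divide_le_eq)
            hence "g (SP T L z \<omega>) = 1" by (simp add: g_def)
            thus ?thesis by (simp add: indicator_def)
          qed simp
        qed
        finally show ?thesis .
      qed simp
    qed
    also have "\<dots> = ennreal (J L)" by (rule JF[symmetric])
    finally have "ennreal (c * p) \<le> ennreal (J L)" .
    moreover have "J L \<ge> 0" unfolding J_def by (intro Bochner_Integration.integral_nonneg g01)
    ultimately show ?thesis by (simp add: ennreal_le_iff)
  qed
  have "c * p \<le> (\<integral>z. g (zc z) \<partial>\<mu>)" by (rule LIMSEQ_le_const[OF lim]) (use low in blast)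
  also have "\<dots> \<le> (\<integral>z. indicator (cball z0 (2 * \<epsilon>)) z \<partial>\<mu>)"
  proof (rule integral_mono)
    have gm: "(\<lambda>z. g (zc z)) \<in> borel_measurable \<mu>" using gzm measurable_cong_sets[OF sets_mu refl] by blast
    show "integrable \<mu> (\<lambda>z. g (zc z))" by (rule mu.integrable_const_bound[where B = 1]) (use gm gb in auto)
    show "integrable \<mu> (indicator (cball z0 (2 * \<epsilon>)) :: _ \<Rightarrow> real)" by (rule integrable_real_indicator) (auto simp: sets_mu mu.emeasure_eq_measure)
    fix z
    show "g (zc z) \<le> indicator (cball z0 (2 * \<epsilon>)) z"
    proof (cases "z \<in> cball z0 (2 * \<epsilon>)")
      case False
      hence "norm (zc z - zc z0) / \<epsilon> \<ge> 2" using \<epsilon> by (simp add: norm_zc_diff le_divide_eq dist_commute)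
      thus ?thesis using False by (simp add: g_def)
    qed (simp add: g01)
  qed
  also have "\<dots> = mu.prob (cball z0 (2 * \<epsilon>))" by (simp add: sets_mu)
  finally show ?thesis by (simp add: mu.emeasure_eq_measure)
qed

text \<open>Two rates are compared. If \<open>m z0 = 0\<close>, continuity makes the mass of a small
  disc about \<open>z0\<close> negligible against its area; transport from \<open>z1\<close> gives
  it at least a fixed multiple of its area, since \<open>p\<close>, \<open>a\<close> and
  \<open>K\<close> are chosen before \<open>\<epsilon>\<close>.\<close>

lemma density_propagates:
  assumes c: "ctrl T Zs b1 b2" and Z0: "Zs 0 = zc z1" and ZT: "Zs T = zc z0" and m1: "m z1 > 0"
  shows "m z0 > 0"
proof (rule ccontr)
  assume "\<not> m z0 > 0"
  hence mz0: "m z0 = 0" using m_nonneg[of z0] by linarith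
  have T: "T > 0" using c by (simp add: ctrl_def)
  define Q where "Q = exp (- integral {0..T} Zs)"
  have Q0: "Q \<noteq> 0" by (simp add: Q_def)
  hence Qp: "norm Q > 0" by simp
  define a where "a = m z1 / 2"
  have a: "a > 0" using m1 by (simp add: a_def)
  have cont: "isCont m z" for z using m_cont continuous_on_eq_continuous_at[OF open_UNIV] by blast
  obtain \<delta>1 where \<delta>1: "\<delta>1 > 0" "\<And>z. dist z z1 < \<delta>1 \<Longrightarrow> dist (m z) (m z1) < a"
    using cont[of z1] a unfolding continuous_at_eps_delta by meson
  \<comment> \<open>Stability is needed twice. The first use fixes the radius \<open>r\<close> of
    the disc of starts on which \<open>q\<close> stays near \<open>Q\<close>; only then is the
    precision known that \<open>moebius_hit\<close> demands of the run from
    \<open>z1\<close>.\<close>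
  have e1: "norm Q / 8 > 0" using Qp by simp
  obtain \<rho>1 L1 where tr1: "tracks T (cnoise b1 b2) Zs (norm Q / 8) \<rho>1 L1" using ctrl_stable[OF c e1] by blast
  hence \<rho>1: "\<rho>1 > 0" by (simp add: tracks_def)
  define r where "r = min \<rho>1 (\<delta>1 / 2)"
  have r: "r > 0" "r \<le> \<rho>1" "r < \<delta>1" using \<rho>1 \<delta>1(1) by (auto simp: r_def)
  have e2: "r / (4 * (norm Q)\<^sup>2) > 0" using r Qp by simp
  obtain \<rho>2 L2 where tr2: "tracks T (cnoise b1 b2) Zs (r / (4 * (norm Q)\<^sup>2)) \<rho>2 L2" using ctrl_stable[OF c e2] by blast
  hence \<rho>2: "\<rho>2 > 0" by (simp add: tracks_def)
  define \<rho> where "\<rho> = min \<rho>1 \<rho>2"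
  have \<rho>: "\<rho> > 0" using \<rho>1 \<rho>2 by (simp add: \<rho>_def)
  have "\<exists>p>0. \<exists>L0. \<forall>L\<ge>L0. prob (Tube T (cnoise b1 b2) \<rho> L) \<ge> p"
    by (rule Tube_prob[where ?b1.0 = b1 and ?b2.0 = b2, OF T _ _ \<rho>]) (use c in \<open>auto simp: ctrl_def cnoise_def\<close>)
  then obtain p L3 where p: "p > 0" and pT: "\<forall>L\<ge>L3. prob (Tube T (cnoise b1 b2) \<rho> L) \<ge> p"
    by (elim exE conjE) (rule that, assumption+)
  define K where "K = 2 / (norm Q)\<^sup>2"
  have K: "K > 0" using Qp by (simp add: K_def)
  define V where "V = unit_ball_vol (2::real)"
  have V: "V > 0" by (simp add: V_def)
  \<comment> \<open>With \<open>\<epsilon> = K * s\<close> this makes the upper bound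
    \<open>\<eta> * V * (2 * \<epsilon>)^2\<close> exactly half of the lower bound
    \<open>a * V * s^2 * p\<close>.\<close>
  define \<eta> where "\<eta> = p * a / (8 * K\<^sup>2)"
  have \<eta>: "\<eta> > 0" using p a K by (simp add: \<eta>_def)
  obtain \<delta>2 where \<delta>2: "\<delta>2 > 0" "\<And>z. dist z z0 < \<delta>2 \<Longrightarrow> dist (m z) (m z0) < \<eta>"
    using cont[of z0] \<eta> unfolding continuous_at_eps_delta by meson
  define \<epsilon> where "\<epsilon> = min (K * r / 2) (\<delta>2 / 4)"
  have \<epsilon>: "\<epsilon> > 0" using K r \<delta>2(1) by (simp add: \<epsilon>_def)
  define s where "s = \<epsilon> / K"
  have s: "s > 0" "s \<le> r / 2" "K * s = \<epsilon>" using \<epsilon> K by (auto simp: s_def \<epsilon>_def field_simps min_def)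
  have "ennreal (a * (V * s\<^sup>2) * p) \<le> emeasure \<mu> (cball z0 (2 * \<epsilon>))"
  proof (rule hit_lower[OF T \<epsilon>, where G = "Tube T (cnoise b1 b2) \<rho>" and ?L0.0 = "max L1 (max L2 L3)" and r = s])
    show "Tube T (cnoise b1 b2) \<rho> L \<in> events \<and> prob (Tube T (cnoise b1 b2) \<rho> L) \<ge> p" if "max L1 (max L2 L3) \<le> L" for L
      using pT that T by auto
    fix L \<omega> assume L: "max L1 (max L2 L3) \<le> L" and w: "\<omega> \<in> Tube T (cnoise b1 b2) \<rho> L"
    let ?N = "nz sg cg (inc W1 T L \<omega>) (inc W2 T L \<omega>)"
    have "\<exists>w. norm (w - zc z1) \<le> r / 2 \<and> (\<forall>w'. norm (w' - w) \<le> r / 2 \<longrightarrow> norm (sP (T / real L) ?N w' L - zc z0) \<le> 2 / (norm Q)\<^sup>2 * norm (w' - w))"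
    proof (rule moebius_hit[OF Q0 r(1)])
      show "norm (sq (T / real L) ?N w L - Q) \<le> norm Q / 8" if "norm (w - zc z1) \<le> r" for w
        unfolding Q_def by (rule tracksD(1)[OF tr1[unfolded Q_def]]) (use that L \<open>\<omega> \<in> _\<close> r Z0 in \<open>auto simp: Tube_def \<rho>_def\<close>)
      show "norm (sP (T / real L) ?N (zc z1) L - zc z0) \<le> r / (4 * (norm Q)\<^sup>2)"
        unfolding ZT[symmetric] by (rule tracksD(2)[OF tr2]) (use L w \<rho>2 Z0 in \<open>auto simp: Tube_def \<rho>_def\<close>)
    qed
    then obtain w0 where w0: "norm (w0 - zc z1) \<le> r / 2"
      "\<And>w'. norm (w' - w0) \<le> r / 2 \<Longrightarrow> norm (sP (T / real L) ?N w' L - zc z0) \<le> 2 / (norm Q)\<^sup>2 * norm (w' - w0)" by blast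
    define u where "u = (Re w0, Im w0)"
    have u: "zc u = w0" by (simp add: u_def zc_surj)
    show "\<exists>w. ennreal (a * (V * s\<^sup>2)) \<le> emeasure \<mu> (cball w s) \<and> (\<forall>z\<in>cball w s. norm (SP T L z \<omega> - zc z0) \<le> \<epsilon>)"
    proof (rule exI[of _ u], intro conjI ballI)
      show "ennreal (a * (V * s\<^sup>2)) \<le> emeasure \<mu> (cball u s)" unfolding V_def
      proof (rule mu_cball_lower)
        fix z assume "z \<in> cball u s"
        hence "dist z u \<le> r / 2" using s by (simp add: dist_commute)
        moreover have "dist u z1 \<le> r / 2" using w0(1) u norm_zc_diff by metis
        ultimately have "dist z z1 < \<delta>1" using r dist_triangle[of z z1 u] by linarith
        hence "\<bar>m z - m z1\<bar> < a" using \<delta>1(2) by (simp add: dist_real_def)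
        thus "a \<le> m z" unfolding a_def by linarith
      qed (use s a in auto)
      fix z assume z: "z \<in> cball u s"
      hence zs: "norm (zc z - w0) \<le> s" unfolding u[symmetric] norm_zc_diff by (simp add: dist_commute)
      have "norm (SP T L z \<omega> - zc z0) \<le> K * norm (zc z - w0)" unfolding SP_def K_def using zs s by (intro w0(2)) auto
      also have "\<dots> \<le> K * s" using zs K by (intro mult_left_mono) auto
      finally show "norm (SP T L z \<omega> - zc z0) \<le> \<epsilon>" using s by simp
    qed
  qed (use p a V in auto)
  also have "\<dots> \<le> ennreal (\<eta> * (unit_ball_vol 2 * (2 * \<epsilon>)\<^sup>2))"
  proof (rule mu_cball_upper)
    fix z assume "z \<in> cball z0 (2 * \<epsilon>)"
    hence "dist z z0 < \<delta>2" using \<delta>2(1) unfolding \<epsilon>_def by (auto simp: dist_commute min_def split: if_splits)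
    hence "\<bar>m z - m z0\<bar> < \<eta>" using \<delta>2(2) by (simp add: dist_real_def)
    thus "m z \<le> \<eta>" using mz0 by simp
  qed (use \<eta> \<epsilon> in auto)
  finally have "a * (V * s\<^sup>2) * p \<le> \<eta> * (V * (2 * \<epsilon>)\<^sup>2)" using \<eta> V by (simp add: ennreal_le_iff V_def)
  also have "\<dots> = \<eta> * 4 * K\<^sup>2 * V * s\<^sup>2" unfolding s(3)[symmetric] by (simp add: power2_eq_square)
  also have "\<dots> = (a * (V * s\<^sup>2) * p) / 2" using K by (simp add: \<eta>_def field_simps)
  finally have "a * (V * s\<^sup>2) * p \<le> (a * (V * s\<^sup>2) * p) / 2" .
  moreover have "a * (V * s\<^sup>2) * p > 0" using a V s p by simp
  ultimately show False by linarith
qed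

lemma m_pos_exists: "\<exists>z. m z > 0 \<and> z \<in> A" if A: "A \<in> sets borel" "emeasure \<mu> A > 0" for A
proof (rule ccontr)
  assume "\<not> ?thesis"
  hence "\<not> m z > 0" if "z \<in> A" for z using that by blast
  hence "m z = 0" if "z \<in> A" for z using m_nonneg[of z] that by fastforce
  hence "(\<integral>\<^sup>+z. ennreal (m z) * indicator A z \<partial>lborel) = 0" by (intro nn_integral_zero') (auto simp: indicator_def)
  thus False using A emeasure_mu by simp
qed

lemma positive_elliptic:
  assumes "\<sigma>x > 0"
  shows "m z0 > 0"
proof -
  have sg0: "sg > 0" using assms by (simp add: sg_def)
  have "emeasure \<mu> UNIV > 0" using mu.emeasure_space_1 by simp
  then obtain z1 where z1: "m z1 > 0" using m_pos_exists[of UNIV] by auto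
  define D where "D = zc z0 - zc z1"
  define Zs where "Zs t = zc z1 + of_real t * D" for t
  define b1 where "b1 t = Re (D - (Zs t)\<^sup>2) / sg" for t
  define b2 where "b2 t = Im (D - (Zs t)\<^sup>2) / cg" for t
  have "ctrl 1 Zs b1 b2" unfolding ctrl_def
  proof (intro conjI ballI)
    have c: "continuous_on {0..1} Zs" unfolding Zs_def[abs_def] by (intro continuous_intros)
    show "continuous_on {0..1} b1" unfolding b1_def[abs_def] using sg0 by (intro continuous_intros c) auto
    show "continuous_on {0..1} b2" unfolding b2_def[abs_def] using cg by (intro continuous_intros c) auto
    fix t :: real
    have "(Zs has_vector_derivative D) (at t within {0..1})"
      unfolding Zs_def[abs_def] by (auto intro!: derivative_eq_intros)
    moreover have "(Zs t)\<^sup>2 + Complex (sg * b1 t) (cg * b2 t) = D" using sg0 cg by (simp add: b1_def b2_def complex_eq_iff)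
    ultimately show "(Zs has_vector_derivative ((Zs t)\<^sup>2 + Complex (sg * b1 t) (cg * b2 t))) (at t within {0..1})" by simp
  qed simp
  thus ?thesis by (rule density_propagates[OF _ _ _ z1]) (auto simp: Zs_def D_def)
qed

end

section \<open>The degenerate case without noise in the first coordinate\<close>

context sde_setting begin

text \<open>The first coordinate is now differentiable with \<open>x' = x^2 - y^2 <= x^2\<close>, so
  from \<open>x < 0\<close> it cannot reach 0 in finite time: with \<open>|x| <= B\<close>, the
  function \<open>x * exp (B * u)\<close> does not increase up to the first time with
  \<open>x >= 0\<close>.\<close>

lemma left_half_plane_invariant:
  assumes sx0: "\<sigma>x = 0" and g: "good z \<omega>" and z: "fst z < 0" and t: "t \<ge> 0"
  shows "X z t \<omega> < 0"
proof (rule ccontr)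
  assume "\<not> X z t \<omega> < 0"
  hence xt: "X z t \<omega> \<ge> 0" by simp
  define x where "x u = X z u \<omega>" for u
  define f where "f u = (X z u \<omega>)\<^sup>2 - (Y z u \<omega>)\<^sup>2" for u
  have sg0: "sg = 0" by (rule trans[OF sg_def]) (simp add: sx0)
  have cZ: "continuous_on {0..t} (\<lambda>u. Z z u \<omega>)" using g unfolding good_def by (auto elim: continuous_on_subset)
  have cx: "continuous_on {0..t} x" and cy: "continuous_on {0..t} (\<lambda>u. Y z u \<omega>)"
    using continuous_on_Re[OF cZ] continuous_on_Im[OF cZ] by (auto simp: x_def[abs_def] Z_def)
  have cf: "continuous_on {0..t} f" unfolding f_def[abs_def] x_def[symmetric] by (intro continuous_intros cx cy)
  have eq: "x u = fst z + integral {0..u} f" if "u \<in> {0..t}" for u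
  proof -
    have i: "(\<lambda>u. (Z z u \<omega>)\<^sup>2) integrable_on {0..u}"
      using that by (intro integrable_continuous_real continuous_intros continuous_on_subset[OF cZ]) auto
    have "Re (integral {0..u} (\<lambda>u. (Z z u \<omega>)\<^sup>2)) = integral {0..u} f"
      using integral_linear[OF i bounded_linear_Re] by (simp add: o_def Z_def power2_eq_square f_def[abs_def])
    moreover have "Z z u \<omega> = zc z + integral {0..u} (\<lambda>u. (Z z u \<omega>)\<^sup>2) + noise \<omega> u" using g that by (simp add: good_def)
    ultimately show ?thesis by (simp add: x_def zc_def noise_def sg0 Z_def complex_eq_iff)
  qed
  have dx: "(x has_real_derivative f u) (at u)" if "0 < u" "u < t" for u
  proof -
    have "((\<lambda>u. integral {0..u} f) has_real_derivative f u) (at u within {0..t})"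
      using that by (intro integral_has_real_derivative cf) auto
    hence "((\<lambda>u. fst z + integral {0..u} f) has_real_derivative f u) (at u within {0..t})" by (auto intro!: derivative_eq_intros)
    hence "(x has_real_derivative f u) (at u within {0..t})"
      by (rule has_field_derivative_transform_within[where d = 1]) (use eq that in auto)
    thus ?thesis using that by (simp add: at_within_Icc_at)
  qed
  have "bounded (x ` {0..t})" by (rule compact_imp_bounded[OF compact_continuous_image[OF cx]]) simp
  then obtain B where "\<forall>u\<in>{0..t}. \<bar>x u\<bar> \<le> B" unfolding bounded_iff by auto
  hence B: "\<And>u. u \<in> {0..t} \<Longrightarrow> \<bar>x u\<bar> \<le> B" by blast
  define S where "S = {0..t} \<inter> x -` {0..}"
  have "closed S" unfolding S_def by (intro continuous_closed_preimage cx) auto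
  hence cS: "compact S" unfolding S_def by (auto simp: compact_eq_bounded_closed intro: bounded_subset[OF bounded_closed_interval[of 0 t]])
  have "t \<in> S" using xt t by (simp add: S_def x_def)
  then obtain \<tau> where \<tau>: "\<tau> \<in> S" "\<And>u. u \<in> S \<Longrightarrow> \<tau> \<le> u" using compact_attains_inf[OF cS] by blast
  have x0: "x 0 = fst z" using eq[of 0] t by simp
  have \<tau>0: "0 < \<tau>" "\<tau> \<le> t" "x \<tau> \<ge> 0" using \<tau>(1) x0 z unfolding S_def by (auto simp: less_le)
  define h where "h u = x u * exp (B * u)" for u
  have "h \<tau> \<le> h 0"
  proof (rule DERIV_nonpos_imp_decreasing_open[OF less_imp_le[OF \<tau>0(1)]])
    show "continuous_on {0..\<tau>} h" unfolding h_def[abs_def] using \<tau>0 by (intro continuous_intros continuous_on_subset[OF cx]) auto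
    fix u assume u: "0 < u" "u < \<tau>"
    have "x u < 0" using \<tau>(2)[of u] u \<tau>0 by (force simp: S_def)
    moreover have "x u + B \<ge> 0" using B[of u] u \<tau>0 by auto
    ultimately have "x u * (x u + B) \<le> 0" by (intro mult_nonpos_nonneg) auto
    moreover have "f u \<le> x u * x u" by (simp add: f_def x_def power2_eq_square)
    ultimately have "f u + B * x u \<le> 0" by (simp add: algebra_simps)
    hence "exp (B * u) * (f u + B * x u) \<le> 0" by (intro mult_nonneg_nonpos) auto
    moreover have "(h has_real_derivative exp (B * u) * (f u + B * x u)) (at u)"
      unfolding h_def[abs_def] using u \<tau>0 by (auto intro!: derivative_eq_intros dx simp: algebra_simps)
    ultimately show "\<exists>y. (h has_real_derivative y) (at u) \<and> y \<le> 0" by blast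
  qed
  moreover have "h \<tau> \<ge> 0" using \<tau>0 by (simp add: h_def)
  ultimately show False using x0 z by (simp add: h_def)
qed

text \<open>The noiseless flow from \<open>w\<close> has its pole at \<open>t = 1 / w\<close>, which
  is not real as \<open>snd z\<close> is nonzero, and its real part has the sign of
  \<open>fst z - t * |w|^2\<close>. Integer times leave only countably many exceptional sets in
  \<open>mu_right_half_plane\<close>.\<close>

lemma reaches_left:
  assumes y: "snd z \<noteq> 0"
  shows "\<exists>n::nat. n > 0 \<and> transition_prob M X Y (real n) z {z. fst z < 0} > 0"
proof -
  let ?w = "zc z"
  have w0: "norm ?w > 0" using y by (auto simp: zc_def complex_eq_iff)
  obtain n0 :: nat where n0: "real n0 > fst z / (norm ?w)\<^sup>2" using reals_Archimedean2 by blast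
  define n where "n = Suc n0"
  have n: "n > 0" "real n > fst z / (norm ?w)\<^sup>2" using n0 by (auto simp: n_def)
  have den: "1 - of_real t * ?w \<noteq> 0" for t
  proof
    assume e: "1 - of_real t * ?w = 0"
    hence "Im (1 - of_real t * ?w) = 0" "Re (1 - of_real t * ?w) = 0" by (simp_all only: zero_complex.simps)
    hence "t * snd z = 0" "1 - t * fst z = 0" by (simp_all add: zc_def)
    thus False using y by auto
  qed
  define Zs where "Zs t = ?w / (1 - of_real t * ?w)" for t
  have c: "ctrl (real n) Zs (\<lambda>_. 0) (\<lambda>_. 0)" unfolding ctrl_def
  proof (intro conjI ballI)
    fix t
    have "((\<lambda>t. 1 - complex_of_real t * ?w) has_vector_derivative - ?w) (at t within {0..real n})"
      by (auto intro!: derivative_eq_intros)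
    moreover have "((\<lambda>v. ?w / v) has_field_derivative - ?w / (1 - of_real t * ?w)\<^sup>2) (at (1 - of_real t * ?w) within ((\<lambda>t. 1 - complex_of_real t * ?w) ` {0..real n}))"
      using den[of t] by (auto intro!: derivative_eq_intros simp: power2_eq_square)
    ultimately have "((\<lambda>v. ?w / v) \<circ> (\<lambda>t. 1 - complex_of_real t * ?w) has_vector_derivative - ?w * (- ?w / (1 - of_real t * ?w)\<^sup>2)) (at t within {0..real n})"
      by (rule field_vector_diff_chain_within)
    moreover have "- ?w * (- ?w / (1 - of_real t * ?w)\<^sup>2) = (Zs t)\<^sup>2 + Complex (sg * 0) (cg * 0)"
      by (simp add: Zs_def power_divide power2_eq_square complex_eq_iff)
    ultimately show "(Zs has_vector_derivative (Zs t)\<^sup>2 + Complex (sg * 0) (cg * 0)) (at t within {0..real n})"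
      by (simp add: o_def Zs_def[abs_def])
  qed (use n in auto)
  have "Re (Zs (real n)) = (fst z - real n * (norm ?w)\<^sup>2) / (norm (1 - of_real (real n) * ?w))\<^sup>2"
    by (simp add: Zs_def Re_divide' cmod_power2 zc_def) (simp add: algebra_simps power2_eq_square)
  also have "\<dots> < 0" using n w0 den[of "real n"] by (intro divide_neg_pos) (auto simp: field_simps)
  finally have neg: "Re (Zs (real n)) < 0" .
  have [measurable]: "Z z (real n) \<in> borel_measurable M" by auto
  have XYm: "X z (real n) \<in> borel_measurable M" by auto
  have "0 < prob {\<omega> \<in> space M. norm (Z z (real n) \<omega> - Zs (real n)) \<le> - Re (Zs (real n)) / 2}"
    by (rule steer_prob[OF c]) (use neg in \<open>auto simp: Zs_def\<close>)
  also have "\<dots> \<le> prob {\<omega> \<in> space M. X z (real n) \<omega> < 0}"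
  proof (rule finite_measure_mono)
    show "{\<omega> \<in> space M. X z (real n) \<omega> < 0} \<in> events" using XYm by measurable
    show "{\<omega> \<in> space M. norm (Z z (real n) \<omega> - Zs (real n)) \<le> - Re (Zs (real n)) / 2} \<subseteq> {\<omega> \<in> space M. X z (real n) \<omega> < 0}"
    proof clarify
      fix \<omega> assume "norm (Z z (real n) \<omega> - Zs (real n)) \<le> - Re (Zs (real n)) / 2"
      hence "Re (Z z (real n) \<omega> - Zs (real n)) \<le> - Re (Zs (real n)) / 2" using complex_Re_le_cmod order.trans by blast
      thus "X z (real n) \<omega> < 0" using neg by (simp add: Z_def)
    qed
  qed
  finally show ?thesis using n(1) by (intro exI[of _ n]) (simp add: transition_prob_def emeasure_eq_measure)
qed

end

context sde_density begin

lemma AE_snd_nonzero: "AE z in \<mu>. snd z \<noteq> 0"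
proof -
  have "emeasure (lborel \<Otimes>\<^sub>M lborel) ((UNIV :: real set) \<times> {0::real}) = emeasure lborel (UNIV :: real set) * emeasure lborel {0::real}"
    by (rule sigma_finite_measure.emeasure_pair_measure_Times[OF sigma_finite_lborel]) auto
  moreover have "(UNIV :: real set) \<times> {0::real} \<in> sets borel" by (intro borel_closed closed_Times) auto
  ultimately have n: "UNIV \<times> {0::real} \<in> null_sets (lborel :: (real \<times> real) measure)" by (auto simp: lborel_prod null_sets_def)
  have "AE z in (lborel :: (real \<times> real) measure). snd z \<noteq> 0" by (rule AE_I'[OF n]) auto
  thus ?thesis unfolding mu_eq by (subst AE_density) auto
qed

text \<open>Nothing leaves the left half-plane, so by invariance no mass may enter it: almost every
  start outside has probability 0 of being inside at any positive integer time. Off the line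
  \<open>snd z = 0\<close>, which is null because \<open>\<mu>\<close> has a density, this
  contradicts \<open>reaches_left\<close>.\<close>

lemma mu_right_half_plane:
  assumes sx0: "\<sigma>x = 0"
  shows "AE z in \<mu>. fst z < 0"
proof -
  define H where "H = {z :: real \<times> real. fst z < 0}"
  have H: "H \<in> sets borel" unfolding H_def by (intro borel_open open_Collect_less continuous_intros)
  have Hmu: "H \<in> sets \<mu>" using H by (simp add: sets_mu)
  have step: "AE z in \<mu>. z \<notin> H \<longrightarrow> transition_prob M X Y (real n) z H = 0" if n: "n > 0" for n :: nat
  proof -
    let ?P = "\<lambda>z. transition_prob M X Y (real n) z H"
    have T: "real n > 0" using n by simp
    have k: "ker (real n) \<in> measurable \<mu> (subprob_algebra borel)" using ker_mu[OF T] by (rule measurable_prob_algebraD)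
    have Pm[measurable]: "?P \<in> borel_measurable \<mu>"
      unfolding emeasure_ker[OF T H, symmetric] by (rule measurable_emeasure_kernel[OF k H])
    have P1: "?P z = 1" if "z \<in> H" for z
    proof -
      have XYm: "X z (real n) \<in> borel_measurable M" by auto
      have "AE \<omega> in M. X z (real n) \<omega> < 0" using AE_good[of z]
        by eventually_elim (rule left_half_plane_invariant[OF sx0], use that in \<open>auto simp: H_def\<close>)
      hence "prob {\<omega> \<in> space M. X z (real n) \<omega> < 0} = 1" using XYm by (subst prob_Collect_eq_1) auto
      thus ?thesis by (simp add: transition_prob_def H_def emeasure_eq_measure)
    qed
    have "emeasure \<mu> H = (\<integral>\<^sup>+z. ?P z \<partial>\<mu>)" using inv H T by (simp add: invariant_prob_measure_def)
    also have "\<dots> = (\<integral>\<^sup>+z. indicator H z + ?P z * indicator (- H) z \<partial>\<mu>)"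
      by (intro nn_integral_cong) (auto simp: indicator_def P1)
    also have "\<dots> = emeasure \<mu> H + (\<integral>\<^sup>+z. ?P z * indicator (- H) z \<partial>\<mu>)"
      using Hmu by (subst nn_integral_add) (auto simp: nn_integral_indicator sets_mu)
    finally have "(\<integral>\<^sup>+z. ?P z * indicator (- H) z \<partial>\<mu>) = 0"
      by (simp add: mu.emeasure_eq_measure)
    hence "AE z in \<mu>. ?P z * indicator (- H) z = 0"
      using H by (subst (asm) nn_integral_0_iff_AE) (auto simp: sets_mu)
    thus ?thesis by eventually_elim (auto simp: indicator_def split: if_splits)
  qed
  have "AE z in \<mu>. \<forall>n::nat. n > 0 \<longrightarrow> z \<notin> H \<longrightarrow> transition_prob M X Y (real n) z H = 0"
    unfolding AE_all_countable using step by auto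
  with AE_snd_nonzero show ?thesis
  proof eventually_elim
    case (elim z)
    show ?case
    proof (rule ccontr)
      assume "\<not> fst z < 0"
      hence "z \<notin> H" by (simp add: H_def)
      thus False using elim reaches_left[OF elim(1)] unfolding H_def by (metis less_irrefl)
    qed
  qed
qed

lemma vanishes_right:
  assumes sx0: "\<sigma>x = 0" and x: "x \<ge> 0"
  shows "m (x, y) = 0"
proof (rule ccontr)
  assume "m (x, y) \<noteq> 0"
  hence p: "m (x, y) > 0" using m_nonneg[of "(x, y)"] by linarith
  define a where "a = m (x, y) / 2"
  have a: "a > 0" using p by (simp add: a_def)
  have "isCont m (x, y)" using m_cont continuous_on_eq_continuous_at[OF open_UNIV] by blast
  then obtain \<delta> where \<delta>: "\<delta> > 0" "\<And>z. dist z (x, y) < \<delta> \<Longrightarrow> dist (m z) (m (x, y)) < a"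
    using a unfolding continuous_at_eps_delta by meson
  \<comment> \<open>The centre is moved to the right so that the disc of radius
    \<open>\<delta> / 4\<close> misses the left half-plane even when \<open>x = 0\<close>.\<close>
  let ?c = "(x + \<delta> / 2, y)"
  have dc: "dist ?c (x, y) = \<delta> / 2" using \<delta>(1) by (simp add: dist_Pair_Pair dist_real_def)
  have "ennreal (a * (unit_ball_vol 2 * (\<delta> / 4)\<^sup>2)) \<le> emeasure \<mu> (cball ?c (\<delta> / 4))"
  proof (rule mu_cball_lower)
    fix z assume "z \<in> cball ?c (\<delta> / 4)"
    hence "dist z (x, y) < \<delta>" using dist_triangle[of z "(x, y)" ?c] dc \<delta>(1) by (simp add: dist_commute)
    hence "\<bar>m z - m (x, y)\<bar> < a" using \<delta>(2) by (simp add: dist_real_def)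
    thus "a \<le> m z" unfolding a_def by linarith
  qed (use a \<delta> in auto)
  moreover have "emeasure \<mu> (cball ?c (\<delta> / 4)) = 0"
  proof -
    have "AE z in \<mu>. z \<notin> cball ?c (\<delta> / 4)" using mu_right_half_plane[OF sx0]
    proof eventually_elim
      case (elim z)
      have "\<bar>fst z - (x + \<delta> / 2)\<bar> \<le> dist z ?c" using dist_fst_le[of z ?c] by (simp add: dist_real_def)
      thus ?case using elim x \<delta>(1) by (auto simp: dist_commute)
    qed
    hence "emeasure \<mu> {z \<in> space \<mu>. z \<in> cball ?c (\<delta> / 4)} = 0" by (rule emeasure_eq_0_AE)
    moreover have "{z \<in> space \<mu>. z \<in> cball ?c (\<delta> / 4)} = cball ?c (\<delta> / 4)" by auto
    ultimately show ?thesis by simp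
  qed
  moreover have "a * (unit_ball_vol 2 * (\<delta> / 4)\<^sup>2) > 0" using a \<delta>(1) by (intro mult_pos_pos) auto
  ultimately show False by (simp add: ennreal_eq_0_iff)
qed

text \<open>In the coordinates \<open>z = (-1 + i a) / \<theta>\<close> the degenerate control system is \<open>\<theta>' = 1 - a^2\<close> with \<open>a\<close> as the control;
  \<open>move\<close> uses a control that is affine in time.\<close>

definition "pt \<theta> a = (- 1 / \<theta>, a / \<theta>)" for \<theta> a :: real

lemma move:
  assumes sx0: "\<sigma>x = 0" and T: "T \<ge> 0" and m0: "m (pt \<theta>0 a) > 0"
    and pos: "\<And>t. t \<in> {0..T} \<Longrightarrow> \<theta>0 + t - a\<^sup>2 * t - a * \<kappa> * t\<^sup>2 - \<kappa>\<^sup>2 * t ^ 3 / 3 > 0"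
  shows "m (pt (\<theta>0 + T - a\<^sup>2 * T - a * \<kappa> * T\<^sup>2 - \<kappa>\<^sup>2 * T ^ 3 / 3) (a + \<kappa> * T)) > 0"
proof (cases "T = 0")
  case True thus ?thesis using m0 by simp
next
  case False
  hence T0: "T > 0" using T by simp
  define \<theta> where "\<theta> t = \<theta>0 + t - a\<^sup>2 * t - a * \<kappa> * t\<^sup>2 - \<kappa>\<^sup>2 * t ^ 3 / 3" for t
  define \<alpha> where "\<alpha> t = a + \<kappa> * t" for t
  have th: "\<theta> t > 0" if "t \<in> {0..T}" for t using pos[OF that] by (simp add: \<theta>_def)
  have d\<theta>: "(\<theta> has_real_derivative 1 - (\<alpha> t)\<^sup>2) (at t within {0..T})" for t
    unfolding \<theta>_def[abs_def] \<alpha>_def by (auto intro!: derivative_eq_intros simp: power2_eq_square algebra_simps)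
  have d\<alpha>: "(\<alpha> has_real_derivative \<kappa>) (at t within {0..T})" for t
    unfolding \<alpha>_def[abs_def] by (auto intro!: derivative_eq_intros)
  define Zs where "Zs t = Complex (- 1 / \<theta> t) (\<alpha> t / \<theta> t)" for t
  \<comment> \<open>Read off the imaginary part of the equation. The real part contains no control;
    it holds because \<open>\<theta>' = 1 - \<alpha>^2\<close>.\<close>
  define b where "b t = (\<kappa> / \<theta> t + \<alpha> t * (1 + (\<alpha> t)\<^sup>2) / (\<theta> t)\<^sup>2) / cg" for t
  have c\<theta>: "continuous_on {0..T} \<theta>" unfolding \<theta>_def[abs_def] by (intro continuous_intros) auto
  have c\<alpha>: "continuous_on {0..T} \<alpha>" unfolding \<alpha>_def[abs_def] by (intro continuous_intros)
  have "ctrl T Zs (\<lambda>_. 0) b" unfolding ctrl_def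
  proof (intro conjI ballI T0)
    have "\<theta> t \<noteq> 0" if "t \<in> {0..T}" for t using th[OF that] by simp
    thus "continuous_on {0..T} b" unfolding b_def[abs_def] using cg by (intro continuous_intros c\<theta> c\<alpha>) auto
    fix t assume t: "t \<in> {0..T}"
    have t0: "\<theta> t \<noteq> 0" using th[OF t] by simp
    have 1: "((\<lambda>t. - 1 / \<theta> t) has_real_derivative (1 - (\<alpha> t)\<^sup>2) / (\<theta> t)\<^sup>2) (at t within {0..T})"
      using DERIV_divide[OF DERIV_const[of "- 1"] d\<theta> t0] by (simp add: power2_eq_square)
    have 2: "((\<lambda>t. \<alpha> t / \<theta> t) has_real_derivative (\<kappa> * \<theta> t - \<alpha> t * (1 - (\<alpha> t)\<^sup>2)) / (\<theta> t * \<theta> t)) (at t within {0..T})"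
      by (rule DERIV_divide[OF d\<alpha> d\<theta> t0])
    show "(Zs has_vector_derivative (Zs t)\<^sup>2 + Complex (sg * 0) (cg * b t)) (at t within {0..T})"
      unfolding has_vector_derivative_complex_iff
    proof
      have "Re ((Zs t)\<^sup>2 + Complex (sg * 0) (cg * b t)) = (1 - (\<alpha> t)\<^sup>2) / (\<theta> t)\<^sup>2"
        using t0 by (simp add: Zs_def power2_eq_square diff_divide_distrib)
      thus "((\<lambda>x. Re (Zs x)) has_real_derivative Re ((Zs t)\<^sup>2 + Complex (sg * 0) (cg * b t))) (at t within {0..T})"
        using 1 by (simp add: Zs_def)
      have "Im ((Zs t)\<^sup>2 + Complex (sg * 0) (cg * b t)) = - 2 * \<alpha> t / (\<theta> t)\<^sup>2 + (\<kappa> / \<theta> t + \<alpha> t * (1 + (\<alpha> t)\<^sup>2) / (\<theta> t)\<^sup>2)"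
        using cg by (simp add: Zs_def power2_eq_square b_def)
      also have "\<dots> = (\<kappa> * \<theta> t - \<alpha> t * (1 - (\<alpha> t)\<^sup>2)) / (\<theta> t * \<theta> t)"
        using t0 by (simp add: power2_eq_square divide_simps) (simp add: algebra_simps)
      finally show "((\<lambda>x. Im (Zs x)) has_real_derivative Im ((Zs t)\<^sup>2 + Complex (sg * 0) (cg * b t))) (at t within {0..T})"
        using 2 by (simp add: Zs_def)
    qed
  qed auto
  from density_propagates[OF this, of "pt \<theta>0 a" "pt (\<theta> T) (\<alpha> T)"]
  have "m (pt (\<theta> T) (\<alpha> T)) > 0" using m0 by (simp add: Zs_def zc_def pt_def \<theta>_def \<alpha>_def)
  thus ?thesis by (simp add: \<theta>_def \<alpha>_def)
qed

text \<open>\<open>(a^2 + a * b + b^2) / 3\<close> is the mean of the squared control along the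
  affine path from \<open>a\<close> to \<open>b\<close>. In a short time the control can change by
  any amount at little cost in \<open>\<theta>\<close>, and \<open>small\<close> keeps
  \<open>\<theta>\<close> positive on the way.\<close>

lemma vertical_move:
  assumes sx0: "\<sigma>x = 0" and T: "T > 0" and m0: "m (pt \<theta>0 a) > 0"
    and small: "T * (1 + a\<^sup>2 + \<bar>a\<bar> * \<bar>b - a\<bar> + (b - a)\<^sup>2) < \<theta>0"
  shows "m (pt (\<theta>0 + T * (1 - (a\<^sup>2 + a * b + b\<^sup>2) / 3)) b) > 0"
proof -
  define \<kappa> where "\<kappa> = (b - a) / T"
  have kT: "\<kappa> * T = b - a" using T by (simp add: \<kappa>_def)
  have "m (pt (\<theta>0 + T - a\<^sup>2 * T - a * \<kappa> * T\<^sup>2 - \<kappa>\<^sup>2 * T ^ 3 / 3) (a + \<kappa> * T)) > 0"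
  proof (rule move[OF sx0 _ m0])
    fix t assume t: "t \<in> {0..T}"
    have kt: "\<bar>\<kappa> * t\<bar> \<le> \<bar>b - a\<bar>"
    proof -
      have "\<bar>\<kappa> * t\<bar> \<le> \<bar>\<kappa>\<bar> * T" unfolding abs_mult using t by (intro mult_left_mono) auto
      also have "\<dots> = \<bar>\<kappa> * T\<bar>" using T by (simp add: abs_mult)
      finally show ?thesis by (simp add: kT)
    qed
    have 1: "a * (\<kappa> * t) \<le> \<bar>a\<bar> * \<bar>b - a\<bar>"
    proof -
      have "a * (\<kappa> * t) \<le> \<bar>a\<bar> * \<bar>\<kappa> * t\<bar>" by (metis abs_ge_self abs_mult)
      also have "\<dots> \<le> \<bar>a\<bar> * \<bar>b - a\<bar>" by (intro mult_left_mono kt) auto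
      finally show ?thesis .
    qed
    have 2: "(\<kappa> * t)\<^sup>2 \<le> (b - a)\<^sup>2" using kt by (rule abs_le_square_iff[THEN iffD1])
    let ?q = "a\<^sup>2 + a * (\<kappa> * t) + (\<kappa> * t)\<^sup>2 / 3 - 1"
    have q: "?q \<le> 1 + a\<^sup>2 + \<bar>a\<bar> * \<bar>b - a\<bar> + (b - a)\<^sup>2" using 1 2 zero_le_power2[of "b - a"] by linarith
    have "t * ?q \<le> t * (1 + a\<^sup>2 + \<bar>a\<bar> * \<bar>b - a\<bar> + (b - a)\<^sup>2)" using t q by (intro mult_left_mono) auto
    also have "\<dots> \<le> T * (1 + a\<^sup>2 + \<bar>a\<bar> * \<bar>b - a\<bar> + (b - a)\<^sup>2)" using t by (intro mult_right_mono) auto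
    finally have "t * ?q < \<theta>0" using small by linarith
    moreover have "\<theta>0 + t - a\<^sup>2 * t - a * \<kappa> * t\<^sup>2 - \<kappa>\<^sup>2 * t ^ 3 / 3 = \<theta>0 - t * ?q"
      by (simp add: algebra_simps power2_eq_square power3_eq_cube)
    ultimately show "\<theta>0 + t - a\<^sup>2 * t - a * \<kappa> * t\<^sup>2 - \<kappa>\<^sup>2 * t ^ 3 / 3 > 0" by linarith
  qed (use T in auto)
  moreover have "\<theta>0 + T - a\<^sup>2 * T - a * \<kappa> * T\<^sup>2 - \<kappa>\<^sup>2 * T ^ 3 / 3 = \<theta>0 + T * (1 - (a\<^sup>2 + a * b + b\<^sup>2) / 3)"
  proof -
    have "\<theta>0 + T - a\<^sup>2 * T - a * \<kappa> * T\<^sup>2 - \<kappa>\<^sup>2 * T ^ 3 / 3 = \<theta>0 + T * (1 - a\<^sup>2 - a * (\<kappa> * T) - (\<kappa> * T)\<^sup>2 / 3)"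
      by (simp add: algebra_simps power2_eq_square power3_eq_cube)
    also have "1 - a\<^sup>2 - a * (\<kappa> * T) - (\<kappa> * T)\<^sup>2 / 3 = 1 - (a\<^sup>2 + a * b + b\<^sup>2) / 3"
      unfolding kT by (simp add: power2_eq_square field_simps)
    finally show ?thesis .
  qed
  ultimately show ?thesis using kT by simp
qed

text \<open>Five moves: bring \<open>a\<close> to 2, stay there while \<open>\<theta>' = -3\<close>
  lowers \<open>\<theta>\<close>, bring \<open>a\<close> to 0, stay there while
  \<open>\<theta>' = 1\<close> raises it, and finally bring \<open>a\<close> to
  \<open>a1\<close>.\<close>

lemma positive_left:
  assumes sx0: "\<sigma>x = 0" and x: "x < 0"
  shows "m (x, y) > 0"
proof -
  have Hb: "{z :: real \<times> real. fst z < 0} \<in> sets borel" by (intro borel_open open_Collect_less continuous_intros)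
  have "AE z in \<mu>. z \<in> {z. fst z < 0}" using mu_right_half_plane[OF sx0] by simp
  hence "mu.prob {z. fst z < 0} = 1" using Hb by (subst mu.prob_eq_1) (auto simp: sets_mu)
  hence "emeasure \<mu> {z. fst z < 0} > 0" by (simp add: mu.emeasure_eq_measure)
  then obtain z1 where z1: "m z1 > 0" "fst z1 < 0" using m_pos_exists[OF Hb] by auto
  define \<theta>0 where "\<theta>0 = - 1 / fst z1"
  define a0 where "a0 = snd z1 * \<theta>0"
  have \<theta>0: "\<theta>0 > 0" using z1 by (simp add: \<theta>0_def divide_neg_neg)
  have p0: "m (pt \<theta>0 a0) > 0" using z1 \<theta>0 by (simp add: pt_def a0_def) (simp add: \<theta>0_def)
  define \<theta>1 where "\<theta>1 = - 1 / x"
  define a1 where "a1 = y * \<theta>1"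
  have \<theta>1: "\<theta>1 > 0" using x by (simp add: \<theta>1_def divide_neg_neg)
  have target: "pt \<theta>1 a1 = (x, y)" using x \<theta>1 by (simp add: pt_def a1_def) (simp add: \<theta>1_def)
  have bound: "\<bar>1 - (a\<^sup>2 + a * b + b\<^sup>2) / 3\<bar> \<le> 1 + a\<^sup>2 + \<bar>a\<bar> * \<bar>b - a\<bar> + (b - a)\<^sup>2" for a b :: real
  proof -
    have "(a\<^sup>2 + a * b + b\<^sup>2) / 3 = a\<^sup>2 + a * (b - a) + (b - a)\<^sup>2 / 3" by (simp add: power2_eq_square field_simps)
    moreover have "\<bar>a * (b - a)\<bar> = \<bar>a\<bar> * \<bar>b - a\<bar>" by (rule abs_mult)
    ultimately show ?thesis using zero_le_power2[of a] zero_le_power2[of "b - a"] by linarith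
  qed
  have vert: "\<exists>\<theta>'. \<bar>\<theta>' - \<theta>\<bar> \<le> \<theta> / 2 \<and> m (pt \<theta>' b) > 0" if "\<theta> > 0" "m (pt \<theta> a) > 0" for \<theta> a b
  proof -
    define Qc where "Qc = 1 + a\<^sup>2 + \<bar>a\<bar> * \<bar>b - a\<bar> + (b - a)\<^sup>2"
    have Qc: "Qc \<ge> 1" unfolding Qc_def by simp
    define T where "T = \<theta> / (2 * Qc)"
    have T: "T > 0" "T * Qc = \<theta> / 2" using that Qc by (auto simp: T_def)
    have "m (pt (\<theta> + T * (1 - (a\<^sup>2 + a * b + b\<^sup>2) / 3)) b) > 0"
      by (rule vertical_move[OF sx0 T(1) that(2)]) (use T that in \<open>simp add: Qc_def\<close>)
    moreover have "\<bar>T * (1 - (a\<^sup>2 + a * b + b\<^sup>2) / 3)\<bar> \<le> T * Qc"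
      unfolding abs_mult using bound[of a b] T by (simp add: Qc_def mult_left_mono)
    ultimately show ?thesis using T by (intro exI[of _ "\<theta> + T * (1 - (a\<^sup>2 + a * b + b\<^sup>2) / 3)"]) simp
  qed
  define Qc where "Qc = 1 + 0\<^sup>2 + \<bar>0\<bar> * \<bar>a1 - 0\<bar> + (a1 - 0)\<^sup>2"
  have Qc: "Qc \<ge> 1" unfolding Qc_def by simp
  define T where "T = \<theta>1 / (4 * Qc)"
  have T: "T > 0" "T * Qc = \<theta>1 / 4" using \<theta>1 Qc by (auto simp: T_def)
  \<comment> \<open>The change of \<open>\<theta>\<close> during the last move is known in advance;
    subtracting it makes that move end exactly at \<open>\<theta>1\<close>.\<close>
  define \<theta>p where "\<theta>p = \<theta>1 - T * (1 - (0\<^sup>2 + 0 * a1 + a1\<^sup>2) / 3)"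
  have "\<bar>T * (1 - (0\<^sup>2 + 0 * a1 + a1\<^sup>2) / 3)\<bar> \<le> T * Qc"
    unfolding abs_mult using bound[of 0 a1] T by (simp add: Qc_def mult_left_mono)
  hence \<theta>p: "\<theta>p \<ge> 3/4 * \<theta>1" using T unfolding \<theta>p_def by linarith
  obtain \<theta>a where \<theta>a: "\<bar>\<theta>a - \<theta>0\<bar> \<le> \<theta>0 / 2" "m (pt \<theta>a 2) > 0" using vert[OF \<theta>0 p0] by blast
  have \<theta>a0: "\<theta>a > 0" using \<theta>a \<theta>0 by linarith
  \<comment> \<open>Low enough that the move from \<open>a = 2\<close> to \<open>a = 0\<close>,
    which changes \<open>\<theta>\<close> by at most half of its value, ends below
    \<open>\<theta>p\<close>; from there \<open>\<theta>\<close> only has to rise.\<close>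
  define \<theta>b where "\<theta>b = min \<theta>a (\<theta>p / 2)"
  have \<theta>b: "\<theta>b > 0" "\<theta>b \<le> \<theta>a" "\<theta>b \<le> \<theta>p / 2" using \<theta>a0 \<theta>p \<theta>1 by (auto simp: \<theta>b_def)
  define D where "D = (\<theta>a - \<theta>b) / 3"
  have "m (pt (\<theta>a + D - 2\<^sup>2 * D - 2 * 0 * D\<^sup>2 - 0\<^sup>2 * D ^ 3 / 3) (2 + 0 * D)) > 0"
  proof (rule move[OF sx0 _ \<theta>a(2)])
    show "D \<ge> 0" using \<theta>b by (simp add: D_def)
    fix t assume "t \<in> {0..D}"
    hence "3 * t \<le> \<theta>a - \<theta>b" by (simp add: D_def)
    thus "\<theta>a + t - 2\<^sup>2 * t - 2 * 0 * t\<^sup>2 - 0\<^sup>2 * t ^ 3 / 3 > 0" using \<theta>b by simp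
  qed
  moreover have "\<theta>a + D - 2\<^sup>2 * D - 2 * 0 * D\<^sup>2 - 0\<^sup>2 * D ^ 3 / 3 = \<theta>b" by (simp add: D_def field_simps)
  ultimately have "m (pt \<theta>b 2) > 0" by (simp only: mult_zero_left add_0_right)
  then obtain \<theta>c where \<theta>c: "\<bar>\<theta>c - \<theta>b\<bar> \<le> \<theta>b / 2" "m (pt \<theta>c 0) > 0" using vert[OF \<theta>b(1)] by blast
  have "\<theta>c \<le> \<theta>p" "\<theta>c > 0" using \<theta>c \<theta>b \<theta>p \<theta>1 by linarith+
  hence "m (pt (\<theta>c + (\<theta>p - \<theta>c) - 0\<^sup>2 * (\<theta>p - \<theta>c) - 0 * 0 * (\<theta>p - \<theta>c)\<^sup>2 - 0\<^sup>2 * (\<theta>p - \<theta>c) ^ 3 / 3) (0 + 0 * (\<theta>p - \<theta>c))) > 0"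
    by (intro move[OF sx0 _ \<theta>c(2)]) auto
  hence "m (pt \<theta>p 0) > 0" by simp
  hence "m (pt (\<theta>p + T * (1 - (0\<^sup>2 + 0 * a1 + a1\<^sup>2) / 3)) a1) > 0"
    by (rule vertical_move[OF sx0 T(1)]) (use T \<theta>p \<theta>1 in \<open>simp add: Qc_def\<close>)
  hence "m (pt \<theta>1 a1) > 0" by (simp add: \<theta>p_def)
  thus ?thesis unfolding target .
qed

end

theorem theorem3:
  fixes M :: "'a measure"
    and W1 W2 :: "real \<Rightarrow> 'a \<Rightarrow> real"
    and X Y :: "real \<times> real \<Rightarrow> real \<Rightarrow> 'a \<Rightarrow> real"
    and \<sigma>x \<sigma>y :: real
    and \<mu> :: "(real \<times> real) measure"
  assumes "\<sigma>x \<ge> 0" and "\<sigma>y > 0"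
    and "prob_space M"
    and "standard_brownian_motion M W1" and "standard_brownian_motion M W2"
    and "independent_processes M W1 W2"
    and "\<And>z. sde_solution M W1 W2 \<sigma>x \<sigma>y z (X z) (Y z)"
    and "invariant_prob_measure (transition_prob M X Y) \<mu>"
    and "\<And>\<nu>. invariant_prob_measure (transition_prob M X Y) \<nu> \<Longrightarrow> \<nu> = \<mu>"
  shows "\<exists>m :: real \<times> real \<Rightarrow> real.
           smooth m \<and> (\<forall>z. m z \<ge> 0) \<and> \<mu> = density lborel (\<lambda>z. ennreal (m z)) \<and>
           (\<sigma>x > 0 \<and> \<sigma>y > 0 \<longrightarrow> (\<forall>z. m z > 0)) \<and>
           (\<sigma>x = 0 \<and> \<sigma>y > 0 \<longrightarrow>
              (\<forall>x y. x \<ge> 0 \<longrightarrow> m (x, y) = 0) \<and> (\<forall>x y. x < 0 \<longrightarrow> m (x, y) > 0))"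
proof -
  interpret prob_space M by fact
  interpret sde_invariant M W1 W2 X Y \<sigma>x \<sigma>y \<mu>
    by unfold_locales (fact assms)+
  obtain m where m: "smooth m" "\<And>z. 0 \<le> m z" "\<mu> = density lborel (\<lambda>z. ennreal (m z))"
    using smooth_density by blast
  have mc: "continuous_on UNIV m" using m(1) unfolding smooth_def by (elim allE[of _ 0]) simp
  interpret sde_density M W1 W2 X Y \<sigma>x \<sigma>y \<mu> m
    by unfold_locales (fact mc m)+
  show ?thesis
  proof (rule exI[of _ m], intro conjI impI allI)
    show "m z > 0" if "\<sigma>x > 0 \<and> \<sigma>y > 0" for z using that positive_elliptic by blast
    show "m (x, y) = 0" if "\<sigma>x = 0 \<and> \<sigma>y > 0" "x \<ge> 0" for x y using that vanishes_right by blast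
    show "m (x, y) > 0" if "\<sigma>x = 0 \<and> \<sigma>y > 0" "x < 0" for x y using that positive_left by blast
  qed (fact m)+
qed

end
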